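(* Let $s>s_1>\frac12$, let $u\in L^2_s(\mathbb{R})$ be real-valued, $k\in\rho(L_u)\cup(\mathbb{R}^+\pm0i)$ and $\lambda>0$. Let $m_1(k)=m_1(\cdot,k)$ and $m_e(\lambda\pm0i)=m_e(\cdot,\lambda\pm0i)$ be the Jost solutions, and let $$\Gamma(\lambda)=1+i\int_{\mathbb{R}}u(x)m_e(x,\lambda+0i)e^{-i\lambda x}\,dx,\qquad \beta(\lambda)=i\int_{\mathbb{R}}u(x)m_1(x,\lambda+0i)e^{-i\lambda x}\,dx.$$ Let $m_1^0(0)=m_1^0(\cdot,0)$ be the modified Jost function at $k=0$. Then there exists $\epsilon\in(0,1)$ such that as $k\to0$ and $\lambda\to0^+$: (a) if $u$ is a generic potential, $$m_1(k)=\frac{2\pi}{\langle m_1^0(0),u\rangle\log k}\,m_1^0(0)+O\Big(\frac1{|\log^2k|}\Big),$$ $$m_e(\lambda\pm0i)=\frac{2\pi}{\langle m_1^0(0),u\rangle\log(\lambda\pm0i)}\,m_1^0(0)+O\Big(\frac1{|\log^2\lambda|}\Big),$$ $$\Gamma(\lambda)=1+\frac{2\pi i}{\log(\lambda+0i)}+O\Big(\frac1{|\log^2\lambda|}\Big),\qquad \beta(\lambda)=\frac{2\pi i}{\log(\lambda+0i)}+O\Big(\frac1{|\log^2\lambda|}\Big);$$ (b) if $u$ is a non-generic potential, $$m_1(k)=m_1^0(0)+O(|k|^\epsilon|\log k|),\qquad m_e(\lambda\pm0i)=m_1^0(0)+O(\lambda^\epsilon|\log\lambda|),$$ $$\Gamma(\lambda)=1+O(\lambda^\epsilon|\log\lambda|),\qquad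 \beta(\lambda)=O(\lambda^\epsilon|\log\lambda|).$$ Here $\log$ is the branch with branch cut on $[0,\infty)$. The $O$ terms are meant in the usual sense in the formulas for $\Gamma$ and $\beta$, and in the sense of the $L^\infty_{-(s-s_1)}(\mathbb{R})$ norm in the formulas for $m_1$ and $m_e$.
   Context: Notation. $w(x)=1+|x|$; $L^p_s(\mathbb{R})=\{f: w^sf\in L^p(\mathbb{R})\}$ with norm $\|w^sf\|_p$. $\mathbb{R}^+=(0,\infty)$, $\mathbb{R}^-=(-\infty,0)$. $\langle f,g\rangle=\int_{\mathbb{R}}f\bar g\,dx$. $C_+$ is the Cauchy projection $\widehat{C_+f}=\chi_{\mathbb{R}^+}\hat f$, $\mathbb{H}^+=C_+(L^2(\mathbb{R}))$, and $\rho(L_u)$ is the resolvent set of $L_u=\frac1i\partial_x-C_+uC_+$ on $\mathbb{H}^+$ with natural domain $\{\varphi\in\mathbb{H}^+:\varphi'\in L^2\}$. $\mathbb{R}^+\pm0i$ denotes two copies of $(0,\infty)$, regarded as the upper edge ($\lambda+0i$) and lower edge ($\lambda-0i$) of the cut along $(0,\infty)$. The branch of $\log$ is continuous up to these edges: $\log k=\log|k|+i\arg k$ with $\arg k\in(0,2\pi)$ off the cut, $\log(\lambda+0i)=\log\lambda$ and $\log(\lambda-0i)=\log\lambda+2\pi i$. Kernels: $G_k(x)=\frac1{2\pi}\int_0^\infty\frac{e^{ix\xi}}{\xi-k}d\xi$ for $k\in\mathbb{C}\setminus[0,\infty)$; for $\lambda>0$, $G_{\lambda\pm0i}(x)=\pm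 ie^{i\lambda x}\chi_{\mathbb{R}^\pm}(x)-\widetilde G_\lambda(x)$, where $\widetilde G_\lambda(x)=\frac1{2\pi}\int_{-\infty}^0\frac{e^{ix\xi}}{\xi-\lambda}d\xi$. Jost solutions: $m_1(\cdot,k)$ (for $k\in\rho(L_u)\cup(\mathbb{R}^+\pm0i)$) and $m_e(\cdot,\lambda\pm0i)$ are the unique functions in $L^\infty_{-(s-s_1)}(\mathbb{R})$ (known to exist) with $m_1(\cdot,k)=1+G_k*(u\,m_1(\cdot,k))$ and $m_e(\cdot,\lambda\pm0i)=e^{i\lambda x}+G_{\lambda\pm0i}*(u\,m_e(\cdot,\lambda\pm0i))$. Modified Jost function at $0$: fix a smooth complex-valued $\chi$ on $[0,\infty)$ with $\chi=1$ on $[0,1]$, $\chi=0$ on $[2,\infty)$ and $\mathrm{Im}\int_1^2\frac{\chi(\xi)}{\xi}d\xi\ne0$. Set $G_0^0(x)=\frac1{2\pi}\lim_{N\to\infty}\int_0^N\frac{e^{ix\xi}-\chi(\xi)}{\xi}d\xi$ for $x\neq0$. Then $m_1^0(\cdot,0)$ is the unique solution in $L^\infty_{-(s-s_1)}(\mathbb{R})$ (known to exist) of $m_1^0(\cdot,0)=1+G_0^0*(u\,m_1^0(\cdot,0))$. The potential $u$ is called generic if $\int_{\mathbb{R}}u(x)m_1^0(x,0)\,dx\neq0$, and non-generic if $\int_{\mathbb{R}}u(x)m_1^0(x,0)\,dx=0$ (this does not depend on the choice of $\chi$). *)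

theory Defs
  imports "HOL-Analysis.Analysis" "HOL-Probability.Essential_Supremum" "HOL-Library.Landau_Symbols"
begin

section \<open>Weighted Lebesgue spaces\<close>

text \<open>Elements of the spaces below are Borel representatives of the usual classes of functions
  modulo equality almost everywhere; all equations between them are meant almost everywhere.\<close>

definition wt :: "real \<Rightarrow> real" where
  "wt x = 1 + \<bar>x\<bar>"

definition L2 :: "(real \<Rightarrow> complex) set" where
  "L2 = {f. f \<in> borel_measurable lborel \<and> integrable lborel (\<lambda>x. (cmod (f x))\<^sup>2)}"

definition L2_norm :: "(real \<Rightarrow> complex) \<Rightarrow> real" where
  "L2_norm f = sqrt (LINT x|lborel. (cmod (f x))\<^sup>2)"

definition L2_weighted :: "real \<Rightarrow> (real \<Rightarrow> complex) set" where
  "L2_weighted q = {f. (\<lambda>x. of_real (wt x powr q) * f x) \<in> L2}"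

definition Linf_norm :: "real \<Rightarrow> (real \<Rightarrow> complex) \<Rightarrow> ereal" where
  "Linf_norm q f = esssup lborel (\<lambda>x. ereal (cmod (of_real (wt x powr q) * f x)))"

definition Linf_weighted :: "real \<Rightarrow> (real \<Rightarrow> complex) set" where
  "Linf_weighted q = {f. f \<in> borel_measurable lborel \<and> Linf_norm q f < \<infinity>}"

definition pairing :: "(real \<Rightarrow> complex) \<Rightarrow> (real \<Rightarrow> complex) \<Rightarrow> complex" where
  "pairing f g = (LINT x|lborel. f x * cnj (g x))"

definition conv :: "(real \<Rightarrow> complex) \<Rightarrow> (real \<Rightarrow> complex) \<Rightarrow> real \<Rightarrow> complex" where
  "conv G f x = (LINT y|lborel. G (x - y) * f y)"

text \<open>\<open>Linf_bigo q F f g\<close> says that \<open>f = O(g)\<close> along the filter \<open>F\<close> in the norm of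
  \<open>Linf_weighted q\<close>. The norm is kept in \<^typ>\<open>ereal\<close>, so that an infinite norm is not
  silently replaced by \<open>0\<close>.\<close>

definition Linf_bigo :: "real \<Rightarrow> 'a filter \<Rightarrow> ('a \<Rightarrow> real \<Rightarrow> complex) \<Rightarrow> ('a \<Rightarrow> real) \<Rightarrow> bool" where
  "Linf_bigo q F f g \<longleftrightarrow> (\<exists>C::real. \<forall>\<^sub>F k in F. Linf_norm q (f k) \<le> ereal (C * g k))"


section \<open>Smooth functions and weak derivatives\<close>

text \<open>At boundary points of \<open>S\<close> the derivatives are one-sided.\<close>

definition smooth_on :: "real set \<Rightarrow> (real \<Rightarrow> 'a::real_normed_vector) \<Rightarrow> bool" where
  "smooth_on S f \<longleftrightarrow> (\<exists>D. (\<forall>x\<in>S. D 0 x = f x) \<and>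
     (\<forall>n::nat. \<forall>x\<in>S. (D n has_vector_derivative D (Suc n) x) (at x within S)))"

definition test_fun :: "(real \<Rightarrow> real) \<Rightarrow> bool" where
  "test_fun \<eta> \<longleftrightarrow> smooth_on UNIV \<eta> \<and> (\<exists>R. \<forall>x. \<bar>x\<bar> > R \<longrightarrow> \<eta> x = 0)"

definition has_weak_deriv :: "(real \<Rightarrow> complex) \<Rightarrow> (real \<Rightarrow> complex) \<Rightarrow> bool" where
  "has_weak_deriv \<phi> \<phi>' \<longleftrightarrow> (\<forall>\<eta>. test_fun \<eta> \<longrightarrow>
     (LINT x|lborel. \<phi> x * of_real (deriv \<eta> x)) = - (LINT x|lborel. \<phi>' x * of_real (\<eta> x)))"


section \<open>The Cauchy projection and the operator \<open>L\<^sub>u\<close>\<close>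

text \<open>The Fourier transform on \<open>L2\<close>, as the limit in \<open>L2\<close> of the transforms of the truncations
  to \<open>[-N, N]\<close>. The normalisation does not affect the Cauchy projection.\<close>

definition has_fourier :: "(real \<Rightarrow> complex) \<Rightarrow> (real \<Rightarrow> complex) \<Rightarrow> bool" where
  "has_fourier f F \<longleftrightarrow> f \<in> L2 \<and> F \<in> L2 \<and>
     ((\<lambda>N::real. \<integral>\<^sup>+ \<xi>. ennreal ((cmod (F \<xi> -
          of_real (1 / sqrt (2 * pi)) * (LBINT x:{-N..N}. f x * cis (- (x * \<xi>)))))\<^sup>2) \<partial>lborel)
        \<longlongrightarrow> 0) at_top"

text \<open>\<open>is_Cplus f g\<close> means \<open>C\<^sub>+ f = g\<close> in \<open>L2\<close>.\<close>

definition is_Cplus :: "(real \<Rightarrow> complex) \<Rightarrow> (real \<Rightarrow> complex) \<Rightarrow> bool" where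
  "is_Cplus f g \<longleftrightarrow> (\<exists>F. has_fourier f F \<and> has_fourier g (\<lambda>\<xi>. indicator {0<..} \<xi> * F \<xi>))"

definition Hardy :: "(real \<Rightarrow> complex) set" where
  "Hardy = {g. \<exists>f\<in>L2. is_Cplus f g}"

text \<open>\<open>is_Lu u \<phi> \<psi>\<close> means that \<open>\<phi>\<close> is in the domain of \<open>L\<^sub>u = -i \<partial>\<^sub>x - C\<^sub>+ u C\<^sub>+\<close> and
  \<open>L\<^sub>u \<phi> = \<psi>\<close>. The product \<open>u C\<^sub>+ \<phi>\<close> is automatically in \<open>L2\<close> when \<open>u\<close> is, since elements of the
  domain are bounded.\<close>

definition is_Lu :: "(real \<Rightarrow> real) \<Rightarrow> (real \<Rightarrow> complex) \<Rightarrow> (real \<Rightarrow> complex) \<Rightarrow> bool" where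
  "is_Lu u \<phi> \<psi> \<longleftrightarrow> \<phi> \<in> Hardy \<and> \<psi> \<in> Hardy \<and>
     (\<exists>\<phi>' p q. \<phi>' \<in> L2 \<and> has_weak_deriv \<phi> \<phi>' \<and>
        is_Cplus \<phi> p \<and> is_Cplus (\<lambda>x. of_real (u x) * p x) q \<and>
        (AE x in lborel. \<psi> x = \<phi>' x / \<i> - q x))"

text \<open>\<open>k\<close> is in the resolvent set iff \<open>L\<^sub>u - k\<close> is a bijection from its domain onto the Hardy space
  whose inverse is bounded.\<close>

definition resolvent_set_Lu :: "(real \<Rightarrow> real) \<Rightarrow> complex set" where
  "resolvent_set_Lu u = {k.
     (\<forall>f\<in>Hardy. \<exists>\<phi>. is_Lu u \<phi> (\<lambda>x. f x + k * \<phi> x) \<and>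
        (\<forall>\<phi>'. is_Lu u \<phi>' (\<lambda>x. f x + k * \<phi>' x) \<longrightarrow> (AE x in lborel. \<phi>' x = \<phi> x))) \<and>
     (\<exists>C. \<forall>f\<in>Hardy. \<forall>\<phi>. is_Lu u \<phi> (\<lambda>x. f x + k * \<phi> x) \<longrightarrow> L2_norm \<phi> \<le> C * L2_norm f)}"


section \<open>The cut plane with its two edges\<close>

text \<open>\<open>Edge Above lam\<close> is \<open>lam + 0i\<close> and \<open>Edge Below lam\<close> is \<open>lam - 0i\<close>.\<close>

datatype side = Above | Below

datatype cut_point = Off complex | Edge side real

fun cut_abs :: "cut_point \<Rightarrow> real" where
  "cut_abs (Off k) = cmod k"
| "cut_abs (Edge \<sigma> lam) = \<bar>lam\<bar>"

fun cut_log :: "cut_point \<Rightarrow> complex" where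
  "cut_log (Off k) = of_real (ln (cmod k)) + \<i> * of_real (Arg2pi k)"
| "cut_log (Edge Above lam) = of_real (ln lam)"
| "cut_log (Edge Below lam) = of_real (ln lam) + 2 * of_real pi * \<i>"

definition jost_domain :: "(real \<Rightarrow> real) \<Rightarrow> cut_point set" where
  "jost_domain u = Off ` resolvent_set_Lu u \<union> {Edge \<sigma> lam | \<sigma> lam. lam > 0}"

text \<open>The filter \<open>k \<rightarrow> 0\<close>, \<open>k \<noteq> 0\<close>, within the union of the resolvent set and the two edges.\<close>

definition k_to_0 :: "(real \<Rightarrow> real) \<Rightarrow> cut_point filter" where
  "k_to_0 u = inf (filtercomap cut_abs (at_right 0)) (principal (jost_domain u))"


section \<open>Kernels\<close>

text \<open>The integrals defining the kernels converge only conditionally, and only for \<open>x \<noteq> 0\<close>; they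
  are improper integrals. The value at \<open>x = 0\<close> is irrelevant for convolutions.\<close>

definition G_off :: "complex \<Rightarrow> real \<Rightarrow> complex" where
  "G_off k x = of_real (1 / (2 * pi)) *
     Lim at_top (\<lambda>N::real. LBINT \<xi>:{0..N}. cis (x * \<xi>) / (of_real \<xi> - k))"

definition G_tilde :: "real \<Rightarrow> real \<Rightarrow> complex" where
  "G_tilde lam x = of_real (1 / (2 * pi)) *
     Lim at_top (\<lambda>N::real. LBINT \<xi>:{-N..0}. cis (x * \<xi>) / (of_real \<xi> - of_real lam))"

fun G :: "cut_point \<Rightarrow> real \<Rightarrow> complex" where
  "G (Off k) x = G_off k x"
| "G (Edge Above lam) x = \<i> * cis (lam * x) * indicator {0<..} x - G_tilde lam x"
| "G (Edge Below lam) x = - \<i> * cis (lam * x) * indicator {..<0} x - G_tilde lam x"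

definition cutoff_fun :: "(real \<Rightarrow> complex) \<Rightarrow> bool" where
  "cutoff_fun c \<longleftrightarrow> smooth_on {0..} c \<and> (\<forall>\<xi>\<in>{0..1}. c \<xi> = 1) \<and> (\<forall>\<xi>\<ge>2. c \<xi> = 0) \<and>
     Im (LBINT \<xi>:{1..2}. c \<xi> / of_real \<xi>) \<noteq> 0"

definition G_zero :: "(real \<Rightarrow> complex) \<Rightarrow> real \<Rightarrow> complex" where
  "G_zero c x = of_real (1 / (2 * pi)) *
     Lim at_top (\<lambda>N::real. LBINT \<xi>:{0..N}. (cis (x * \<xi>) - c \<xi>) / of_real \<xi>)"


section \<open>Jost solutions and scattering coefficients\<close>

definition solves_jost_eq ::
    "real \<Rightarrow> (real \<Rightarrow> real) \<Rightarrow> (real \<Rightarrow> complex) \<Rightarrow> (real \<Rightarrow> complex) \<Rightarrow> (real \<Rightarrow> complex) \<Rightarrow> bool" where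
  "solves_jost_eq q u K g m \<longleftrightarrow> m \<in> Linf_weighted q \<and>
     (AE x in lborel. m x = g x + conv K (\<lambda>y. of_real (u y) * m y) x)"

text \<open>\<open>m\<close> is the unique solution of \<open>m = g + K * (u m)\<close> in \<open>Linf_weighted q\<close>.\<close>

definition is_jost_solution ::
    "real \<Rightarrow> (real \<Rightarrow> real) \<Rightarrow> (real \<Rightarrow> complex) \<Rightarrow> (real \<Rightarrow> complex) \<Rightarrow> (real \<Rightarrow> complex) \<Rightarrow> bool" where
  "is_jost_solution q u K g m \<longleftrightarrow> solves_jost_eq q u K g m \<and>
     (\<forall>m'. solves_jost_eq q u K g m' \<longrightarrow> (AE x in lborel. m' x = m x))"

definition Gamma_coeff ::
    "(real \<Rightarrow> real) \<Rightarrow> (side \<Rightarrow> real \<Rightarrow> real \<Rightarrow> complex) \<Rightarrow> real \<Rightarrow> complex" where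
  "Gamma_coeff u me lam = 1 + \<i> * (LINT x|lborel. of_real (u x) * me Above lam x * cis (- (lam * x)))"

definition beta_coeff ::
    "(real \<Rightarrow> real) \<Rightarrow> (cut_point \<Rightarrow> real \<Rightarrow> complex) \<Rightarrow> real \<Rightarrow> complex" where
  "beta_coeff u m1 lam = \<i> * (LINT x|lborel. of_real (u x) * m1 (Edge Above lam) x * cis (- (lam * x)))"

text \<open>Here \<open>m0\<close> is the modified Jost function at \<open>0\<close>.\<close>

definition generic :: "(real \<Rightarrow> real) \<Rightarrow> (real \<Rightarrow> complex) \<Rightarrow> bool" where
  "generic u m0 \<longleftrightarrow> (LINT x|lborel. of_real (u x) * m0 x) \<noteq> 0"

end

(* As k tends to 0 the kernel expands as G_k = G_0^0 + nu(k) + O(|k|^a (1+|x|)^b) with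
   nu(k) = mu - log k / (2 pi), so the Jost equation becomes
     (1 - T) m = 1 + nu(k) P + small,   P = integral of u m,   T m = G_0^0 * (u m).
   T is compact on the weighted space (the weights leave room for Arzela-Ascoli on the compactified
   line), and uniqueness of m_1^0 makes 1 - T injective; compactness then makes it bounded below.
   Hence m = alpha m_1^0 + small with alpha = 1 + nu(k) P, and pairing with u gives
   P = alpha I + small, where I is the integral of u m_1^0.  The resulting scalar equation
   alpha = 1 + nu(k) (alpha I + small) is solved by alpha ~ -1 / (nu(k) I) ~ 2 pi / (I log k)
   if I is nonzero, and by alpha ~ 1 if I = 0.
   The kernel expansion fails for an unsided k on the cut, so one also needs that no positive number is
   in the resolvent set: if L_u - lam hit the Hardy function whose Fourier transform is the indicator
   of (lam, lam + 1), then (xi - lam) times the Fourier transform of the preimage would jump at lam,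
   which is impossible for a square integrable preimage. *)
theory Submission
  imports Defs "HOL-Probability.Sinc_Integral" "HOL-Complex_Analysis.Complex_Analysis" "HOL-Real_Asymp.Real_Asymp"
begin

section \<open>Oscillatory integrals and the kernels\<close>

text \<open>The weight of \<open>u\<close> is spent through two exponents 0 < a < b. Growth w^b of
  the remainders is affordable because b < s - s1, which keeps T compact, and b < s1 - 1/2, which
  keeps |u| w^(s - s1 + b) integrable; the gap a < b makes \<xi>^(b - a - 1) integrable at 0 and so
  produces the power |k|^a. Since nu(k) diverges, the rank one term nu(k) P cannot be treated as a
  perturbation, and neither m nor alpha is bounded beforehand: all error bounds carry the factor 1 +
  |alpha|, which disappears only in the scalar equation, where |k|^a beats every power of the
  logarithm. The families m_1 and m_e are handled together by allowing an inhomogeneity within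
  O(|k|^a w^b) of 1. In the spectral claim the jump is detected without pointwise values of Fourier
  transforms, by pairing with the wave packets e^(-i lam x) r(\<epsilon> x), r(y) = y/(1 + y^2): up
  to a constant, r is the transform of sgn(t) e^(-|t|), whose oddness cancels the continuous
  contribution of u C_+ phi and keeps the jump.\<close>

lemma norm_cis_diff_le: "cmod (cis a - cis b) \<le> \<bar>a - b\<bar>"
proof -
  have "cis a - cis b = cis b * (cis (a - b) - 1)"
    by (simp add: cis_mult ring_distribs)
  then have "cmod (cis a - cis b) = cmod (exp (\<i> * of_real (a - b)) - 1)"
    by (simp add: norm_mult cis_conv_exp)
  also have "\<dots> = 2 * \<bar>sin ((a - b) / 2)\<bar>"
    by (rule dist_exp_i_1)
  also have "\<dots> \<le> \<bar>a - b\<bar>"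
    using abs_sin_x_le_abs_x[of "(a - b)/2"] by simp
  finally show ?thesis .
qed

text \<open>Interpolates between the Lipschitz bound |a - b| and the trivial bound 2. A fractional
  power t trades decay in k for growth in x: a phase e^(ikx) - 1 costs |k|^t |x|^t.\<close>

lemma norm_cis_diff_powr_le:
  assumes "0 < t" "t \<le> 1"
  shows "cmod (cis a - cis b) \<le> 2 * \<bar>a - b\<bar> powr t"
proof (cases "\<bar>a - b\<bar> \<le> 1")
  case True
  have "\<bar>a - b\<bar> \<le> \<bar>a - b\<bar> powr t"
  proof (cases "a = b")
    case False
    then have "\<bar>a - b\<bar> powr 1 \<le> \<bar>a - b\<bar> powr t"
      using True assms by (intro powr_mono') auto
    then show ?thesis using False by simp
  qed simp
  then show ?thesis using norm_cis_diff_le[of a b] by linarith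
next
  case False
  have "cmod (cis a - cis b) \<le> 2" using norm_triangle_ineq4[of "cis a" "cis b"] by simp
  moreover have "1 \<le> \<bar>a - b\<bar> powr t" using False assms by (intro ge_one_powr_ge_zero) auto
  ultimately show ?thesis by linarith
qed

text \<open>Covers non-integrable \<open>f\<close> as well: its Bochner integral is 0 by convention,
  and the bound then holds because \<open>g\<close> is nonnegative almost everywhere.\<close>

lemma norm_integral_le_dominated:
  fixes f :: "'a \<Rightarrow> 'b::{banach, second_countable_topology}"
  assumes "integrable M g" "AE x in M. norm (f x) \<le> g x"
  shows "norm (integral\<^sup>L M f) \<le> integral\<^sup>L M g"
proof (cases "integrable M f")
  case True
  have "norm (integral\<^sup>L M f) \<le> (LINT x|M. norm (f x))" by (rule integral_norm_bound)
  also have "\<dots> \<le> integral\<^sup>L M g" using True assms by (intro integral_mono_AE) auto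
  finally show ?thesis .
next
  case False
  have "AE x in M. 0 \<le> g x" using assms(2) by (auto elim!: eventually_mono intro: order_trans[OF norm_ge_zero])
  then show ?thesis using False by (simp add: not_integrable_integral_eq integral_nonneg_AE)
qed

lemma norm_set_integral_le_dominated:
  fixes f :: "'a \<Rightarrow> 'b::{banach, second_countable_topology}"
  assumes "set_integrable M A g" "\<And>x. x \<in> A \<Longrightarrow> norm (f x) \<le> g x"
  shows "norm (set_lebesgue_integral M A f) \<le> set_lebesgue_integral M A g"
  unfolding set_lebesgue_integral_def
  using assms by (intro norm_integral_le_dominated) (auto simp: set_integrable_def indicator_def)

section \<open>Integrals of powers, scaling and splitting of intervals\<close>

lemma has_bochner_powr_Icc:
  fixes p R :: real
  assumes "0 < p" "0 \<le> R"
  shows "set_integrable lborel {0..R} (\<lambda>t. t powr (p - 1))"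
    and "(LBINT t:{0..R}. t powr (p - 1)) = R powr p / p"
proof -
  have "((\<lambda>x. x powr (p - 1)) has_integral (R powr p / p)) {0..R}"
    using has_integral_powr_from_0[of "p-1" R] assms by simp
  then have nn: "integral\<^sup>N lborel (\<lambda>x. indicator {0..R} x * (x powr (p - 1))) = R powr p / p"
    by (intro nn_integral_has_integral_lebesgue) auto
  have "has_bochner_integral lborel (\<lambda>x. indicator {0..R} x *\<^sub>R x powr (p - 1)) (R powr p / p)"
    using nn assms by (intro has_bochner_integral_nn_integral) (auto simp: indicator_def split: if_splits)
  then show "set_integrable lborel {0..R} (\<lambda>t. t powr (p - 1))"
     "(LBINT t:{0..R}. t powr (p - 1)) = R powr p / p"
    by (auto simp: set_integrable_def set_lebesgue_integral_def dest: has_bochner_integral_integral_eq integrable.intros)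
qed

lemma has_bochner_abs_powr_Icc:
  fixes p R :: real
  assumes "0 < p" "0 \<le> R"
  shows "set_integrable lborel {c-R..c+R} (\<lambda>t. \<bar>t - c\<bar> powr (p - 1))"
    and "(LBINT t:{c-R..c+R}. \<bar>t - c\<bar> powr (p - 1)) = 2 * R powr p / p"
proof -
  let ?g = "\<lambda>t. indicator {0..R} t *\<^sub>R t powr (p - 1)"
  have 1: "has_bochner_integral lborel ?g (R powr p / p)"
    using has_bochner_powr_Icc[OF assms] by (simp add: set_integrable_def set_lebesgue_integral_def has_bochner_integral_iff)
  have 2: "has_bochner_integral lborel (\<lambda>t. ?g (- c + 1 * t)) (R powr p / p)"
    using lborel_has_bochner_integral_real_affine_iff[of 1 ?g "R powr p / p" "-c"] 1 by simp
  have 3: "has_bochner_integral lborel (\<lambda>t. ?g (c + (-1) * t)) (R powr p / p)"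
    using lborel_has_bochner_integral_real_affine_iff[of "-1" ?g "R powr p / p" c] 1 by simp
  have "has_bochner_integral lborel (\<lambda>t. ?g (- c + 1 * t) + ?g (c + (-1) * t)) (R powr p / p + R powr p / p)"
    by (rule has_bochner_integral_add[OF 2 3])
  \<comment> \<open>The two half-line pieces overlap at t = c, harmlessly, as
    \<open>0 powr _\<close> is 0.\<close>
  moreover have "?g (- c + 1 * t) + ?g (c + (-1) * t) = indicator {c-R..c+R} t *\<^sub>R \<bar>t - c\<bar> powr (p - 1)" for t
    using assms by (cases "t = c") (auto simp: indicator_def abs_if)
  ultimately have "has_bochner_integral lborel (\<lambda>t. indicator {c-R..c+R} t *\<^sub>R \<bar>t - c\<bar> powr (p - 1)) (2 * R powr p / p)"
    by simp
  then show "set_integrable lborel {c-R..c+R} (\<lambda>t. \<bar>t - c\<bar> powr (p - 1))"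
    "(LBINT t:{c-R..c+R}. \<bar>t - c\<bar> powr (p - 1)) = 2 * R powr p / p"
    by (auto simp: set_integrable_def set_lebesgue_integral_def dest: has_bochner_integral_integral_eq integrable.intros)
qed

lemma set_integrable_inverse_square:
  "set_integrable lborel {1..} (\<lambda>t::real. 1 / t\<^sup>2)"
proof -
  have 1: "((\<lambda>t. t powr (-2)) has_integral -(1 powr (-2 + 1)) / (-2 + 1)) {1::real..}"
    by (rule has_integral_powr_to_inf) auto
  then have nn: "integral\<^sup>N lborel (\<lambda>x. indicator {1::real..} x * (x powr (-2))) = ennreal (-(1 powr (-2 + 1)) / (-2 + 1))"
    by (intro nn_integral_has_integral_lebesgue) auto
  have "has_bochner_integral lborel (\<lambda>x. indicator {1::real..} x * (x powr (-2))) (-(1 powr (-2 + 1)) / (-2 + 1))"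
    using nn by (intro has_bochner_integral_nn_integral) (auto simp: indicator_def split: if_splits)
  then have "integrable lborel (\<lambda>x. indicator {1::real..} x * (x powr (-2)))"
    by (auto dest: integrable.intros)
  then show ?thesis
    unfolding set_integrable_def
    by (rule Bochner_Integration.integrable_cong[THEN iffD1, rotated 2])
       (auto simp: indicator_def powr_minus powr_numeral field_simps)
qed

lemma set_lborel_scale:
  fixes f :: "real \<Rightarrow> complex"
  assumes "c > 0"
  shows "(LBINT t:{c*a..c*b}. f t) = c *\<^sub>R (LBINT t:{a..b}. f (c * t))"
proof -
  have "(LBINT t:{c*a..c*b}. f t) = c *\<^sub>R (LBINT t. indicator {c*a..c*b} (0 + c * t) *\<^sub>R f (0 + c * t))"
    using lborel_integral_real_affine[of c "\<lambda>t. indicator {c*a..c*b} t *\<^sub>R f t" 0] assms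
    by (simp add: set_lebesgue_integral_def)
  also have "(\<lambda>t. indicator {c*a..c*b} (0 + c * t) *\<^sub>R f (0 + c * t)) = (\<lambda>t. indicator {a..b} t *\<^sub>R f (c * t))"
    using assms by (auto simp: indicator_def fun_eq_iff)
  finally show ?thesis by (simp add: set_lebesgue_integral_def)
qed

lemma set_integral_Icc_split:
  fixes f :: "real \<Rightarrow> complex"
  assumes "a \<le> b" "b \<le> c" "set_integrable lborel {a..b} f" "set_integrable lborel {b..c} f"
  shows "set_integrable lborel {a..c} f"
    and "(LBINT t:{a..c}. f t) = (LBINT t:{a..b}. f t) + (LBINT t:{b..c}. f t)"
proof -
  have eq: "{a..c} = {a..b} \<union> {b..c}" using assms by auto
  show "set_integrable lborel {a..c} f" unfolding eq using assms by (intro set_integrable_Un) auto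
  have "AE x in lborel. \<not> (x \<in> {a..b} \<and> x \<in> {b..c})"
    using AE_lborel_singleton[of b] by eventually_elim auto
  then show "(LBINT t:{a..c}. f t) = (LBINT t:{a..b}. f t) + (LBINT t:{b..c}. f t)"
    unfolding eq using assms
    by (intro set_integral_Un_AE) auto
qed

section \<open>The regularised exponential integral and its logarithmic limit\<close>

lemma norm_cis_quotient_le: "cmod ((cis (x * \<xi>) - 1) / of_real \<xi>) \<le> \<bar>x\<bar>"
proof (cases "\<xi> = 0")
  case False
  have "cmod (cis (x * \<xi>) - cis 0) \<le> \<bar>x * \<xi>\<bar>" using norm_cis_diff_le[of "x * \<xi>" 0] by simp
  then show ?thesis using False by (simp add: norm_divide abs_mult field_simps)
qed simp

lemma cis_measurable [measurable (raw)]: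
  "f \<in> borel_measurable M \<Longrightarrow> (\<lambda>x. cis (f x)) \<in> borel_measurable M"
  unfolding cis_conv_exp by measurable

lemma set_integrable_cis_quotient:
  "set_integrable lborel {a..b} (\<lambda>\<xi>. (cis (x * \<xi>) - 1) / of_real \<xi>)"
proof (rule set_integrable_bound)
  show "set_integrable lborel {a..b} (\<lambda>_. \<bar>x\<bar>)"
    by (intro borel_integrable_atLeastAtMost' continuous_intros)
  show "set_borel_measurable lborel {a..b} (\<lambda>\<xi>. (cis (x * \<xi>) - 1) / complex_of_real \<xi>)"
    unfolding set_borel_measurable_def by measurable
  show "AE t in lborel. t \<in> {a..b} \<longrightarrow> norm ((cis (x * t) - 1) / complex_of_real t) \<le> norm \<bar>x\<bar>"
    using norm_cis_quotient_le[of x] by auto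
qed

lemma set_integrable_cis_over:
  "0 < a \<Longrightarrow> set_integrable lborel {a..b} (\<lambda>\<xi>. cis (x * \<xi>) / of_real \<xi>)"
  by (intro borel_integrable_atLeastAtMost' continuous_intros) auto

text \<open>Integration by parts: \<open>?F\<close> has derivative cis \<xi> / \<xi> minus the
  absolutely integrable \<open>?g\<close>, and \<open>?F\<close> vanishes at infinity.\<close>

lemma convergent_cis_over:
  "\<exists>L. ((\<lambda>N. LBINT \<xi>:{1..N}. cis \<xi> / of_real \<xi>) \<longlongrightarrow> L) at_top"
proof -
  let ?g = "\<lambda>\<xi>::real. cis \<xi> / (\<i> * of_real (\<xi>\<^sup>2))"
  let ?F = "\<lambda>\<xi>::real. cis \<xi> / (\<i> * of_real \<xi>)"
  have dF: "(?F has_vector_derivative (cis \<xi> / of_real \<xi> - ?g \<xi>)) (at \<xi> within S)" if "\<xi> \<noteq> 0" for \<xi> S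
    using that unfolding has_vector_derivative_def
    by (auto intro!: derivative_eq_intros simp: field_simps power2_eq_square scaleR_conv_of_real)
  have gi: "set_integrable lborel {1..} ?g"
  proof (rule set_integrable_bound[OF set_integrable_inverse_square])
    show "set_borel_measurable lborel {1..} ?g" unfolding set_borel_measurable_def by measurable
  qed (auto simp: norm_mult norm_divide norm_power)
  have lim1: "((\<lambda>N. LBINT \<xi>:{1..N}. ?g \<xi>) \<longlongrightarrow> (LBINT \<xi>:{1..}. ?g \<xi>)) at_top"
    by (rule tendsto_set_lebesgue_integral_at_top) (simp, rule gi)
  have lim2: "(?F \<longlongrightarrow> 0) at_top"
  proof (rule Lim_null_comparison)
    show "\<forall>\<^sub>F x in at_top. cmod (cis x / (\<i> * complex_of_real x)) \<le> 1 / x"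
      using eventually_gt_at_top[of "0::real"] by eventually_elim (simp add: norm_mult norm_divide)
    show "((\<lambda>x::real. 1 / x) \<longlongrightarrow> 0) at_top" by real_asymp
  qed
  have eq: "(LBINT \<xi>:{1..N}. cis \<xi> / of_real \<xi>) = (?F N - ?F 1) + (LBINT \<xi>:{1..N}. ?g \<xi>)" if N: "N \<ge> 1" for N
  proof -
    have "(LBINT \<xi>:{1..N}. cis \<xi> / of_real \<xi> - ?g \<xi>) = ?F N - ?F 1"
      unfolding set_lebesgue_integral_def
    proof (rule integral_FTC_atLeastAtMost[OF N])
      show "(?F has_vector_derivative (cis x / of_real x - ?g x)) (at x within {1..N})" if "1 \<le> x" for x
        using that by (intro dF) simp
    qed (auto intro!: continuous_intros)
    moreover have "(LBINT \<xi>:{1..N}. cis \<xi> / of_real \<xi> - ?g \<xi>) = (LBINT \<xi>:{1..N}. cis \<xi> / of_real \<xi>) - (LBINT \<xi>:{1..N}. ?g \<xi>)"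
      using set_integrable_cis_over[of 1 N 1]
      by (intro set_integral_diff borel_integrable_atLeastAtMost' continuous_intros) auto
    ultimately show ?thesis by simp
  qed
  have "((\<lambda>N. (?F N - ?F 1) + (LBINT \<xi>:{1..N}. ?g \<xi>)) \<longlongrightarrow> (0 - ?F 1) + (LBINT \<xi>:{1..}. ?g \<xi>)) at_top"
    by (intro tendsto_intros lim1 lim2)
  then have "((\<lambda>N. LBINT \<xi>:{1..N}. cis \<xi> / of_real \<xi>) \<longlongrightarrow> (0 - ?F 1) + (LBINT \<xi>:{1..}. ?g \<xi>)) at_top"
    by (rule Lim_transform_eventually)
       (use eventually_ge_at_top[of "1::real"] in \<open>eventually_elim, simp add: eq\<close>)
  then show ?thesis by blast
qed

text \<open>The integral over [0, N] of e^(ix\<xi>) minus the indicator of [0, 1], divided by \<xi>: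
  the sharp cutoff counterpart of the integral in \<open>G_zero\<close>, split so that each piece is
  absolutely integrable.\<close>

definition cis_split :: "real \<Rightarrow> real \<Rightarrow> complex" where
  "cis_split x N = (LBINT \<xi>:{0..1}. (cis (x * \<xi>) - 1) / of_real \<xi>) + (LBINT \<xi>:{1..N}. cis (x * \<xi>) / of_real \<xi>)"

lemma integral_inverse_Icc:
  assumes "0 < a" "a \<le> b"
  shows "set_integrable lborel {a..b} (\<lambda>t. 1 / complex_of_real t)"
    and "(LBINT t:{a..b}. 1 / complex_of_real t) = of_real (ln b - ln a)"
proof -
  show "set_integrable lborel {a..b} (\<lambda>t. 1 / complex_of_real t)"
    using assms by (intro borel_integrable_atLeastAtMost' continuous_intros) auto
  have "(LBINT t:{a..b}. 1 / complex_of_real t) = of_real (ln b) - of_real (ln a)"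
    unfolding set_lebesgue_integral_def
  proof (rule integral_FTC_atLeastAtMost[OF assms(2)])
    fix x assume "a \<le> x" "x \<le> b"
    then have "x > 0" using assms by simp
    have "(ln has_vector_derivative 1 / x) (at x within {a..b})"
      using DERIV_ln_divide[OF \<open>x > 0\<close>] unfolding has_real_derivative_iff_has_vector_derivative
      by (rule has_vector_derivative_at_within)
    then have "(ln has_real_derivative 1 / x) (at x within {a..b})"
      by (simp add: has_real_derivative_iff_has_vector_derivative)
    then have "((\<lambda>x. complex_of_real (ln x)) has_vector_derivative of_real (1 / x)) (at x within {a..b})"
      by (rule has_vector_derivative_of_real)
    then show "((\<lambda>x. complex_of_real (ln x)) has_vector_derivative 1 / complex_of_real x) (at x within {a..b})" by simp
  qed (use assms in \<open>auto intro!: continuous_intros\<close>)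
  then show "(LBINT t:{a..b}. 1 / complex_of_real t) = of_real (ln b - ln a)" by simp
qed

text \<open>Moving the splitting point from d to e transfers the integral of 1/\<xi> over [d, e],
  which is ln e - ln d; adding the logarithm makes the expression independent of the splitting
  point.\<close>

lemma cis_split_shift:
  assumes "0 < d" "d \<le> e" "e \<le> M"
  shows "(LBINT \<xi>:{0..d}. (cis \<xi> - 1) / of_real \<xi>) + (LBINT \<xi>:{d..M}. cis \<xi> / of_real \<xi>) + of_real (ln d)
       = (LBINT \<xi>:{0..e}. (cis \<xi> - 1) / of_real \<xi>) + (LBINT \<xi>:{e..M}. cis \<xi> / of_real \<xi>) + of_real (ln e)"
proof -
  note A = set_integrable_cis_quotient[of _ _ 1, simplified]
  note B = set_integrable_cis_over[of _ _ 1, simplified]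
  have 1: "(LBINT \<xi>:{0..e}. (cis \<xi> - 1) / of_real \<xi>) = (LBINT \<xi>:{0..d}. (cis \<xi> - 1) / of_real \<xi>) + (LBINT \<xi>:{d..e}. (cis \<xi> - 1) / of_real \<xi>)"
    using assms by (intro set_integral_Icc_split(2) A) auto
  have 2: "(LBINT \<xi>:{d..M}. cis \<xi> / of_real \<xi>) = (LBINT \<xi>:{d..e}. cis \<xi> / of_real \<xi>) + (LBINT \<xi>:{e..M}. cis \<xi> / of_real \<xi>)"
    using assms by (intro set_integral_Icc_split(2) B) auto
  have "(LBINT \<xi>:{d..e}. (cis \<xi> - 1) / of_real \<xi>) = (LBINT \<xi>:{d..e}. cis \<xi> / of_real \<xi> - 1 / of_real \<xi>)"
    by (simp add: diff_divide_distrib)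
  also have "\<dots> = (LBINT \<xi>:{d..e}. cis \<xi> / of_real \<xi>) - (LBINT \<xi>:{d..e}. 1 / of_real \<xi>)"
    using assms by (intro set_integral_diff B integral_inverse_Icc) auto
  finally have 3: "(LBINT \<xi>:{d..e}. (cis \<xi> - 1) / of_real \<xi>) = (LBINT \<xi>:{d..e}. cis \<xi> / of_real \<xi>) - of_real (ln e - ln d)"
    using integral_inverse_Icc[of d e] assms by simp
  show ?thesis unfolding 1 2 3 by simp
qed

text \<open>Passing to the variable x \<xi> moves the splitting point from 1 to x, and moving it
  back to 1 costs ln x. This is the source of the logarithm in the limit kernel.\<close>

lemma cis_split_scale:
  assumes "0 < x" "1 \<le> N" "1 \<le> x * N"
  shows "cis_split x N = cis_split 1 (x * N) - of_real (ln x)"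
proof -
  have 1: "(LBINT \<xi>:{0..1}. (cis (x * \<xi>) - 1) / of_real \<xi>) = (LBINT \<xi>:{0..x}. (cis \<xi> - 1) / of_real \<xi>)"
    using set_lborel_scale[OF assms(1), of 0 1 "\<lambda>\<xi>. (cis \<xi> - 1) / of_real \<xi>"] assms
    unfolding set_integral_scaleR_right[symmetric]
    by (simp add: scaleR_conv_of_real del: set_integral_mult_right)
  have 2: "(LBINT \<xi>:{1..N}. cis (x * \<xi>) / of_real \<xi>) = (LBINT \<xi>:{x..x*N}. cis \<xi> / of_real \<xi>)"
    using set_lborel_scale[OF assms(1), of 1 N "\<lambda>\<xi>. cis \<xi> / of_real \<xi>"] assms
    unfolding set_integral_scaleR_right[symmetric]
    by (simp add: scaleR_conv_of_real del: set_integral_mult_right)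
  show ?thesis
  proof (cases "x \<le> 1")
    case True
    show ?thesis using cis_split_shift[of x 1 "x * N"] assms True
      unfolding cis_split_def 1 2 by (simp add: algebra_simps)
  next
    case False
    have "x * 1 \<le> x * N" using assms by (intro mult_left_mono) auto
    then show ?thesis using cis_split_shift[of 1 x "x * N"] assms False
      unfolding cis_split_def 1 2 by (simp add: algebra_simps)
  qed
qed

lemma cis_split_uminus: "cis_split (- x) N = cnj (cis_split x N)"
proof -
  have "cnj (set_lebesgue_integral lborel A f) = set_lebesgue_integral lborel A (\<lambda>x. cnj (f x))" for A :: "real set" and f
    unfolding set_lebesgue_integral_def Bochner_Integration.integral_cnj[symmetric] by simp
  then show ?thesis unfolding cis_split_def by (simp add: cis_cnj[symmetric])
qed

text \<open>The subtracted 1 is real, so it drops out of the imaginary part, and both pieces combine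
  to the integral of sin \<xi> / \<xi>.\<close>

lemma Im_cis_split:
  assumes "1 \<le> N"
  shows "Im (cis_split 1 N) = Si N"
proof -
  let ?f = "\<lambda>\<xi>::real. sin \<xi> / \<xi>"
  have I1: "set_integrable lborel {0..1} (\<lambda>\<xi>. (cis \<xi> - 1) / complex_of_real \<xi>)"
    using set_integrable_cis_quotient[of 0 1 1] by simp
  have I2: "set_integrable lborel {1..N} (\<lambda>\<xi>. cis \<xi> / complex_of_real \<xi>)"
    using set_integrable_cis_over[of 1 N 1] by simp
  have im: "Im (set_lebesgue_integral lborel A f) = set_lebesgue_integral lborel A (\<lambda>x. Im (f x))"
    "set_integrable lborel A (\<lambda>x. Im (f x))" if "set_integrable lborel A f" for A :: "real set" and f
    using that unfolding set_lebesgue_integral_def set_integrable_def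
    by (simp_all add: integral_Im[symmetric] integrable_Im del: integral_Im) (auto dest: integrable_Im)
  have s: "Im ((cis \<xi> - 1) / complex_of_real \<xi>) = ?f \<xi>" "Im (cis \<xi> / complex_of_real \<xi>) = ?f \<xi>" for \<xi>
    by (simp_all add: Im_divide_of_real)
  have J: "set_integrable lborel {0..1} ?f" "set_integrable lborel {1..N} ?f"
    using im(2)[OF I1] im(2)[OF I2] by (simp_all add: s)
  have "Im (cis_split 1 N) = (LBINT \<xi>:{0..1}. ?f \<xi>) + (LBINT \<xi>:{1..N}. ?f \<xi>)"
    unfolding cis_split_def using im(1)[OF I1] im(1)[OF I2] by (simp add: s)
  also have "\<dots> = (LBINT \<xi>:{0..N}. ?f \<xi>)"
  proof -
    have "AE x in lborel. \<not> (x \<in> {0..1} \<and> x \<in> {1..N})"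
      using AE_lborel_singleton[of "1::real"] by eventually_elim auto
    then have "(LBINT \<xi>:{0..1} \<union> {1..N}. ?f \<xi>) = (LBINT \<xi>:{0..1}. ?f \<xi>) + (LBINT \<xi>:{1..N}. ?f \<xi>)"
      using J by (intro set_integral_Un_AE) auto
    moreover have "{0..1} \<union> {1..N} = {0..N}" using assms by auto
    ultimately show ?thesis by simp
  qed
  also have "\<dots> = Si N"
    unfolding Si_def using assms by (simp add: zero_ereal_def interval_integral_Icc)
  finally show ?thesis .
qed

text \<open>Limit of \<open>cis_split\<close> as N grows, up to the real constant \<open>g\<close>;
  in the case that arises \<open>g\<close> is minus Euler's constant, and it cancels in differences
  of kernels. The step pi/2 sgn x is the limit of the sine integral.\<close>

definition log_kernel :: "real \<Rightarrow> real \<Rightarrow> complex" where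
  "log_kernel g x = Complex (g - ln \<bar>x\<bar>) (pi / 2 * sgn x)"

text \<open>Scaling reduces x > 0 to x = 1, and conjugation gives x < 0. At x = 1 the imaginary part
  is the limit pi/2 of \<open>Si\<close>, and the real part is simply named
  \<open>g\<close>.\<close>

lemma cis_split_tendsto:
  obtains g where "\<And>x. x \<noteq> 0 \<Longrightarrow> (cis_split x \<longlongrightarrow> log_kernel g x) at_top"
proof -
  obtain L where L: "((\<lambda>N. LBINT \<xi>:{1..N}. cis \<xi> / complex_of_real \<xi>) \<longlongrightarrow> L) at_top"
    using convergent_cis_over by blast
  define J where "J = (LBINT \<xi>:{0..1}. (cis \<xi> - 1) / complex_of_real \<xi>) + L"
  have J: "(cis_split 1 \<longlongrightarrow> J) at_top"
    unfolding cis_split_def J_def using L by (auto intro!: tendsto_intros)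
  have "((\<lambda>N. Im (cis_split 1 N)) \<longlongrightarrow> Im J) at_top" by (intro tendsto_intros J)
  moreover have "((\<lambda>N. Im (cis_split 1 N)) \<longlongrightarrow> pi / 2) at_top"
    by (rule Lim_transform_eventually[OF Si_at_top])
       (use eventually_ge_at_top[of "1::real"] in \<open>eventually_elim, simp add: Im_cis_split\<close>)
  ultimately have ImJ: "Im J = pi / 2" using tendsto_unique trivial_limit_at_top_linorder by blast
  have pos: "(cis_split x \<longlongrightarrow> log_kernel (Re J) x) at_top" if "x > 0" for x
  proof -
    have "LIM N at_top. x * N :> at_top" using that by real_asymp
    then have "((\<lambda>N. cis_split 1 (x * N) - of_real (ln x)) \<longlongrightarrow> J - of_real (ln x)) at_top"
      by (intro tendsto_intros filterlim_compose[OF J])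
    moreover have "J - of_real (ln x) = log_kernel (Re J) x"
      using that ImJ by (simp add: log_kernel_def complex_eq_iff)
    moreover have "\<forall>\<^sub>F N in at_top. cis_split 1 (x * N) - of_real (ln x) = cis_split x N"
      using eventually_ge_at_top[of "1::real"] eventually_ge_at_top[of "1/x"]
    proof eventually_elim
      case (elim N)
      then show ?case using that cis_split_scale[of x N] by (simp add: field_simps)
    qed
    ultimately show ?thesis by (auto intro: Lim_transform_eventually)
  qed
  have "(cis_split x \<longlongrightarrow> log_kernel (Re J) x) at_top" if "x \<noteq> 0" for x
  proof (cases "x > 0")
    case False
    then have "((\<lambda>N. cnj (cis_split (- x) N)) \<longlongrightarrow> cnj (log_kernel (Re J) (- x))) at_top"
      using that by (intro tendsto_intros pos) auto
    moreover have "cnj (log_kernel (Re J) (- x)) = log_kernel (Re J) x"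
      by (simp add: log_kernel_def complex_eq_iff sgn_minus)
    moreover have "(\<lambda>N. cnj (cis_split (- x) N)) = cis_split x"
      using cis_split_uminus[of "-x"] by (auto simp: fun_eq_iff)
    ultimately show ?thesis by simp
  qed (use pos in auto)
  then show ?thesis using that by blast
qed

lemma one_le_wt: "1 \<le> wt x" by (simp add: wt_def)

section \<open>The resolvent integral as k tends to 0 off the cut\<close>

lemma of_real_minus_notin_nonpos:
  fixes k :: complex
  assumes "k \<notin> \<real>\<^sub>\<ge>\<^sub>0" "0 \<le> \<xi>"
  shows "of_real \<xi> - k \<notin> \<real>\<^sub>\<le>\<^sub>0"
proof
  assume "of_real \<xi> - k \<in> \<real>\<^sub>\<le>\<^sub>0"
  then obtain r where "of_real \<xi> - k = complex_of_real r" "r \<le> 0" by (auto simp: nonpos_Reals_def)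
  then have "k = complex_of_real (\<xi> - r)" by (simp add: algebra_simps)
  then have "k \<in> \<real>\<^sub>\<ge>\<^sub>0" using assms \<open>r \<le> 0\<close> by (simp add: complex_nonneg_Reals_iff)
  then show False using assms by simp
qed

lemma of_real_minus_nonzero:
  "(k::complex) \<notin> \<real>\<^sub>\<ge>\<^sub>0 \<Longrightarrow> 0 \<le> \<xi> \<Longrightarrow> of_real \<xi> - k \<noteq> 0"
  using of_real_minus_notin_nonpos[of k \<xi>] by auto

text \<open>For k off [0, \<infinity>) the path \<xi> - k with \<xi> nonnegative stays clear of
  (-\<infinity>, 0], so the principal \<open>Ln\<close> is a primitive along it.\<close>

lemma integral_resolvent_Icc:
  assumes k: "k \<notin> \<real>\<^sub>\<ge>\<^sub>0" and "0 \<le> c" "c \<le> d"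
  shows "(LBINT \<xi>:{c..d}. 1 / (of_real \<xi> - k)) = Ln (of_real d - k) - Ln (of_real c - k)"
  unfolding set_lebesgue_integral_def
proof (rule integral_FTC_atLeastAtMost[OF assms(3)])
  fix x assume "c \<le> x" "x \<le> d"
  then have "of_real x - k \<notin> \<real>\<^sub>\<le>\<^sub>0" using assms by (intro of_real_minus_notin_nonpos) auto
  then have "(Ln has_field_derivative inverse (of_real x - k)) (at (of_real x - k))" 
    by (rule has_field_derivative_Ln)
  then have "((\<lambda>x. Ln (of_real x - k)) has_vector_derivative (1 * inverse (of_real x - k))) (at x within {c..d})"
    by (intro field_vector_diff_chain_within[unfolded o_def, where f = "\<lambda>x. of_real x - k" and g = Ln and f' = 1])
      (auto intro!: derivative_eq_intros has_field_derivative_at_within simp: has_vector_derivative_def scaleR_conv_of_real)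
  then show "((\<lambda>x. Ln (of_real x - k)) has_vector_derivative 1 / (of_real x - k)) (at x within {c..d})"
    by (simp add: field_simps)
next
  show "continuous_on {c..d} (\<lambda>\<xi>. 1 / (complex_of_real \<xi> - k))"
    using assms of_real_minus_nonzero[OF k] by (intro continuous_intros) auto
qed

lemma set_integrable_resolvent:
  fixes k :: complex and f :: "real \<Rightarrow> complex"
  assumes "k \<notin> \<real>\<^sub>\<ge>\<^sub>0" "0 \<le> c" "continuous_on {c..d} f"
  shows "set_integrable lborel {c..d} (\<lambda>\<xi>. f \<xi> / (of_real \<xi> - k))"
  using assms of_real_minus_nonzero[OF assms(1)]
  by (intro borel_integrable_atLeastAtMost' continuous_intros) auto

lemma resolvent_diff:
  fixes k :: complex
  assumes "k \<notin> \<real>\<^sub>\<ge>\<^sub>0" "0 < \<xi>"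
  shows "1 / (of_real \<xi> - k) - 1 / of_real \<xi> = k / (of_real \<xi> * (of_real \<xi> - k))"
proof -
  have "of_real \<xi> - k \<noteq> 0" "complex_of_real \<xi> \<noteq> 0" using assms of_real_minus_nonzero[of k \<xi>] by auto
  then show ?thesis by (simp add: divide_simps)
qed

text \<open>The threshold 2|k| gives |\<xi> - k| \<ge> \<xi>/2.\<close>

lemma norm_resolvent_diff_le:
  assumes "k \<notin> \<real>\<^sub>\<ge>\<^sub>0" "0 < \<xi>" "2 * cmod k \<le> \<xi>"
  shows "cmod (1 / (of_real \<xi> - k) - 1 / of_real \<xi>) \<le> 2 * cmod k / \<xi>\<^sup>2"
proof -
  have "\<xi> / 2 \<le> cmod (of_real \<xi> - k)"
    using norm_triangle_ineq2[of "of_real \<xi>" k] assms by simp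
  then have "cmod k / (\<xi> * cmod (of_real \<xi> - k)) \<le> cmod k / (\<xi> * (\<xi> / 2))"
    using assms by (intro divide_left_mono mult_left_mono mult_pos_pos) auto
  then show ?thesis
    using assms unfolding resolvent_diff[OF assms(1,2)] norm_divide norm_mult
    by (simp add: power2_eq_square mult.commute)
qed

text \<open>The bound does not depend on k: 2|k| - k has modulus between |k| and 3|k|, and two
  principal arguments differ by at most 2 pi.\<close>

lemma norm_Ln_diff_le:
  assumes "k \<noteq> 0"
  shows "cmod (Ln (of_real (2 * cmod k) - k) - Ln (- k)) \<le> 2 + 2 * pi"
proof -
  let ?w = "of_real (2 * cmod k) - k"
  have w1: "cmod k \<le> cmod ?w" using norm_triangle_ineq2[of "of_real (2 * cmod k)" k] by simp
  have w2: "cmod ?w \<le> 3 * cmod k" using norm_triangle_ineq4[of "of_real (2 * cmod k)" k] by simp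
  have w0: "?w \<noteq> 0" using w1 assms by auto
  have "ln (cmod ?w) \<le> ln (3 * cmod k)" using w2 w0 assms by (subst ln_le_cancel_iff) auto
  also have "\<dots> = ln 3 + ln (cmod k)" using assms by (simp add: ln_mult)
  also have "ln (3::real) \<le> 3 - 1" by (rule ln_le_minus_one) simp
  finally have 1: "ln (cmod ?w) - ln (cmod k) \<le> 2" by simp
  have 2: "ln (cmod k) \<le> ln (cmod ?w)" using w1 w0 assms by (subst ln_le_cancel_iff) auto
  have "\<bar>Re (Ln ?w - Ln (- k))\<bar> \<le> 2" using 1 2 w0 assms by simp
  moreover have "\<bar>Im (Ln ?w - Ln (- k))\<bar> \<le> 2 * pi"
    using Im_Ln_le_pi[OF w0] mpi_less_Im_Ln[OF w0] Im_Ln_le_pi[of "-k"] mpi_less_Im_Ln[of "-k"] assms by auto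
  ultimately show ?thesis using cmod_le[of "Ln ?w - Ln (- k)"] by linarith
qed

lemma abs_powr_le_wt:
  assumes "0 \<le> a" "a \<le> b"
  shows "\<bar>x\<bar> powr a \<le> wt x powr b"
proof -
  have "\<bar>x\<bar> powr a \<le> wt x powr a" using assms by (intro powr_mono2) (auto simp: wt_def)
  also have "\<dots> \<le> wt x powr b" using assms one_le_wt by (intro powr_mono) auto
  finally show ?thesis .
qed

text \<open>Away from the singularity the factor e^(ix\<xi>) - 1 contributes |x\<xi>|^b and the
  resolvent difference |k|/\<xi>^2. Giving up all but the power a of |k| leaves \<xi>^(b - a - 1),
  integrable at 0 exactly because a < b.\<close>

lemma far_perturbation_le:
  assumes "0 < a" "a < b" "b \<le> 1" and k: "k \<notin> \<real>\<^sub>\<ge>\<^sub>0" "cmod k \<le> 1/2"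
  shows "cmod (LBINT \<xi>:{2 * cmod k..1}. (cis (x * \<xi>) - 1) * (1 / (of_real \<xi> - k) - 1 / of_real \<xi>))
     \<le> 4 / (b - a) * cmod k powr a * wt x powr b"
proof -
  define r where "r = cmod k"
  have r: "0 < r" "r \<le> 1/2" using k by (auto simp: r_def)
  let ?h = "\<lambda>\<xi>. 4 * \<bar>x\<bar> powr b * r powr a * \<xi> powr ((b - a) - 1)"
  have I: "set_integrable lborel {0..1} (\<lambda>\<xi>. \<xi> powr ((b - a) - 1))" 
     "(LBINT \<xi>:{0..1}. \<xi> powr ((b - a) - 1)) = 1 / (b - a)"
    using has_bochner_powr_Icc[of "b - a" 1] assms by auto
  have I': "set_integrable lborel {2 * r..1} ?h" 
    using r by (intro set_integrable_mult_right set_integrable_subset[OF I(1)]) auto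
  have "cmod (LBINT \<xi>:{2 * r..1}. (cis (x * \<xi>) - 1) * (1 / (of_real \<xi> - k) - 1 / of_real \<xi>))
     \<le> (LBINT \<xi>:{2 * r..1}. ?h \<xi>)"
  proof (rule norm_set_integral_le_dominated[OF I'])
    fix \<xi> assume \<xi>: "\<xi> \<in> {2 * r..1}"
    then have "\<xi> > 0" using r by auto
    have 1: "cmod (cis (x * \<xi>) - 1) \<le> 2 * (\<bar>x\<bar> powr b * \<xi> powr b)"
      using norm_cis_diff_powr_le[of b "x * \<xi>" 0] assms \<open>\<xi> > 0\<close> by (simp add: abs_mult powr_mult)
    have 2: "cmod (1 / (of_real \<xi> - k) - 1 / of_real \<xi>) \<le> 2 * r / \<xi>\<^sup>2"
      unfolding r_def using \<xi> \<open>\<xi> > 0\<close> k r by (intro norm_resolvent_diff_le) (auto simp: r_def)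
    \<comment> \<open>Uses r \<le> \<xi> to exchange r^(1 - a) for \<xi>^(1 - a).\<close>
    have "r / \<xi>\<^sup>2 \<le> r powr a * \<xi> powr (- 1 - a)"
    proof -
      have "r = r powr a * r powr (1 - a)" using r by (simp add: powr_add[symmetric])
      also have "\<dots> \<le> r powr a * \<xi> powr (1 - a)" 
        using \<xi> r assms by (intro mult_left_mono powr_mono2) auto
      also have "\<dots> = r powr a * \<xi> powr (-1 - a) * \<xi>\<^sup>2"
        using \<open>\<xi> > 0\<close> by (simp add: powr_add[symmetric] flip: powr_numeral)
      finally show ?thesis using \<open>\<xi> > 0\<close> by (simp add: field_simps)
    qed
    then have 3: "2 * r / \<xi>\<^sup>2 \<le> 2 * (r powr a * \<xi> powr (- 1 - a))" by simp
    have "cmod ((cis (x * \<xi>) - 1) * (1 / (of_real \<xi> - k) - 1 / of_real \<xi>))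
       \<le> (2 * (\<bar>x\<bar> powr b * \<xi> powr b)) * (2 * (r powr a * \<xi> powr (- 1 - a)))"
      unfolding norm_mult using 1 2 3 by (intro mult_mono order_trans[OF 2 3]) auto
    also have "\<dots> = 4 * \<bar>x\<bar> powr b * r powr a * (\<xi> powr b * \<xi> powr (- 1 - a))" by (simp add: algebra_simps)
    also have "\<xi> powr b * \<xi> powr (- 1 - a) = \<xi> powr ((b - a) - 1)"
      using \<open>\<xi> > 0\<close> by (simp add: powr_add[symmetric] algebra_simps)
    finally show "cmod ((cis (x * \<xi>) - 1) * (1 / (of_real \<xi> - k) - 1 / of_real \<xi>)) \<le> ?h \<xi>" .
  qed
  also have "\<dots> = 4 * \<bar>x\<bar> powr b * r powr a * (LBINT \<xi>:{2 * r..1}. \<xi> powr ((b - a) - 1))"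
    by (simp add: set_integral_mult_right)
  also have "(LBINT \<xi>:{2 * r..1}. \<xi> powr ((b - a) - 1)) \<le> (LBINT \<xi>:{0..1}. \<xi> powr ((b - a) - 1))"
    using I(1) r unfolding set_lebesgue_integral_def set_integrable_def
    by (intro integral_mono') (auto simp: indicator_def)
  also have "(LBINT \<xi>:{0..1}. \<xi> powr ((b - a) - 1)) = 1 / (b - a)" by (rule I(2))
  finally have "cmod (LBINT \<xi>:{2 * r..1}. (cis (x * \<xi>) - 1) * (1 / (of_real \<xi> - k) - 1 / of_real \<xi>))
     \<le> 4 * \<bar>x\<bar> powr b * r powr a * (1 / (b - a))" by (simp add: mult_left_mono)
  also have "\<dots> \<le> 4 * wt x powr b * r powr a * (1 / (b - a))"
    using assms by (intro mult_right_mono mult_left_mono abs_powr_le_wt) auto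
  finally show ?thesis by (simp add: r_def field_simps)
qed

lemma near_perturbation_le:
  assumes "0 < a" "a < b" "b \<le> 1" and k: "k \<notin> \<real>\<^sub>\<ge>\<^sub>0" "cmod k \<le> 1/2"
  shows "cmod (LBINT \<xi>:{0..2 * cmod k}. (cis (x * \<xi>) - 1) * (1 / (of_real \<xi> - k) - 1 / of_real \<xi>))
     \<le> (16 / a + 4 + 4 * pi) * cmod k powr a * wt x powr b"
proof -
  define r where "r = cmod k"
  have r: "0 < r" "r \<le> 1/2" using k by (auto simp: r_def)
  define \<kappa> where "\<kappa> = Re k"
  have \<kappa>: "\<bar>\<kappa>\<bar> \<le> r" by (simp add: \<kappa>_def r_def abs_Re_le_cmod)
  let ?A = "{0..2 * r}"
  let ?f1 = "\<lambda>\<xi>. (cis (x * \<xi>) - cis (x * \<kappa>)) / (of_real \<xi> - k)"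
  let ?f2 = "\<lambda>\<xi>. (cis (x * \<kappa>) - 1) / (of_real \<xi> - k)"
  let ?f3 = "\<lambda>\<xi>. (cis (x * \<xi>) - 1) / of_real \<xi>"
  have i1: "set_integrable lborel ?A ?f1" by (intro set_integrable_resolvent k continuous_intros) auto
  have i2: "set_integrable lborel ?A ?f2" by (intro set_integrable_resolvent k continuous_intros) auto
  have i3: "set_integrable lborel ?A ?f3" by (rule set_integrable_cis_quotient)
  have "(cis (x * \<xi>) - 1) * (1 / (of_real \<xi> - k) - 1 / of_real \<xi>) = ?f1 \<xi> + ?f2 \<xi> - ?f3 \<xi>" for \<xi>
    by (simp add: diff_divide_distrib algebra_simps)
  then have "(LBINT \<xi>:?A. (cis (x * \<xi>) - 1) * (1 / (of_real \<xi> - k) - 1 / of_real \<xi>))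
    = (LBINT \<xi>:?A. ?f1 \<xi> + ?f2 \<xi> - ?f3 \<xi>)" by simp
  also have "\<dots> = (LBINT \<xi>:?A. ?f1 \<xi>) + (LBINT \<xi>:?A. ?f2 \<xi>) - (LBINT \<xi>:?A. ?f3 \<xi>)"
    using i1 i2 i3 by (simp add: set_integral_add set_integral_diff)
  finally have eq: "(LBINT \<xi>:?A. (cis (x * \<xi>) - 1) * (1 / (of_real \<xi> - k) - 1 / of_real \<xi>))
    = (LBINT \<xi>:?A. ?f1 \<xi>) + (LBINT \<xi>:?A. ?f2 \<xi>) - (LBINT \<xi>:?A. ?f3 \<xi>)" .
  have b1: "cmod (LBINT \<xi>:?A. ?f1 \<xi>) \<le> 12 / a * r powr a * \<bar>x\<bar> powr a"
  proof -
    \<comment> \<open>Since |\<kappa>| \<le> r, the radius 3r makes the symmetric interval contain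
      [0, 2r].\<close>
    let ?B = "{\<kappa> - 3 * r..\<kappa> + 3 * r}"
    have I: "set_integrable lborel ?B (\<lambda>t. \<bar>t - \<kappa>\<bar> powr (a - 1))"
      "(LBINT t:?B. \<bar>t - \<kappa>\<bar> powr (a - 1)) = 2 * (3 * r) powr a / a"
      using has_bochner_abs_powr_Icc[of a "3 * r" \<kappa>] assms r by auto
    have I': "set_integrable lborel ?A (\<lambda>t. 2 * \<bar>x\<bar> powr a * \<bar>t - \<kappa>\<bar> powr (a - 1))"
      using r \<kappa> by (intro set_integrable_mult_right set_integrable_subset[OF I(1)]) auto
    have "cmod (LBINT \<xi>:?A. ?f1 \<xi>) \<le> (LBINT t:?A. 2 * \<bar>x\<bar> powr a * \<bar>t - \<kappa>\<bar> powr (a - 1))"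
    proof (rule norm_set_integral_le_dominated[OF I'])
      fix \<xi> assume "\<xi> \<in> ?A"
      show "cmod (?f1 \<xi>) \<le> 2 * \<bar>x\<bar> powr a * \<bar>\<xi> - \<kappa>\<bar> powr (a - 1)"
      proof (cases "\<xi> = \<kappa>")
        case False
        have "cmod (cis (x * \<xi>) - cis (x * \<kappa>)) \<le> 2 * \<bar>x * (\<xi> - \<kappa>)\<bar> powr a"
          using norm_cis_diff_powr_le[of a "x * \<xi>" "x * \<kappa>"] assms by (simp add: algebra_simps)
        also have "\<dots> = 2 * \<bar>x\<bar> powr a * \<bar>\<xi> - \<kappa>\<bar> powr a" by (simp add: abs_mult powr_mult)
        finally have 1: "cmod (cis (x * \<xi>) - cis (x * \<kappa>)) \<le> 2 * \<bar>x\<bar> powr a * \<bar>\<xi> - \<kappa>\<bar> powr a" .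
        have 2: "\<bar>\<xi> - \<kappa>\<bar> \<le> cmod (of_real \<xi> - k)"
          using abs_Re_le_cmod[of "of_real \<xi> - k"] by (simp add: \<kappa>_def)
        have "cmod (?f1 \<xi>) \<le> (2 * \<bar>x\<bar> powr a * \<bar>\<xi> - \<kappa>\<bar> powr a) / \<bar>\<xi> - \<kappa>\<bar>"
          unfolding norm_divide using 1 2 False by (intro frac_le) auto
        also have "\<dots> = 2 * \<bar>x\<bar> powr a * \<bar>\<xi> - \<kappa>\<bar> powr (a - 1)"
          using False by (simp add: powr_diff)
        finally show ?thesis .
      qed simp
    qed
    also have "\<dots> = 2 * \<bar>x\<bar> powr a * (LBINT t:?A. \<bar>t - \<kappa>\<bar> powr (a - 1))"
      by (simp add: set_integral_mult_right)
    also have "\<dots> \<le> 2 * \<bar>x\<bar> powr a * (LBINT t:?B. \<bar>t - \<kappa>\<bar> powr (a - 1))"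
      using I(1) r \<kappa> unfolding set_lebesgue_integral_def set_integrable_def
      by (intro mult_left_mono integral_mono') (auto simp: indicator_def)
    also have "\<dots> = 2 * \<bar>x\<bar> powr a * (2 * (3 powr a * r powr a) / a)" using r by (simp add: I powr_mult)
    also have "\<dots> \<le> 2 * \<bar>x\<bar> powr a * (2 * (3 * r powr a) / a)"
      using assms powr_mono[of a 1 "3::real"] by (intro mult_left_mono divide_right_mono mult_right_mono) auto
    finally show ?thesis by (simp add: field_simps)
  qed
  have b2: "cmod (LBINT \<xi>:?A. ?f2 \<xi>) \<le> (4 + 4 * pi) * r powr a * \<bar>x\<bar> powr a"
  proof -
    have "(LBINT \<xi>:?A. ?f2 \<xi>) = (LBINT \<xi>:?A. (cis (x * \<kappa>) - 1) * (1 / (of_real \<xi> - k)))" by simp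
    also have "\<dots> = (cis (x * \<kappa>) - 1) * (Ln (of_real (2 * r) - k) - Ln (of_real 0 - k))"
      using integral_resolvent_Icc[OF k(1), of 0 "2 * r"] r by (simp only: set_integral_mult_right)
    finally have e: "(LBINT \<xi>:?A. ?f2 \<xi>) = (cis (x * \<kappa>) - 1) * (Ln (of_real (2 * r) - k) - Ln (- k))" by simp
    have "cmod (cis (x * \<kappa>) - 1) \<le> 2 * (\<bar>x\<bar> powr a * \<bar>\<kappa>\<bar> powr a)"
      using norm_cis_diff_powr_le[of a "x * \<kappa>" 0] assms by (simp add: abs_mult powr_mult)
    also have "\<dots> \<le> 2 * (\<bar>x\<bar> powr a * r powr a)"
      using \<kappa> assms by (intro mult_left_mono powr_mono2) auto
    finally have "cmod (LBINT \<xi>:?A. ?f2 \<xi>) \<le> 2 * (\<bar>x\<bar> powr a * r powr a) * (2 + 2 * pi)"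
      unfolding e norm_mult using norm_Ln_diff_le[of k] r
      by (intro mult_mono) (auto simp: r_def)
    then show ?thesis by (simp add: algebra_simps)
  qed
  have b3: "cmod (LBINT \<xi>:?A. ?f3 \<xi>) \<le> 4 / a * r powr a * \<bar>x\<bar> powr a"
  proof -
    have I: "set_integrable lborel ?A (\<lambda>t. t powr (a - 1))"
      "(LBINT t:?A. t powr (a - 1)) = (2 * r) powr a / a"
      using has_bochner_powr_Icc[of a "2 * r"] assms r by auto
    have "cmod (LBINT \<xi>:?A. ?f3 \<xi>) \<le> (LBINT t:?A. 2 * \<bar>x\<bar> powr a * t powr (a - 1))"
    proof (rule norm_set_integral_le_dominated)
      fix \<xi> assume \<xi>: "\<xi> \<in> ?A"
      show "cmod (?f3 \<xi>) \<le> 2 * \<bar>x\<bar> powr a * \<xi> powr (a - 1)"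
      proof (cases "\<xi> = 0")
        case False
        have "cmod (cis (x * \<xi>) - 1) \<le> 2 * (\<bar>x\<bar> powr a * \<xi> powr a)"
          using norm_cis_diff_powr_le[of a "x * \<xi>" 0] assms \<xi> by (simp add: abs_mult powr_mult)
        then have "cmod (?f3 \<xi>) \<le> 2 * (\<bar>x\<bar> powr a * \<xi> powr a) / \<xi>"
          using False \<xi> by (simp add: norm_divide divide_right_mono)
        then show ?thesis using False \<xi> by (simp add: powr_diff)
      qed simp
    qed (intro set_integrable_mult_right I)
    also have "\<dots> = 2 * \<bar>x\<bar> powr a * (LBINT t:?A. t powr (a - 1))"
      by (simp add: set_integral_mult_right)
    also have "\<dots> = 2 * \<bar>x\<bar> powr a * ((2 powr a * r powr a) / a)" using r by (simp add: I powr_mult)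
    also have "\<dots> \<le> 2 * \<bar>x\<bar> powr a * ((2 * r powr a) / a)"
      using assms powr_mono[of a 1 "2::real"] by (intro mult_left_mono divide_right_mono mult_right_mono) auto
    finally show ?thesis by (simp add: field_simps)
  qed
  have "cmod ((LBINT \<xi>:?A. ?f1 \<xi>) + (LBINT \<xi>:?A. ?f2 \<xi>) - (LBINT \<xi>:?A. ?f3 \<xi>))
    \<le> 12 / a * r powr a * \<bar>x\<bar> powr a + (4 + 4 * pi) * r powr a * \<bar>x\<bar> powr a + 4 / a * r powr a * \<bar>x\<bar> powr a"
    using b1 b2 b3 norm_triangle_ineq4[of "(LBINT \<xi>:?A. ?f1 \<xi>) + (LBINT \<xi>:?A. ?f2 \<xi>)" "LBINT \<xi>:?A. ?f3 \<xi>"]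
      norm_triangle_ineq[of "LBINT \<xi>:?A. ?f1 \<xi>" "LBINT \<xi>:?A. ?f2 \<xi>"] by linarith
  also have "\<dots> = (16 / a + 4 + 4 * pi) * r powr a * \<bar>x\<bar> powr a" by (simp add: field_simps)
  also have "\<dots> \<le> (16 / a + 4 + 4 * pi) * r powr a * wt x powr b"
    using assms by (intro mult_left_mono abs_powr_le_wt) auto
  finally show ?thesis unfolding eq r_def[symmetric] .
qed

text \<open>On [0, 1] the integrand is 1/(\<xi> - k) + (e^(ix\<xi>) - 1)/\<xi> plus a perturbation;
  on [1, N] it is e^(ix\<xi>)/\<xi> plus an absolutely integrable one. The term 1/(\<xi> - k)
  integrates to Ln(1 - k) - Ln(-k), the source of the logarithm of k; the other main terms form
  \<open>cis_split\<close>, and Ln(1 - k) = O(|k|) goes into the remainder P.\<close>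

lemma cis_resolvent_tendsto:
  assumes ab: "0 < a" "a < b" "b \<le> 1"
    and g: "\<And>x. x \<noteq> 0 \<Longrightarrow> (cis_split x \<longlongrightarrow> log_kernel g x) at_top"
  obtains C where "0 \<le> C"
    "\<And>k x. k \<notin> \<real>\<^sub>\<ge>\<^sub>0 \<Longrightarrow> cmod k < 1/2 \<Longrightarrow> x \<noteq> 0 \<Longrightarrow>
       \<exists>P. ((\<lambda>N. LBINT \<xi>:{0..N}. cis (x * \<xi>) / (of_real \<xi> - k)) \<longlongrightarrow> log_kernel g x - Ln (- k) + P) at_top
         \<and> cmod P \<le> C * cmod k powr a * wt x powr b"
proof -
  define D where "D = (LBINT t:{1..}. 1 / t\<^sup>2 :: real)"
  have D0: "0 \<le> D" unfolding D_def set_lebesgue_integral_def by (rule integral_nonneg_AE) auto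
  define C where "C = 4 / (b - a) + (16 / a + 4 + 4 * pi) + (2 * D + 2)"
  have "\<exists>P. ((\<lambda>N. LBINT \<xi>:{0..N}. cis (x * \<xi>) / (of_real \<xi> - k)) \<longlongrightarrow> log_kernel g x - Ln (- k) + P) at_top
         \<and> cmod P \<le> C * cmod k powr a * wt x powr b"
    if k: "k \<notin> \<real>\<^sub>\<ge>\<^sub>0" "cmod k < 1/2" and x: "x \<noteq> 0" for k x
  proof -
    have r: "0 < cmod k" "cmod k \<le> 1/2" using k by auto
    let ?d = "\<lambda>\<xi>. 1 / (of_real \<xi> - k) - 1 / complex_of_real \<xi>"
    define P1 where "P1 = (LBINT \<xi>:{0..1}. (cis (x * \<xi>) - 1) * ?d \<xi>)"
    define P2 where "P2 = (LBINT \<xi>:{1..}. cis (x * \<xi>) * ?d \<xi>)"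
    define P where "P = P1 + P2 + Ln (1 - k)"
    have i1: "set_integrable lborel {c..d} (\<lambda>\<xi>. (cis (x * \<xi>) - 1) * ?d \<xi>)" if "0 \<le> c" for c d
    proof -
      have "set_integrable lborel {c..d} (\<lambda>\<xi>. (cis (x * \<xi>) - 1) / (of_real \<xi> - k) - (cis (x * \<xi>) - 1) / of_real \<xi>)"
        using that by (intro set_integral_diff set_integrable_cis_quotient set_integrable_resolvent k continuous_intros)
      then show ?thesis by (simp add: right_diff_distrib)
    qed
    have e1: "P1 = (LBINT \<xi>:{0..2 * cmod k}. (cis (x * \<xi>) - 1) * ?d \<xi>) + (LBINT \<xi>:{2 * cmod k..1}. (cis (x * \<xi>) - 1) * ?d \<xi>)"
      unfolding P1_def using r by (intro set_integral_Icc_split(2) i1) auto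
    have n1: "cmod P1 \<le> (16 / a + 4 + 4 * pi) * cmod k powr a * wt x powr b + 4 / (b - a) * cmod k powr a * wt x powr b"
      unfolding e1 by (rule norm_triangle_le[OF add_mono[OF near_perturbation_le[OF ab k(1) r(2)] far_perturbation_le[OF ab k(1) r(2)]]])
    have b2: "cmod (cis (x * \<xi>) * ?d \<xi>) \<le> 2 * cmod k * (1 / \<xi>\<^sup>2)" if "\<xi> \<in> {1..}" for \<xi>
      using norm_resolvent_diff_le[OF k(1), of \<xi>] that r by (simp add: norm_mult)
    have i2: "set_integrable lborel {1..} (\<lambda>\<xi>. cis (x * \<xi>) * ?d \<xi>)"
    proof (rule set_integrable_bound)
      show "set_integrable lborel {1..} (\<lambda>\<xi>. 2 * cmod k * (1 / \<xi>\<^sup>2))"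
        by (intro set_integrable_mult_right set_integrable_inverse_square)
      show "set_borel_measurable lborel {1..} (\<lambda>\<xi>. cis (x * \<xi>) * ?d \<xi>)"
        unfolding set_borel_measurable_def by measurable
      show "AE \<xi> in lborel. \<xi> \<in> {1..} \<longrightarrow> norm (cis (x * \<xi>) * ?d \<xi>) \<le> norm (2 * cmod k * (1 / \<xi>\<^sup>2))"
      proof (rule AE_I2, rule impI)
        fix \<xi> :: real assume "\<xi> \<in> {1..}"
        then show "norm (cis (x * \<xi>) * ?d \<xi>) \<le> norm (2 * cmod k * (1 / \<xi>\<^sup>2))"
          using b2[of \<xi>] by simp
      qed
    qed
    have n2: "cmod P2 \<le> 2 * cmod k * D"
    proof -
      have "cmod P2 \<le> (LBINT \<xi>:{1..}. 2 * cmod k * (1 / \<xi>\<^sup>2))"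
        unfolding P2_def
        by (intro norm_set_integral_le_dominated set_integrable_mult_right set_integrable_inverse_square b2)
      then show ?thesis by (simp only: set_integral_mult_right D_def)
    qed
    have n3: "cmod (Ln (1 - k)) \<le> 2 * cmod k" using norm_Ln_le[of "-k"] k by simp
    \<comment> \<open>Errors linear in |k| fit into the remainder because |k| < 1, a < 1 and w \<ge>
      1.\<close>
    have kr: "cmod k \<le> cmod k powr a * wt x powr b"
    proof -
      have "cmod k = cmod k powr 1 * 1" using r by simp
      also have "\<dots> \<le> cmod k powr a * wt x powr b"
        using r ab one_le_wt by (intro mult_mono powr_mono' ge_one_powr_ge_zero) auto
      finally show ?thesis .
    qed
    have "cmod P \<le> cmod P1 + cmod P2 + cmod (Ln (1 - k))"
      unfolding P_def using norm_triangle_ineq[of "P1 + P2" "Ln (1 - k)"] norm_triangle_ineq[of P1 P2] by linarith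
    also have "\<dots> \<le> cmod P1 + 2 * cmod k * D + 2 * cmod k" using n2 n3 by simp
    also have "\<dots> = cmod P1 + (2 * D + 2) * cmod k" by (simp add: algebra_simps)
    also have "\<dots> \<le> ((16 / a + 4 + 4 * pi) * cmod k powr a * wt x powr b + 4 / (b - a) * cmod k powr a * wt x powr b)
        + (2 * D + 2) * (cmod k powr a * wt x powr b)"
      using n1 kr D0 by (intro add_mono mult_left_mono) auto
    also have "\<dots> = C * cmod k powr a * wt x powr b" by (simp add: C_def algebra_simps)
    finally have nP: "cmod P \<le> C * cmod k powr a * wt x powr b" .
    have eq: "(LBINT \<xi>:{0..N}. cis (x * \<xi>) / (of_real \<xi> - k)) =
       (Ln (1 - k) - Ln (- k)) + cis_split x N + P1 + (LBINT \<xi>:{1..N}. cis (x * \<xi>) * ?d \<xi>)" if N: "1 \<le> N" for N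
    proof -
      have "(LBINT \<xi>:{0..N}. cis (x * \<xi>) / (of_real \<xi> - k)) = (LBINT \<xi>:{0..1}. cis (x * \<xi>) / (of_real \<xi> - k))
         + (LBINT \<xi>:{1..N}. cis (x * \<xi>) / (of_real \<xi> - k))"
        using N by (intro set_integral_Icc_split(2) set_integrable_resolvent k continuous_intros) auto
      moreover have "(LBINT \<xi>:{0..1}. cis (x * \<xi>) / (of_real \<xi> - k))
        = (LBINT \<xi>:{0..1}. 1 / (of_real \<xi> - k)) + (LBINT \<xi>:{0..1}. (cis (x * \<xi>) - 1) / of_real \<xi>) + P1"
      proof -
        have "(LBINT \<xi>:{0..1}. cis (x * \<xi>) / (of_real \<xi> - k))
          = (LBINT \<xi>:{0..1}. (1 / (of_real \<xi> - k) + (cis (x * \<xi>) - 1) / of_real \<xi>) + (cis (x * \<xi>) - 1) * ?d \<xi>)"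
          by (simp add: diff_divide_distrib algebra_simps)
        also have "\<dots> = (LBINT \<xi>:{0..1}. 1 / (of_real \<xi> - k) + (cis (x * \<xi>) - 1) / of_real \<xi>) + P1"
          unfolding P1_def
          by (intro set_integral_add i1 set_integrable_resolvent set_integrable_cis_quotient k continuous_intros) auto
        also have "(LBINT \<xi>:{0..1}. 1 / (of_real \<xi> - k) + (cis (x * \<xi>) - 1) / of_real \<xi>)
          = (LBINT \<xi>:{0..1}. 1 / (of_real \<xi> - k)) + (LBINT \<xi>:{0..1}. (cis (x * \<xi>) - 1) / of_real \<xi>)"
          by (intro set_integral_add i1 set_integrable_resolvent set_integrable_cis_quotient k continuous_intros) auto
        finally show ?thesis .
      qed
      moreover have "(LBINT \<xi>:{1..N}. cis (x * \<xi>) / (of_real \<xi> - k))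
         = (LBINT \<xi>:{1..N}. cis (x * \<xi>) / of_real \<xi>) + (LBINT \<xi>:{1..N}. cis (x * \<xi>) * ?d \<xi>)"
      proof -
        have "(LBINT \<xi>:{1..N}. cis (x * \<xi>) / (of_real \<xi> - k))
          = (LBINT \<xi>:{1..N}. cis (x * \<xi>) / of_real \<xi> + cis (x * \<xi>) * ?d \<xi>)"
          by (simp add: algebra_simps)
        also have "\<dots> = (LBINT \<xi>:{1..N}. cis (x * \<xi>) / of_real \<xi>) + (LBINT \<xi>:{1..N}. cis (x * \<xi>) * ?d \<xi>)"
          by (intro set_integral_add set_integrable_cis_over set_integrable_subset[OF i2]) auto
        finally show ?thesis .
      qed
      moreover have "(LBINT \<xi>:{0..1}. 1 / (of_real \<xi> - k)) = Ln (1 - k) - Ln (- k)"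
        using integral_resolvent_Icc[OF k(1), of 0 1] by simp
      ultimately show ?thesis unfolding cis_split_def by (simp add: algebra_simps)
    qed
    have "((\<lambda>N. LBINT \<xi>:{1..N}. cis (x * \<xi>) * ?d \<xi>) \<longlongrightarrow> P2) at_top"
      unfolding P2_def by (rule tendsto_set_lebesgue_integral_at_top[OF _ i2]) simp
    then have "((\<lambda>N. (Ln (1 - k) - Ln (- k)) + cis_split x N + P1 + (LBINT \<xi>:{1..N}. cis (x * \<xi>) * ?d \<xi>))
      \<longlongrightarrow> (Ln (1 - k) - Ln (- k)) + log_kernel g x + P1 + P2) at_top"
      by (intro tendsto_intros g x)
    then have "((\<lambda>N. LBINT \<xi>:{0..N}. cis (x * \<xi>) / (of_real \<xi> - k))
      \<longlongrightarrow> (Ln (1 - k) - Ln (- k)) + log_kernel g x + P1 + P2) at_top"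
      by (rule Lim_transform_eventually)
        (use eventually_ge_at_top[of "1::real"] in \<open>eventually_elim, simp only: eq\<close>)
    moreover have "(Ln (1 - k) - Ln (- k)) + log_kernel g x + P1 + P2 = log_kernel g x - Ln (- k) + P"
      by (simp add: P_def)
    ultimately show ?thesis using nP by auto
  qed
  moreover have "0 \<le> C" unfolding C_def using ab D0 by simp
  ultimately show ?thesis using that by blast
qed

section \<open>Expansion of the kernels at zero energy\<close>

lemma cutoff_fun_continuous: "cutoff_fun c \<Longrightarrow> continuous_on {0..} c"
proof -
  assume "cutoff_fun c"
  then obtain D where D: "\<And>x. x \<in> {0..} \<Longrightarrow> D 0 x = c x"
    "\<And>n x. x \<in> {0..} \<Longrightarrow> (D n has_vector_derivative D (Suc n) x) (at x within {0..})"
    unfolding cutoff_fun_def smooth_on_def by blast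
  have "continuous_on {0..} (D 0)"
    using D(2) by (auto simp: continuous_on_eq_continuous_within intro: has_vector_derivative_continuous)
  then show ?thesis using D(1) by (rule continuous_on_cong[THEN iffD1, OF refl, rotated 1]) simp
qed

lemma Lim_eq: "(f \<longlongrightarrow> (l::complex)) (at_top :: real filter) \<Longrightarrow> Lim at_top f = l"
  by (rule tendsto_Lim) auto

text \<open>Replacing the sharp cutoff of \<open>cis_split\<close> by \<open>c\<close> changes the
  integral only on [1, 2], hence by the constant integral of c/\<xi>; different cutoffs give kernels
  differing by a constant.\<close>

lemma G_zero_eq:
  assumes c: "cutoff_fun c" and x: "x \<noteq> 0"
    and g: "(cis_split x \<longlongrightarrow> log_kernel g x) at_top"
  shows "G_zero c x = (log_kernel g x - (LBINT \<xi>:{1..2}. c \<xi> / of_real \<xi>)) / (2 * of_real pi)"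
proof -
  have cont: "continuous_on {0..} c" by (rule cutoff_fun_continuous[OF c])
  have c1: "c \<xi> = 1" if "\<xi> \<in> {0..1}" for \<xi> using c that by (auto simp: cutoff_fun_def)
  have c2: "c \<xi> = 0" if "2 \<le> \<xi>" for \<xi> using c that by (auto simp: cutoff_fun_def)
  have ic: "set_integrable lborel {1..N} (\<lambda>\<xi>. c \<xi> / of_real \<xi>)" for N
    by (intro borel_integrable_atLeastAtMost' continuous_intros continuous_on_subset[OF cont]) auto
  have eq: "(LBINT \<xi>:{0..N}. (cis (x * \<xi>) - c \<xi>) / of_real \<xi>) = cis_split x N - (LBINT \<xi>:{1..2}. c \<xi> / of_real \<xi>)" if N: "2 \<le> N" for N
  proof -
    have j1: "set_integrable lborel {0..1} (\<lambda>\<xi>. (cis (x * \<xi>) - c \<xi>) / of_real \<xi>)"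
      using set_integrable_cis_quotient[of 0 1 x]
      by (rule set_integrable_cong[THEN iffD1, rotated 3]) (auto simp: c1)
    have e1: "(LBINT \<xi>:{0..1}. (cis (x * \<xi>) - c \<xi>) / of_real \<xi>) = (LBINT \<xi>:{0..1}. (cis (x * \<xi>) - 1) / of_real \<xi>)"
      by (intro set_lebesgue_integral_cong) (auto simp: c1)
    have j2: "set_integrable lborel {1..N} (\<lambda>\<xi>. (cis (x * \<xi>) - c \<xi>) / of_real \<xi>)"
      unfolding diff_divide_distrib by (intro set_integral_diff ic set_integrable_cis_over) auto
    have e2: "(LBINT \<xi>:{1..N}. (cis (x * \<xi>) - c \<xi>) / of_real \<xi>) = (LBINT \<xi>:{1..N}. cis (x * \<xi>) / of_real \<xi>) - (LBINT \<xi>:{1..N}. c \<xi> / of_real \<xi>)"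
      unfolding diff_divide_distrib by (intro set_integral_diff ic set_integrable_cis_over) auto
    have "(LBINT \<xi>:{1..N}. c \<xi> / of_real \<xi>) = (LBINT \<xi>:{1..2}. c \<xi> / of_real \<xi>) + (LBINT \<xi>:{2..N}. c \<xi> / of_real \<xi>)"
      using N by (intro set_integral_Icc_split(2) ic set_integrable_subset[OF ic[of N]]) auto
    also have "(LBINT \<xi>:{2..N}. c \<xi> / of_real \<xi>) = (LBINT \<xi>:{2..N}. 0)"
      by (intro set_lebesgue_integral_cong) (auto simp: c2)
    finally have e3: "(LBINT \<xi>:{1..N}. c \<xi> / of_real \<xi>) = (LBINT \<xi>:{1..2}. c \<xi> / of_real \<xi>)" by simp
    have "(LBINT \<xi>:{0..N}. (cis (x * \<xi>) - c \<xi>) / of_real \<xi>) = (LBINT \<xi>:{0..1}. (cis (x * \<xi>) - c \<xi>) / of_real \<xi>)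
      + (LBINT \<xi>:{1..N}. (cis (x * \<xi>) - c \<xi>) / of_real \<xi>)"
      using N by (intro set_integral_Icc_split(2) j1 j2) auto
    then show ?thesis unfolding e1 e2 e3 cis_split_def by simp
  qed
  have "((\<lambda>N. cis_split x N - (LBINT \<xi>:{1..2}. c \<xi> / of_real \<xi>)) \<longlongrightarrow> log_kernel g x - (LBINT \<xi>:{1..2}. c \<xi> / of_real \<xi>)) at_top"
    by (intro tendsto_intros g)
  then have "((\<lambda>N. LBINT \<xi>:{0..N}. (cis (x * \<xi>) - c \<xi>) / of_real \<xi>) \<longlongrightarrow> log_kernel g x - (LBINT \<xi>:{1..2}. c \<xi> / of_real \<xi>)) at_top"
    by (rule Lim_transform_eventually)
      (use eventually_ge_at_top[of "2::real"] in \<open>eventually_elim, simp only: eq\<close>)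
  then show ?thesis unfolding G_zero_def by (simp add: Lim_eq)
qed

fun off_axis :: "cut_point \<Rightarrow> bool" where
  "off_axis (Off k) \<longleftrightarrow> k \<notin> \<real>\<^sub>\<ge>\<^sub>0"
| "off_axis (Edge \<sigma> lam) \<longleftrightarrow> lam > 0"

text \<open>Reflecting \<xi> turns the integral over the negative half line at energy lam into the
  resolvent integral at -lam with x reversed. For lam > 0 the point -lam lies off the cut, so the
  edge kernels inherit the expansion proved off the axis.\<close>

lemma G_tilde_eq:
  assumes "((\<lambda>N. LBINT \<xi>:{0..N}. cis (- x * \<xi>) / (of_real \<xi> - (- of_real lam))) \<longlongrightarrow> L) at_top"
  shows "G_tilde lam x = - L / (2 * of_real pi)"
proof -
  have "(LBINT \<xi>:{-N..0}. cis (x * \<xi>) / (of_real \<xi> - of_real lam))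
     = - (LBINT \<xi>:{0..N}. cis (- x * \<xi>) / (of_real \<xi> - (- of_real lam)))" for N
  proof -
    have "(LBINT \<xi>:{-N..0}. cis (x * \<xi>) / (of_real \<xi> - of_real lam)) =
      (LBINT \<xi>. indicator {-N..0} (-\<xi>) *\<^sub>R (cis (x * (-\<xi>)) / (of_real (-\<xi>) - of_real lam)))"
      using lborel_integral_real_affine[of "-1" "\<lambda>\<xi>. indicator {-N..0} \<xi> *\<^sub>R (cis (x * \<xi>) / (of_real \<xi> - of_real lam))" 0]
      by (simp add: set_lebesgue_integral_def)
    also have "\<dots> = (LBINT \<xi>. - (indicator {0..N} \<xi> *\<^sub>R (cis (- x * \<xi>) / (of_real \<xi> - (- of_real lam)))))"
    proof (rule Bochner_Integration.integral_cong[OF refl])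
      fix \<xi> :: real
      have "complex_of_real (-\<xi>) - of_real lam = - (of_real \<xi> - (- of_real lam))" by simp
      moreover have "indicator {-N..0} (-\<xi>) = (indicator {0..N} \<xi> :: real)" by (auto simp: indicator_def)
      ultimately show "indicator {-N..0} (-\<xi>) *\<^sub>R (cis (x * (-\<xi>)) / (of_real (-\<xi>) - of_real lam))
        = - (indicator {0..N} \<xi> *\<^sub>R (cis (- x * \<xi>) / (of_real \<xi> - (- of_real lam))))"
        by (simp only: divide_minus_right scaleR_minus_right) simp
    qed
    finally show ?thesis by (simp add: set_lebesgue_integral_def)
  qed
  then have "((\<lambda>N. LBINT \<xi>:{-N..0}. cis (x * \<xi>) / (of_real \<xi> - of_real lam)) \<longlongrightarrow> - L) at_top"
    using tendsto_minus[OF assms] by simp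
  then show ?thesis unfolding G_tilde_def by (simp add: Lim_eq)
qed

text \<open>Passing to -k carries the branch cut (-\<infinity>, 0] of \<open>Ln\<close> onto [0,
  \<infinity>) and shifts the argument by pi.\<close>

lemma Ln_uminus_eq_cut_log:
  assumes "k \<notin> \<real>\<^sub>\<ge>\<^sub>0"
  shows "Ln (- k) = cut_log (Off k) - \<i> * of_real pi"
proof -
  have "k \<noteq> 0" using assms by auto
  have "0 < Arg2pi k" using assms by (rule Arg2pi_gt_0)
  then have "Im (Ln (- k)) = Arg2pi k - pi" using Arg2pi_Ln by fastforce
  moreover have "Re (Ln (- k)) = ln (cmod k)" using \<open>k \<noteq> 0\<close> by simp
  ultimately show ?thesis by (simp add: complex_eq_iff)
qed

lemma log_kernel_uminus:
  "log_kernel g (- x) = log_kernel g x - \<i> * of_real (pi * sgn x)"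
  by (simp add: log_kernel_def complex_eq_iff sgn_minus)

lemma kernel_asymptotics:
  assumes ab: "0 < a" "a < b" "b \<le> 1" and c: "cutoff_fun c"
  obtains g w C \<mu> where
    "\<And>x. x \<noteq> 0 \<Longrightarrow> G_zero c x = (log_kernel g x - w) / (2 * of_real pi)" and "0 \<le> C"
    "\<And>\<kappa> x. off_axis \<kappa> \<Longrightarrow> cut_abs \<kappa> < 1/2 \<Longrightarrow> x \<noteq> 0 \<Longrightarrow>
       cmod (G \<kappa> x - G_zero c x - (\<mu> - cut_log \<kappa> / (2 * of_real pi))) \<le> C * cut_abs \<kappa> powr a * wt x powr b"
proof -
  obtain g where g: "\<And>x. x \<noteq> 0 \<Longrightarrow> (cis_split x \<longlongrightarrow> log_kernel g x) at_top"
    using cis_split_tendsto by blast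
  obtain C where C: "0 \<le> C"
    "\<And>k x. k \<notin> \<real>\<^sub>\<ge>\<^sub>0 \<Longrightarrow> cmod k < 1/2 \<Longrightarrow> x \<noteq> 0 \<Longrightarrow>
       \<exists>P. ((\<lambda>N. LBINT \<xi>:{0..N}. cis (x * \<xi>) / (of_real \<xi> - k)) \<longlongrightarrow> log_kernel g x - Ln (- k) + P) at_top
         \<and> cmod P \<le> C * cmod k powr a * wt x powr b"
    using cis_resolvent_tendsto[OF ab g] by blast
  define w where "w = (LBINT \<xi>:{1..2}. c \<xi> / of_real \<xi>)"
  \<comment> \<open>The summand i/2 comes from Ln(-k) = log k - i pi, and w from the cutoff in
    \<open>G_zero\<close>.\<close>
  define \<mu> where "\<mu> = \<i> / 2 + w / (2 * of_real pi)"
  have Z: "G_zero c x = (log_kernel g x - w) / (2 * of_real pi)" if "x \<noteq> 0" for x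
    unfolding w_def using c that g[OF that] by (rule G_zero_eq)
  have "cmod (G \<kappa> x - G_zero c x - (\<mu> - cut_log \<kappa> / (2 * of_real pi))) \<le> (C + 2) * cut_abs \<kappa> powr a * wt x powr b"
    if \<kappa>: "off_axis \<kappa>" "cut_abs \<kappa> < 1/2" and x: "x \<noteq> 0" for \<kappa> x
  proof (cases \<kappa>)
    case (Off k)
    then have k: "k \<notin> \<real>\<^sub>\<ge>\<^sub>0" "cmod k < 1/2" using \<kappa> by auto
    obtain P where P: "((\<lambda>N. LBINT \<xi>:{0..N}. cis (x * \<xi>) / (of_real \<xi> - k)) \<longlongrightarrow> log_kernel g x - Ln (- k) + P) at_top"
      "cmod P \<le> C * cmod k powr a * wt x powr b"
      using C(2)[OF k x] by blast
    have "G_off k x = (log_kernel g x - Ln (- k) + P) / (2 * of_real pi)"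
      unfolding G_off_def by (simp add: Lim_eq[OF P(1)])
    then have "G \<kappa> x - G_zero c x - (\<mu> - cut_log \<kappa> / (2 * of_real pi)) = P / (2 * of_real pi)"
    proof -
      have "cut_log \<kappa> = Ln (- k) + \<i> * of_real pi" using Ln_uminus_eq_cut_log[OF k(1)] Off by simp
      then have "cut_log \<kappa> / (2 * of_real pi) = Ln (- k) / (2 * of_real pi) + \<i> / 2"
        by (simp add: add_divide_distrib)
      moreover have "G \<kappa> x = G_off k x" using Off by simp
      ultimately show ?thesis using \<open>G_off k x = _\<close>
        by (simp only: Z[OF x] \<mu>_def) (simp add: add_divide_distrib diff_divide_distrib)
    qed
    then have "cmod (G \<kappa> x - G_zero c x - (\<mu> - cut_log \<kappa> / (2 * of_real pi))) = cmod P / (2 * pi)"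
      by (simp add: norm_divide norm_mult)
    also have "\<dots> \<le> cmod P / 1" using pi_gt3 by (intro divide_left_mono) auto
    also have "\<dots> \<le> C * cmod k powr a * wt x powr b" using P by simp
    also have "\<dots> \<le> (C + 2) * cmod k powr a * wt x powr b" by (intro mult_right_mono) auto
    finally show ?thesis using Off by simp
  next
    case (Edge \<sigma> lam)
    then have lam: "lam > 0" "lam < 1/2" using \<kappa> by auto
    define k where "k = - complex_of_real lam"
    have k: "k \<notin> \<real>\<^sub>\<ge>\<^sub>0" "cmod k < 1/2" "cmod k = lam" using lam by (auto simp: k_def complex_nonneg_Reals_iff)
    have Lnk: "Ln (- k) = of_real (ln lam)" using lam by (simp add: k_def Ln_of_real)
    obtain P where P: "((\<lambda>N. LBINT \<xi>:{0..N}. cis (- x * \<xi>) / (of_real \<xi> - k)) \<longlongrightarrow> log_kernel g (- x) - Ln (- k) + P) at_top"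
      "cmod P \<le> C * cmod k powr a * wt (- x) powr b"
      using C(2)[OF k(1,2), of "-x"] x by auto
    have T: "G_tilde lam x = - (log_kernel g (- x) - Ln (- k) + P) / (2 * of_real pi)"
      unfolding k_def by (rule G_tilde_eq[OF P(1)[unfolded k_def]])
    have nP: "cmod P \<le> C * lam powr a * wt x powr b" using P(2) k by (simp add: wt_def)
    have e: "cmod (cis (lam * x) - 1) \<le> 2 * lam powr a * wt x powr b"
    proof -
      have "cmod (cis (lam * x) - 1) \<le> 2 * (lam powr a * \<bar>x\<bar> powr a)"
        using norm_cis_diff_powr_le[of a "lam * x" 0] ab lam by (simp add: abs_mult powr_mult)
      also have "\<dots> \<le> 2 * (lam powr a * wt x powr b)"
        using ab by (intro mult_left_mono abs_powr_le_wt) auto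
      finally show ?thesis by simp
    qed
    have fin: "cmod (Q + P / (2 * of_real pi)) \<le> (C + 2) * lam powr a * wt x powr b"
      if "cmod Q \<le> 2 * lam powr a * wt x powr b" for Q
    proof -
      have "cmod (P / (2 * of_real pi)) \<le> cmod P / 1"
        unfolding norm_divide norm_mult using pi_gt3 by (intro divide_left_mono) auto
      then have "cmod (Q + P / (2 * of_real pi)) \<le> 2 * lam powr a * wt x powr b + C * lam powr a * wt x powr b"
        using that nP by (intro norm_triangle_le) auto
      then show ?thesis by (simp add: algebra_simps)
    qed
    have eqA: "- G_tilde lam x - G_zero c x - (\<mu> - of_real (ln lam) / (2 * of_real pi)) =
       P / (2 * of_real pi) - \<i> * of_real (sgn x) / 2 - \<i> / 2"
    proof -
      have "\<i> * of_real (pi * sgn x) / (2 * of_real pi) = \<i> * of_real (sgn x) / 2" by simp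
      then show ?thesis
        unfolding T Z[OF x] \<mu>_def Lnk log_kernel_uminus
        by (simp only: add_divide_distrib diff_divide_distrib minus_add_distrib minus_diff_eq minus_divide_left[symmetric]) simp
    qed
    \<comment> \<open>The reversal of x in \<open>G_tilde\<close> leaves a step -i on x > 0 relative
      to the common expansion.\<close>
    have eqB: "- G_tilde lam x - G_zero c x - (\<mu> - of_real (ln lam) / (2 * of_real pi)) =
       P / (2 * of_real pi) - (if x > 0 then \<i> else 0)"
    proof (cases "x > 0")
      case True
      then have "sgn x = 1" by simp
      then show ?thesis unfolding eqA using True by (simp add: field_simps)
    next
      case False
      then have "sgn x = - 1" using x by simp
      then show ?thesis unfolding eqA using False by (simp add: field_simps)
    qed
    show ?thesis
    proof (cases \<sigma>)
      case Above
      \<comment> \<open>The explicit term i e^(i lam x) on x > 0 cancels this step up to e^(i lam x)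
        - 1, which is O(lam^a w^b).\<close>
      have "G \<kappa> x - G_zero c x - (\<mu> - cut_log \<kappa> / (2 * of_real pi)) =
         (if x > 0 then \<i> * (cis (lam * x) - 1) else 0) + P / (2 * of_real pi)"
        using eqB x by (cases "x > 0") (simp_all add: Edge Above algebra_simps)
      then show ?thesis using fin[of "if x > 0 then \<i> * (cis (lam * x) - 1) else 0"] e lam Edge
        by (auto simp: norm_mult split: if_splits)
    next
      case Below
      \<comment> \<open>Here log(lam - 0i) carries 2 pi i, which shifts the step to +i on x < 0,
        where the explicit term of the lower edge cancels it.\<close>
      have "G \<kappa> x - G_zero c x - (\<mu> - cut_log \<kappa> / (2 * of_real pi)) =
         (if x < 0 then - \<i> * (cis (lam * x) - 1) else 0) + P / (2 * of_real pi)"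
        using eqB x by (cases "x > 0") (simp_all add: Edge Below algebra_simps add_divide_distrib)
      then show ?thesis using fin[of "if x < 0 then - \<i> * (cis (lam * x) - 1) else 0"] e lam Edge
        by (auto simp: norm_mult split: if_splits)
    qed
  qed
  then show ?thesis using that[of g w "C + 2" \<mu>] Z C(1) by auto
qed

section \<open>Compactness in weighted spaces\<close>

lemma wt_pos [simp]: "0 < wt x" by (simp add: wt_def)

lemma wt_nonneg [simp]: "0 \<le> wt x" by (simp add: wt_def)

lemma wt_nonzero [simp]: "wt x \<noteq> 0"
  using wt_pos[of x] by linarith

lemma wt_measurable [measurable]: "wt \<in> borel_measurable borel"
  unfolding wt_def [abs_def] by measurable

lemma one_le_wt_powr: "0 \<le> p \<Longrightarrow> 1 \<le> wt x powr p"
  using one_le_wt by (intro ge_one_powr_ge_zero) auto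

lemma integrable_wt_powr:
  assumes "p > 1"
  shows "integrable lborel (\<lambda>x. wt x powr (- p))"
proof -
  have "((\<lambda>x::real. x powr (- p)) has_integral -(1 powr (- p + 1)) / (- p + 1)) {1..}"
    using assms by (intro has_integral_powr_to_inf) auto
  then have nn: "integral\<^sup>N lborel (\<lambda>x. indicator {1::real..} x * (x powr (- p))) = ennreal (-(1 powr (- p + 1)) / (- p + 1))"
    by (intro nn_integral_has_integral_lebesgue) auto
  have "has_bochner_integral lborel (\<lambda>x. indicator {1::real..} x * (x powr (- p))) (-(1 powr (- p + 1)) / (- p + 1))"
    using nn assms by (intro has_bochner_integral_nn_integral) (auto simp: indicator_def split: if_splits)
  then have i: "integrable lborel (\<lambda>x. indicator {1::real..} x * (x powr (- p)))" by (rule integrable.intros)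
  have 1: "integrable lborel (\<lambda>x. indicator {1::real..} (1 + 1 * x) * ((1 + 1 * x) powr (- p)))"
    by (rule lborel_integrable_real_affine[OF i]) simp
  have 2: "integrable lborel (\<lambda>x. indicator {1::real..} (1 + (-1) * x) * ((1 + (-1) * x) powr (- p)))"
    by (rule lborel_integrable_real_affine[OF i]) simp
  show ?thesis
    by (rule Bochner_Integration.integrable_bound[OF Bochner_Integration.integrable_add[OF 1 2]])
       (auto simp: wt_def indicator_def)
qed

text \<open>A Peetre-type inequality: it separates growth in x - y into growth in x and in y, so
  that the former can be taken out of a convolution.\<close>

lemma wt_diff_le: "wt (x - y) \<le> wt x * wt y"
  by (simp add: wt_def algebra_simps) (smt (verit) abs_ge_zero abs_triangle_ineq4 mult_nonneg_nonneg)

text \<open>The substitution \<open>t = x / (1 + |x|)\<close> compactifies the line, so that the ordinary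
  Arzela--Ascoli theorem on \<open>[-1, 1]\<close> applies.\<close>

lemma weighted_Arzela_Ascoli:
  fixes F :: "nat \<Rightarrow> real \<Rightarrow> complex"
  assumes b: "b < q" "0 \<le> b"
    and bound: "\<And>n x. cmod (F n x) \<le> M * wt x powr b"
    and holder: "\<And>n x y. cmod (F n x - F n y) \<le> H * \<bar>x - y\<bar> powr (1/4)"
  obtains k g where "strict_mono (k :: nat \<Rightarrow> nat)" "continuous_on UNIV g"
    "\<And>e. 0 < e \<Longrightarrow> \<exists>N. \<forall>n x. n \<ge> N \<longrightarrow> cmod (F (k n) x - g x) \<le> e * wt x powr q"
proof -
  \<comment> \<open>At t = 1 and t = -1 the factor \<open>0 powr q\<close> is 0, so the value of the
    quotient there does not matter and \<open>E n\<close> vanishes at both ends.\<close>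
  define E where "E n t = of_real ((1 - \<bar>t\<bar>) powr q) * F n (t / (1 - \<bar>t\<bar>))" for n and t :: real
  have M0: "0 \<le> M" 
  proof -
    have "0 \<le> M * wt 0 powr b" using bound[of 0 0] norm_ge_zero order_trans by blast
    then show ?thesis by (simp add: wt_def)
  qed
  have wphi: "wt (t / (1 - \<bar>t\<bar>)) = 1 / (1 - \<bar>t\<bar>)" if "\<bar>t\<bar> < 1" for t
    using that by (simp add: wt_def abs_divide field_simps)
  have Ebd: "cmod (E n t) \<le> M * (1 - \<bar>t\<bar>) powr (q - b)" if "t \<in> {-1..1}" for n t
  proof (cases "\<bar>t\<bar> < 1")
    case True
    have "cmod (E n t) \<le> (1 - \<bar>t\<bar>) powr q * (M * (1 / (1 - \<bar>t\<bar>)) powr b)"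
      unfolding E_def norm_mult using bound[of n "t / (1 - \<bar>t\<bar>)"] wphi[OF True] by (simp add: mult_left_mono)
    also have "\<dots> = M * (1 - \<bar>t\<bar>) powr (q - b)" using True by (simp add: powr_diff powr_divide)
    finally show ?thesis .
  next
    case False
    then have "1 - \<bar>t\<bar> = 0" using that by auto
    then show ?thesis by (simp add: E_def)
  qed
  have Ele: "cmod (E n t) \<le> M" if "t \<in> {-1..1}" for n t
  proof -
    have "(1 - \<bar>t\<bar>) powr (q - b) \<le> 1" using that b by (intro powr_le1) auto
    then have "M * (1 - \<bar>t\<bar>) powr (q - b) \<le> M * 1" using M0 by (intro mult_left_mono)
    then show ?thesis using Ebd[OF that, of n] by linarith
  qed
  \<comment> \<open>Interior points use the common Hoelder bound; at the ends the gap b < q makes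
    all \<open>E n\<close> uniformly small.\<close>
  have equi: "\<exists>d>0. \<forall>n y. y \<in> {-1..1} \<and> norm (t - y) < d \<longrightarrow> cmod (E n t - E n y) < e"
    if t: "t \<in> {-1..1}" and e: "0 < e" for t e
  proof (cases "\<bar>t\<bar> < 1")
    case True
    define \<omega> where "\<omega> y = \<bar>(1 - \<bar>t\<bar>) powr q - (1 - \<bar>y\<bar>) powr q\<bar> * (M * wt (t / (1 - \<bar>t\<bar>)) powr b)
       + H * \<bar>t / (1 - \<bar>t\<bar>) - y / (1 - \<bar>y\<bar>)\<bar> powr (1/4)" for y
    have "((\<lambda>y. \<bar>t / (1 - \<bar>t\<bar>) - y / (1 - \<bar>y\<bar>)\<bar>) \<longlongrightarrow> 0) (at t)"
      using True by (auto intro!: tendsto_eq_intros)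
    then have "((\<lambda>y. \<bar>t / (1 - \<bar>t\<bar>) - y / (1 - \<bar>y\<bar>)\<bar> powr (1/4)) \<longlongrightarrow> 0) (at t)"
      by (rule tendsto_zero_powrI[OF _ tendsto_const]) auto
    moreover have "((\<lambda>y. \<bar>(1 - \<bar>t\<bar>) powr q - (1 - \<bar>y\<bar>) powr q\<bar>) \<longlongrightarrow> 0) (at t)"
      using True by (auto intro!: tendsto_eq_intros)
    ultimately have "(\<omega> \<longlongrightarrow> 0 * (M * wt (t / (1 - \<bar>t\<bar>)) powr b) + H * 0) (at t)"
      unfolding \<omega>_def by (intro tendsto_intros)
    then have "(\<omega> \<longlongrightarrow> 0) (at t)" by simp
    then have "\<forall>\<^sub>F y in at t. \<omega> y < e" using e by (rule order_tendstoD)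
    then obtain d where d: "d > 0" "\<And>y. y \<noteq> t \<Longrightarrow> dist y t < d \<Longrightarrow> \<omega> y < e"
      by (auto simp: eventually_at)
    have le: "cmod (E n t - E n y) \<le> \<omega> y" if y: "y \<in> {-1..1}" for n y
    proof -
      let ?p = "\<lambda>t. (1 - \<bar>t\<bar>) powr q" and ?\<phi> = "\<lambda>t. t / (1 - \<bar>t\<bar>)"
      have "E n t - E n y = of_real (?p t - ?p y) * F n (?\<phi> t) + of_real (?p y) * (F n (?\<phi> t) - F n (?\<phi> y))"
        by (simp add: E_def algebra_simps)
      then have "cmod (E n t - E n y) \<le> \<bar>?p t - ?p y\<bar> * cmod (F n (?\<phi> t)) + ?p y * cmod (F n (?\<phi> t) - F n (?\<phi> y))"
        by (metis norm_triangle_ineq norm_mult norm_of_real abs_of_nonneg powr_ge_zero)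
      also have "\<dots> \<le> \<bar>?p t - ?p y\<bar> * (M * wt (?\<phi> t) powr b) + 1 * (H * \<bar>?\<phi> t - ?\<phi> y\<bar> powr (1/4))"
        using y b by (intro add_mono mult_mono bound holder powr_le1) auto
      finally show ?thesis by (simp add: \<omega>_def)
    qed
    show ?thesis
    proof (intro exI[of _ d] conjI allI impI)
      fix n y assume y: "y \<in> {-1..1} \<and> norm (t - y) < d"
      show "cmod (E n t - E n y) < e"
      proof (cases "y = t")
        case False
        then show ?thesis using le[of y n] d(2)[of y] y by (simp add: dist_real_def abs_minus_commute)
      qed (use e in simp)
    qed (rule d)
  next
    case False
    then have t1: "\<bar>t\<bar> = 1" using t by auto
    \<comment> \<open>Chosen so that M d^(q - b) = M e / (M + 1) < e.\<close>
    define d where "d = (e / (M + 1)) powr (1 / (q - b))"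
    have d0: "d > 0" using e M0 by (simp add: d_def)
    show ?thesis
    proof (intro exI[of _ d] conjI allI impI d0)
      fix n y assume y: "y \<in> {-1..1} \<and> norm (t - y) < d"
      have "E n t = 0" using t1 by (simp add: E_def)
      then have "cmod (E n t - E n y) \<le> M * (1 - \<bar>y\<bar>) powr (q - b)" using Ebd[of y n] y by simp
      also have "\<dots> \<le> M * d powr (q - b)"
        using y t1 b M0 by (intro mult_left_mono powr_mono2) auto
      also have "\<dots> = M * (e / (M + 1))" using e M0 b by (simp add: d_def powr_powr)
      also have "\<dots> < e" using e M0 by (simp add: field_simps)
      finally show "cmod (E n t - E n y) < e" .
    qed
  qed
  obtain gg k where gg: "continuous_on {-1..1} gg" "strict_mono (k :: nat \<Rightarrow> nat)"
    "\<And>e. 0 < e \<Longrightarrow> \<exists>N. \<forall>n x. n \<ge> N \<and> x \<in> {-1..1} \<longrightarrow> norm (E (k n) x - gg x) < e"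
    using Arzela_Ascoli[of "{-1..1::real}" E M] Ele equi by (metis compact_Icc)
  define g where "g x = of_real (wt x powr q) * gg (x / wt x)" for x
  have in1: "x / wt x \<in> {-1..1}" for x by (auto simp: wt_def field_simps)
  show ?thesis
  proof (rule that[of k g])
    show "continuous_on UNIV g"
      unfolding g_def
    proof (intro continuous_intros continuous_on_compose2[OF gg(1)])
      show "(\<lambda>x. x / wt x) ` UNIV \<subseteq> {-1..1}" using in1 by auto
    qed (auto simp: wt_def intro!: continuous_intros)
    show "\<exists>N. \<forall>n x. n \<ge> N \<longrightarrow> cmod (F (k n) x - g x) \<le> e * wt x powr q" if "0 < e" for e
    proof -
      obtain N where N: "\<And>n x. n \<ge> N \<Longrightarrow> x \<in> {-1..1} \<Longrightarrow> norm (E (k n) x - gg x) < e"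
        using gg(3)[OF \<open>0 < e\<close>] by blast
      have "cmod (F (k n) x - g x) \<le> e * wt x powr q" if "n \<ge> N" for n x
      proof -
        have a: "1 - \<bar>x / wt x\<bar> = 1 / wt x" by (simp add: wt_def field_simps)
        have "(x / wt x) / (1 / wt x) = x" by (simp add: wt_def field_simps)
        then have "E (k n) (x / wt x) = of_real ((1 / wt x) powr q) * F (k n) x"
          unfolding E_def a by simp
        then have "F (k n) x = of_real (wt x powr q) * E (k n) (x / wt x)"
          by (simp add: powr_divide)
        then have "F (k n) x - g x = of_real (wt x powr q) * (E (k n) (x / wt x) - gg (x / wt x))"
          by (simp add: g_def algebra_simps)
        then have "cmod (F (k n) x - g x) = wt x powr q * cmod (E (k n) (x / wt x) - gg (x / wt x))"
          by (simp add: norm_mult)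
        also have "\<dots> \<le> wt x powr q * e" using N[OF that in1[of x]] by (intro mult_left_mono) auto
        finally show ?thesis by (simp add: mult.commute)
      qed
      then show ?thesis by blast
    qed
  qed (rule gg)
qed

section \<open>Size, Hoelder continuity and measurability of the kernels\<close>

lemma ln_1_plus_le: 
  assumes "0 \<le> t"
  shows "ln (1 + t) \<le> 5 * (t::real) powr (1/4)"
proof (cases "t \<le> 1")
  case True
  show ?thesis
  proof (cases "t = 0")
    case False
    have "t powr 1 \<le> t powr (1/4)" using True False assms by (intro powr_mono') auto
    then show ?thesis using ln_add_one_self_le_self[of t] False assms by simp
  qed simp
next
  case False
  have "ln (1 + t) \<le> ln (2 * t)" using False by simp
  also have "\<dots> = ln 2 + ln t" using False by (simp add: ln_mult)
  also have "\<dots> \<le> 1 + 4 * t powr (1/4)"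
    using ln_powr_bound[of t "1/4"] False ln_2_less_1 by simp
  finally have "ln (1 + t) \<le> 1 + 4 * t powr (1/4)" .
  moreover have "1 \<le> t powr (1/4)" using False by (intro ge_one_powr_ge_zero) auto
  ultimately show ?thesis by simp
qed

lemma abs_ln_diff_le:
  assumes "0 < a" "a \<le> b" "b - a \<le> h"
  shows "\<bar>ln a - ln b\<bar> \<le> 5 * h powr (1/4) * (a::real) powr (-1/4)"
proof -
  have "\<bar>ln a - ln b\<bar> = ln (b / a)" using assms by (simp add: ln_div)
  also have "b / a = 1 + (b - a) / a" using assms by (simp add: field_simps)
  also have "ln (1 + (b - a) / a) \<le> 5 * ((b - a) / a) powr (1/4)" using assms by (intro ln_1_plus_le) auto
  also have "\<dots> \<le> 5 * (h / a) powr (1/4)" using assms by (intro mult_left_mono powr_mono2 divide_right_mono) auto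
  also have "\<dots> = 5 * h powr (1/4) * a powr (-1/4)" using assms by (simp add: powr_divide powr_minus_divide)
  finally show ?thesis .
qed

text \<open>For |a| \<le> |b| the logarithm contributes ln(1 + t) \<le> 5 t^(1/4) with t = (|b| -
  |a|)/|a|. The step of the imaginary part occurs only between points of opposite sign, where |a|
  \<le> |a - b|, so |a - b|^(1/4) |a|^(-1/4) \<ge> 1 dominates it. The exponent 1/4 is below 1/2, so
  the singularity is locally square integrable and can be paired with an L^2 potential.\<close>

lemma log_kernel_holder:
  assumes "a \<noteq> 0" "b \<noteq> 0"
  shows "cmod (log_kernel g a - log_kernel g b) \<le> 10 * \<bar>a - b\<bar> powr (1/4) * (\<bar>a\<bar> powr (-1/4) + \<bar>b\<bar> powr (-1/4))"
proof -
  have *: "cmod (log_kernel g a - log_kernel g b) \<le> 10 * \<bar>a - b\<bar> powr (1/4) * (\<bar>a\<bar> powr (-1/4))"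
    if ab: "a \<noteq> 0" "b \<noteq> 0" "\<bar>a\<bar> \<le> \<bar>b\<bar>" for a b :: real
  proof -
    have 1: "\<bar>ln \<bar>a\<bar> - ln \<bar>b\<bar>\<bar> \<le> 5 * \<bar>a - b\<bar> powr (1/4) * \<bar>a\<bar> powr (-1/4)"
      using ab by (intro abs_ln_diff_le) auto
    have 2: "\<bar>pi / 2 * (sgn a - sgn b)\<bar> \<le> 4 * (\<bar>a - b\<bar> powr (1/4) * \<bar>a\<bar> powr (-1/4))"
    proof (cases "sgn a = sgn b")
      case False
      then have "\<bar>a\<bar> \<le> \<bar>a - b\<bar>" using ab by (auto simp: sgn_real_def split: if_splits)
      then have "(\<bar>a\<bar> / \<bar>a\<bar>) powr (1/4) \<le> (\<bar>a - b\<bar> / \<bar>a\<bar>) powr (1/4)"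
        using ab by (intro powr_mono2 divide_right_mono) auto
      then have "1 \<le> \<bar>a - b\<bar> powr (1/4) * \<bar>a\<bar> powr (-1/4)"
        using ab by (simp add: powr_divide powr_minus_divide)
      moreover have "\<bar>pi / 2 * (sgn a - sgn b)\<bar> \<le> 4" 
        using False ab pi_less_4 by (auto simp: sgn_real_def split: if_splits)
      ultimately show ?thesis by linarith
    qed simp
    have "cmod (log_kernel g a - log_kernel g b) \<le> \<bar>ln \<bar>a\<bar> - ln \<bar>b\<bar>\<bar> + \<bar>pi / 2 * (sgn a - sgn b)\<bar>"
      using cmod_le[of "log_kernel g a - log_kernel g b"]
      by (simp add: log_kernel_def right_diff_distrib abs_minus_commute)
    also have "\<dots> \<le> 10 * (\<bar>a - b\<bar> powr (1/4) * \<bar>a\<bar> powr (-1/4))"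
    proof -
      have "0 \<le> \<bar>a - b\<bar> powr (1/4) * \<bar>a\<bar> powr (-1/4)" by simp
      then show ?thesis using 1 2 unfolding mult.assoc by linarith
    qed
    finally show ?thesis by simp
  qed
  show ?thesis
  proof (cases "\<bar>a\<bar> \<le> \<bar>b\<bar>")
    case True
    then show ?thesis using *[of a b] assms by (simp add: distrib_left add_increasing2)
  next
    case False
    then show ?thesis using *[of b a] assms
      by (simp add: distrib_left add_increasing norm_minus_commute abs_minus_commute)
  qed
qed

text \<open>For large x, ln|x| is at most |x|^b / b; for small x its modulus is at most 4
  |x|^(-1/4). The sum of the two powers is always at least 1 and so absorbs constants.\<close>

lemma log_kernel_bound:
  assumes "0 < b"
  obtains C where "0 \<le> C" "\<And>x. x \<noteq> 0 \<Longrightarrow> cmod (log_kernel g x) \<le> C * (\<bar>x\<bar> powr b + \<bar>x\<bar> powr (-1/4))"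
proof -
  define C where "C = 1 / b + 4 + \<bar>g\<bar> + 2"
  have "cmod (log_kernel g x) \<le> C * (\<bar>x\<bar> powr b + \<bar>x\<bar> powr (-1/4))" if x: "x \<noteq> 0" for x
  proof -
    let ?S = "\<bar>x\<bar> powr b + \<bar>x\<bar> powr (-1/4)"
    have S1: "1 \<le> ?S \<and> \<bar>ln \<bar>x\<bar>\<bar> \<le> (1 / b + 4) * ?S"
    proof (cases "1 \<le> \<bar>x\<bar>")
      case True
      have "\<bar>ln \<bar>x\<bar>\<bar> \<le> \<bar>x\<bar> powr b / b" using ln_powr_bound[of "\<bar>x\<bar>" b] True assms by simp
      also have "\<dots> \<le> (1 / b + 4) * \<bar>x\<bar> powr b" by (simp add: algebra_simps)
      also have "\<dots> \<le> (1 / b + 4) * ?S" using assms by (intro mult_left_mono) auto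
      finally show ?thesis using True assms ge_one_powr_ge_zero[of "\<bar>x\<bar>" b] by (simp add: add_increasing2)
    next
      case False
      have "\<bar>ln \<bar>x\<bar>\<bar> = ln (1 / \<bar>x\<bar>)" using x False by (simp add: ln_div)
      also have "\<dots> \<le> (1 / \<bar>x\<bar>) powr (1/4) / (1/4)" using False x by (intro ln_powr_bound) (auto simp: field_simps)
      also have "\<dots> = 4 * \<bar>x\<bar> powr (-1/4)" by (simp add: powr_divide powr_minus_divide)
      also have "\<dots> \<le> (1 / b + 4) * \<bar>x\<bar> powr (-1/4)" using assms by (intro mult_right_mono) auto
      also have "\<dots> \<le> (1 / b + 4) * ?S" using assms by (intro mult_left_mono) auto
      finally have l: "\<bar>ln \<bar>x\<bar>\<bar> \<le> (1 / b + 4) * ?S" .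
      have "1 powr (-1/4) \<le> \<bar>x\<bar> powr (-1/4)" using False x by (intro powr_mono2') auto
      then show ?thesis using l by (simp add: add_increasing)
    qed
    have "cmod (log_kernel g x) \<le> \<bar>g - ln \<bar>x\<bar>\<bar> + \<bar>pi / 2 * sgn x\<bar>"
      using cmod_le[of "log_kernel g x"] by (simp add: log_kernel_def)
    also have "\<bar>pi / 2 * sgn x\<bar> \<le> 2" using pi_less_4 by (simp add: abs_mult sgn_real_def)
    also have "\<bar>g - ln \<bar>x\<bar>\<bar> \<le> \<bar>g\<bar> + \<bar>ln \<bar>x\<bar>\<bar>" by simp
    also have "\<bar>g\<bar> + \<bar>ln \<bar>x\<bar>\<bar> + 2 \<le> \<bar>g\<bar> * ?S + (1 / b + 4) * ?S + 2 * ?S"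
      using S1 mult_left_mono[of 1 ?S "\<bar>g\<bar>"] by (intro add_mono) auto
    also have "\<dots> = C * ?S" by (simp add: C_def algebra_simps)
    finally show ?thesis by simp
  qed
  moreover have "0 \<le> C" using assms by (simp add: C_def)
  ultimately show ?thesis using that by blast
qed

lemma log_kernel_measurable [measurable]: "log_kernel g \<in> borel_measurable borel"
proof -
  have "log_kernel g = (\<lambda>x. of_real (g - ln \<bar>x\<bar>) + \<i> * of_real (pi / 2 * sgn x))"
    by (auto simp: log_kernel_def complex_eq_iff fun_eq_iff)
  then show ?thesis by simp
qed

text \<open>The kernels are known as limits only off x = 0; freezing the value at 0 yields a
  sequence converging everywhere.\<close>

lemma borel_measurable_punctured_limit:
  fixes L :: "real \<Rightarrow> complex"
  assumes f: "\<And>n::nat. f n \<in> borel_measurable borel" and lim: "\<And>x. x \<noteq> 0 \<Longrightarrow> (\<lambda>n. f n x) \<longlonglongrightarrow> L x"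
  shows "L \<in> borel_measurable borel"
proof (rule borel_measurable_LIMSEQ_metric)
  show "(\<lambda>x. if x = 0 then L 0 else f n x) \<in> borel_measurable borel" for n
    using f[of n] by measurable
  show "(\<lambda>n. if x = 0 then L 0 else f n x) \<longlonglongrightarrow> L x" for x
    using lim[of x] by (cases "x = 0") auto
qed

lemma cis_resolvent_convergent:
  assumes "k \<notin> \<real>\<^sub>\<ge>\<^sub>0" "cmod k < 1/2" "x \<noteq> 0"
  shows "\<exists>L. ((\<lambda>N. LBINT \<xi>:{0..N}. cis (x * \<xi>) / (of_real \<xi> - k)) \<longlongrightarrow> L) at_top"
proof -
  obtain g where g: "\<And>x. x \<noteq> 0 \<Longrightarrow> (cis_split x \<longlongrightarrow> log_kernel g x) at_top"
    using cis_split_tendsto by blast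
  show ?thesis
  proof (rule cis_resolvent_tendsto[of "1/4" "1/2" g])
    show "(cis_split y \<longlongrightarrow> log_kernel g y) at_top" if "y \<noteq> 0" for y using that by (rule g)
  next
    fix C
    assume h: "\<And>k x. k \<notin> \<real>\<^sub>\<ge>\<^sub>0 \<Longrightarrow> cmod k < 1/2 \<Longrightarrow> x \<noteq> 0 \<Longrightarrow>
       \<exists>P. ((\<lambda>N. LBINT \<xi>:{0..N}. cis (x * \<xi>) / (of_real \<xi> - k)) \<longlongrightarrow> log_kernel g x - Ln (- k) + P) at_top
         \<and> cmod P \<le> C * cmod k powr (1/4) * wt x powr (1/2)"
    show ?thesis using h[OF assms] by blast
  qed auto
qed

lemma G_off_measurable:
  assumes "k \<notin> \<real>\<^sub>\<ge>\<^sub>0" "cmod k < 1/2"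
  shows "G_off k \<in> borel_measurable borel"
proof -
  define L where "L x = Lim at_top (\<lambda>N. LBINT \<xi>:{0..N}. cis (x * \<xi>) / (of_real \<xi> - k))" for x
  have lim: "((\<lambda>N. LBINT \<xi>:{0..N}. cis (x * \<xi>) / (of_real \<xi> - k)) \<longlongrightarrow> L x) at_top" if x: "x \<noteq> 0" for x
  proof -
    obtain l where l: "((\<lambda>N. LBINT \<xi>:{0..N}. cis (x * \<xi>) / (of_real \<xi> - k)) \<longlongrightarrow> l) at_top"
      using cis_resolvent_convergent[OF assms x] by blast
    then show ?thesis unfolding L_def by (simp only: Lim_eq[OF l])
  qed
  have "L \<in> borel_measurable borel"
  proof (rule borel_measurable_punctured_limit)
    show "(\<lambda>x. LBINT \<xi>:{0..real n}. cis (x * \<xi>) / (of_real \<xi> - k)) \<in> borel_measurable borel" for n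
      unfolding set_lebesgue_integral_def by measurable
    show "(\<lambda>n. LBINT \<xi>:{0..real n}. cis (x * \<xi>) / (of_real \<xi> - k)) \<longlonglongrightarrow> L x" if "x \<noteq> 0" for x
      by (rule filterlim_compose[OF lim[OF that] filterlim_real_sequentially])
  qed
  moreover have "G_off k = (\<lambda>x. of_real (1 / (2 * pi)) * L x)" by (simp add: G_off_def L_def fun_eq_iff)
  ultimately show ?thesis by simp
qed

lemma G_tilde_measurable:
  assumes "lam > 0" "lam < 1/2"
  shows "G_tilde lam \<in> borel_measurable borel"
proof -
  define k where "k = - complex_of_real lam"
  have k: "k \<notin> \<real>\<^sub>\<ge>\<^sub>0" "cmod k < 1/2" using assms by (auto simp: k_def complex_nonneg_Reals_iff)
  have eq: "G_tilde lam x = - G_off k (- x)" if x: "x \<noteq> 0" for x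
  proof -
    obtain L where L: "((\<lambda>N. LBINT \<xi>:{0..N}. cis (- x * \<xi>) / (of_real \<xi> - k)) \<longlongrightarrow> L) at_top"
      using cis_resolvent_convergent[OF k, of "-x"] x by auto
    show ?thesis using G_tilde_eq[OF L[unfolded k_def]] Lim_eq[OF L] by (simp add: G_off_def)
  qed
  have "G_tilde lam = (\<lambda>x. if x = 0 then G_tilde lam 0 else - G_off k (- x))"
    using eq by (auto simp: fun_eq_iff)
  moreover have "(\<lambda>x. if x = 0 then G_tilde lam 0 else - G_off k (- x)) \<in> borel_measurable borel"
    using G_off_measurable[OF k] by measurable
  ultimately show ?thesis by simp
qed

lemma G_measurable:
  assumes "off_axis \<kappa>" "cut_abs \<kappa> < 1/2"
  shows "G \<kappa> \<in> borel_measurable borel"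
proof (cases \<kappa>)
  case (Off k)
  then have "G \<kappa> = G_off k" by (auto simp: fun_eq_iff)
  then show ?thesis using G_off_measurable[of k] assms Off by simp
next
  case (Edge \<sigma> lam)
  then have [measurable]: "G_tilde lam \<in> borel_measurable borel"
    using assms by (intro G_tilde_measurable) auto
  show ?thesis
  proof (cases \<sigma>)
    case Above
    then have "G \<kappa> = (\<lambda>x. \<i> * cis (lam * x) * indicator {0<..} x - G_tilde lam x)" using Edge by (auto simp: fun_eq_iff)
    then show ?thesis by simp
  next
    case Below
    then have "G \<kappa> = (\<lambda>x. - \<i> * cis (lam * x) * indicator {..<0} x - G_tilde lam x)" using Edge by (auto simp: fun_eq_iff)
    then show ?thesis by simp
  qed
qed

section \<open>Weighted sup norms and the weighted potential\<close>

lemma norm_weighted: "cmod (of_real (wt x powr (- p)) * f x) \<le> N \<longleftrightarrow> cmod (f x) \<le> N * wt x powr p"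
proof -
  have "cmod (of_real (wt x powr (- p)) * f x) = cmod (f x) / wt x powr p"
    by (simp add: norm_mult norm_divide powr_minus_divide)
  moreover have "0 < wt x powr p" by (simp add: wt_def)
  ultimately show ?thesis by (simp add: pos_divide_le_eq)
qed

lemma Linf_norm_le:
  assumes "f \<in> borel_measurable borel" "AE x in lborel. cmod (f x) \<le> N * wt x powr p"
  shows "Linf_norm (- p) f \<le> ereal N"
  unfolding Linf_norm_def
proof (rule esssup_I)
  show "(\<lambda>x. ereal (cmod (of_real (wt x powr - p) * f x))) \<in> borel_measurable lborel"
    using assms(1) by measurable
  show "AE x in lborel. ereal (cmod (of_real (wt x powr - p) * f x)) \<le> ereal N"
    using assms(2) by eventually_elim (simp only: ereal_less_eq norm_weighted)
qed

lemma Linf_weightedI: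
  assumes "f \<in> borel_measurable borel" "AE x in lborel. cmod (f x) \<le> N * wt x powr p"
  shows "f \<in> Linf_weighted (- p)"
  using Linf_norm_le[OF assms] assms(1) by (auto simp: Linf_weighted_def intro: le_less_trans)

text \<open>Presents the norm as a least constant, since the essential supremum is itself an almost
  everywhere bound. Minimality lets an estimate of \<open>f\<close> in terms of its own norm be fed
  back and absorbed.\<close>

lemma Linf_weightedE:
  assumes "f \<in> Linf_weighted (- p)"
  obtains N where "f \<in> borel_measurable borel" "0 \<le> N" "AE x in lborel. cmod (f x) \<le> N * wt x powr p"
    "\<And>N'. AE x in lborel. cmod (f x) \<le> N' * wt x powr p \<Longrightarrow> N \<le> N'"
proof -
  have f: "f \<in> borel_measurable borel" and fin: "Linf_norm (- p) f < \<infinity>"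
    using assms by (auto simp: Linf_weighted_def)
  have ae: "AE x in lborel. ereal (cmod (of_real (wt x powr - p) * f x)) \<le> Linf_norm (- p) f"
    unfolding Linf_norm_def by (rule esssup_AE)
  \<comment> \<open>A negative essential supremum would make a modulus negative almost everywhere,
    impossible as Lebesgue measure is not zero. With finiteness this yields a real
    \<open>N\<close>.\<close>
  have "0 \<le> Linf_norm (- p) f"
  proof (rule ccontr)
    assume "\<not> 0 \<le> Linf_norm (- p) f"
    have "AE x in (lborel :: real measure). False" using ae
    proof eventually_elim
      case (elim x)
      have "0 \<le> ereal (cmod (of_real (wt x powr - p) * f x))" by (simp only: ereal_less_eq(5) norm_ge_zero)
      then show False using elim \<open>\<not> 0 \<le> Linf_norm (- p) f\<close> by (meson order_trans)
    qed
    then show False using ae_filter_eq_bot_iff[of "lborel :: real measure"] 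
      by (simp add: eventually_False)
  qed
  then obtain N where N: "Linf_norm (- p) f = ereal N" "0 \<le> N"
    using fin by (cases "Linf_norm (- p) f") auto
  show ?thesis
  proof (rule that[OF f N(2)])
    show "AE x in lborel. cmod (f x) \<le> N * wt x powr p"
      using ae unfolding N(1) by eventually_elim (simp only: ereal_less_eq norm_weighted)
    show "N \<le> N'" if "AE x in lborel. cmod (f x) \<le> N' * wt x powr p" for N'
      using Linf_norm_le[OF f that] N(1) by simp
  qed
qed

text \<open>The weight of \<open>u\<close> is split: w^(s - s1) pays for the growth of the Jost
  functions, and w^s1 with s1 > 1/2 remains to make the product integrable.\<close>

locale weighted_potential =
  fixes s s1 :: real and u :: "real \<Rightarrow> real"
  assumes s1: "s1 > 1/2" and s: "s > s1" and u: "(\<lambda>x. complex_of_real (u x)) \<in> L2_weighted s"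
begin

abbreviation q :: real where "q \<equiv> s - s1"

text \<open>Pointwise majorant of |u f| for f of weighted norm at most 1.\<close>

definition U :: "real \<Rightarrow> real" where "U y = \<bar>u y\<bar> * wt y powr q"

lemma u_measurable [measurable]: "u \<in> borel_measurable borel"
proof -
  have 1: "(\<lambda>x. complex_of_real (wt x powr s) * complex_of_real (u x)) \<in> borel_measurable borel"
    using u by (simp add: L2_weighted_def L2_def)
  have "(\<lambda>x. Re (complex_of_real (wt x powr s) * complex_of_real (u x)) / wt x powr s) \<in> borel_measurable borel"
    using 1 by measurable
  moreover have "Re (complex_of_real (wt x powr s) * complex_of_real (u x)) / wt x powr s = u x" for x
    by (simp add: wt_def)
  ultimately show ?thesis by simp
qed

lemma U_measurable [measurable]: "U \<in> borel_measurable borel"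
  unfolding U_def [abs_def] by measurable

lemma U_nonneg [simp]: "0 \<le> U y" by (simp add: U_def)

lemma integrable_weighted_square: "integrable lborel (\<lambda>x. (wt x powr s * \<bar>u x\<bar>)\<^sup>2)"
  using u by (simp add: L2_weighted_def L2_def norm_mult)

lemma integrable_U_square: "integrable lborel (\<lambda>y. (U y)\<^sup>2)"
proof (rule Bochner_Integration.integrable_bound[OF integrable_weighted_square])
  have "(U x)\<^sup>2 \<le> (wt x powr s * \<bar>u x\<bar>)\<^sup>2" for x
  proof (rule power_mono)
    have "wt x powr q \<le> wt x powr s" using s1 one_le_wt by (intro powr_mono) auto
    then show "U x \<le> wt x powr s * \<bar>u x\<bar>" unfolding U_def by (simp add: mult.commute mult_left_mono)
  qed simp
  then show "AE x in lborel. norm ((U x)\<^sup>2) \<le> norm ((wt x powr s * \<bar>u x\<bar>)\<^sup>2)" by simp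
qed simp

text \<open>Cauchy-Schwarz in the form ab \<le> a^2 + b^2: U w^p is the product of w^s |u| and w^(p
  - s1), and the latter is square integrable exactly when p < s1 - 1/2.\<close>

lemma integrable_U_wt:
  assumes "p < s1 - 1/2"
  shows "integrable lborel (\<lambda>y. U y * wt y powr p)"
proof -
  have i: "integrable lborel (\<lambda>x. wt x powr (- (2 * (s1 - p))))"
    using assms by (intro integrable_wt_powr) auto
  show ?thesis
  proof (rule Bochner_Integration.integrable_bound[OF Bochner_Integration.integrable_add[OF integrable_weighted_square i]])
    have "U x * wt x powr p \<le> (wt x powr s * \<bar>u x\<bar>)\<^sup>2 + wt x powr (- (2 * (s1 - p)))" for x
    proof -
      have "U x * wt x powr p = (wt x powr s * \<bar>u x\<bar>) * wt x powr (p - s1)"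
        by (simp add: U_def powr_add[symmetric] powr_diff field_simps)
      also have "\<dots> \<le> (wt x powr s * \<bar>u x\<bar>)\<^sup>2 + (wt x powr (p - s1))\<^sup>2"
        by (rule order_trans[OF _ sum_squares_bound[THEN order_trans[rotated]]]) auto
      also have "(wt x powr (p - s1))\<^sup>2 = wt x powr (- (2 * (s1 - p)))"
        by (simp add: powr_power algebra_simps wt_def)
      finally show ?thesis .
    qed
    then show "AE x in lborel. norm (U x * wt x powr p) \<le> norm ((wt x powr s * \<bar>u x\<bar>)\<^sup>2 + wt x powr (- (2 * (s1 - p))))"
      by (auto intro!: AE_I2 order_trans[OF _ abs_ge_self])
  qed simp
qed

lemma integrable_U: "integrable lborel U"
  using integrable_U_wt[of 0] s1 by simp

text \<open>For |x - y| \<le> 1 the product is at most |x - y|^(-1/2) + U^2, both integrable there;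
  farther away the singular factor is at most 1. The resulting bound is uniform in x.\<close>

lemma U_singular:
  obtains V where "0 \<le> V" "\<And>x::real. integrable lborel (\<lambda>y. \<bar>x - y\<bar> powr (-1/4) * U y)"
    "\<And>x::real. (LINT y|lborel. \<bar>x - y\<bar> powr (-1/4) * U y) \<le> V"
proof -
  \<comment> \<open>4 is the integral of |t|^(-1/2) over [-1, 1].\<close>
  define V where "V = 4 + (LINT y|lborel. (U y)\<^sup>2) + (LINT y|lborel. U y)"
  let ?d = "\<lambda>(x::real) y. indicator {x-1..x+1} y *\<^sub>R \<bar>y - x\<bar> powr (1/2 - 1) + (U y)\<^sup>2 + U y"
  have I: "set_integrable lborel {x-1..x+1} (\<lambda>y. \<bar>y - x\<bar> powr (1/2 - 1))"
    "(LBINT y:{x-1..x+1}. \<bar>y - x\<bar> powr (1/2 - 1)) = 4" for x :: real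
    using has_bochner_abs_powr_Icc[of "1/2" 1 x] by auto
  have Id: "integrable lborel (?d x)" for x :: real
    using I(1)[of x] by (intro Bochner_Integration.integrable_add integrable_U_square integrable_U) (simp add: set_integrable_def)
  have Vd: "integral\<^sup>L lborel (?d x) = V" for x :: real
    using I[of x] unfolding V_def
    by (simp add: integrable_U_square integrable_U set_integrable_def set_lebesgue_integral_def)
  have le: "\<bar>x - y\<bar> powr (-1/4) * U y \<le> ?d x y" for x y :: real
  proof (cases "\<bar>x - y\<bar> \<le> 1")
    case True
    have "\<bar>x - y\<bar> powr (-1/4) * U y \<le> (\<bar>x - y\<bar> powr (-1/4))\<^sup>2 + (U y)\<^sup>2"
      by (rule order_trans[OF _ sum_squares_bound[THEN order_trans[rotated]]]) auto
    also have "(\<bar>x - y\<bar> powr (-1/4))\<^sup>2 = \<bar>y - x\<bar> powr (1/2 - 1)"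
      by (cases "x = y") (simp_all add: powr_power abs_minus_commute)
    finally have "\<bar>x - y\<bar> powr (-1/4) * U y \<le> \<bar>y - x\<bar> powr (1/2 - 1) + (U y)\<^sup>2" .
    moreover have "indicator {x-1..x+1} y = (1::real)" using True by (auto simp: indicator_def)
    ultimately show ?thesis by (simp add: add_increasing2)
  next
    case False
    then have "\<bar>x - y\<bar> powr (-1/4) \<le> 1 powr (-1/4)" by (intro powr_mono2') auto
    then have "\<bar>x - y\<bar> powr (-1/4) * U y \<le> 1 * U y" by (intro mult_right_mono) auto
    then show ?thesis by (simp add: indicator_def add_increasing)
  qed
  have int: "integrable lborel (\<lambda>y. \<bar>x - y\<bar> powr (-1/4) * U y)" for x :: real
    using le[of x] by (intro Bochner_Integration.integrable_bound[OF Id[of x]]) (auto intro!: order_trans[OF _ abs_ge_self])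
  moreover have "(LINT y|lborel. \<bar>x - y\<bar> powr (-1/4) * U y) \<le> V" for x :: real
    unfolding Vd[of x, symmetric] using le by (intro integral_mono int Id)
  moreover have "0 \<le> V" unfolding V_def by (intro add_nonneg_nonneg integral_nonneg_AE) auto
  ultimately show ?thesis using that by blast
qed

end

context weighted_potential
begin

text \<open>Weighted norm at most \<open>N\<close>, kept with real constants and measurability so
  that estimates need no arithmetic in \<open>ereal\<close>.\<close>

definition bounded_by_wt :: "real \<Rightarrow> (real \<Rightarrow> complex) \<Rightarrow> bool" where
  "bounded_by_wt N f \<longleftrightarrow> f \<in> borel_measurable borel \<and> (AE x in lborel. cmod (f x) \<le> N * wt x powr q)"

lemma u_times_bound:
  assumes "bounded_by_wt N f"
  shows "AE y in lborel. cmod (of_real (u y) * f y) \<le> N * U y"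
  using assms unfolding bounded_by_wt_def
  by (auto elim!: eventually_mono simp: norm_mult U_def dest: mult_left_mono[where c = "\<bar>u _\<bar>"] intro: order_trans)
     (metis (no_types, opaque_lifting) abs_ge_zero mult.left_commute mult_left_mono)

lemma bounded_by_wt_measurable: "bounded_by_wt N f \<Longrightarrow> f \<in> borel_measurable borel"
  by (simp add: bounded_by_wt_def)

lemma bounded_by_wt_scale:
  "bounded_by_wt N f \<Longrightarrow> bounded_by_wt (cmod z * N) (\<lambda>x. z * f x)"
  unfolding bounded_by_wt_def by (auto elim!: eventually_mono simp: norm_mult mult.assoc intro!: mult_left_mono)

lemma bounded_by_wt_diff:
  assumes "bounded_by_wt N f" "bounded_by_wt M g"
  shows "bounded_by_wt (N + M) (\<lambda>x. f x - g x)"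
proof -
  have "AE x in lborel. cmod (f x - g x) \<le> (N + M) * wt x powr q"
    using assms[unfolded bounded_by_wt_def, THEN conjunct2]
  proof eventually_elim
    case (elim x)
    then show ?case using norm_triangle_ineq4[of "f x" "g x"] by (simp add: distrib_right)
  qed
  then show ?thesis using assms unfolding bounded_by_wt_def by (blast intro: borel_measurable_diff)
qed

lemma bounded_by_wt_mono: "bounded_by_wt N f \<Longrightarrow> N \<le> M \<Longrightarrow> bounded_by_wt M f"
  unfolding bounded_by_wt_def
  by (auto elim!: eventually_mono intro: order_trans mult_right_mono)

lemma bounded_by_wt_cong_AE:
  "bounded_by_wt N f \<Longrightarrow> g \<in> borel_measurable borel \<Longrightarrow> AE x in lborel. g x = f x \<Longrightarrow> bounded_by_wt N g"
  unfolding bounded_by_wt_def by (auto elim: eventually_elim2)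

lemma Linf_weighted_iff: "f \<in> Linf_weighted (- q) \<longleftrightarrow> (\<exists>N\<ge>0. bounded_by_wt N f)"
proof
  assume "f \<in> Linf_weighted (- q)"
  then show "\<exists>N\<ge>0. bounded_by_wt N f"
    by (rule Linf_weightedE) (auto simp: bounded_by_wt_def)
next
  assume "\<exists>N\<ge>0. bounded_by_wt N f"
  then show "f \<in> Linf_weighted (- q)"
    unfolding bounded_by_wt_def by (blast intro: Linf_weightedI)
qed

end

section \<open>Integral operators with logarithmic kernels\<close>

text \<open>Abstracts what the argument takes from G_0^0. The power b dominates the logarithmic
  growth; b < q leaves room for compactness, and b < s1 - 1/2 makes U w^b integrable.\<close>

locale log_type_kernel = weighted_potential +
  fixes K :: "real \<Rightarrow> complex" and b C :: real
  assumes b: "0 < b" "b < q" "b < s1 - 1/2" and C: "0 \<le> C"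
    and K_measurable [measurable]: "K \<in> borel_measurable borel"
    and K_bound: "\<And>x. x \<noteq> 0 \<Longrightarrow> cmod (K x) \<le> C * (\<bar>x\<bar> powr b + \<bar>x\<bar> powr (-1/4))"
    and K_holder: "\<And>x y. x \<noteq> 0 \<Longrightarrow> y \<noteq> 0 \<Longrightarrow>
       cmod (K x - K y) \<le> C * \<bar>x - y\<bar> powr (1/4) * (\<bar>x\<bar> powr (-1/4) + \<bar>y\<bar> powr (-1/4))"
begin

abbreviation "T f \<equiv> conv K (\<lambda>y. of_real (u y) * f y)"

lemma abs_diff_powr_le: "\<bar>x - y\<bar> powr b \<le> wt x powr b * wt y powr b"
proof -
  have "\<bar>x - y\<bar> powr b \<le> wt (x - y) powr b" using b by (intro abs_powr_le_wt) auto
  also have "\<dots> \<le> (wt x * wt y) powr b" using b by (intro powr_mono2 wt_diff_le) auto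
  finally show ?thesis by (simp add: powr_mult)
qed

text \<open>One constant, uniform over balls, for the growth w^b and for the Hoelder seminorm of T
  f: these are the hypotheses of \<open>weighted_Arzela_Ascoli\<close>.\<close>

definition T_bound :: "real \<Rightarrow> bool" where
  "T_bound M \<longleftrightarrow> 0 \<le> M \<and> (\<forall>N f x y. 0 \<le> N \<longrightarrow> bounded_by_wt N f \<longrightarrow>
     integrable lborel (\<lambda>y. K (x - y) * (of_real (u y) * f y)) \<and>
     cmod (T f x) \<le> N * M * wt x powr b \<and> cmod (T f x - T f y) \<le> N * M * \<bar>x - y\<bar> powr (1/4))"

lemma T_boundD:
  assumes "T_bound M"
  shows "0 \<le> M"
    "\<And>N f x. 0 \<le> N \<Longrightarrow> bounded_by_wt N f \<Longrightarrow> integrable lborel (\<lambda>y. K (x - y) * (of_real (u y) * f y))"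
    "\<And>N f x. 0 \<le> N \<Longrightarrow> bounded_by_wt N f \<Longrightarrow> cmod (T f x) \<le> N * M * wt x powr b"
    "\<And>N f x y. 0 \<le> N \<Longrightarrow> bounded_by_wt N f \<Longrightarrow> cmod (T f x - T f y) \<le> N * M * \<bar>x - y\<bar> powr (1/4)"
  using assms unfolding T_bound_def by blast+

text \<open>The part |x - y|^b of the kernel bound separates into w(x)^b w(y)^b and leaves the
  integral W of U w^b; the singular part is controlled by the constant V of
  \<open>U_singular\<close>.\<close>

lemma T_bound_exists: "\<exists>M. T_bound M"
proof -
  obtain V where V: "0 \<le> V" "\<And>x::real. integrable lborel (\<lambda>y. \<bar>x - y\<bar> powr (-1/4) * U y)"
    "\<And>x::real. (LINT y|lborel. \<bar>x - y\<bar> powr (-1/4) * U y) \<le> V"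
    using U_singular by blast
  define W where "W = (LINT y|lborel. U y * wt y powr b)"
  have iW: "integrable lborel (\<lambda>y. U y * wt y powr b)" by (rule integrable_U_wt[OF b(3)])
  have W0: "0 \<le> W" unfolding W_def by (rule integral_nonneg_AE) auto
  \<comment> \<open>The factor 2 accounts for the singularities at both x and y in the Hoelder
    estimate.\<close>
  define M where "M = 2 * C * (W + V)"
  have ne: "AE y in lborel. x - y \<noteq> 0" for x :: real
    using AE_lborel_singleton[of x] by eventually_elim auto
  let ?g = "\<lambda>N x y. N * C * (wt x powr b * (U y * wt y powr b) + \<bar>x - y\<bar> powr (-1/4) * U y)"
  have ig: "integrable lborel (?g N x)" for N x
    by (intro integrable_mult_right Bochner_Integration.integrable_add iW V)
  have bd: "AE y in lborel. cmod (K (x - y) * (of_real (u y) * f y)) \<le> ?g N x y"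
    if N: "0 \<le> N" "bounded_by_wt N f" for N f x
    using u_times_bound[OF N(2)] ne[of x]
  proof eventually_elim
    case (elim y)
    have "cmod (K (x - y) * (of_real (u y) * f y)) \<le> (C * (\<bar>x - y\<bar> powr b + \<bar>x - y\<bar> powr (-1/4))) * (N * U y)"
      unfolding norm_mult[of "K _"] using elim K_bound[of "x - y"] C by (intro mult_mono) auto
    also have "\<dots> \<le> (C * (wt x powr b * wt y powr b + \<bar>x - y\<bar> powr (-1/4))) * (N * U y)"
      using C N abs_diff_powr_le[of x y] by (intro mult_right_mono mult_left_mono add_right_mono) auto
    also have "\<dots> = ?g N x y" by (simp add: algebra_simps)
    finally show ?case .
  qed
  have int: "integrable lborel (\<lambda>y. K (x - y) * (of_real (u y) * f y))"
    if N: "0 \<le> N" "bounded_by_wt N f" for N f x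
  proof (rule Bochner_Integration.integrable_bound[OF ig[of N x]])
    have [measurable]: "f \<in> borel_measurable borel" using N(2) by (rule bounded_by_wt_measurable)
    show "(\<lambda>y. K (x - y) * (of_real (u y) * f y)) \<in> borel_measurable lborel" by measurable
    show "AE y in lborel. norm (K (x - y) * (of_real (u y) * f y)) \<le> norm (?g N x y)"
      using bd[OF N, of x] by eventually_elim (auto intro: order_trans[OF _ abs_ge_self])
  qed
  moreover have "cmod (T f x) \<le> N * M * wt x powr b" if N: "0 \<le> N" "bounded_by_wt N f" for N f x
  proof -
    have "cmod (T f x) \<le> (LINT y|lborel. ?g N x y)"
      unfolding conv_def by (rule norm_integral_le_dominated[OF ig bd[OF N]])
    also have "\<dots> = N * C * (wt x powr b * W + (LINT y|lborel. \<bar>x - y\<bar> powr (-1/4) * U y))"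
      using iW V(2)[of x] by (simp add: W_def)
    also have "\<dots> \<le> N * C * (wt x powr b * W + V)"
      using V(3)[of x] N C by (intro mult_left_mono add_left_mono) auto
    also have "\<dots> \<le> N * C * (wt x powr b * W + V * wt x powr b)"
      using V(1) N C one_le_wt_powr[of b x] b mult_left_mono[of 1 "wt x powr b" V]
      by (intro mult_left_mono add_left_mono) auto
    also have "\<dots> = N * C * (W + V) * wt x powr b" by (simp add: algebra_simps)
    also have "\<dots> \<le> 2 * (N * C * (W + V) * wt x powr b)"
      using N C W0 V(1) by simp
    also have "\<dots> = N * M * wt x powr b" by (simp add: M_def)
    finally show ?thesis .
  qed
  moreover have "cmod (T f x - T f y) \<le> N * M * \<bar>x - y\<bar> powr (1/4)"
    if N: "0 \<le> N" "bounded_by_wt N f" for N f x y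
  proof -
    let ?h = "\<lambda>z. N * (C * \<bar>x - y\<bar> powr (1/4)) * (\<bar>x - z\<bar> powr (-1/4) * U z + \<bar>y - z\<bar> powr (-1/4) * U z)"
    have ih: "integrable lborel ?h"
      by (intro integrable_mult_right Bochner_Integration.integrable_add V)
    have "cmod (T f x - T f y) = cmod (LINT z|lborel. K (x - z) * (of_real (u z) * f z) - K (y - z) * (of_real (u z) * f z))"
      unfolding conv_def Bochner_Integration.integral_diff[OF int[OF N, of x] int[OF N, of y]] ..
    also have "\<dots> \<le> (LINT z|lborel. ?h z)"
    proof (rule norm_integral_le_dominated[OF ih])
      show "AE z in lborel. cmod (K (x - z) * (of_real (u z) * f z) - K (y - z) * (of_real (u z) * f z)) \<le> ?h z"
        using u_times_bound[OF N(2)] ne[of x] ne[of y]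
      proof eventually_elim
        case (elim z)
        have "cmod (K (x - z) * (of_real (u z) * f z) - K (y - z) * (of_real (u z) * f z))
          = cmod (K (x - z) - K (y - z)) * cmod (of_real (u z) * f z)"
          by (simp only: left_diff_distrib[symmetric] norm_mult)
        also have "\<dots> \<le> (C * \<bar>(x - z) - (y - z)\<bar> powr (1/4) * (\<bar>x - z\<bar> powr (-1/4) + \<bar>y - z\<bar> powr (-1/4))) * (N * U z)"
          using elim C by (intro mult_mono K_holder) auto
        also have "\<dots> = ?h z" by (simp add: algebra_simps)
        finally show ?case .
      qed
    qed
    also have "\<dots> = N * (C * \<bar>x - y\<bar> powr (1/4)) * ((LINT z|lborel. \<bar>x - z\<bar> powr (-1/4) * U z) + (LINT z|lborel. \<bar>y - z\<bar> powr (-1/4) * U z))"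
      using V(2) by simp
    also have "\<dots> \<le> N * (C * \<bar>x - y\<bar> powr (1/4)) * (V + V)"
      using V(3) N C by (intro mult_left_mono add_mono) auto
    also have "\<dots> = 2 * (N * (C * \<bar>x - y\<bar> powr (1/4))) * V" by simp
    also have "\<dots> \<le> 2 * (N * (C * \<bar>x - y\<bar> powr (1/4))) * (W + V)" using W0 N C by (intro mult_left_mono) auto
    also have "\<dots> = N * M * \<bar>x - y\<bar> powr (1/4)" by (simp add: M_def)
    finally show ?thesis .
  qed
  moreover have "0 \<le> M" using C W0 V(1) by (simp add: M_def)
  ultimately have "T_bound M" unfolding T_bound_def by blast
  then show ?thesis ..
qed

lemma T_diff:
  assumes "0 \<le> N" "bounded_by_wt N f" "0 \<le> N'" "bounded_by_wt N' g"
  shows "T (\<lambda>y. f y - g y) x = T f x - T g x"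
proof -
  obtain M where "T_bound M" using T_bound_exists ..
  note int = T_boundD(2)[OF this]
  show ?thesis unfolding conv_def
    using Bochner_Integration.integral_diff[OF int[OF assms(1,2), of x] int[OF assms(3,4), of x]]
    by (simp add: algebra_simps)
qed

lemma T_scale: "T (\<lambda>y. z * f y) x = z * T f x"
proof -
  have "T (\<lambda>y. z * f y) x = (LINT y|lborel. z * (K (x - y) * (of_real (u y) * f y)))"
    unfolding conv_def by (simp add: mult.left_commute)
  also have "\<dots> = z * T f x" unfolding conv_def by (rule integral_mult_right_zero)
  finally show ?thesis .
qed

text \<open>Otherwise there are \<open>h n\<close> of norm at most 1 but not at most 1/2 whose
  images under 1 - T tend to 0. Along a subsequence T (h n) converges by Arzela-Ascoli, hence so
  does h n, and the limit g satisfies T g = g. Now m0 - g solves the same equation as m0, uniqueness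
  gives g = 0, and this contradicts the lower bound 1/2.\<close>

lemma bounded_below:
  assumes uniq: "is_jost_solution (- q) u K g0 m0"
  obtains B where "0 < B"
    "\<And>f M. f \<in> Linf_weighted (- q) \<Longrightarrow> 0 \<le> M \<Longrightarrow> AE x in lborel. cmod (f x - T f x) \<le> M * wt x powr q
       \<Longrightarrow> bounded_by_wt (B * M) f"
proof -
  define A where "A f M \<longleftrightarrow> f \<in> Linf_weighted (- q) \<and> 0 \<le> M \<and> (AE x in lborel. cmod (f x - T f x) \<le> M * wt x powr q)"
    for f M
  have "\<exists>B>0. \<forall>f M. A f M \<longrightarrow> bounded_by_wt (B * M) f"
  proof (rule ccontr)
    assume neg: "\<not> ?thesis"
    have "\<forall>n. \<exists>h. bounded_by_wt 1 h \<and> \<not> bounded_by_wt (1/2) h \<and> (AE x in lborel. cmod (h x - T h x) \<le> (1 / Suc n) * wt x powr q)"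
    proof
      fix n
      have "0 < real (Suc n)" by simp
      with neg have "\<not> (\<forall>f M. A f M \<longrightarrow> bounded_by_wt (real (Suc n) * M) f)"
        by (metis (no_types))
      then obtain f M where "A f M" "\<not> bounded_by_wt (real (Suc n) * M) f"
        unfolding not_all not_imp by (elim exE conjE)
      then have f: "f \<in> Linf_weighted (- q)" "0 \<le> M" 
        "AE x in lborel. cmod (f x - T f x) \<le> M * wt x powr q" "\<not> bounded_by_wt (Suc n * M) f"
        unfolding A_def by blast+
      obtain N where N: "f \<in> borel_measurable borel" "0 \<le> N" "AE x in lborel. cmod (f x) \<le> N * wt x powr q"
        "\<And>N'. AE x in lborel. cmod (f x) \<le> N' * wt x powr q \<Longrightarrow> N \<le> N'"
        by (rule Linf_weightedE[OF f(1)], rule that; blast)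
      have fN: "bounded_by_wt N f" using N by (simp add: bounded_by_wt_def)
      \<comment> \<open>The least constant N of f exceeds (n + 1) M, so the residual of f/N is below
        1/(n + 1).\<close>
      have big: "Suc n * M < N"
        using bounded_by_wt_mono[OF fN, of "Suc n * M"] f(4) by linarith
      have N0: "N > 0" using big f(2) by (smt (verit) mult_nonneg_nonneg of_nat_0_le_iff)
      \<comment> \<open>Dividing by the least constant gives norm 1, so the bound 1/2 fails by
        minimality of \<open>N\<close>.\<close>
      let ?h = "\<lambda>x. of_real (1 / N) * f x"
      have "bounded_by_wt 1 ?h" using bounded_by_wt_scale[OF fN, of "of_real (1 / N)"] N0 by (simp add: norm_divide)
      moreover have "\<not> bounded_by_wt (1/2) ?h"
      proof
        assume "bounded_by_wt (1/2) ?h"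
        then have "bounded_by_wt (N / 2) f"
          using bounded_by_wt_scale[of "1/2" ?h "of_real N"] N0 by simp
        then show False using N(4)[of "N / 2"] N0 by (simp add: bounded_by_wt_def)
      qed
      moreover have "AE x in lborel. cmod (?h x - T ?h x) \<le> (1 / Suc n) * wt x powr q"
        using f(3)
      proof eventually_elim
        case (elim x)
        have "?h x - T ?h x = of_real (1 / N) * (f x - T f x)" by (simp only: T_scale right_diff_distrib)
        then have "cmod (?h x - T ?h x) = (1 / N) * cmod (f x - T f x)" using N0 by (simp add: norm_mult norm_divide)
        also have "\<dots> \<le> (1 / N) * (M * wt x powr q)" using elim N0 by (intro mult_left_mono) auto
        also have "\<dots> = (M / N) * wt x powr q" by simp
        also have "\<dots> \<le> (1 / Suc n) * wt x powr q" using big N0 by (intro mult_right_mono) (auto simp: field_simps)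
        finally show ?case .
      qed
      ultimately show "\<exists>h. bounded_by_wt 1 h \<and> \<not> bounded_by_wt (1/2) h \<and> (AE x in lborel. cmod (h x - T h x) \<le> (1 / Suc n) * wt x powr q)"
        by (intro exI[of _ ?h] conjI)
    qed
    from choice[OF this] obtain h where hh: "\<forall>n. bounded_by_wt 1 (h n) \<and> \<not> bounded_by_wt (1/2) (h n) \<and>
      (AE x in lborel. cmod (h n x - T (h n) x) \<le> (1 / Suc n) * wt x powr q)" ..
    have h: "bounded_by_wt 1 (h n)" "\<not> bounded_by_wt (1/2) (h n)"
      "AE x in lborel. cmod (h n x - T (h n) x) \<le> (1 / Suc n) * wt x powr q" for n
      using spec[OF hh, of n] by blast+
    obtain M where "T_bound M" using T_bound_exists ..
    note M = T_boundD[OF this]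
    have F: "cmod (T (h n) x) \<le> M * wt x powr b" "cmod (T (h n) x - T (h n) y) \<le> M * \<bar>x - y\<bar> powr (1/4)" for n x y
      using M(3)[OF _ h(1)[of n], of x] M(4)[OF _ h(1)[of n], of x y] by auto
    have "\<exists>k g. strict_mono (k :: nat \<Rightarrow> nat) \<and> continuous_on UNIV g \<and>
      (\<forall>e>0. \<exists>N. \<forall>n x. n \<ge> N \<longrightarrow> cmod (T (h (k n)) x - g x) \<le> e * wt x powr q)"
    proof (rule weighted_Arzela_Ascoli[of b q "\<lambda>n. T (h n)" M M])
      fix k :: "nat \<Rightarrow> nat" and g
      assume "strict_mono k" "continuous_on UNIV g"
        and c: "\<And>e. 0 < e \<Longrightarrow> \<exists>N. \<forall>n x. n \<ge> N \<longrightarrow> cmod (T (h (k n)) x - g x) \<le> e * wt x powr q"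
      then show ?thesis
        by (intro exI[of _ k] exI[of _ g] conjI allI impI c)
    qed (use b F in auto)
    then obtain k g where k: "strict_mono (k :: nat \<Rightarrow> nat)" and g: "continuous_on UNIV g"
      and conv_g': "\<forall>e>0. \<exists>N. \<forall>n x. n \<ge> N \<longrightarrow> cmod (T (h (k n)) x - g x) \<le> e * wt x powr q"
      by (elim exE conjE)
    note conv_g = conv_g'[rule_format]
    have gm [measurable]: "g \<in> borel_measurable borel" using g by (rule borel_measurable_continuous_onI)
    have gb: "bounded_by_wt (1 + M) g"
    proof -
      obtain n where n: "\<And>x. cmod (T (h (k n)) x - g x) \<le> 1 * wt x powr q" using conv_g[of 1] by auto
      have "cmod (g x) \<le> (1 + M) * wt x powr q" for x
      proof -
        have "wt x powr b \<le> wt x powr q" using b one_le_wt by (intro powr_mono) auto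
        then have "M * wt x powr b \<le> M * wt x powr q" using M(1) by (rule mult_left_mono)
        then show ?thesis using n[of x] F(1)[of "k n" x] norm_triangle_ineq2[of "g x" "T (h (k n)) x"]
          by (simp add: norm_minus_commute algebra_simps)
      qed
      then show ?thesis by (simp add: bounded_by_wt_def)
    qed
    have close: "\<exists>n. bounded_by_wt e (\<lambda>x. h (k n) x - g x) \<and> (\<forall>x. cmod (T (h (k n)) x - g x) \<le> e * wt x powr q)"
      if e0: "0 < e" for e
    proof -
      obtain N where N': "\<forall>n x. n \<ge> N \<longrightarrow> cmod (T (h (k n)) x - g x) \<le> (e/2) * wt x powr q"
        using conv_g[OF half_gt_zero[OF e0]] ..
      note N = N'[rule_format]
      obtain N' where N': "1 / Suc N' < e/2" using nat_approx_posE[OF half_gt_zero[OF e0]] .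
      define n where "n = max N N'"
      have "1 / Suc (k n) \<le> 1 / real (Suc N')"
        using strict_mono_imp_increasing[OF k, of n] by (intro divide_left_mono) (auto simp: n_def)
      then have kn: "1 / Suc (k n) \<le> e/2" using N' by simp
      have "AE x in lborel. cmod (h (k n) x - g x) \<le> e * wt x powr q"
        using h(3)[of "k n"]
      proof eventually_elim
        case (elim x)
        have "(1 / Suc (k n)) * wt x powr q \<le> (e/2) * wt x powr q" using kn by (rule mult_right_mono) simp
        moreover have "cmod (h (k n) x - g x) \<le> cmod (h (k n) x - T (h (k n)) x) + cmod (T (h (k n)) x - g x)"
          by (rule order_trans[OF _ norm_triangle_ineq]) simp
        moreover have "cmod (T (h (k n)) x - g x) \<le> (e/2) * wt x powr q" by (rule N) (simp add: n_def)
        moreover have "(e/2) * wt x powr q + (e/2) * wt x powr q = e * wt x powr q" by simp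
        ultimately show ?case using elim by linarith
      qed
      moreover have "(\<lambda>x. h (k n) x - g x) \<in> borel_measurable borel"
        using bounded_by_wt_measurable[OF h(1)] gm by (rule borel_measurable_diff)
      moreover have "cmod (T (h (k n)) x - g x) \<le> e * wt x powr q" for x
      proof -
        have "(e/2) * wt x powr q \<le> e * wt x powr q" using e0 by (intro mult_right_mono) auto
        then show ?thesis using N[of n x] by (simp add: n_def)
      qed
      ultimately show ?thesis by (auto simp: bounded_by_wt_def)
    qed
    have Tg: "T g x = g x" for x
    proof -
      have "cmod (T g x - g x) \<le> 0 + e" if e: "e > 0" for e
      proof -
        \<comment> \<open>Makes d (M w^b + w^q) equal to e; the two terms are the errors of T
          applied to h - g and of the uniform limit.\<close>
        define d where "d = e / (M * wt x powr b + wt x powr q)"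
        have pos: "0 < M * wt x powr b + wt x powr q" using M(1) by (intro add_nonneg_pos) auto
        have d: "d > 0" using e pos by (simp add: d_def)
        obtain n where n: "bounded_by_wt d (\<lambda>x. h (k n) x - g x)" "\<And>x. cmod (T (h (k n)) x - g x) \<le> d * wt x powr q"
          using close[OF d] by blast
        have "T (h (k n)) x - T g x = T (\<lambda>y. h (k n) y - g y) x"
          using T_diff[OF _ h(1)[of "k n"] _ gb] M(1) by simp
        then have "cmod (T (h (k n)) x - T g x) \<le> d * M * wt x powr b" using M(3)[OF _ n(1)] d by simp
        then have "cmod (T g x - g x) \<le> d * M * wt x powr b + d * wt x powr q"
          using n(2)[of x] norm_triangle_ineq[of "T g x - T (h (k n)) x" "T (h (k n)) x - g x"]
          by (simp add: norm_minus_commute)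
        also have "\<dots> = d * (M * wt x powr b + wt x powr q)" by (simp add: algebra_simps)
        also have "\<dots> = e" using pos by (simp add: d_def)
        finally show ?thesis by simp
      qed
      then have "cmod (T g x - g x) \<le> 0" by (rule field_le_epsilon)
      then show ?thesis by simp
    qed
    have m0: "m0 \<in> Linf_weighted (- q)" "AE x in lborel. m0 x = g0 x + T m0 x"
      and un: "\<And>m'. solves_jost_eq (- q) u K g0 m' \<Longrightarrow> AE x in lborel. m' x = m0 x"
      using uniq unfolding is_jost_solution_def solves_jost_eq_def by blast+
    obtain N0 where N0: "0 \<le> N0" "bounded_by_wt N0 m0" using m0(1) unfolding Linf_weighted_iff by blast
    have gz: "AE x in lborel. g x = 0"
    proof -
      have "AE x in lborel. m0 x - g x = g0 x + T (\<lambda>y. m0 y - g y) x"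
        using m0(2)
      proof eventually_elim
        case (elim x)
        then show ?case using T_diff[OF N0 _ gb, of x] M(1) Tg[of x] by simp
      qed
      moreover have "(\<lambda>x. m0 x - g x) \<in> Linf_weighted (- q)"
        unfolding Linf_weighted_iff using bounded_by_wt_diff[OF N0(2) gb] N0(1) M(1)
        by (intro exI[of _ "N0 + (1 + M)"]) simp
      ultimately have "AE x in lborel. m0 x - g x = m0 x"
        by (intro un) (simp add: solves_jost_eq_def)
      then show ?thesis by eventually_elim simp
    qed
    obtain n where n: "bounded_by_wt (1/2) (\<lambda>x. h (k n) x - g x)" using close[of "1/2"] by auto
    have "bounded_by_wt (1/2) (h (k n))"
      using n bounded_by_wt_measurable[OF h(1)]
      by (rule bounded_by_wt_cong_AE) (use gz in \<open>eventually_elim, simp\<close>)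
    then show False using h(2) by blast
  qed
  then show ?thesis using that unfolding A_def by blast
qed

end

section \<open>The positive half line lies in the spectrum\<close>

lemma borel_measurable_cis [measurable]: "cis \<in> borel_measurable borel"
  unfolding cis_conv_exp [abs_def] by measurable

lemma L2_measurable: "f \<in> L2 \<Longrightarrow> f \<in> borel_measurable borel"
  by (simp add: L2_def)

lemma L2_integrable: "f \<in> L2 \<Longrightarrow> integrable lborel (\<lambda>x. (cmod (f x))\<^sup>2)"
  by (simp add: L2_def)

lemma mult_le_sum_squares: "a * b \<le> a\<^sup>2 + (b::real)\<^sup>2"
  using sum_squares_bound[of a b] zero_le_power2[of a] zero_le_power2[of b] by linarith

text \<open>Young's inequality with a free weight t, which takes the place of Cauchy-Schwarz
  below.\<close>

lemma mult_le_scaled_squares: 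
  assumes "t > 0" shows "a * b \<le> t * a\<^sup>2 + b\<^sup>2 / (t::real)"
proof -
  have "a * b = (sqrt t * a) * (b / sqrt t)" using assms by simp
  also have "\<dots> \<le> (sqrt t * a)\<^sup>2 + (b / sqrt t)\<^sup>2" by (rule mult_le_sum_squares)
  also have "\<dots> = t * a\<^sup>2 + b\<^sup>2 / t" using assms by (simp add: power_mult_distrib power_divide)
  finally show ?thesis .
qed

lemma L2_mult_integrable:
  assumes "f \<in> L2" "g \<in> L2"
  shows "integrable lborel (\<lambda>x. f x * g x)"
proof (rule Bochner_Integration.integrable_bound)
  show "integrable lborel (\<lambda>x. (cmod (f x))\<^sup>2 + (cmod (g x))\<^sup>2)"
    using assms by (intro Bochner_Integration.integrable_add L2_integrable)
  show "(\<lambda>x. f x * g x) \<in> borel_measurable lborel"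
    using assms[THEN L2_measurable] by measurable
  show "AE x in lborel. norm (f x * g x) \<le> norm ((cmod (f x))\<^sup>2 + (cmod (g x))\<^sup>2)"
    by (auto simp: norm_mult intro!: mult_le_sum_squares)
qed

lemma L2_set_integrable:
  assumes "f \<in> L2"
  shows "set_integrable lborel {-N..N} f"
proof -
  have 1: "set_integrable lborel {-N..N} (\<lambda>x. 1 + (cmod (f x))\<^sup>2)"
  proof (rule set_integral_add)
    show "set_integrable lborel {-N..N} (\<lambda>x. 1::real)"
      by (intro borel_integrable_atLeastAtMost' continuous_intros)
    have "set_integrable lborel UNIV (\<lambda>x. (cmod (f x))\<^sup>2)" 
      using L2_integrable[OF assms] by (simp add: set_integrable_def)
    then show "set_integrable lborel {-N..N} (\<lambda>x. (cmod (f x))\<^sup>2)"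
      by (rule set_integrable_subset) auto
  qed
  show ?thesis
  proof (rule set_integrable_bound[OF 1])
    show "set_borel_measurable lborel {-N..N} f"
      unfolding set_borel_measurable_def using L2_measurable[OF assms] by measurable
    have "cmod (f x) \<le> 1 + (cmod (f x))\<^sup>2" for x
      using mult_le_sum_squares[of 1 "cmod (f x)"] by simp
    then show "AE x in lborel. x \<in> {-N..N} \<longrightarrow> norm (f x) \<le> norm (1 + (cmod (f x))\<^sup>2)"
      by (auto intro: order_trans[OF _ abs_ge_self])
  qed
qed

section \<open>The truncated Fourier transform and Parseval's formula\<close>

definition trunc_fourier :: "(real \<Rightarrow> complex) \<Rightarrow> real \<Rightarrow> real \<Rightarrow> complex" where
  "trunc_fourier f N \<xi> = of_real (1 / sqrt (2 * pi)) * (LBINT x:{-N..N}. f x * cis (- (x * \<xi>)))"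

lemma trunc_fourier_measurable:
  assumes [measurable]: "f \<in> borel_measurable borel"
  shows "trunc_fourier f N \<in> borel_measurable borel"
  unfolding trunc_fourier_def [abs_def] set_lebesgue_integral_def by measurable

lemma has_fourierD:
  assumes "has_fourier f F"
  shows "f \<in> L2" "F \<in> L2"
    "((\<lambda>N. \<integral>\<^sup>+ \<xi>. ennreal ((cmod (F \<xi> - trunc_fourier f N \<xi>))\<^sup>2) \<partial>lborel) \<longlongrightarrow> 0) at_top"
  using assms by (auto simp: has_fourier_def trunc_fourier_def)

text \<open>Truncation to [-N, N] makes f integrable, so Fubini applies to f(x) g(\<xi>)
  e^(-ix\<xi>) although f is only in L^2.\<close>

lemma trunc_fourier_Fubini:
  assumes f: "f \<in> L2" and g: "integrable lborel g"
  shows "integrable lborel (\<lambda>\<xi>. trunc_fourier f N \<xi> * g \<xi>)"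
    and "(LINT \<xi>|lborel. trunc_fourier f N \<xi> * g \<xi>) =
      of_real (1 / sqrt (2 * pi)) * (LBINT x:{-N..N}. f x * (LINT \<xi>|lborel. g \<xi> * cis (- (x * \<xi>))))"
proof -
  have [measurable]: "f \<in> borel_measurable borel" by (rule L2_measurable[OF f])
  have [measurable]: "g \<in> borel_measurable borel" using borel_measurable_integrable[OF g] by simp
  define k where "k x \<xi> = indicator {-N..N} x *\<^sub>R (f x * (g \<xi> * cis (- (x * \<xi>))))" for x \<xi>
  have if1: "integrable lborel (\<lambda>x. indicator {-N..N} x *\<^sub>R f x)"
    using L2_set_integrable[OF f, of N] by (simp add: set_integrable_def)
  have gi: "integrable lborel (\<lambda>\<xi>. g \<xi> * cis (- (x * \<xi>)))" for x
    by (rule Bochner_Integration.integrable_bound[OF g]) (auto simp: norm_mult)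
  have km: "case_prod k \<in> borel_measurable (lborel \<Otimes>\<^sub>M lborel)"
    unfolding k_def by measurable
  have int: "integrable (lborel \<Otimes>\<^sub>M lborel) (case_prod k)"
  proof (rule lborel_pair.Fubini_integrable[OF km])
    have "(\<lambda>x. LINT \<xi>|lborel. norm (case_prod k (x, \<xi>))) =
      (\<lambda>x. norm (indicator {-N..N} x *\<^sub>R f x) * (LINT \<xi>|lborel. norm (g \<xi>)))"
      by (auto simp: k_def norm_mult mult.assoc fun_eq_iff)
    then show "integrable lborel (\<lambda>x. LINT \<xi>|lborel. norm (case_prod k (x, \<xi>)))"
      using if1 by (simp only: integrable_mult_left integrable_norm)
    show "AE x in lborel. integrable lborel (\<lambda>\<xi>. case_prod k (x, \<xi>))"
    proof (rule AE_I2)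
      fix x
      have "integrable lborel (\<lambda>\<xi>. (indicator {-N..N} x *\<^sub>R f x) * (g \<xi> * cis (- (x * \<xi>))))"
        by (intro integrable_mult_right gi)
      then show "integrable lborel (\<lambda>\<xi>. case_prod k (x, \<xi>))" by (simp add: k_def)
    qed
  qed
  have e1: "(LINT x|lborel. k x \<xi>) = (LBINT x:{-N..N}. f x * cis (- (x * \<xi>))) * g \<xi>" for \<xi>
  proof -
    have "(LINT x|lborel. k x \<xi>) = (LINT x|lborel. (indicator {-N..N} x *\<^sub>R (f x * cis (- (x * \<xi>)))) * g \<xi>)"
      by (simp add: k_def mult_ac)
    also have "\<dots> = (LBINT x:{-N..N}. f x * cis (- (x * \<xi>))) * g \<xi>"
      unfolding set_lebesgue_integral_def by (rule integral_mult_left_zero)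
    finally show ?thesis .
  qed
  have e2: "(LINT \<xi>|lborel. k x \<xi>) = indicator {-N..N} x *\<^sub>R (f x * (LINT \<xi>|lborel. g \<xi> * cis (- (x * \<xi>))))" for x
  proof -
    have "(LINT \<xi>|lborel. k x \<xi>) = (LINT \<xi>|lborel. (indicator {-N..N} x *\<^sub>R f x) * (g \<xi> * cis (- (x * \<xi>))))"
      by (simp add: k_def)
    also have "\<dots> = (indicator {-N..N} x *\<^sub>R f x) * (LINT \<xi>|lborel. g \<xi> * cis (- (x * \<xi>)))"
      by (rule integral_mult_right_zero)
    finally show ?thesis by simp
  qed
  have "integrable lborel (\<lambda>\<xi>. LINT x|lborel. k x \<xi>)"
    using lborel_pair.integrable_snd[OF int] by simp
  then have "integrable lborel (\<lambda>\<xi>. of_real (1 / sqrt (2 * pi)) * ((LBINT x:{-N..N}. f x * cis (- (x * \<xi>))) * g \<xi>))"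
    unfolding e1 by (rule integrable_mult_right)
  then show "integrable lborel (\<lambda>\<xi>. trunc_fourier f N \<xi> * g \<xi>)"
    by (simp add: trunc_fourier_def mult.assoc)
  have "(LINT \<xi>|lborel. trunc_fourier f N \<xi> * g \<xi>) = (LINT \<xi>|lborel. of_real (1 / sqrt (2 * pi)) * (LINT x|lborel. k x \<xi>))"
    unfolding e1 by (simp add: trunc_fourier_def mult.assoc)
  also have "\<dots> = of_real (1 / sqrt (2 * pi)) * (LINT \<xi>|lborel. (LINT x|lborel. k x \<xi>))"
    by (rule integral_mult_right_zero)
  also have "(LINT \<xi>|lborel. (LINT x|lborel. k x \<xi>)) = (LINT x|lborel. (LINT \<xi>|lborel. k x \<xi>))"
    using lborel_pair.Fubini_integral[OF int] by simp
  finally show "(LINT \<xi>|lborel. trunc_fourier f N \<xi> * g \<xi>) =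
      of_real (1 / sqrt (2 * pi)) * (LBINT x:{-N..N}. f x * (LINT \<xi>|lborel. g \<xi> * cis (- (x * \<xi>))))"
    unfolding e2 set_lebesgue_integral_def .
qed

text \<open>The bilinear multiplication formula, without conjugation: the transform is moved from f
  to g. It holds for each truncation by Fubini; N is sent to infinity by L^2 convergence on the side
  of F and by dominated convergence on the other side.\<close>

lemma fourier_parseval:
  assumes F: "has_fourier f F" and g: "integrable lborel g" "g \<in> L2"
    and fg: "integrable lborel (\<lambda>x. f x * (LINT \<xi>|lborel. g \<xi> * cis (- (x * \<xi>))))"
  shows "(LINT x|lborel. f x * (LINT \<xi>|lborel. g \<xi> * cis (- (x * \<xi>)))) =
    of_real (sqrt (2 * pi)) * (LINT \<xi>|lborel. F \<xi> * g \<xi>)"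
proof -
  note fF = has_fourierD[OF F]
  have [measurable]: "f \<in> borel_measurable borel" "F \<in> borel_measurable borel" "g \<in> borel_measurable borel"
    using fF g by (auto intro: L2_measurable)
  have [measurable]: "trunc_fourier f N \<in> borel_measurable borel" for N by (rule trunc_fourier_measurable) measurable
  define E where "E N = (\<integral>\<^sup>+ \<xi>. ennreal ((cmod (F \<xi> - trunc_fourier f N \<xi>))\<^sup>2) \<partial>lborel)" for N
  have Elim: "(E \<longlongrightarrow> 0) at_top" using fF(3) unfolding E_def .
  define g2 where "g2 = (LINT \<xi>|lborel. (cmod (g \<xi>))\<^sup>2)"
  have Fg: "integrable lborel (\<lambda>\<xi>. F \<xi> * g \<xi>)" by (rule L2_mult_integrable[OF fF(2) g(2)])
  have "((\<lambda>N. LINT \<xi>|lborel. trunc_fourier f N \<xi> * g \<xi>) \<longlongrightarrow> (LINT \<xi>|lborel. F \<xi> * g \<xi>)) at_top"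
  proof (rule tendstoI)
    fix e :: real assume e: "e > 0"
    \<comment> \<open>With this weight in Young's inequality the g-term stays below e/2, and once E
      N < t e/4 the other term is below e/4.\<close>
    define t where "t = e / (2 * (g2 + 1))"
    have g2: "0 \<le> g2" unfolding g2_def by (rule integral_nonneg_AE) auto
    have pos: "0 < 2 * (g2 + 1)" using g2 by (intro mult_pos_pos add_nonneg_pos) auto
    have t: "t > 0" unfolding t_def using e pos by (rule divide_pos_pos)
    have "t * (2 * (g2 + 1)) = e" unfolding t_def using pos by simp
    then have "t * g2 < e / 2" using t by (simp add: algebra_simps)
    have "\<forall>\<^sub>F N in at_top. E N < ennreal (t * e / 4)"
      using Elim e t by (intro order_tendstoD) (auto simp: ennreal_zero_less_mult_iff)
    then show "\<forall>\<^sub>F N in at_top. dist (LINT \<xi>|lborel. trunc_fourier f N \<xi> * g \<xi>) (LINT \<xi>|lborel. F \<xi> * g \<xi>) < e"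
    proof eventually_elim
      case (elim N)
      let ?d = "\<lambda>\<xi>. cmod (F \<xi> - trunc_fourier f N \<xi>)"
      have fin: "E N < \<infinity>" using elim by (rule order_less_trans) simp
      have i: "integrable lborel (\<lambda>\<xi>. (?d \<xi>)\<^sup>2)"
        using fin by (intro integrableI_bounded) (auto simp: E_def)
      have El: "(LINT \<xi>|lborel. (?d \<xi>)\<^sup>2) < t * e / 4"
      proof -
        have "ennreal (LINT \<xi>|lborel. (?d \<xi>)\<^sup>2) = E N"
          unfolding E_def by (rule nn_integral_eq_integral[OF i, symmetric]) auto
        then have "ennreal (LINT \<xi>|lborel. (?d \<xi>)\<^sup>2) < ennreal (t * e / 4)" using elim by simp
        moreover have "0 \<le> (LINT \<xi>|lborel. (?d \<xi>)\<^sup>2)" by (rule integral_nonneg_AE) auto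
        ultimately show ?thesis by (simp only: ennreal_less_iff)
      qed
      have "dist (LINT \<xi>|lborel. trunc_fourier f N \<xi> * g \<xi>) (LINT \<xi>|lborel. F \<xi> * g \<xi>)
        = cmod (LINT \<xi>|lborel. trunc_fourier f N \<xi> * g \<xi> - F \<xi> * g \<xi>)"
        unfolding dist_norm by (subst Bochner_Integration.integral_diff[OF trunc_fourier_Fubini(1)[OF fF(1) g(1)] Fg]) simp
      also have "\<dots> \<le> (LINT \<xi>|lborel. t * (cmod (g \<xi>))\<^sup>2 + (?d \<xi>)\<^sup>2 / t)"
      proof (rule norm_integral_le_dominated)
        show "integrable lborel (\<lambda>\<xi>. t * (cmod (g \<xi>))\<^sup>2 + (?d \<xi>)\<^sup>2 / t)"
          using i L2_integrable[OF g(2)] by simp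
        show "AE \<xi> in lborel. cmod (trunc_fourier f N \<xi> * g \<xi> - F \<xi> * g \<xi>) \<le> t * (cmod (g \<xi>))\<^sup>2 + (?d \<xi>)\<^sup>2 / t"
        proof (rule AE_I2)
          fix \<xi>
          have "cmod (trunc_fourier f N \<xi> * g \<xi> - F \<xi> * g \<xi>) = cmod (g \<xi>) * ?d \<xi>"
          proof -
            have "trunc_fourier f N \<xi> * g \<xi> - F \<xi> * g \<xi> = - (g \<xi> * (F \<xi> - trunc_fourier f N \<xi>))"
              by (simp add: algebra_simps)
            then show ?thesis by (simp only: norm_minus_cancel norm_mult)
          qed
          then show "cmod (trunc_fourier f N \<xi> * g \<xi> - F \<xi> * g \<xi>) \<le> t * (cmod (g \<xi>))\<^sup>2 + (?d \<xi>)\<^sup>2 / t"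
            using mult_le_scaled_squares[OF t] by simp
        qed
      qed
      also have "\<dots> = t * g2 + (LINT \<xi>|lborel. (?d \<xi>)\<^sup>2) / t"
        using i L2_integrable[OF g(2)] by (simp add: g2_def)
      also have "\<dots> < e / 2 + (t * e / 4) / t"
        using El t \<open>t * g2 < e / 2\<close> by (intro add_strict_mono divide_strict_right_mono)
      also have "\<dots> < e" using t e by simp
      finally show ?case .
    qed
  qed
  then have l1: "((\<lambda>N. of_real (1 / sqrt (2 * pi)) * (LBINT x:{-N..N}. f x * (LINT \<xi>|lborel. g \<xi> * cis (- (x * \<xi>)))))
     \<longlongrightarrow> (LINT \<xi>|lborel. F \<xi> * g \<xi>)) at_top"
    unfolding trunc_fourier_Fubini(2)[OF fF(1) g(1)] .
  have "((\<lambda>N. LBINT x:{-N..N}. f x * (LINT \<xi>|lborel. g \<xi> * cis (- (x * \<xi>))))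
     \<longlongrightarrow> (LINT x|lborel. f x * (LINT \<xi>|lborel. g \<xi> * cis (- (x * \<xi>))))) at_top"
    unfolding set_lebesgue_integral_def
  proof (rule integral_dominated_convergence_at_top[OF _ _ integrable_norm[OF fg]])
    show "AE x in lborel. ((\<lambda>N. indicator {-N..N} x *\<^sub>R (f x * (LINT \<xi>|lborel. g \<xi> * cis (- (x * \<xi>)))))
       \<longlongrightarrow> f x * (LINT \<xi>|lborel. g \<xi> * cis (- (x * \<xi>)))) at_top"
    proof (rule AE_I2)
      fix x
      have "\<forall>\<^sub>F N in at_top. f x * (LINT \<xi>|lborel. g \<xi> * cis (- (x * \<xi>))) =
         indicator {-N..N} x *\<^sub>R (f x * (LINT \<xi>|lborel. g \<xi> * cis (- (x * \<xi>))))"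
        using eventually_ge_at_top[of "\<bar>x\<bar>"] by eventually_elim (auto simp: indicator_def)
      then show "((\<lambda>N. indicator {-N..N} x *\<^sub>R (f x * (LINT \<xi>|lborel. g \<xi> * cis (- (x * \<xi>)))))
       \<longlongrightarrow> f x * (LINT \<xi>|lborel. g \<xi> * cis (- (x * \<xi>)))) at_top"
        by (rule Lim_transform_eventually[OF tendsto_const])
    qed
    show "\<forall>\<^sub>F N in at_top. AE x in lborel. norm (indicator {-N..N} x *\<^sub>R (f x * (LINT \<xi>|lborel. g \<xi> * cis (- (x * \<xi>)))))
       \<le> norm (f x * (LINT \<xi>|lborel. g \<xi> * cis (- (x * \<xi>))))"
      by (intro always_eventually allI AE_I2) (simp add: indicator_def)
  qed measurable
  then have "((\<lambda>N. of_real (1 / sqrt (2 * pi)) * (LBINT x:{-N..N}. f x * (LINT \<xi>|lborel. g \<xi> * cis (- (x * \<xi>)))))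
     \<longlongrightarrow> of_real (1 / sqrt (2 * pi)) * (LINT x|lborel. f x * (LINT \<xi>|lborel. g \<xi> * cis (- (x * \<xi>))))) at_top"
    by (intro tendsto_intros)
  from tendsto_unique[OF trivial_limit_at_top_linorder this l1]
  have "of_real (1 / sqrt (2 * pi)) * (LINT x|lborel. f x * (LINT \<xi>|lborel. g \<xi> * cis (- (x * \<xi>)))) = (LINT \<xi>|lborel. F \<xi> * g \<xi>)" .
  then show ?thesis by (simp add: field_simps)
qed

text \<open>For integrable f the truncated transforms converge pointwise to the usual integral, and
  Fatou's lemma identifies this limit with the L^2 limit F. It provides a continuous representative
  of the transform.\<close>

lemma fourier_integrable_AE:
  assumes F: "has_fourier f F" and f: "integrable lborel f"
  shows "AE \<xi> in lborel. F \<xi> = of_real (1 / sqrt (2 * pi)) * (LINT x|lborel. f x * cis (- (x * \<xi>)))"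
proof -
  note fF = has_fourierD[OF F]
  have [measurable]: "f \<in> borel_measurable borel" "F \<in> borel_measurable borel"
    using fF by (auto intro: L2_measurable)
  have [measurable]: "trunc_fourier f N \<in> borel_measurable borel" for N by (rule trunc_fourier_measurable) measurable
  define h where "h \<xi> = of_real (1 / sqrt (2 * pi)) * (LINT x|lborel. f x * cis (- (x * \<xi>)))" for \<xi>
  have [measurable]: "h \<in> borel_measurable borel" unfolding h_def [abs_def] by measurable
  have lim: "(\<lambda>n. trunc_fourier f (real n) \<xi>) \<longlonglongrightarrow> h \<xi>" for \<xi>
    unfolding trunc_fourier_def h_def set_lebesgue_integral_def
  proof (intro tendsto_mult tendsto_const integral_dominated_convergence[OF _ _ integrable_norm[OF f]])
    show "AE x in lborel. (\<lambda>n. indicator {- real n..real n} x *\<^sub>R (f x * cis (- (x * \<xi>)))) \<longlonglongrightarrow> f x * cis (- (x * \<xi>))"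
    proof (rule AE_I2)
      fix x
      have "\<forall>\<^sub>F n in sequentially. f x * cis (- (x * \<xi>)) = indicator {- real n..real n} x *\<^sub>R (f x * cis (- (x * \<xi>)))"
        using eventually_ge_at_top[of "nat \<lceil>\<bar>x\<bar>\<rceil>"] by eventually_elim (auto simp: indicator_def abs_le_iff nat_le_iff ceiling_le_iff)
      then show "(\<lambda>n. indicator {- real n..real n} x *\<^sub>R (f x * cis (- (x * \<xi>)))) \<longlonglongrightarrow> f x * cis (- (x * \<xi>))"
        by (rule Lim_transform_eventually[OF tendsto_const])
    qed
    show "AE x in lborel. norm (indicator {- real n..real n} x *\<^sub>R (f x * cis (- (x * \<xi>)))) \<le> norm (f x)" for n
      by (intro AE_I2) (simp add: indicator_def norm_mult)
  qed measurable
  have "(\<integral>\<^sup>+ \<xi>. ennreal ((cmod (F \<xi> - h \<xi>))\<^sup>2) \<partial>lborel)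
      = (\<integral>\<^sup>+ \<xi>. liminf (\<lambda>n. ennreal ((cmod (F \<xi> - trunc_fourier f (real n) \<xi>))\<^sup>2)) \<partial>lborel)"
  proof (rule nn_integral_cong)
    fix \<xi>
    have "(\<lambda>n. ennreal ((cmod (F \<xi> - trunc_fourier f (real n) \<xi>))\<^sup>2)) \<longlonglongrightarrow> ennreal ((cmod (F \<xi> - h \<xi>))\<^sup>2)"
      by (intro tendsto_ennrealI tendsto_intros lim)
    then show "ennreal ((cmod (F \<xi> - h \<xi>))\<^sup>2) = liminf (\<lambda>n. ennreal ((cmod (F \<xi> - trunc_fourier f (real n) \<xi>))\<^sup>2))"
      by (rule lim_imp_Liminf[OF sequentially_bot, symmetric])
  qed
  also have "\<dots> \<le> liminf (\<lambda>n. \<integral>\<^sup>+ \<xi>. ennreal ((cmod (F \<xi> - trunc_fourier f (real n) \<xi>))\<^sup>2) \<partial>lborel)"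
    by (rule nn_integral_liminf) measurable
  also have "\<dots> = 0"
    by (rule lim_imp_Liminf[OF sequentially_bot filterlim_compose[OF fF(3) filterlim_real_sequentially]])
  finally have "(\<integral>\<^sup>+ \<xi>. ennreal ((cmod (F \<xi> - h \<xi>))\<^sup>2) \<partial>lborel) = 0" by simp
  then have "AE \<xi> in lborel. ennreal ((cmod (F \<xi> - h \<xi>))\<^sup>2) = 0"
    by (subst (asm) nn_integral_0_iff_AE) measurable
  then show ?thesis unfolding h_def by eventually_elim simp
qed

section \<open>The Hardy function whose transform is an indicator\<close>

definition sine_tail :: "real \<Rightarrow> real" where
  "sine_tail y = Si \<bar>y\<bar> - pi / 2"

text \<open>Si t + (cos t - 1)/t is nondecreasing and Si t + (cos t + 1)/t is nonincreasing, both
  with limit pi/2; this brackets Si y within 2/y.\<close>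

lemma sine_tail_le:
  assumes "y > 0" shows "\<bar>Si y - pi / 2\<bar> \<le> 2 / y"
proof -
  let ?h = "\<lambda>\<sigma> t. Si t + cos t / t + \<sigma> / t"
  have der: "((\<lambda>t. ?h \<sigma> t) has_real_derivative (- (cos t + \<sigma>) / t\<^sup>2)) (at t)" if "t > 0" for t \<sigma>
    using that by (auto intro!: derivative_eq_intros DERIV_Si simp: power2_eq_square field_simps)
  have cossmall: "((\<lambda>t::real. cos t / t) \<longlongrightarrow> 0) at_top"
  proof (rule Lim_null_comparison)
    show "\<forall>\<^sub>F x in at_top. norm (cos x / x) \<le> 1 / (x::real)"
      using eventually_gt_at_top[of "0::real"] by eventually_elim (simp add: divide_right_mono)
    show "((\<lambda>x::real. 1 / x) \<longlongrightarrow> 0) at_top" by real_asymp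
  qed
  have lim: "((\<lambda>t. ?h \<sigma> t) \<longlongrightarrow> pi / 2) at_top" for \<sigma>
  proof -
    have "((\<lambda>t::real. \<sigma> / t) \<longlongrightarrow> 0) at_top" by real_asymp
    then have "((\<lambda>t. ?h \<sigma> t) \<longlongrightarrow> pi / 2 + 0 + 0) at_top"
      by (intro tendsto_add Si_at_top cossmall)
    then show ?thesis by simp
  qed
  have up: "?h (-1) y \<le> pi / 2"
  proof (rule tendsto_lowerbound[OF lim[of "-1"]])
    show "\<forall>\<^sub>F t in at_top. ?h (-1) y \<le> ?h (-1) t"
      using eventually_ge_at_top[of y]
    proof eventually_elim
      case (elim t)
      show ?case
      proof (rule DERIV_nonneg_imp_nondecreasing[OF elim])
        fix x assume "y \<le> x" "x \<le> t"
        then show "\<exists>y. ((\<lambda>t. ?h (-1) t) has_real_derivative y) (at x) \<and> 0 \<le> y"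
          using der[of x "-1"] assms by (intro exI conjI) auto
      qed
    qed
  qed simp
  have lo: "pi / 2 \<le> ?h 1 y"
  proof (rule tendsto_upperbound[OF lim[of 1]])
    show "\<forall>\<^sub>F t in at_top. ?h 1 t \<le> ?h 1 y"
      using eventually_ge_at_top[of y]
    proof eventually_elim
      case (elim t)
      show ?case
      proof (rule DERIV_nonpos_imp_nonincreasing[OF elim])
        fix x assume "y \<le> x" "x \<le> t"
        moreover have "- 1 \<le> cos x" by simp
        ultimately show "\<exists>y. ((\<lambda>t. ?h 1 t) has_real_derivative y) (at x) \<and> y \<le> 0"
          using der[of x 1] assms by (intro exI conjI) (auto intro!: divide_nonpos_nonneg)
      qed
    qed
  qed simp
  define r where "r = 1 / y"
  define d where "d = cos y / y"
  have "\<bar>d\<bar> \<le> r" using assms by (simp add: d_def r_def divide_right_mono)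
  moreover have "Si y + d - r \<le> pi / 2" "pi / 2 \<le> Si y + d + r"
    using up lo by (simp_all add: d_def r_def)
  ultimately have "\<bar>Si y - pi / 2\<bar> \<le> 2 * r" unfolding abs_le_iff by linarith
  then show ?thesis by (simp add: r_def)
qed

lemma sine_tail_square_le:
  obtains B where "0 \<le> B" "\<And>y. (sine_tail y)\<^sup>2 \<le> B * wt y powr (- 2)"
proof -
  obtain A where A: "\<And>T. \<bar>Si T\<bar> \<le> A" using bounded_Si by blast
  define B where "B = (max (2 * (A + 2)) 4)\<^sup>2"
  have "(sine_tail y)\<^sup>2 \<le> B * wt y powr (- 2)" for y
  proof -
    have w: "wt y powr (- 2) = 1 / (wt y)\<^sup>2" by (simp add: powr_minus_divide)
    have "\<bar>sine_tail y\<bar> * wt y \<le> max (2 * (A + 2)) 4"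
    proof (cases "\<bar>y\<bar> \<le> 1")
      case True
      have "\<bar>sine_tail y\<bar> \<le> A + 2" using A[of "\<bar>y\<bar>"] pi_less_4 pi_gt_zero unfolding sine_tail_def abs_le_iff by linarith
      moreover have "wt y \<le> 2" using True by (simp add: wt_def)
      ultimately have "\<bar>sine_tail y\<bar> * wt y \<le> (A + 2) * 2" by (intro mult_mono) auto
      then show ?thesis by simp
    next
      case False
      have "\<bar>sine_tail y\<bar> \<le> 2 / \<bar>y\<bar>" using sine_tail_le[of "\<bar>y\<bar>"] False by (simp add: sine_tail_def)
      moreover have "wt y \<le> 2 * \<bar>y\<bar>" using False by (simp add: wt_def)
      ultimately have "\<bar>sine_tail y\<bar> * wt y \<le> (2 / \<bar>y\<bar>) * (2 * \<bar>y\<bar>)" by (intro mult_mono) auto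
      also have "\<dots> = 4" using False by simp
      finally show ?thesis by simp
    qed
    then have "(\<bar>sine_tail y\<bar> * wt y)\<^sup>2 \<le> (max (2 * (A + 2)) 4)\<^sup>2" by (intro power_mono) auto
    also have "\<dots> = B" by (simp only: B_def)
    finally have "(sine_tail y)\<^sup>2 * (wt y)\<^sup>2 \<le> B" by (simp add: power_mult_distrib)
    then show ?thesis by (simp add: w pos_le_divide_eq)
  qed
  moreover have "0 \<le> B" by (simp add: B_def)
  ultimately show ?thesis using that by blast
qed

text \<open>Adding the values at x and -x turns the integrand into 2 sin(ax)/x.\<close>

lemma cis_primitive_integral:
  assumes N: "0 \<le> N" and a: "a \<noteq> 0"
  shows "set_integrable lborel {-N..N} (\<lambda>x. (cis (a * x) - 1) / (\<i> * of_real x))"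
    and "(LBINT x:{-N..N}. (cis (a * x) - 1) / (\<i> * of_real x)) = of_real (sgn a * (2 * Si (N * \<bar>a\<bar>)))"
proof -
  let ?g = "\<lambda>x. (cis (a * x) - 1) / (\<i> * complex_of_real x)"
  have geq: "?g x = (1 / \<i>) * ((cis (a * x) - 1) / of_real x)" for x
    by (simp only: times_divide_times_eq mult_1_left)
  have int: "set_integrable lborel {c..d} ?g" for c d
    unfolding geq by (rule set_integrable_mult_right[OF set_integrable_cis_quotient])
  show "set_integrable lborel {-N..N} ?g" by (rule int)
  have "(LBINT x:{-N..N}. ?g x) = (LBINT x:{-N..0}. ?g x) + (LBINT x:{0..N}. ?g x)"
    using N by (intro set_integral_Icc_split(2) int) auto
  also have "(LBINT x:{-N..0}. ?g x) = (LBINT x:{0..N}. ?g (- x))"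
  proof -
    have "indicator {-N..0} (-x) = (indicator {0..N} x :: real)" for x by (auto simp: indicator_def)
    then show ?thesis
      using lborel_integral_real_affine[of "-1" "\<lambda>x. indicator {-N..0} x *\<^sub>R ?g x" 0]
      by (simp add: set_lebesgue_integral_def)
  qed
  also have "(LBINT x:{0..N}. ?g (- x)) + (LBINT x:{0..N}. ?g x) = (LBINT x:{0..N}. ?g (- x) + ?g x)"
  proof (rule set_integral_add(2)[symmetric])
    have "?g (- x) = (-1 / \<i>) * ((cis (- a * x) - 1) / of_real x)" for x
      by (simp only: times_divide_times_eq) (simp add: minus_divide_left)
    then have "(\<lambda>x. ?g (- x)) = (\<lambda>x. (-1 / \<i>) * ((cis (- a * x) - 1) / of_real x))" by (rule ext)
    then show "set_integrable lborel {0..N} (\<lambda>x. ?g (- x))"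
      by (simp only: set_integrable_mult_right[OF set_integrable_cis_quotient])
  qed (rule int)
  also have "(\<lambda>x. ?g (- x) + ?g x) = (\<lambda>x. complex_of_real (2 * (sin (x * a) / x)))"
  proof
    fix x :: real
    have "cis (a * x) - cis (- (a * x)) = 2 * \<i> * of_real (sin (x * a))"
      by (simp add: complex_eq_iff mult.commute)
    then show "?g (- x) + ?g x = complex_of_real (2 * (sin (x * a) / x))"
      by (cases "x = 0") (simp_all add: field_simps)
  qed
  also have "(LBINT x:{0..N}. complex_of_real (2 * (sin (x * a) / x))) = of_real (LBINT x:{0..N}. 2 * (sin (x * a) / x))"
    by (rule set_integral_complex_of_real)
  also have "(LBINT x:{0..N}. 2 * (sin (x * a) / x)) = 2 * (LBINT x:{0..N}. sin (x * a) / x)"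
    by (rule set_integral_mult_right)
  also have "(LBINT x:{0..N}. sin (x * a) / x) = sgn a * Si (N * \<bar>a\<bar>)"
    using LBINT_I0c_sin_scale_divide[OF N, of a] N by (simp add: zero_ereal_def interval_integral_Icc)
  finally show "(LBINT x:{-N..N}. ?g x) = of_real (sgn a * (2 * Si (N * \<bar>a\<bar>)))" by simp
qed

text \<open>The inverse Fourier transform of the indicator of (lam, lam + 1). At x = 0 the formula
  evaluates to 0 instead of the limit, which affects only a null set.\<close>

definition band :: "real \<Rightarrow> real \<Rightarrow> complex" where
  "band lam x = of_real (1 / sqrt (2 * pi)) * ((cis ((lam + 1) * x) - cis (lam * x)) / (\<i> * of_real x))"

lemma band_measurable [measurable]: "band lam \<in> borel_measurable borel"
  unfolding band_def [abs_def] by measurable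

lemma band_L2: "band lam \<in> L2"
proof -
  have "cmod (band lam x) * wt x \<le> 2" for x
  proof -
    have p: "1 / sqrt (2 * pi) \<le> 1" using pi_gt3 by simp
    have e: "cmod (band lam x) = 1 / sqrt (2 * pi) * (cmod (cis ((lam + 1) * x) - cis (lam * x)) / \<bar>x\<bar>)"
      by (simp add: band_def norm_mult norm_divide)
    have n1: "cmod (cis ((lam + 1) * x) - cis (lam * x)) \<le> \<bar>x\<bar>"
      using norm_cis_diff_le[of "(lam + 1) * x" "lam * x"] by (simp add: algebra_simps)
    have n2: "cmod (cis ((lam + 1) * x) - cis (lam * x)) \<le> 2"
      using norm_triangle_ineq4[of "cis ((lam + 1) * x)" "cis (lam * x)"] by simp
    show ?thesis
    proof (cases "\<bar>x\<bar> \<le> 1")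
      case True
      have "cmod (cis ((lam + 1) * x) - cis (lam * x)) / \<bar>x\<bar> \<le> 1" using n1 by (cases "x = 0") auto
      then have "cmod (band lam x) \<le> 1 * 1" unfolding e using p by (intro mult_mono) auto
      then have "cmod (band lam x) * wt x \<le> 1 * 2" using True by (intro mult_mono) (auto simp: wt_def)
      then show ?thesis by simp
    next
      case False
      have s2: "sqrt (2 * pi) \<ge> 2" using pi_gt3 by (intro real_le_rsqrt) simp
      have "cmod (band lam x) \<le> (1 / 2) * (2 / \<bar>x\<bar>)" unfolding e using n2 s2
        by (intro mult_mono divide_right_mono divide_left_mono) auto
      then have "cmod (band lam x) * wt x \<le> (1 / 2 * (2 / \<bar>x\<bar>)) * (2 * \<bar>x\<bar>)"
        using False by (intro mult_mono) (auto simp: wt_def)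
      then show ?thesis using False by simp
    qed
  qed
  then have b: "(cmod (band lam x))\<^sup>2 \<le> 4 * wt x powr (- 2)" for x
  proof -
    have "(cmod (band lam x) * wt x)\<^sup>2 \<le> 2\<^sup>2" using \<open>\<And>x. cmod (band lam x) * wt x \<le> 2\<close> by (intro power_mono) auto
    then have "(cmod (band lam x))\<^sup>2 * (wt x)\<^sup>2 \<le> 4" by (simp add: power_mult_distrib)
    then show ?thesis by (simp add: powr_minus_divide pos_le_divide_eq)
  qed
  have "integrable lborel (\<lambda>x. (cmod (band lam x))\<^sup>2)"
  proof (rule Bochner_Integration.integrable_bound)
    show "integrable lborel (\<lambda>x. 4 * wt x powr (- 2))" by (intro integrable_mult_right integrable_wt_powr) simp
    show "AE x in lborel. norm ((cmod (band lam x))\<^sup>2) \<le> norm (4 * wt x powr (- 2))" using b by simp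
  qed measurable
  then show ?thesis by (simp add: L2_def)
qed

lemma trunc_fourier_band:
  assumes N: "0 \<le> N" and \<xi>: "\<xi> \<noteq> lam" "\<xi> \<noteq> lam + 1"
  shows "trunc_fourier (band lam) N \<xi> =
    of_real ((sgn (lam + 1 - \<xi>) * Si (N * \<bar>lam + 1 - \<xi>\<bar>) - sgn (lam - \<xi>) * Si (N * \<bar>lam - \<xi>\<bar>)) / pi)"
proof -
  let ?g = "\<lambda>a x. (cis (a * x) - 1) / (\<i> * complex_of_real x)"
  have "band lam x * cis (- (x * \<xi>)) = of_real (1 / sqrt (2 * pi)) * (?g (lam + 1 - \<xi>) x - ?g (lam - \<xi>) x)" for x
  proof -
    have "(cis ((lam + 1) * x) - cis (lam * x)) * cis (- (x * \<xi>)) = (cis ((lam + 1 - \<xi>) * x) - 1) - (cis ((lam - \<xi>) * x) - 1)"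
      by (simp add: left_diff_distrib cis_mult) (simp add: algebra_simps)
    then show ?thesis unfolding band_def by (simp add: diff_divide_distrib[symmetric] mult.assoc)
  qed
  then have "(LBINT x:{-N..N}. band lam x * cis (- (x * \<xi>))) =
     of_real (1 / sqrt (2 * pi)) * (LBINT x:{-N..N}. ?g (lam + 1 - \<xi>) x - ?g (lam - \<xi>) x)"
    by (simp only: set_integral_mult_right)
  also have "(LBINT x:{-N..N}. ?g (lam + 1 - \<xi>) x - ?g (lam - \<xi>) x)
    = (LBINT x:{-N..N}. ?g (lam + 1 - \<xi>) x) - (LBINT x:{-N..N}. ?g (lam - \<xi>) x)"
    using N \<xi> by (intro set_integral_diff(2) cis_primitive_integral(1)) auto
  also have "\<dots> = of_real (sgn (lam + 1 - \<xi>) * (2 * Si (N * \<bar>lam + 1 - \<xi>\<bar>))) - of_real (sgn (lam - \<xi>) * (2 * Si (N * \<bar>lam - \<xi>\<bar>)))"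
    using N \<xi> by (subst (1 2) cis_primitive_integral(2)) auto
  finally have "trunc_fourier (band lam) N \<xi> = of_real ((1 / sqrt (2 * pi)) * ((1 / sqrt (2 * pi)) * 
    (sgn (lam + 1 - \<xi>) * (2 * Si (N * \<bar>lam + 1 - \<xi>\<bar>)) - sgn (lam - \<xi>) * (2 * Si (N * \<bar>lam - \<xi>\<bar>)))))"
    unfolding trunc_fourier_def by (simp only: of_real_mult of_real_diff)
  also have "(1 / sqrt (2 * pi)) * ((1 / sqrt (2 * pi)) * 
    (sgn (lam + 1 - \<xi>) * (2 * Si (N * \<bar>lam + 1 - \<xi>\<bar>)) - sgn (lam - \<xi>) * (2 * Si (N * \<bar>lam - \<xi>\<bar>))))
    = (sgn (lam + 1 - \<xi>) * Si (N * \<bar>lam + 1 - \<xi>\<bar>) - sgn (lam - \<xi>) * Si (N * \<bar>lam - \<xi>\<bar>)) / pi"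
  proof -
    have "(1 / sqrt (2 * pi)) * ((1 / sqrt (2 * pi)) * X) = X / (2 * pi)" for X by simp
    then show ?thesis by (simp add: field_simps)
  qed
  finally show ?thesis .
qed

text \<open>Each end c of the band contributes a step, and truncation at N replaces its height pi/2
  by Si(N |c - \<xi>|). The error is a combination of two \<open>sine_tail\<close> terms, whose
  squared L^2 norms scale like 1/N.\<close>

lemma band_fourier: "has_fourier (band lam) (\<lambda>\<xi>. indicator {lam<..<lam+1} \<xi>)"
proof -
  let ?F = "\<lambda>\<xi>. indicator {lam<..<lam+1} \<xi> :: complex"
  have FL2: "?F \<in> L2"
  proof -
    have "(\<lambda>x. (cmod (?F x))\<^sup>2) = (\<lambda>x. indicator {lam<..<lam+1} x)" by (auto simp: indicator_def)
    then show ?thesis by (simp add: L2_def)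
  qed
  obtain B where B: "0 \<le> B" "\<And>y. (sine_tail y)\<^sup>2 \<le> B * wt y powr (- 2)" using sine_tail_square_le by blast
  define W where "W = (LINT y|lborel. wt y powr (- 2))"
  have Wi: "integrable lborel (\<lambda>y. wt y powr (- 2))" by (rule integrable_wt_powr) simp
  \<comment> \<open>The substitution y = N (c - \<xi>) yields the factor 1/N.\<close>
  have scaled: "(\<integral>\<^sup>+ \<xi>. ennreal (wt (N * (c - \<xi>)) powr (- 2)) \<partial>lborel) = ennreal (W / N)" if "N > 0" for N c
  proof -
    have "(\<integral>\<^sup>+ y. ennreal (wt y powr (- 2)) \<partial>lborel) = ennreal \<bar>- N\<bar> * (\<integral>\<^sup>+ \<xi>. ennreal (wt (N * c + (- N) * \<xi>) powr (- 2)) \<partial>lborel)"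
      using that by (intro nn_integral_real_affine) auto
    moreover have "(\<integral>\<^sup>+ y. ennreal (wt y powr (- 2)) \<partial>lborel) = ennreal W"
      unfolding W_def by (rule nn_integral_eq_integral[OF Wi]) auto
    moreover have "N * c + (- N) * \<xi> = N * (c - \<xi>)" for \<xi> by (simp add: algebra_simps)
    ultimately have e: "ennreal W = ennreal N * (\<integral>\<^sup>+ \<xi>. ennreal (wt (N * (c - \<xi>)) powr (- 2)) \<partial>lborel)"
      using that by simp
    have "ennreal (W / N) = ennreal (1 / N) * ennreal W" using that by (simp add: ennreal_mult'[symmetric])
    also have "\<dots> = (ennreal (1 / N) * ennreal N) * (\<integral>\<^sup>+ \<xi>. ennreal (wt (N * (c - \<xi>)) powr (- 2)) \<partial>lborel)"
      unfolding e by (simp add: mult.assoc)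
    also have "ennreal (1 / N) * ennreal N = 1" using that by (simp add: ennreal_mult'[symmetric])
    finally show ?thesis by simp
  qed
  have bound: "(\<integral>\<^sup>+ \<xi>. ennreal ((cmod (?F \<xi> - trunc_fourier (band lam) N \<xi>))\<^sup>2) \<partial>lborel) \<le> ennreal (4 * B * W / N)"
    if N: "N > 0" for N
  proof -
    let ?v = "\<lambda>c \<xi>. wt (N * (c - \<xi>)) powr (- 2)"
    have "AE \<xi> in lborel. ennreal ((cmod (?F \<xi> - trunc_fourier (band lam) N \<xi>))\<^sup>2) \<le> ennreal (2 * B) * (ennreal (?v (lam + 1) \<xi>) + ennreal (?v lam \<xi>))"
      using AE_lborel_singleton[of lam] AE_lborel_singleton[of "lam + 1"]
    proof eventually_elim
      case (elim \<xi>)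
      let ?a = "lam + 1 - \<xi>" and ?b = "lam - \<xi>"
      have F: "?F \<xi> = of_real ((sgn ?a * (pi / 2) - sgn ?b * (pi / 2)) / pi)"
        using elim by (auto simp: indicator_def sgn_real_def field_simps)
      have s: "Si (N * \<bar>c\<bar>) - pi / 2 = sine_tail (N * c)" for c using N by (simp add: sine_tail_def abs_mult)
      have "trunc_fourier (band lam) N \<xi> - ?F \<xi> = of_real ((sgn ?a * sine_tail (N * ?a) - sgn ?b * sine_tail (N * ?b)) / pi)"
        unfolding trunc_fourier_band[OF less_imp_le[OF N] elim] F s[symmetric]
        by (simp add: algebra_simps diff_divide_distrib add_divide_distrib)
      then have "cmod (?F \<xi> - trunc_fourier (band lam) N \<xi>) = \<bar>sgn ?a * sine_tail (N * ?a) - sgn ?b * sine_tail (N * ?b)\<bar> / pi"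
        by (simp only: norm_minus_commute[of "?F \<xi>"] norm_of_real) simp
      also have "\<dots> \<le> (\<bar>sine_tail (N * ?a)\<bar> + \<bar>sine_tail (N * ?b)\<bar>) / 1"
        using pi_gt3 by (intro frac_le order_trans[OF abs_triangle_ineq4] add_mono) (auto simp: abs_mult sgn_real_def)
      finally have "(cmod (?F \<xi> - trunc_fourier (band lam) N \<xi>))\<^sup>2 \<le> (\<bar>sine_tail (N * ?a)\<bar> + \<bar>sine_tail (N * ?b)\<bar>)\<^sup>2"
        by (intro power_mono) auto
      also have "\<dots> \<le> 2 * ((sine_tail (N * ?a))\<^sup>2 + (sine_tail (N * ?b))\<^sup>2)"
        using sum_squares_bound[of "\<bar>sine_tail (N * ?a)\<bar>" "\<bar>sine_tail (N * ?b)\<bar>"] by (simp add: power2_sum)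
      also have "\<dots> \<le> 2 * (B * ?v (lam + 1) \<xi> + B * ?v lam \<xi>)"
        by (intro mult_left_mono add_mono B) auto
      finally have "(cmod (?F \<xi> - trunc_fourier (band lam) N \<xi>))\<^sup>2 \<le> (2 * B) * (?v (lam + 1) \<xi> + ?v lam \<xi>)"
        by (simp add: algebra_simps)
      then show ?case using B(1) by (simp add: ennreal_mult'[symmetric] ennreal_plus[symmetric] ennreal_leI del: ennreal_plus)
    qed
    then have "(\<integral>\<^sup>+ \<xi>. ennreal ((cmod (?F \<xi> - trunc_fourier (band lam) N \<xi>))\<^sup>2) \<partial>lborel)
      \<le> (\<integral>\<^sup>+ \<xi>. ennreal (2 * B) * (ennreal (?v (lam + 1) \<xi>) + ennreal (?v lam \<xi>)) \<partial>lborel)"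
      by (rule nn_integral_mono_AE)
    also have "\<dots> = ennreal (2 * B) * ((\<integral>\<^sup>+ \<xi>. ennreal (?v (lam + 1) \<xi>) \<partial>lborel) + (\<integral>\<^sup>+ \<xi>. ennreal (?v lam \<xi>) \<partial>lborel))"
      by (simp add: nn_integral_cmult nn_integral_add)
    also have "\<dots> = ennreal (4 * B * W / N)"
    proof -
      have "0 \<le> W" unfolding W_def by (rule integral_nonneg_AE) auto
      then show ?thesis unfolding scaled[OF N] using N B(1)
        by (simp add: ennreal_plus[symmetric] ennreal_mult'[symmetric] del: ennreal_plus)
    qed
    finally show ?thesis .
  qed
  have "((\<lambda>N. \<integral>\<^sup>+ \<xi>. ennreal ((cmod (?F \<xi> - trunc_fourier (band lam) N \<xi>))\<^sup>2) \<partial>lborel) \<longlongrightarrow> 0) at_top"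
  proof (rule tendsto_sandwich[OF _ _ tendsto_const])
    have "((\<lambda>N. 4 * B * W / N) \<longlongrightarrow> 0) at_top" by real_asymp
    then show "((\<lambda>N. ennreal (4 * B * W / N)) \<longlongrightarrow> 0) at_top" by (metis tendsto_ennrealI ennreal_0)
    show "\<forall>\<^sub>F N in at_top. (\<integral>\<^sup>+ \<xi>. ennreal ((cmod (?F \<xi> - trunc_fourier (band lam) N \<xi>))\<^sup>2) \<partial>lborel) \<le> ennreal (4 * B * W / N)"
      using eventually_gt_at_top[of 0] by eventually_elim (rule bound)
  qed auto
  then show ?thesis using band_L2 FL2 by (simp add: has_fourier_def trunc_fourier_def)
qed

lemma band_Hardy:
  assumes "0 < lam" shows "band lam \<in> Hardy"
proof -
  have "(\<lambda>\<xi>. indicator {0<..} \<xi> * indicator {lam<..<lam+1} \<xi>) = (\<lambda>\<xi>. indicator {lam<..<lam+1} \<xi> :: complex)"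
    using assms by (auto simp: indicator_def fun_eq_iff)
  then have "is_Cplus (band lam) (band lam)"
    unfolding is_Cplus_def using band_fourier[of lam] by (intro exI[of _ "\<lambda>\<xi>. indicator {lam<..<lam+1} \<xi>"]) simp
  then show ?thesis unfolding Hardy_def using band_L2 by blast
qed

section \<open>Smooth functions, and weak derivatives tested beyond compact support\<close>

text \<open>Smoothness without a formula for the n-th derivative: if a class of functions contains a
  derivative of each of its members, iterating a choice of derivative gives all orders.\<close>

lemma smooth_on_UNIV_closed:
  fixes f :: "real \<Rightarrow> 'a::real_normed_vector"
  assumes f: "f \<in> S" and cl: "\<And>f. f \<in> S \<Longrightarrow> \<exists>f'\<in>S. \<forall>x. (f has_vector_derivative f' x) (at x)"
  shows "smooth_on UNIV f"
proof -
  have "\<forall>f\<in>S. \<exists>f'. f' \<in> S \<and> (\<forall>x. (f has_vector_derivative f' x) (at x))" using cl by blast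
  from bchoice[OF this] obtain d where
    d: "\<forall>f\<in>S. d f \<in> S \<and> (\<forall>x. (f has_vector_derivative d f x) (at x))" ..
  have S: "(d ^^ n) f \<in> S" for n by (induction n) (use f d in auto)
  show ?thesis
    unfolding smooth_on_def using d S by (intro exI[of _ "\<lambda>n. (d ^^ n) f"]) auto
qed

lemma smooth_onE:
  assumes "smooth_on UNIV (f :: real \<Rightarrow> real)"
  obtains D where "D 0 = f" "\<And>n x. (D n has_real_derivative D (Suc n) x) (at x)"
proof -
  obtain D where D: "\<forall>x\<in>UNIV. D 0 x = f x" "\<forall>n::nat. \<forall>x\<in>UNIV. (D n has_vector_derivative D (Suc n) x) (at x within UNIV)"
    using assms unfolding smooth_on_def by blast
  have "D 0 = f" using D(1) by auto
  moreover have "(D n has_real_derivative D (Suc n) x) (at x)" for n x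
    using D(2) by (simp add: has_real_derivative_iff_has_vector_derivative)
  ultimately show ?thesis using that by blast
qed

lemma smooth_mult:
  fixes f g :: "real \<Rightarrow> real"
  assumes "smooth_on UNIV f" "smooth_on UNIV g"
  shows "smooth_on UNIV (\<lambda>x. f x * g x)"
proof -
  obtain F where F: "F 0 = f" "\<And>n x. (F n has_real_derivative F (Suc n) x) (at x)"
    using smooth_onE[OF assms(1)] by metis
  obtain H where H: "H 0 = g" "\<And>n x. (H n has_real_derivative H (Suc n) x) (at x)"
    using smooth_onE[OF assms(2)] by metis
  \<comment> \<open>A list of pairs (i, j) stands for the sum of the products F_i H_j;
    \<open>l'\<close> is the product rule on such lists, so these sums are closed under
    differentiation.\<close>
  define P where "P l x = (\<Sum>p\<leftarrow>l. F (fst p) x * H (snd p) x)" for l :: "(nat \<times> nat) list" and x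
  define l' where "l' l = concat (map (\<lambda>p. [(Suc (fst p), snd p), (fst p, Suc (snd p))]) l)" for l :: "(nat \<times> nat) list"
  have der: "(P l has_real_derivative P (l' l) x) (at x)" for l x
  proof (induction l)
    case Nil
    then show ?case by (simp add: P_def [abs_def] l'_def)
  next
    case (Cons p l)
    have "((\<lambda>x. F (fst p) x * H (snd p) x + P l x) has_real_derivative
       (F (Suc (fst p)) x * H (snd p) x + H (Suc (snd p)) x * F (fst p) x) + P (l' l) x) (at x)"
      by (intro DERIV_add DERIV_mult F H Cons)
    then show ?case by (simp add: P_def [abs_def] l'_def algebra_simps)
  qed
  show ?thesis
  proof (rule smooth_on_UNIV_closed)
    show "(\<lambda>x. f x * g x) \<in> range P" 
      by (rule range_eqI[of _ _ "[(0, 0)]"]) (simp add: P_def [abs_def] F H)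
    show "\<exists>f'\<in>range P. \<forall>x. (h has_vector_derivative f' x) (at x)" if "h \<in> range P" for h
      using that der by (auto simp: has_real_derivative_iff_has_vector_derivative)
  qed
qed

lemma smooth_affine:
  fixes f :: "real \<Rightarrow> real"
  assumes "smooth_on UNIV f"
  shows "smooth_on UNIV (\<lambda>x. f (a * x + b))"
proof -
  obtain F where F: "F 0 = f" "\<And>n x. (F n has_real_derivative F (Suc n) x) (at x)"
    using smooth_onE[OF assms(1)] by metis
  have "((\<lambda>x. a ^ n * F n (a * x + b)) has_real_derivative (a ^ Suc n * F (Suc n) (a * x + b))) (at x)" for n x
    by (rule derivative_eq_intros DERIV_chain2[OF F(2)] refl | simp)+
  then show ?thesis
    unfolding smooth_on_def
    by (intro exI[of _ "\<lambda>n x. a ^ n * F n (a * x + b)"]) (simp add: F(1) has_real_derivative_iff_has_vector_derivative[symmetric])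
qed

lemma smooth_trig: "smooth_on UNIV (\<lambda>x::real. sin (a * x))" "smooth_on UNIV (\<lambda>x::real. cos (a * x))"
proof -
  let ?S = "{(\<lambda>x::real. c * sin (a * x) + d * cos (a * x)) | c d. True}"
  have cl: "\<exists>f'\<in>?S. \<forall>x. (f has_vector_derivative f' x) (at x)" if fS: "f \<in> ?S" for f
  proof -
    obtain c d where f: "f = (\<lambda>x. c * sin (a * x) + d * cos (a * x))" using fS by blast
    have "(f has_real_derivative (- (d * a)) * sin (a * x) + (c * a) * cos (a * x)) (at x)" for x
      unfolding f by (auto intro!: derivative_eq_intros)
    moreover have "(\<lambda>x. (- (d * a)) * sin (a * x) + (c * a) * cos (a * x)) \<in> ?S" by blast
    ultimately show ?thesis
      by (intro bexI[of _ "\<lambda>x. (- (d * a)) * sin (a * x) + (c * a) * cos (a * x)"])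
        (auto simp only: has_real_derivative_iff_has_vector_derivative)
  qed
  have "(\<lambda>x. sin (a * x)) = (\<lambda>x. 1 * sin (a * x) + 0 * cos (a * x))"
    "(\<lambda>x. cos (a * x)) = (\<lambda>x. 0 * sin (a * x) + 1 * cos (a * x))" by simp_all
  then have m: "(\<lambda>x. sin (a * x)) \<in> ?S" "(\<lambda>x. cos (a * x)) \<in> ?S" by blast+
  show "smooth_on UNIV (\<lambda>x. sin (a * x))" by (rule smooth_on_UNIV_closed[OF m(1) cl])
  show "smooth_on UNIV (\<lambda>x. cos (a * x))" by (rule smooth_on_UNIV_closed[OF m(2) cl])
qed

lemma one_plus_square_pos: "0 < 1 + (x::real)\<^sup>2"
  by (simp add: add_pos_nonneg)

lemma smooth_rational: "smooth_on UNIV (\<lambda>x::real. x / (1 + x\<^sup>2))"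
proof -
  let ?S = "{(\<lambda>x::real. poly p x / (1 + x\<^sup>2) ^ n) | p n. True}"
  have cl: "\<exists>f'\<in>?S. \<forall>x. (f has_vector_derivative f' x) (at x)" if fS: "f \<in> ?S" for f
  proof -
    obtain p n where f: "f = (\<lambda>x. poly p x / (1 + x\<^sup>2) ^ n)" using fS by blast
    \<comment> \<open>Numerator left by the quotient rule after cancelling common powers of 1 +
      x^2.\<close>
    let ?r = "pderiv p * [:1, 0, 1:] - smult (2 * of_nat n) ([:0, 1:] * p)"
    have "(f has_real_derivative poly ?r x / (1 + x\<^sup>2) ^ Suc n) (at x)" for x
    proof -
      have nz: "1 + x\<^sup>2 \<noteq> 0" using one_plus_square_pos[of x] by linarith
      define Y where "Y = 1 + x\<^sup>2"
      have Y: "Y \<noteq> 0" using nz by (simp add: Y_def)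
      have r: "poly ?r x = poly (pderiv p) x * Y - 2 * of_nat n * x * poly p x"
        by (simp add: Y_def power2_eq_square algebra_simps)
      show ?thesis
      proof (cases n)
        case 0
        have "poly ?r x / (1 + x\<^sup>2) ^ Suc n = poly (pderiv p) x"
          unfolding r Y_def[symmetric] using Y 0 by simp
        then show ?thesis unfolding f using poly_DERIV[of p x] 0 by simp
      next
        case (Suc m)
        have "((\<lambda>x. (1 + x\<^sup>2) ^ n) has_real_derivative of_nat n * (1 + x\<^sup>2) ^ m * (2 * x)) (at x)"
        proof -
          have "((\<lambda>x. 1 + x\<^sup>2) has_real_derivative 2 * x) (at x)" by (auto intro!: derivative_eq_intros)
          from DERIV_power[OF this, of n] show ?thesis by (simp add: Suc mult_ac)
        qed
        from DERIV_divide[OF poly_DERIV this, of p]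
        have "(f has_real_derivative (poly (pderiv p) x * (1 + x\<^sup>2) ^ n - poly p x * (of_nat n * (1 + x\<^sup>2) ^ m * (2 * x))) /
            ((1 + x\<^sup>2) ^ n * (1 + x\<^sup>2) ^ n)) (at x)"
          unfolding f using nz by simp
        moreover have "(poly (pderiv p) x * (1 + x\<^sup>2) ^ n - poly p x * (of_nat n * (1 + x\<^sup>2) ^ m * (2 * x))) /
            ((1 + x\<^sup>2) ^ n * (1 + x\<^sup>2) ^ n) = poly ?r x / (1 + x\<^sup>2) ^ Suc n"
          unfolding r Y_def[symmetric] unfolding Suc using Y by (simp add: field_simps)
        ultimately show ?thesis by simp
      qed
    qed
    then show ?thesis
      by (intro bexI[of _ "\<lambda>x. poly ?r x / (1 + x\<^sup>2) ^ Suc n"])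
        (simp add: has_real_derivative_iff_has_vector_derivative[symmetric], blast)
  qed
  show ?thesis
  proof (rule smooth_on_UNIV_closed[of _ ?S, OF _ cl])
    have "(\<lambda>x::real. x / (1 + x\<^sup>2)) = (\<lambda>x. poly [:0, 1:] x / (1 + x\<^sup>2) ^ 1)" by simp
    then show "(\<lambda>x::real. x / (1 + x\<^sup>2)) \<in> ?S" by blast
  qed
qed

text \<open>Functions p(1/x) e^(-1/x), a family closed under differentiation: with y = 1/x the
  polynomial p becomes y^2 (p - p').\<close>

definition flat :: "real poly \<Rightarrow> real \<Rightarrow> real" where
  "flat p x = (if x > 0 then poly p (1 / x) * exp (- (1 / x)) else 0)"

text \<open>The extra power y^k lets the induction on the coefficients of p go through.\<close>

lemma poly_exp_tendsto_0: "((\<lambda>y. y ^ k * poly p y * exp (- y)) \<longlongrightarrow> (0::real)) at_top"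
proof (induction p arbitrary: k)
  case (pCons a p)
  have "((\<lambda>y::real. y ^ k * exp (- y)) \<longlongrightarrow> 0) at_top"
    using tendsto_power_div_exp_0[of k] by (simp add: exp_minus field_simps)
  then have "((\<lambda>y. a * (y ^ k * exp (- y)) + y ^ Suc k * poly p y * exp (- y)) \<longlongrightarrow> a * 0 + 0) at_top"
    by (intro tendsto_intros pCons)
  then show ?case by (simp add: algebra_simps)
qed simp

lemma flat_deriv: "(flat p has_real_derivative flat ([:0, 0, 1:] * (p - pderiv p)) x) (at x)"
proof -
  consider "x > 0" | "x < 0" | "x = 0" by linarith
  then show ?thesis
  proof cases
    case 1
    have "((\<lambda>x. poly p (1 / x) * exp (- (1 / x))) has_real_derivative
        (poly (pderiv p) (1 / x) * (- 1 / x\<^sup>2)) * exp (- (1 / x)) + (exp (- (1 / x)) * (1 / x\<^sup>2)) * poly p (1 / x)) (at x)"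
    proof (rule DERIV_mult)
      show "((\<lambda>x. poly p (1 / x)) has_real_derivative poly (pderiv p) (1 / x) * (- 1 / x\<^sup>2)) (at x)"
        using 1 by (intro DERIV_chain2[OF poly_DERIV]) (auto intro!: derivative_eq_intros simp: power2_eq_square)
      show "((\<lambda>x. exp (- (1 / x))) has_real_derivative exp (- (1 / x)) * (1 / x\<^sup>2)) (at x)"
        using 1 by (auto intro!: derivative_eq_intros simp: power2_eq_square)
    qed
    moreover have "(poly (pderiv p) (1 / x) * (- 1 / x\<^sup>2)) * exp (- (1 / x)) + (exp (- (1 / x)) * (1 / x\<^sup>2)) * poly p (1 / x)
       = flat ([:0, 0, 1:] * (p - pderiv p)) x"
      using 1 by (simp add: flat_def power2_eq_square algebra_simps)
    ultimately have "((\<lambda>x. poly p (1 / x) * exp (- (1 / x))) has_real_derivative flat ([:0, 0, 1:] * (p - pderiv p)) x) (at x)"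
      by simp
    then show ?thesis
      by (rule has_field_derivative_transform_within_open[of _ _ _ "{0<..}"]) (use 1 in \<open>auto simp: flat_def\<close>)
  next
    case 2
    have "((\<lambda>x. 0) has_real_derivative 0) (at x)" by simp
    then have "(flat p has_real_derivative 0) (at x)"
      by (rule has_field_derivative_transform_within_open[of _ _ _ "{..<0}"]) (use 2 in \<open>auto simp: flat_def\<close>)
    then show ?thesis using 2 by (simp add: flat_def)
  next
    case 3
    have l: "((\<lambda>h. (flat p h - flat p 0) / (h - 0)) \<longlongrightarrow> 0) (at_left 0)"
      by (rule tendsto_eventually, rule eventually_mono[OF eventually_at_left_real[of "-1" 0]]) (auto simp: flat_def)
    \<comment> \<open>At the origin the right difference quotient is y p(y) e^(-y) with y = 1/h,
      which tends to 0; the left one is 0.\<close>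
    have "((\<lambda>h. inverse h ^ 1 * poly p (inverse h) * exp (- inverse h)) \<longlongrightarrow> (0::real)) (at_right 0)"
      by (rule filterlim_compose[OF poly_exp_tendsto_0[of 1 p] filterlim_inverse_at_top_right])
    then have r: "((\<lambda>h. (flat p h - flat p 0) / (h - 0)) \<longlongrightarrow> 0) (at_right 0)"
      by (rule Lim_transform_eventually, intro eventually_mono[OF eventually_at_right_real[of 0 1]])
        (auto simp: flat_def field_simps)
    have "((\<lambda>h. (flat p h - flat p 0) / (h - 0)) \<longlongrightarrow> 0) (at 0)"
      using l r by (simp add: filterlim_split_at)
    then show ?thesis using 3 by (simp add: has_field_derivative_iff flat_def)
  qed
qed

lemma smooth_flat: "smooth_on UNIV (flat p)"
proof (rule smooth_on_UNIV_closed)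
  show "flat p \<in> range flat" by simp
  show "\<exists>f'\<in>range flat. \<forall>x. (f has_vector_derivative f' x) (at x)" if "f \<in> range flat" for f
    using that flat_deriv by (auto simp: has_real_derivative_iff_has_vector_derivative)
qed

text \<open>A smooth bump vanishing outside (-1, 1), with the affine arguments in the shape of
  \<open>smooth_affine\<close>. It is not normalised: its value at 0 is e^(-2).\<close>

definition bump :: "real \<Rightarrow> real" where
  "bump x = flat 1 (1 * x + 1) * flat 1 (- 1 * x + 1)"

lemma smooth_bump: "smooth_on UNIV bump"
  unfolding bump_def [abs_def] by (intro smooth_mult smooth_affine smooth_flat)

lemma bump_outside: "1 \<le> \<bar>x\<bar> \<Longrightarrow> bump x = 0"
  by (auto simp: bump_def flat_def abs_if split: if_splits)

lemma bump_0: "bump 0 = exp (- 2)"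
  by (simp add: bump_def flat_def exp_add[symmetric])

lemma bump_estimates:
  obtains B b' where "\<And>x. \<bar>bump x\<bar> \<le> B" "\<And>x. \<bar>b' x\<bar> \<le> B" "\<And>x. (bump has_real_derivative b' x) (at x)"
    "continuous_on UNIV b'"
proof -
  obtain D where D: "D 0 = bump" "\<And>n x. (D n has_real_derivative D (Suc n) x) (at x)"
    using smooth_onE[OF smooth_bump] by metis
  have cont: "continuous_on A (D n)" for n A
    using D(2) by (meson DERIV_continuous_on has_field_derivative_at_within)
  have out: "D n x = 0" if "1 < \<bar>x\<bar>" for n x
    using that
  proof (induction n arbitrary: x)
    case 0
    then show ?case using D(1) bump_outside[of x] by simp
  next
    case (Suc n)
    have "open {x::real. 1 < \<bar>x\<bar>}" by (intro open_Collect_less continuous_intros)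
    then have "((\<lambda>x. 0) has_real_derivative D (Suc n) x) (at x)"
      using D(2)[of n x] Suc by (elim has_field_derivative_transform_within_open) auto
    then show ?case using DERIV_unique[OF _ DERIV_const] by blast
  qed
  have "\<exists>B. \<forall>x. \<bar>D n x\<bar> \<le> B" for n
  proof -
    have "compact (D n ` {-1..1})" by (intro compact_continuous_image cont compact_Icc)
    then have "bounded (D n ` {-1..1})" by (rule compact_imp_bounded)
    then obtain B where B': "\<forall>y\<in>D n ` {-1..1}. norm y \<le> B" unfolding bounded_iff ..
    have B: "norm (D n x) \<le> B" if "x \<in> {-1..1}" for x using B' that by blast
    have "\<bar>D n x\<bar> \<le> max B 0" for x
    proof (cases "1 < \<bar>x\<bar>")
      case True
      then show ?thesis using out[of x n] by simp
    next
      case False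
      then have "norm (D n x) \<le> B" by (intro B) auto
      then show ?thesis by simp
    qed
    then show ?thesis by blast
  qed
  then obtain B0 B1 where B: "\<And>x. \<bar>D 0 x\<bar> \<le> B0" "\<And>x. \<bar>D 1 x\<bar> \<le> B1" by metis
  show ?thesis
  proof (rule that[of "max B0 B1" "D 1"])
    show "\<bar>bump x\<bar> \<le> max B0 B1" for x using B(1)[of x] D(1) by (simp add: max.coboundedI1)
    show "\<bar>D 1 x\<bar> \<le> max B0 B1" for x using B(2)[of x] by (simp add: max.coboundedI2)
    show "(bump has_real_derivative D 1 x) (at x)" for x using D(2)[of 0 x] D(1) by simp
  qed (rule cont)
qed

text \<open>The wave packets decay but have no compact support, so the defining identity is
  extended: multiply \<eta> by bump(x/(n + 1)) and let n grow. The derivative of the cutoff is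
  O(1/(n + 1)), and all products with \<phi> and \<phi>' are integrable, so dominated convergence
  applies.\<close>

lemma weak_deriv_extend:
  assumes w: "has_weak_deriv \<phi> \<phi>'" and \<phi>: "\<phi> \<in> L2" "\<phi>' \<in> L2"
    and sm: "smooth_on UNIV \<eta>" and d: "\<And>x. (\<eta> has_real_derivative \<eta>' x) (at x)"
    and \<eta>: "(\<lambda>x. complex_of_real (\<eta> x)) \<in> L2" "(\<lambda>x. complex_of_real (\<eta>' x)) \<in> L2"
  shows "(LINT x|lborel. \<phi> x * of_real (\<eta>' x)) = - (LINT x|lborel. \<phi>' x * of_real (\<eta> x))"
proof -
  obtain B b' where B: "\<And>x. \<bar>bump x\<bar> \<le> B" "\<And>x. \<bar>b' x\<bar> \<le> B" "\<And>x. (bump has_real_derivative b' x) (at x)"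
    "continuous_on UNIV b'"
    using bump_estimates by metis
  have contb: "continuous_on UNIV bump" using B(3) by (meson DERIV_continuous_on has_field_derivative_at_within)
  have [measurable]: "bump \<in> borel_measurable borel" "b' \<in> borel_measurable borel"
    using contb B(4) by (auto intro: borel_measurable_continuous_onI)
  have [measurable]: "\<phi> \<in> borel_measurable borel" "\<phi>' \<in> borel_measurable borel"
    using \<phi> by (auto intro: L2_measurable)
  have re: "h \<in> borel_measurable borel" if "(\<lambda>x. complex_of_real (h x)) \<in> L2" for h
    using measurable_compose[OF L2_measurable[OF that] borel_measurable_Re] by simp
  have [measurable]: "\<eta> \<in> borel_measurable borel" "\<eta>' \<in> borel_measurable borel"
    using \<eta> by (auto intro: re)
  have B0: "0 \<le> B" using B(1)[of 0] by linarith
  define \<theta> where "\<theta> n x = bump ((1 / real (Suc n)) * x + 0)" for n x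
  define \<theta>' where "\<theta>' n x = b' ((1 / real (Suc n)) * x + 0) * (1 / real (Suc n))" for n x
  have d\<theta>: "(\<theta> n has_real_derivative \<theta>' n x) (at x)" for n x
    unfolding \<theta>_def [abs_def] \<theta>'_def by (rule DERIV_chain2[OF B(3)]) (auto intro!: derivative_eq_intros)
  have test: "test_fun (\<lambda>x. \<eta> x * \<theta> n x)" for n
    unfolding test_fun_def
  proof
    show "smooth_on UNIV (\<lambda>x. \<eta> x * \<theta> n x)" unfolding \<theta>_def
      by (intro smooth_mult sm smooth_affine smooth_bump)
    show "\<exists>R. \<forall>x. R < \<bar>x\<bar> \<longrightarrow> \<eta> x * \<theta> n x = 0"
      by (intro exI[of _ "real (Suc n)"]) (auto simp: \<theta>_def abs_mult field_simps intro!: bump_outside)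
  qed
  have dp: "deriv (\<lambda>x. \<eta> x * \<theta> n x) x = \<eta>' x * \<theta> n x + \<theta>' n x * \<eta> x" for n x
    by (intro DERIV_imp_deriv DERIV_mult d d\<theta>)
  have i1: "integrable lborel (\<lambda>x. \<phi> x * of_real (\<eta>' x))" by (rule L2_mult_integrable[OF \<phi>(1) \<eta>(2)])
  have i2: "integrable lborel (\<lambda>x. \<phi> x * of_real (\<eta> x))" by (rule L2_mult_integrable[OF \<phi>(1) \<eta>(1)])
  have i3: "integrable lborel (\<lambda>x. \<phi>' x * of_real (\<eta> x))" by (rule L2_mult_integrable[OF \<phi>(2) \<eta>(1)])
  have \<theta>lim: "(\<lambda>n. \<theta> n x) \<longlonglongrightarrow> bump 0" for x
  proof -
    have "(\<lambda>n. (1 / real (Suc n)) * x + 0) \<longlonglongrightarrow> 0" by real_asymp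
    moreover have "isCont bump 0" using contb by (simp add: continuous_on_eq_continuous_at)
    ultimately show ?thesis unfolding \<theta>_def by (rule isCont_tendsto_compose[rotated])
  qed
  have \<theta>'lim: "(\<lambda>n. \<theta>' n x) \<longlonglongrightarrow> 0" for x
  proof (rule Lim_null_comparison)
    show "\<forall>\<^sub>F n in sequentially. norm (\<theta>' n x) \<le> B * (1 / real (Suc n))"
      unfolding \<theta>'_def by (intro always_eventually allI) (simp only: norm_mult real_norm_def, auto intro!: mult_right_mono B(2) divide_right_mono)
    show "(\<lambda>n. B * (1 / real (Suc n))) \<longlonglongrightarrow> 0" by real_asymp
  qed
  have \<theta>bd: "\<bar>\<theta> n x\<bar> \<le> B" "\<bar>\<theta>' n x\<bar> \<le> B" for n x
  proof -
    show "\<bar>\<theta> n x\<bar> \<le> B" unfolding \<theta>_def by (rule B)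
    have "\<bar>\<theta>' n x\<bar> \<le> B * 1" unfolding \<theta>'_def abs_mult by (intro mult_mono B) (auto simp: B0)
    then show "\<bar>\<theta>' n x\<bar> \<le> B" by simp
  qed
  have m\<theta> [measurable]: "\<theta> n \<in> borel_measurable borel" "\<theta>' n \<in> borel_measurable borel" for n
    unfolding \<theta>_def [abs_def] \<theta>'_def [abs_def] by measurable
  have "(\<lambda>n. LINT x|lborel. \<phi> x * of_real (\<eta>' x * \<theta> n x + \<theta>' n x * \<eta> x)) \<longlonglongrightarrow> (LINT x|lborel. \<phi> x * of_real (\<eta>' x * bump 0 + 0 * \<eta> x))"
  proof (rule integral_dominated_convergence)
    show "integrable lborel (\<lambda>x. B * (cmod (\<phi> x * of_real (\<eta>' x)) + cmod (\<phi> x * of_real (\<eta> x))))"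
      by (intro integrable_mult_right Bochner_Integration.integrable_add integrable_norm i1 i2)
    show "AE x in lborel. (\<lambda>n. \<phi> x * of_real (\<eta>' x * \<theta> n x + \<theta>' n x * \<eta> x)) \<longlonglongrightarrow> \<phi> x * of_real (\<eta>' x * bump 0 + 0 * \<eta> x)"
      by (intro AE_I2 tendsto_intros \<theta>lim \<theta>'lim)
    show "AE x in lborel. norm (\<phi> x * of_real (\<eta>' x * \<theta> n x + \<theta>' n x * \<eta> x)) \<le> B * (cmod (\<phi> x * of_real (\<eta>' x)) + cmod (\<phi> x * of_real (\<eta> x)))" for n
    proof (rule AE_I2)
      fix x
      have "\<bar>\<eta>' x * \<theta> n x + \<theta>' n x * \<eta> x\<bar> \<le> \<bar>\<eta>' x\<bar> * B + B * \<bar>\<eta> x\<bar>"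
        by (rule order_trans[OF abs_triangle_ineq]) (auto simp: abs_mult intro!: add_mono mult_mono \<theta>bd B0)
      then have "cmod (\<phi> x) * \<bar>\<eta>' x * \<theta> n x + \<theta>' n x * \<eta> x\<bar> \<le> cmod (\<phi> x) * (\<bar>\<eta>' x\<bar> * B + B * \<bar>\<eta> x\<bar>)"
        by (rule mult_left_mono) simp
      then show "norm (\<phi> x * of_real (\<eta>' x * \<theta> n x + \<theta>' n x * \<eta> x)) \<le> B * (cmod (\<phi> x * of_real (\<eta>' x)) + cmod (\<phi> x * of_real (\<eta> x)))"
        by (simp only: norm_mult norm_of_real) (simp add: algebra_simps)
    qed
  qed measurable
  moreover have "(\<lambda>n. - (LINT x|lborel. \<phi>' x * of_real (\<eta> x * \<theta> n x))) \<longlonglongrightarrow> - (LINT x|lborel. \<phi>' x * of_real (\<eta> x * bump 0))"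
  proof (intro tendsto_minus integral_dominated_convergence)
    show "integrable lborel (\<lambda>x. B * cmod (\<phi>' x * of_real (\<eta> x)))"
      by (intro integrable_mult_right integrable_norm i3)
    show "AE x in lborel. (\<lambda>n. \<phi>' x * of_real (\<eta> x * \<theta> n x)) \<longlonglongrightarrow> \<phi>' x * of_real (\<eta> x * bump 0)"
      by (intro AE_I2 tendsto_intros \<theta>lim)
    show "AE x in lborel. norm (\<phi>' x * of_real (\<eta> x * \<theta> n x)) \<le> B * cmod (\<phi>' x * of_real (\<eta> x))" for n
    proof (rule AE_I2)
      fix x
      have "norm (\<phi>' x * of_real (\<eta> x * \<theta> n x)) = cmod (\<phi>' x * of_real (\<eta> x)) * \<bar>\<theta> n x\<bar>"
        by (simp add: norm_mult abs_mult)
      also have "\<dots> \<le> cmod (\<phi>' x * of_real (\<eta> x)) * B" by (intro mult_left_mono \<theta>bd) simp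
      finally show "norm (\<phi>' x * of_real (\<eta> x * \<theta> n x)) \<le> B * cmod (\<phi>' x * of_real (\<eta> x))"
        by (simp only: mult.commute)
    qed
  qed measurable
  moreover have "(LINT x|lborel. \<phi> x * of_real (\<eta>' x * \<theta> n x + \<theta>' n x * \<eta> x)) = - (LINT x|lborel. \<phi>' x * of_real (\<eta> x * \<theta> n x))" for n
    using w test[of n] unfolding has_weak_deriv_def by (simp only: dp[symmetric])
  ultimately have "(LINT x|lborel. \<phi> x * of_real (\<eta>' x * bump 0 + 0 * \<eta> x)) = - (LINT x|lborel. \<phi>' x * of_real (\<eta> x * bump 0))"
    using LIMSEQ_unique by simp
  moreover have "(LINT x|lborel. \<phi> x * of_real (\<eta>' x * bump 0 + 0 * \<eta> x)) = of_real (bump 0) * (LINT x|lborel. \<phi> x * of_real (\<eta>' x))"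
    unfolding integral_mult_right_zero[symmetric] by (simp add: mult_ac)
  moreover have "(LINT x|lborel. \<phi>' x * of_real (\<eta> x * bump 0)) = of_real (bump 0) * (LINT x|lborel. \<phi>' x * of_real (\<eta> x))"
    unfolding integral_mult_right_zero[symmetric] by (simp add: mult_ac)
  ultimately have "of_real (bump 0) * (LINT x|lborel. \<phi> x * of_real (\<eta>' x)) = of_real (bump 0) * (- (LINT x|lborel. \<phi>' x * of_real (\<eta> x)))"
    by simp
  \<comment> \<open>Both limits carry the factor bump 0 = e^(-2), which is cancelled.\<close>
  then have "complex_of_real (bump 0) = 0 \<or> ?thesis" by (simp only: mult_cancel_left)
  then show ?thesis by (simp add: bump_0)
qed

section \<open>An odd kernel that detects jumps\<close>

definition half_exp :: "real \<Rightarrow> real" where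
  "half_exp t = indicator {0..} t * exp (- t)"

lemma half_exp_measurable [measurable]: "half_exp \<in> borel_measurable borel"
  unfolding half_exp_def [abs_def] by measurable

lemma half_exp_has_integral: "has_bochner_integral lborel half_exp 1"
  using has_bochner_integral_I0i_power_exp_m'[of 0] by (simp add: half_exp_def [abs_def] mult.commute)

lemma half_exp_bounds: "0 \<le> half_exp t" "half_exp t \<le> 1"
  by (auto simp: half_exp_def indicator_def)

lemma half_exp_integrable:
  "integrable lborel half_exp" "integrable lborel (\<lambda>t. half_exp (- t))"
proof -
  show "integrable lborel half_exp" using half_exp_has_integral by (rule integrable.intros)
  then show "integrable lborel (\<lambda>t. half_exp (- t))"
    using lborel_integrable_real_affine[of half_exp "-1" 0] by simp
qed

lemma half_exp_integral: "(LINT t|lborel. half_exp t) = 1" "(LINT t|lborel. half_exp (- t)) = 1"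
proof -
  show "(LINT t|lborel. half_exp t) = 1" using half_exp_has_integral by (rule has_bochner_integral_integral_eq)
  then show "(LINT t|lborel. half_exp (- t)) = 1"
    using lborel_integral_real_affine[of "-1" half_exp 0] by simp
qed

lemma half_exp_cis_integrable: "integrable lborel (\<lambda>t. half_exp t * cis (y * t))"
  by (rule Bochner_Integration.integrable_bound[OF half_exp_integrable(1)]) (auto simp: norm_mult half_exp_bounds)

lemma half_exp_fourier: "(LINT t|lborel. half_exp t * cis (- (y * t))) = 1 / (1 + \<i> * of_real y)"
proof -
  define c where "c = 1 + \<i> * complex_of_real y"
  have c: "Re c = 1" by (simp add: c_def)
  then have c0: "c \<noteq> 0" by auto
  have e: "half_exp t * cis (- (y * t)) = indicator {0..} t *\<^sub>R exp (- c * of_real t)" for t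
    unfolding half_exp_def c_def
    by (simp add: cis_conv_exp exp_of_real[symmetric] exp_add[symmetric] indicator_def algebra_simps)
  have si: "set_integrable lborel {0..} (\<lambda>t. exp (- c * of_real t))"
  proof -
    have "integrable lborel (\<lambda>t. half_exp t * cis (- (y * t)))" using half_exp_cis_integrable[of "-y"] by simp
    then show ?thesis unfolding e set_integrable_def .
  qed
  have "((\<lambda>N. LBINT t:{0..N}. exp (- c * of_real t)) \<longlongrightarrow> (LBINT t:{0..}. exp (- c * of_real t))) at_top"
    by (rule tendsto_set_lebesgue_integral_at_top[OF _ si]) simp
  moreover have "((\<lambda>N. LBINT t:{0..N}. exp (- c * of_real t)) \<longlongrightarrow> 1 / c) at_top"
  proof (rule Lim_transform_eventually)
    have "((\<lambda>N. exp (- c * complex_of_real N)) \<longlongrightarrow> 0) at_top"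
    proof (rule Lim_null_comparison)
      show "\<forall>\<^sub>F N in at_top. cmod (exp (- c * complex_of_real N)) \<le> exp (- N)"
        using c by (simp add: norm_exp_eq_Re)
      show "((\<lambda>N::real. exp (- N)) \<longlongrightarrow> 0) at_top" by real_asymp
    qed
    then have "((\<lambda>N. - exp (- c * complex_of_real N) / c - (- exp (- c * complex_of_real 0) / c)) \<longlongrightarrow> - 0 / c - (- exp (- c * complex_of_real 0) / c)) at_top"
      using c0 by (intro tendsto_intros)
    then show "((\<lambda>N. - exp (- c * complex_of_real N) / c - (- exp (- c * complex_of_real 0) / c)) \<longlongrightarrow> 1 / c) at_top" by simp
    show "\<forall>\<^sub>F N in at_top. - exp (- c * complex_of_real N) / c - (- exp (- c * complex_of_real 0) / c) = (LBINT t:{0..N}. exp (- c * of_real t))"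
      using eventually_ge_at_top[of 0]
    proof eventually_elim
      case (elim N)
      show ?case
        unfolding set_lebesgue_integral_def
      proof (rule integral_FTC_atLeastAtMost[OF elim, symmetric])
        show "((\<lambda>t. - exp (- c * complex_of_real t) / c) has_vector_derivative exp (- c * of_real x)) (at x within {0..N})" for x
        proof -
          have "((\<lambda>z. - exp (- c * z) / c) has_field_derivative exp (- c * of_real x)) (at (of_real x))"
            using c0 by (auto intro!: derivative_eq_intros)
          then show ?thesis by (rule has_vector_derivative_real_field)
        qed
      qed (auto intro!: continuous_intros)
    qed
  qed
  ultimately have "(LBINT t:{0..}. exp (- c * of_real t)) = 1 / c"
    using tendsto_unique trivial_limit_at_top_linorder by blast
  then show ?thesis unfolding c_def[symmetric] by (simp add: set_lebesgue_integral_def e)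
qed

text \<open>This is sgn(t) e^(-|t|). Its mean is 0 and its mass on the positive half line is 1, so
  in the scaling limit it annihilates continuous functions and measures jumps. Its Fourier transform
  is rational, hence smooth.\<close>

definition odd_exp :: "real \<Rightarrow> complex" where
  "odd_exp t = of_real (half_exp t) - of_real (half_exp (- t))"

lemma odd_exp_measurable [measurable]: "odd_exp \<in> borel_measurable borel"
  unfolding odd_exp_def [abs_def] by measurable

lemma odd_exp_integrable: "integrable lborel odd_exp"
  unfolding odd_exp_def [abs_def] using half_exp_integrable by (intro Bochner_Integration.integrable_diff) simp_all

lemma odd_exp_integral: "(LINT t|lborel. odd_exp t) = 0"
  unfolding odd_exp_def using half_exp_integrable half_exp_integral
  by (subst Bochner_Integration.integral_diff) simp_all

lemma odd_exp_half_integral: "(LINT t|lborel. indicator {0<..} t *\<^sub>R odd_exp t) = 1"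
proof -
  have "(LINT t|lborel. indicator {0<..} t *\<^sub>R odd_exp t) = (LINT t|lborel. complex_of_real (half_exp t))"
  proof (rule integral_cong_AE)
    show "AE t in lborel. indicator {0<..} t *\<^sub>R odd_exp t = complex_of_real (half_exp t)"
      using AE_lborel_singleton[of 0] by eventually_elim (auto simp: odd_exp_def half_exp_def indicator_def)
  qed measurable
  then show ?thesis using half_exp_integral(1) by simp
qed

lemma odd_exp_norm_le: "cmod (odd_exp t) \<le> 1"
  unfolding odd_exp_def of_real_diff[symmetric] norm_of_real
  using half_exp_bounds[of t] half_exp_bounds[of "-t"] by linarith

lemma odd_exp_fourier: "(LINT t|lborel. odd_exp t * cis (- (y * t))) = - 2 * \<i> * of_real (y / (1 + y\<^sup>2))"
proof -
  have i1: "integrable lborel (\<lambda>t. half_exp t * cis (- (y * t)))" for y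
    using half_exp_cis_integrable[of "-y"] by simp
  have i2: "integrable lborel (\<lambda>t. half_exp (- t) * cis (- (y * t)))"
    using lborel_integrable_real_affine[OF i1[of "-y"], of "-1" 0] by simp
  have "(LINT t|lborel. odd_exp t * cis (- (y * t))) = (LINT t|lborel. half_exp t * cis (- (y * t)) - half_exp (- t) * cis (- (y * t)))"
    by (simp add: odd_exp_def left_diff_distrib)
  also have "\<dots> = (LINT t|lborel. half_exp t * cis (- (y * t))) - (LINT t|lborel. half_exp (- t) * cis (- (y * t)))"
    by (rule Bochner_Integration.integral_diff[OF i1 i2])
  also have "(LINT t|lborel. half_exp (- t) * cis (- (y * t))) = (LINT t|lborel. half_exp t * cis (- (- y * t)))"
    using lborel_integral_real_affine[of "-1" "\<lambda>t. half_exp t * cis (- (- y * t))" 0] by simp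
  also have "(LINT t|lborel. half_exp t * cis (- (y * t))) - (LINT t|lborel. half_exp t * cis (- (- y * t)))
    = 1 / (1 + \<i> * of_real y) - 1 / (1 + \<i> * of_real (- y))"
    by (simp only: half_exp_fourier)
  also have "\<dots> = - 2 * \<i> * of_real (y / (1 + y\<^sup>2))"
  proof -
    have a: "1 + \<i> * of_real y \<noteq> 0" "1 + \<i> * of_real (- y) \<noteq> 0" by (auto simp: complex_eq_iff)
    have b: "(1 + \<i> * of_real y) * (1 + \<i> * of_real (- y)) = of_real (1 + y\<^sup>2)"
      by (simp add: complex_eq_iff power2_eq_square)
    have "1 / (1 + \<i> * of_real y) - 1 / (1 + \<i> * of_real (- y)) = - 2 * \<i> * of_real y / ((1 + \<i> * of_real y) * (1 + \<i> * of_real (- y)))"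
      using a by (simp add: diff_frac_eq)
    then show ?thesis unfolding b by simp
  qed
  finally show ?thesis .
qed

text \<open>\<open>odd_exp\<close> scaled to width \<epsilon> around lam. Having mean 0, it is no
  approximate identity in the usual sense: as \<epsilon> tends to 0 it returns the jump at
  lam.\<close>

definition approx_id :: "real \<Rightarrow> real \<Rightarrow> real \<Rightarrow> complex" where
  "approx_id lam \<epsilon> \<xi> = odd_exp ((\<xi> - lam) / \<epsilon>) / of_real \<epsilon>"

lemma approx_id_measurable [measurable]: "approx_id lam \<epsilon> \<in> borel_measurable borel"
  unfolding approx_id_def [abs_def] by measurable

lemma approx_id_integral:
  assumes "\<epsilon> > 0"
  shows "(LINT \<xi>|lborel. w \<xi> * approx_id lam \<epsilon> \<xi>) = (LINT t|lborel. w (lam + \<epsilon> * t) * odd_exp t)"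
proof -
  have "(LINT \<xi>|lborel. w \<xi> * approx_id lam \<epsilon> \<xi>) = \<epsilon> *\<^sub>R (LINT t|lborel. w (lam + \<epsilon> * t) * approx_id lam \<epsilon> (lam + \<epsilon> * t))"
    using lborel_integral_real_affine[of \<epsilon> "\<lambda>\<xi>. w \<xi> * approx_id lam \<epsilon> \<xi>" lam] assms by simp
  also have "\<dots> = (LINT t|lborel. \<epsilon> *\<^sub>R (w (lam + \<epsilon> * t) * approx_id lam \<epsilon> (lam + \<epsilon> * t)))"
    by (rule integral_scaleR_right[symmetric])
  also have "\<dots> = (LINT t|lborel. w (lam + \<epsilon> * t) * odd_exp t)"
    using assms by (simp add: approx_id_def scaleR_conv_of_real)
  finally show ?thesis .
qed

lemma approx_id_integrable:
  assumes "\<epsilon> > 0"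
  shows "integrable lborel (approx_id lam \<epsilon>)"
proof -
  have "integrable lborel (\<lambda>t. approx_id lam \<epsilon> (lam + \<epsilon> * t))"
    using assms odd_exp_integrable by (simp add: approx_id_def)
  then show ?thesis using assms lborel_integrable_real_affine_iff[of \<epsilon> "approx_id lam \<epsilon>" lam] by simp
qed

lemma approx_id_L2:
  assumes "\<epsilon> > 0"
  shows "approx_id lam \<epsilon> \<in> L2"
proof -
  have "integrable lborel (\<lambda>\<xi>. (cmod (approx_id lam \<epsilon> \<xi>))\<^sup>2)"
  proof (rule Bochner_Integration.integrable_bound)
    show "integrable lborel (\<lambda>\<xi>. (1 / \<epsilon>) * cmod (approx_id lam \<epsilon> \<xi>))"
      using approx_id_integrable[OF assms] by (intro integrable_mult_right integrable_norm)
    have "cmod (approx_id lam \<epsilon> \<xi>) \<le> 1 / \<epsilon>" for \<xi>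
      using odd_exp_norm_le[of "(\<xi> - lam) / \<epsilon>"] assms by (simp add: approx_id_def norm_divide divide_right_mono)
    then have "(cmod (approx_id lam \<epsilon> \<xi>))\<^sup>2 \<le> (1 / \<epsilon>) * cmod (approx_id lam \<epsilon> \<xi>)" for \<xi>
      unfolding power2_eq_square by (intro mult_right_mono) auto
    then show "AE \<xi> in lborel. norm ((cmod (approx_id lam \<epsilon> \<xi>))\<^sup>2) \<le> norm ((1 / \<epsilon>) * cmod (approx_id lam \<epsilon> \<xi>))"
      using assms by (intro AE_I2) simp
  qed measurable
  then show ?thesis by (simp add: L2_def)
qed

lemma approx_id_fourier:
  assumes "\<epsilon> > 0"
  shows "(LINT \<xi>|lborel. approx_id lam \<epsilon> \<xi> * cis (- (x * \<xi>))) =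
    - 2 * \<i> * (cis (- (lam * x)) * of_real ((\<epsilon> * x) / (1 + (\<epsilon> * x)\<^sup>2)))"
proof -
  have "(LINT \<xi>|lborel. approx_id lam \<epsilon> \<xi> * cis (- (x * \<xi>))) = (LINT \<xi>|lborel. cis (- (x * \<xi>)) * approx_id lam \<epsilon> \<xi>)"
    by (simp only: mult.commute)
  also have "\<dots> = (LINT t|lborel. cis (- (x * (lam + \<epsilon> * t))) * odd_exp t)"
    by (rule approx_id_integral[OF assms])
  also have "\<dots> = (LINT t|lborel. cis (- (lam * x)) * (odd_exp t * cis (- ((\<epsilon> * x) * t))))"
  proof (rule Bochner_Integration.integral_cong[OF refl])
    fix t
    have "cis (- (x * (lam + \<epsilon> * t))) = cis (- (lam * x)) * cis (- ((\<epsilon> * x) * t))"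
      unfolding cis_mult by (simp add: algebra_simps)
    then show "cis (- (x * (lam + \<epsilon> * t))) * odd_exp t = cis (- (lam * x)) * (odd_exp t * cis (- ((\<epsilon> * x) * t)))"
      by (simp add: mult_ac)
  qed
  also have "\<dots> = cis (- (lam * x)) * (LINT t|lborel. odd_exp t * cis (- ((\<epsilon> * x) * t)))"
    by (rule integral_mult_right_zero)
  finally show ?thesis unfolding odd_exp_fourier by (simp add: mult_ac)
qed

section \<open>Wave packets concentrated at the frequency lam\<close>

lemma L2_dominated:
  assumes "g \<in> L2" "f \<in> borel_measurable borel" "\<And>x. cmod (f x) \<le> c * cmod (g x)"
  shows "f \<in> L2"
proof -
  have "integrable lborel (\<lambda>x. (cmod (f x))\<^sup>2)"
  proof (rule Bochner_Integration.integrable_bound)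
    show "integrable lborel (\<lambda>x. c\<^sup>2 * (cmod (g x))\<^sup>2)" by (intro integrable_mult_right L2_integrable assms)
    show "AE x in lborel. norm ((cmod (f x))\<^sup>2) \<le> norm (c\<^sup>2 * (cmod (g x))\<^sup>2)"
      using power_mono[OF assms(3) norm_ge_zero, of _ 2] by (auto intro!: AE_I2 simp: power_mult_distrib)
  qed (use assms(2) in measurable)
  then show ?thesis using assms(2) by (simp add: L2_def)
qed

lemma L2_add:
  assumes "f \<in> L2" "g \<in> L2"
  shows "(\<lambda>x. f x + g x) \<in> L2"
proof -
  have [measurable]: "f \<in> borel_measurable borel" "g \<in> borel_measurable borel" using assms by (auto intro: L2_measurable)
  have "integrable lborel (\<lambda>x. (cmod (f x + g x))\<^sup>2)"
  proof (rule Bochner_Integration.integrable_bound)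
    show "integrable lborel (\<lambda>x. 2 * ((cmod (f x))\<^sup>2 + (cmod (g x))\<^sup>2))"
      by (intro integrable_mult_right Bochner_Integration.integrable_add L2_integrable assms)
    have "(cmod (f x + g x))\<^sup>2 \<le> 2 * ((cmod (f x))\<^sup>2 + (cmod (g x))\<^sup>2)" for x
    proof -
      have "(cmod (f x + g x))\<^sup>2 \<le> (cmod (f x) + cmod (g x))\<^sup>2" by (intro power_mono norm_triangle_ineq) auto
      also have "\<dots> \<le> 2 * ((cmod (f x))\<^sup>2 + (cmod (g x))\<^sup>2)"
        using sum_squares_bound[of "cmod (f x)" "cmod (g x)"] by (simp add: power2_sum)
      finally show ?thesis .
    qed
    then show "AE x in lborel. norm ((cmod (f x + g x))\<^sup>2) \<le> norm (2 * ((cmod (f x))\<^sup>2 + (cmod (g x))\<^sup>2))"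
      by (auto intro!: AE_I2 order_trans[OF _ abs_ge_self])
  qed measurable
  then show ?thesis by (simp add: L2_def)
qed

text \<open>Decay like 1/w puts g in L^2, and dilation by \<epsilon> multiplies the squared norm by
  1/\<epsilon>.\<close>

lemma L2_scaled:
  fixes g :: "real \<Rightarrow> real"
  assumes [measurable]: "g \<in> borel_measurable borel" and b: "\<And>y. \<bar>g y\<bar> * wt y \<le> 2" and \<epsilon>: "\<epsilon> > 0"
  shows "(\<lambda>x. complex_of_real (g (\<epsilon> * x))) \<in> L2"
    and "(LINT x|lborel. (g (\<epsilon> * x))\<^sup>2) = (LINT y|lborel. (g y)\<^sup>2) / \<epsilon>"
proof -
  have i: "integrable lborel (\<lambda>y. (g y)\<^sup>2)"
  proof (rule Bochner_Integration.integrable_bound)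
    show "integrable lborel (\<lambda>x. 4 * wt x powr (- 2))" by (intro integrable_mult_right integrable_wt_powr) simp
    have "(g y)\<^sup>2 \<le> 4 * wt y powr (- 2)" for y
    proof -
      have "(\<bar>g y\<bar> * wt y)\<^sup>2 \<le> 2\<^sup>2" using b by (intro power_mono) auto
      then have "(g y)\<^sup>2 * (wt y)\<^sup>2 \<le> 4" by (simp add: power_mult_distrib)
      then show ?thesis by (simp add: powr_minus_divide pos_le_divide_eq)
    qed
    then show "AE x in lborel. norm ((g x)\<^sup>2) \<le> norm (4 * wt x powr (- 2))" by simp
  qed measurable
  have "integrable lborel (\<lambda>x. (g (0 + \<epsilon> * x))\<^sup>2)"
    using \<epsilon> by (intro lborel_integrable_real_affine i) auto
  then show "(\<lambda>x. complex_of_real (g (\<epsilon> * x))) \<in> L2" by (simp add: L2_def)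
  show "(LINT x|lborel. (g (\<epsilon> * x))\<^sup>2) = (LINT y|lborel. (g y)\<^sup>2) / \<epsilon>"
    using lborel_integral_real_affine[of \<epsilon> "\<lambda>y. (g y)\<^sup>2" 0] \<epsilon> by (simp add: field_simps)
qed

text \<open>The Fourier transform of \<open>odd_exp\<close> up to the factor -2i.\<close>

definition rat_fun :: "real \<Rightarrow> real" where "rat_fun y = y / (1 + y\<^sup>2)"

definition rat_fun' :: "real \<Rightarrow> real" where "rat_fun' y = (1 - y\<^sup>2) / (1 + y\<^sup>2)\<^sup>2"

lemma rat_fun_measurable [measurable]: "rat_fun \<in> borel_measurable borel" "rat_fun' \<in> borel_measurable borel"
  unfolding rat_fun_def [abs_def] rat_fun'_def [abs_def] by measurable

lemma rat_fun_deriv: "(rat_fun has_real_derivative rat_fun' y) (at y)"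
proof -
  have nz: "1 + y\<^sup>2 \<noteq> 0" using one_plus_square_pos[of y] by linarith
  have "((\<lambda>y. y / (1 + y\<^sup>2)) has_real_derivative (1 * (1 + y\<^sup>2) - y * (2 * y)) / ((1 + y\<^sup>2) * (1 + y\<^sup>2))) (at y)"
    using nz by (intro DERIV_divide) (auto intro!: derivative_eq_intros)
  moreover have "(1 * (1 + y\<^sup>2) - y * (2 * y)) / ((1 + y\<^sup>2) * (1 + y\<^sup>2)) = rat_fun' y"
    by (simp add: rat_fun'_def power2_eq_square)
  ultimately show ?thesis by (simp add: rat_fun_def [abs_def])
qed

lemma wt_le_rational: "wt y \<le> 2 * (1 + y\<^sup>2)" "\<bar>y\<bar> * wt y \<le> 2 * (1 + y\<^sup>2)"
proof -
  have a: "\<bar>y\<bar> \<le> 1 + y\<^sup>2"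
    using sum_squares_bound[of 1 "\<bar>y\<bar>"] zero_le_power2[of y] by simp
  then show "wt y \<le> 2 * (1 + y\<^sup>2)" unfolding wt_def distrib_left using zero_le_power2[of y] by linarith
  have "\<bar>y\<bar> * wt y = \<bar>y\<bar> + y\<^sup>2" by (simp add: wt_def distrib_left power2_eq_square abs_mult[symmetric])
  then show "\<bar>y\<bar> * wt y \<le> 2 * (1 + y\<^sup>2)" using a zero_le_power2[of y] unfolding distrib_left by linarith
qed

lemma rat_fun_decay: "\<bar>rat_fun y\<bar> * wt y \<le> 2" "\<bar>rat_fun' y\<bar> * wt y \<le> 2"
proof -
  have p: "0 < 1 + y\<^sup>2" by (rule one_plus_square_pos)
  have "\<bar>rat_fun y\<bar> * wt y = (\<bar>y\<bar> * wt y) / (1 + y\<^sup>2)" using p by (simp add: rat_fun_def abs_divide)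
  also have "\<dots> \<le> 2" using wt_le_rational(2)[of y] p by (simp add: pos_divide_le_eq)
  finally show "\<bar>rat_fun y\<bar> * wt y \<le> 2" .
  have "\<bar>1 - y\<^sup>2\<bar> \<le> 1 + y\<^sup>2" using zero_le_power2[of y] by (intro abs_leI) linarith+
  then have "\<bar>rat_fun' y\<bar> \<le> (1 + y\<^sup>2) / (1 + y\<^sup>2)\<^sup>2"
    unfolding rat_fun'_def abs_divide using p by (intro divide_mono) auto
  also have "\<dots> = 1 / (1 + y\<^sup>2)" using p by (simp add: power2_eq_square)
  finally have "\<bar>rat_fun' y\<bar> * wt y \<le> (1 / (1 + y\<^sup>2)) * (2 * (1 + y\<^sup>2))"
    using wt_le_rational(1)[of y] by (intro mult_mono) auto
  moreover have "(1 / P) * (2 * P) = 2" if "P > 0" for P :: real using that by simp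
  ultimately show "\<bar>rat_fun' y\<bar> * wt y \<le> 2" using p by metis
qed

text \<open>Integration by parts: with r = \<open>rat_fun\<close>, E satisfies E' = -i lam E +
  \<epsilon> e^(-i lam x) r'(\<epsilon> x), so the terms in lam cancel and only a multiple of
  \<epsilon> survives.\<close>

lemma weak_deriv_wave_packet:
  assumes w: "has_weak_deriv \<phi> \<phi>'" and \<phi>: "\<phi> \<in> L2" "\<phi>' \<in> L2" and \<epsilon>: "\<epsilon> > 0" and lam: "lam > 0"
  defines "E \<equiv> \<lambda>x. cis (- (lam * x)) * complex_of_real (rat_fun (\<epsilon> * x))"
  shows "E \<in> L2"
    "(LINT x|lborel. (\<phi>' x - \<i> * of_real lam * \<phi> x) * E x) = - (of_real \<epsilon> * (LINT x|lborel. \<phi> x * (cis (- (lam * x)) * of_real (rat_fun' (\<epsilon> * x)))))"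
proof -
  note r = L2_scaled(1)[OF rat_fun_measurable(1) rat_fun_decay(1) \<epsilon>]
  note r' = L2_scaled(1)[OF rat_fun_measurable(2) rat_fun_decay(2) \<epsilon>]
  let ?D = "\<lambda>x. cis (- (lam * x)) * complex_of_real (rat_fun' (\<epsilon> * x))"
  show E: "E \<in> L2" unfolding E_def by (rule L2_dominated[OF r, of _ 1]) (simp_all add: norm_mult)
  have D: "?D \<in> L2" by (rule L2_dominated[OF r', of _ 1]) (simp_all add: norm_mult)
  \<comment> \<open>Weak derivatives are tested with real functions only, so E = \<eta>1 - i \<eta>2
    is treated by real and imaginary part; the summand 0 fits \<open>smooth_affine\<close>.\<close>
  define \<eta>1 where "\<eta>1 x = cos (lam * x) * rat_fun (\<epsilon> * x + 0)" for x
  define \<eta>2 where "\<eta>2 x = sin (lam * x) * rat_fun (\<epsilon> * x + 0)" for x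
  define d1 where "d1 x = - lam * sin (lam * x) * rat_fun (\<epsilon> * x) + \<epsilon> * cos (lam * x) * rat_fun' (\<epsilon> * x)" for x
  define d2 where "d2 x = lam * cos (lam * x) * rat_fun (\<epsilon> * x) + \<epsilon> * sin (lam * x) * rat_fun' (\<epsilon> * x)" for x
  have rs: "((\<lambda>x. rat_fun (\<epsilon> * x + 0)) has_real_derivative rat_fun' (\<epsilon> * x + 0) * \<epsilon>) (at x)" for x
    by (rule DERIV_chain2[OF rat_fun_deriv]) (auto intro!: derivative_eq_intros)
  have dd1: "(\<eta>1 has_real_derivative d1 x) (at x)" for x
  proof -
    have "((\<lambda>x. cos (lam * x)) has_real_derivative - lam * sin (lam * x)) (at x)" by (auto intro!: derivative_eq_intros)
    from DERIV_mult[OF this rs[of x]] show ?thesis by (simp add: \<eta>1_def [abs_def] d1_def mult_ac)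
  qed
  have dd2: "(\<eta>2 has_real_derivative d2 x) (at x)" for x
  proof -
    have "((\<lambda>x. sin (lam * x)) has_real_derivative lam * cos (lam * x)) (at x)" by (auto intro!: derivative_eq_intros)
    from DERIV_mult[OF this rs[of x]] show ?thesis by (simp add: \<eta>2_def [abs_def] d2_def mult_ac)
  qed
  have sm_rat: "smooth_on UNIV rat_fun" unfolding rat_fun_def [abs_def] by (rule smooth_rational)
  have sm1: "smooth_on UNIV \<eta>1" unfolding \<eta>1_def [abs_def] by (intro smooth_mult smooth_trig smooth_affine sm_rat)
  have sm2: "smooth_on UNIV \<eta>2" unfolding \<eta>2_def [abs_def] by (intro smooth_mult smooth_trig smooth_affine sm_rat)
  have trig: "\<bar>sin t\<bar> * a \<le> a" "\<bar>cos t\<bar> * a \<le> a" if "0 \<le> a" for t a :: real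
    using that mult_right_mono[OF abs_sin_le_one, of a t] mult_right_mono[OF abs_cos_le_one, of a t] by simp_all
  have l1: "(\<lambda>x. complex_of_real (\<eta>1 x)) \<in> L2"
    by (rule L2_dominated[OF r, of _ 1]) (auto simp: \<eta>1_def [abs_def] norm_mult abs_mult intro!: trig)
  have l2: "(\<lambda>x. complex_of_real (\<eta>2 x)) \<in> L2"
    by (rule L2_dominated[OF r, of _ 1]) (auto simp: \<eta>2_def [abs_def] norm_mult abs_mult intro!: trig)
  have c1: "(\<lambda>x. complex_of_real (c * h (lam * x) * rat_fun (\<epsilon> * x))) \<in> L2"
    if [measurable]: "h \<in> borel_measurable borel" and "\<And>t. \<bar>h t\<bar> \<le> 1" for c and h :: "real \<Rightarrow> real"
    by (rule L2_dominated[OF r, of _ "\<bar>c\<bar>"])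
      (auto simp: norm_mult abs_mult intro!: mult_left_mono mult_left_le that mult_right_mono)
  have c2: "(\<lambda>x. complex_of_real (c * h (lam * x) * rat_fun' (\<epsilon> * x))) \<in> L2"
    if [measurable]: "h \<in> borel_measurable borel" and "\<And>t. \<bar>h t\<bar> \<le> 1" for c and h :: "real \<Rightarrow> real"
    by (rule L2_dominated[OF r', of _ "\<bar>c\<bar>"])
      (auto simp: norm_mult abs_mult intro!: mult_left_mono mult_left_le that mult_right_mono)
  have m1: "(\<lambda>x. complex_of_real (d1 x)) \<in> L2"
    using L2_add[OF c1[of sin "- lam"] c2[of cos \<epsilon>]] by (simp add: d1_def [abs_def])
  have m2: "(\<lambda>x. complex_of_real (d2 x)) \<in> L2"
    using L2_add[OF c1[of cos lam] c2[of sin \<epsilon>]] by (simp add: d2_def [abs_def])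
  note w1 = weak_deriv_extend[OF w \<phi> sm1 dd1 l1 m1]
  note w2 = weak_deriv_extend[OF w \<phi> sm2 dd2 l2 m2]
  have Eeq: "E x = of_real (\<eta>1 x) - \<i> * of_real (\<eta>2 x)" for x
    by (simp add: E_def \<eta>1_def \<eta>2_def complex_eq_iff)
  have Deq: "of_real (d1 x) - \<i> * of_real (d2 x) = - \<i> * of_real lam * E x + of_real \<epsilon> * ?D x" for x
    by (simp add: E_def d1_def d2_def complex_eq_iff algebra_simps)
  have "(LINT x|lborel. \<phi> x * (of_real (d1 x) - \<i> * of_real (d2 x))) =
      (LINT x|lborel. \<phi> x * of_real (d1 x)) - \<i> * (LINT x|lborel. \<phi> x * of_real (d2 x))"
  proof -
    have "(LINT x|lborel. \<phi> x * (of_real (d1 x) - \<i> * of_real (d2 x))) =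
       (LINT x|lborel. \<phi> x * of_real (d1 x) - \<i> * (\<phi> x * of_real (d2 x)))" by (simp add: algebra_simps)
    also have "\<dots> = (LINT x|lborel. \<phi> x * of_real (d1 x)) - (LINT x|lborel. \<i> * (\<phi> x * of_real (d2 x)))"
      by (intro Bochner_Integration.integral_diff integrable_mult_right L2_mult_integrable \<phi> m1 m2)
    finally show ?thesis by simp
  qed
  also have "\<dots> = - (LINT x|lborel. \<phi>' x * E x)"
  proof -
    have "(LINT x|lborel. \<phi>' x * E x) = (LINT x|lborel. \<phi>' x * of_real (\<eta>1 x) - \<i> * (\<phi>' x * of_real (\<eta>2 x)))"
      unfolding Eeq by (simp add: algebra_simps)
    also have "\<dots> = (LINT x|lborel. \<phi>' x * of_real (\<eta>1 x)) - (LINT x|lborel. \<i> * (\<phi>' x * of_real (\<eta>2 x)))"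
      by (intro Bochner_Integration.integral_diff integrable_mult_right L2_mult_integrable \<phi> l1 l2)
    finally show ?thesis unfolding w1 w2 by simp
  qed
  finally have A: "(LINT x|lborel. \<phi> x * (- \<i> * of_real lam * E x + of_real \<epsilon> * ?D x)) = - (LINT x|lborel. \<phi>' x * E x)"
    unfolding Deq .
  have "(LINT x|lborel. \<phi> x * (- \<i> * of_real lam * E x + of_real \<epsilon> * ?D x)) =
      (LINT x|lborel. (- \<i> * of_real lam) * (\<phi> x * E x) + of_real \<epsilon> * (\<phi> x * ?D x))" by (simp add: algebra_simps)
  also have "\<dots> = (LINT x|lborel. (- \<i> * of_real lam) * (\<phi> x * E x)) + (LINT x|lborel. of_real \<epsilon> * (\<phi> x * ?D x))"
    by (intro Bochner_Integration.integral_add integrable_mult_right L2_mult_integrable \<phi> E D)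
  also have "\<dots> = (- \<i> * of_real lam) * (LINT x|lborel. \<phi> x * E x) + of_real \<epsilon> * (LINT x|lborel. \<phi> x * ?D x)"
    by (simp only: integral_mult_right_zero)
  finally have B: "(- \<i> * of_real lam) * (LINT x|lborel. \<phi> x * E x) + of_real \<epsilon> * (LINT x|lborel. \<phi> x * ?D x) = - (LINT x|lborel. \<phi>' x * E x)"
    unfolding A by simp
  have "(LINT x|lborel. (\<phi>' x - \<i> * of_real lam * \<phi> x) * E x) = (LINT x|lborel. \<phi>' x * E x - (\<i> * of_real lam) * (\<phi> x * E x))"
    by (simp add: algebra_simps)
  also have "\<dots> = (LINT x|lborel. \<phi>' x * E x) - (LINT x|lborel. (\<i> * of_real lam) * (\<phi> x * E x))"
    by (intro Bochner_Integration.integral_diff integrable_mult_right L2_mult_integrable \<phi> E)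
  also have "\<dots> = (LINT x|lborel. \<phi>' x * E x) - (\<i> * of_real lam) * (LINT x|lborel. \<phi> x * E x)"
    by (simp only: integral_mult_right_zero)
  also have "\<dots> = - (of_real \<epsilon> * (LINT x|lborel. \<phi> x * ?D x))" using B by (simp add: algebra_simps)
  finally show "(LINT x|lborel. (\<phi>' x - \<i> * of_real lam * \<phi> x) * E x) = - (of_real \<epsilon> * (LINT x|lborel. \<phi> x * ?D x))" .
qed

text \<open>The packets e^(-i lam x) r'(\<epsilon> x) have L^2 norm of order \<epsilon>^(-1/2), so
  the prefactor \<epsilon> wins by \<epsilon>^(1/2).\<close>

lemma wave_packet_small:
  assumes \<phi>: "\<phi> \<in> L2"
  shows "(\<lambda>n. of_real (1 / Suc n) * (LINT x|lborel. \<phi> x * (cis (- (lam * x)) * complex_of_real (rat_fun' (1 / Suc n * x))))) \<longlonglongrightarrow> 0"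
proof (rule Lim_null_comparison)
  define P where "P = (LINT x|lborel. (cmod (\<phi> x))\<^sup>2)"
  define R where "R = (LINT x|lborel. (rat_fun' x)\<^sup>2)"
  show "\<forall>\<^sub>F n in sequentially. norm (of_real (1 / Suc n) * (LINT x|lborel. \<phi> x * (cis (- (lam * x)) * complex_of_real (rat_fun' (1 / Suc n * x)))))
     \<le> (P + R) / sqrt (Suc n)"
  proof (intro always_eventually allI)
    fix n
    define \<epsilon> where "\<epsilon> = 1 / real (Suc n)"
    have \<epsilon>: "\<epsilon> > 0" by (simp add: \<epsilon>_def)
    note r' = L2_scaled[OF rat_fun_measurable(2) rat_fun_decay(2) \<epsilon>]
    have ri: "integrable lborel (\<lambda>x. (rat_fun' (\<epsilon> * x))\<^sup>2)" using L2_integrable[OF r'(1)] by simp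
    \<comment> \<open>This weight in Young's inequality makes both terms of order
      \<epsilon>^(-1/2).\<close>
    have t: "sqrt \<epsilon> > 0" using \<epsilon> by simp
    have "cmod (LINT x|lborel. \<phi> x * (cis (- (lam * x)) * of_real (rat_fun' (\<epsilon> * x))))
       \<le> (LINT x|lborel. sqrt \<epsilon> * (rat_fun' (\<epsilon> * x))\<^sup>2 + (cmod (\<phi> x))\<^sup>2 / sqrt \<epsilon>)"
    proof (rule norm_integral_le_dominated)
      show "integrable lborel (\<lambda>x. sqrt \<epsilon> * (rat_fun' (\<epsilon> * x))\<^sup>2 + (cmod (\<phi> x))\<^sup>2 / sqrt \<epsilon>)"
        using ri L2_integrable[OF \<phi>] by simp
      show "AE x in lborel. cmod (\<phi> x * (cis (- (lam * x)) * of_real (rat_fun' (\<epsilon> * x)))) \<le> sqrt \<epsilon> * (rat_fun' (\<epsilon> * x))\<^sup>2 + (cmod (\<phi> x))\<^sup>2 / sqrt \<epsilon>"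
        using mult_le_scaled_squares[OF t, of "\<bar>rat_fun' (\<epsilon> * _)\<bar>" "cmod (\<phi> _)"]
        by (intro AE_I2) (simp add: norm_mult mult.commute)
    qed
    also have "\<dots> = sqrt \<epsilon> * (R / \<epsilon>) + P / sqrt \<epsilon>"
      using ri L2_integrable[OF \<phi>] r'(2) by (simp add: P_def R_def)
    also have "\<dots> = (P + R) / sqrt \<epsilon>"
    proof -
      have "sqrt \<epsilon> * (R / \<epsilon>) = R / sqrt \<epsilon>" using \<epsilon> by (simp add: field_simps)
      then show ?thesis by (simp add: add_divide_distrib)
    qed
    finally have "\<epsilon> * cmod (LINT x|lborel. \<phi> x * (cis (- (lam * x)) * of_real (rat_fun' (\<epsilon> * x)))) \<le> \<epsilon> * ((P + R) / sqrt \<epsilon>)"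
      using \<epsilon> by (intro mult_left_mono) auto
    also have "\<dots> = (P + R) * sqrt \<epsilon>" using \<epsilon> by (simp add: field_simps)
    also have "\<dots> = (P + R) / sqrt (Suc n)" by (simp add: \<epsilon>_def real_sqrt_divide)
    finally show "norm (of_real (1 / Suc n) * (LINT x|lborel. \<phi> x * (cis (- (lam * x)) * complex_of_real (rat_fun' (1 / Suc n * x))))) \<le> (P + R) / sqrt (Suc n)"
      using \<epsilon> unfolding \<epsilon>_def[symmetric] norm_mult norm_of_real by simp
  qed
  show "(\<lambda>n. (P + R) / sqrt (Suc n)) \<longlonglongrightarrow> 0" by real_asymp
qed

text \<open>Solving L_u \<phi> - lam \<phi> = band gives \<phi>' - i lam \<phi> = i (band + q).
  Tested with the wave packets, the left side tends to 0. By Parseval the right side tends to a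
  nonzero multiple of the jump at lam of the Fourier transform of band + q; this jump comes from the
  band alone, as the transform of q has a representative continuous there.\<close>

lemma positive_notin_resolvent_set:
  assumes u: "(\<lambda>x. complex_of_real (u x)) \<in> L2" and lam: "lam > 0"
  shows "complex_of_real lam \<notin> resolvent_set_Lu u"
proof
  assume "complex_of_real lam \<in> resolvent_set_Lu u"
  then have "\<exists>\<phi>. is_Lu u \<phi> (\<lambda>x. band lam x + complex_of_real lam * \<phi> x)"
    using band_Hardy[OF lam] unfolding resolvent_set_Lu_def by blast
  then obtain \<phi> where "is_Lu u \<phi> (\<lambda>x. band lam x + complex_of_real lam * \<phi> x)" ..
  then obtain \<phi>' p q where \<phi>': "\<phi>' \<in> L2" and w: "has_weak_deriv \<phi> \<phi>'" and p: "is_Cplus \<phi> p"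
    and q: "is_Cplus (\<lambda>x. of_real (u x) * p x) q"
    and eq: "AE x in lborel. band lam x + complex_of_real lam * \<phi> x = \<phi>' x / \<i> - q x"
    unfolding is_Lu_def by blast
  from p obtain F where F: "has_fourier \<phi> F" "has_fourier p (\<lambda>\<xi>. indicator {0<..} \<xi> * F \<xi>)"
    unfolding is_Cplus_def by blast
  from q obtain H where H: "has_fourier (\<lambda>x. of_real (u x) * p x) H" "has_fourier q (\<lambda>\<xi>. indicator {0<..} \<xi> * H \<xi>)"
    unfolding is_Cplus_def by blast
  have \<phi>: "\<phi> \<in> L2" and pL: "p \<in> L2" and qL: "q \<in> L2"
    using F H by (auto dest: has_fourierD)
  \<comment> \<open>A product of two L^2 functions is integrable, so the transform of u p has the
    bounded continuous representative h.\<close>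
  have up: "integrable lborel (\<lambda>x. of_real (u x) * p x)" by (rule L2_mult_integrable[OF u pL])
  define h where "h \<xi> = of_real (1 / sqrt (2 * pi)) * (LINT x|lborel. (of_real (u x) * p x) * cis (- (x * \<xi>)))" for \<xi>
  have Hh: "AE \<xi> in lborel. H \<xi> = h \<xi>" unfolding h_def by (rule fourier_integrable_AE[OF H(1) up])
  define W where "W = (LINT x|lborel. cmod (of_real (u x) * p x))"
  have [measurable]: "(\<lambda>x. of_real (u x) * p x) \<in> borel_measurable borel" using borel_measurable_integrable[OF up] by simp
  have [measurable]: "H \<in> borel_measurable borel" using has_fourierD(2)[OF H(1)] by (rule L2_measurable)
  have h_meas [measurable]: "h \<in> borel_measurable borel" unfolding h_def [abs_def] by measurable
  have h_bd: "cmod (h \<xi>) \<le> \<bar>1 / sqrt (2 * pi)\<bar> * W" for \<xi>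
  proof -
    have "cmod (LINT x|lborel. (of_real (u x) * p x) * cis (- (x * \<xi>))) \<le> W"
      unfolding W_def by (rule norm_integral_le_dominated[OF integrable_norm[OF up]]) (simp add: norm_mult)
    then show ?thesis unfolding h_def norm_mult norm_of_real by (rule mult_left_mono) simp
  qed
  have h_lim: "(\<lambda>n. h (X n)) \<longlonglongrightarrow> h \<xi>" if "X \<longlonglongrightarrow> \<xi>" for X \<xi>
    unfolding h_def
  proof (intro tendsto_mult tendsto_const integral_dominated_convergence[OF _ _ integrable_norm[OF up]])
    show "AE x in lborel. (\<lambda>n. (of_real (u x) * p x) * cis (- (x * X n))) \<longlonglongrightarrow> (of_real (u x) * p x) * cis (- (x * \<xi>))"
      unfolding cis_conv_exp by (intro AE_I2 tendsto_intros that)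
    show "AE x in lborel. norm ((of_real (u x) * p x) * cis (- (x * X n))) \<le> cmod (of_real (u x) * p x)" for n
      by (simp add: norm_mult)
  qed measurable
  define \<epsilon> where "\<epsilon> n = 1 / real (Suc n)" for n
  have \<epsilon>: "\<epsilon> n > 0" for n by (simp add: \<epsilon>_def)
  have \<epsilon>0: "\<epsilon> \<longlonglongrightarrow> 0" unfolding \<epsilon>_def [abs_def] by real_asymp
  define E where "E n x = cis (- (lam * x)) * complex_of_real (rat_fun (\<epsilon> n * x))" for n x
  have EL: "E n \<in> L2" for n
    using weak_deriv_wave_packet(1)[OF w \<phi> \<phi>' \<epsilon> lam] by (simp add: E_def [abs_def])
  have fe: "(LINT \<xi>|lborel. approx_id lam (\<epsilon> n) \<xi> * cis (- (x * \<xi>))) = - 2 * \<i> * E n x" for n x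
    unfolding approx_id_fourier[OF \<epsilon>] E_def rat_fun_def ..
  have parseval: "(- 2 * \<i>) * (LINT x|lborel. f x * E n x) = of_real (sqrt (2 * pi)) * (LINT t|lborel. Q (lam + \<epsilon> n * t) * odd_exp t)"
    if "has_fourier f Q" for f Q n
  proof -
    have fL: "f \<in> L2" using that by (rule has_fourierD)
    have e: "f x * (- 2 * \<i> * E n x) = (- 2 * \<i>) * (f x * E n x)" for x by simp
    have "integrable lborel (\<lambda>x. f x * (- 2 * \<i> * E n x))"
      unfolding e by (intro integrable_mult_right L2_mult_integrable fL EL)
    then have "(LINT x|lborel. f x * (- 2 * \<i> * E n x)) = of_real (sqrt (2 * pi)) * (LINT \<xi>|lborel. Q \<xi> * approx_id lam (\<epsilon> n) \<xi>)"
      using fourier_parseval[OF that approx_id_integrable[OF \<epsilon>, of lam n] approx_id_L2[OF \<epsilon>, of lam n]] unfolding fe by simp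
    then show ?thesis unfolding e approx_id_integral[OF \<epsilon>] by (simp only: integral_mult_right_zero)
  qed
  \<comment> \<open>Rescaled around lam, the band becomes the half line t > 0, on which
    \<open>odd_exp\<close> has mass 1.\<close>
  have lim1: "(\<lambda>n. LINT t|lborel. indicator {lam<..<lam+1} (lam + \<epsilon> n * t) * odd_exp t) \<longlonglongrightarrow> (LINT t|lborel. indicator {0<..} t *\<^sub>R odd_exp t)"
  proof (rule integral_dominated_convergence[OF _ _ integrable_norm[OF odd_exp_integrable]])
    show "AE t in lborel. (\<lambda>n. indicator {lam<..<lam+1} (lam + \<epsilon> n * t) * odd_exp t) \<longlonglongrightarrow> indicator {0<..} t *\<^sub>R odd_exp t"
    proof (rule AE_I2)
      fix t :: real
      have "(\<lambda>n. \<epsilon> n * t) \<longlonglongrightarrow> 0 * t" by (intro tendsto_intros \<epsilon>0)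
      then have "\<forall>\<^sub>F n in sequentially. \<epsilon> n * t < 1" by (rule order_tendstoD) simp
      then have "\<forall>\<^sub>F n in sequentially. indicator {0<..} t *\<^sub>R odd_exp t = indicator {lam<..<lam+1} (lam + \<epsilon> n * t) * odd_exp t"
      proof eventually_elim
        case (elim n)
        have "0 < \<epsilon> n * t \<longleftrightarrow> 0 < t" using \<epsilon>[of n] by (simp add: zero_less_mult_iff less_not_sym)
        then show ?case using elim by (simp add: indicator_def)
      qed
      then show "(\<lambda>n. indicator {lam<..<lam+1} (lam + \<epsilon> n * t) * odd_exp t) \<longlonglongrightarrow> indicator {0<..} t *\<^sub>R odd_exp t"
        by (rule Lim_transform_eventually[OF tendsto_const])
    qed
    show "AE t in lborel. norm (indicator {lam<..<lam+1} (lam + \<epsilon> n * t) * odd_exp t) \<le> cmod (odd_exp t)" for n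
      by (intro AE_I2) (simp add: indicator_def)
  qed measurable
  \<comment> \<open>Since lam > 0 the projection factor is eventually 1, and h(lam) is integrated
    against a function of mean 0.\<close>
  have lim2: "(\<lambda>n. LINT t|lborel. (indicator {0<..} (lam + \<epsilon> n * t) * h (lam + \<epsilon> n * t)) * odd_exp t) \<longlonglongrightarrow> (LINT t|lborel. h lam * odd_exp t)"
  proof (rule integral_dominated_convergence)
    show "integrable lborel (\<lambda>t. (\<bar>1 / sqrt (2 * pi)\<bar> * W) * cmod (odd_exp t))"
      by (intro integrable_mult_right integrable_norm odd_exp_integrable)
    show "AE t in lborel. (\<lambda>n. (indicator {0<..} (lam + \<epsilon> n * t) * h (lam + \<epsilon> n * t)) * odd_exp t) \<longlonglongrightarrow> h lam * odd_exp t"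
    proof (rule AE_I2)
      fix t :: real
      have l: "(\<lambda>n. lam + \<epsilon> n * t) \<longlonglongrightarrow> lam + 0 * t" by (intro tendsto_intros \<epsilon>0)
      then have "\<forall>\<^sub>F n in sequentially. 0 < lam + \<epsilon> n * t" using lam by (intro order_tendstoD) auto
      then have ev: "\<forall>\<^sub>F n in sequentially. h (lam + \<epsilon> n * t) * odd_exp t = (indicator {0<..} (lam + \<epsilon> n * t) * h (lam + \<epsilon> n * t)) * odd_exp t"
        by eventually_elim (simp add: indicator_def)
      have "(\<lambda>n. h (lam + \<epsilon> n * t) * odd_exp t) \<longlonglongrightarrow> h lam * odd_exp t"
        using l by (intro tendsto_intros h_lim) simp
      then show "(\<lambda>n. (indicator {0<..} (lam + \<epsilon> n * t) * h (lam + \<epsilon> n * t)) * odd_exp t) \<longlonglongrightarrow> h lam * odd_exp t"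
        using ev by (rule Lim_transform_eventually)
    qed
    show "AE t in lborel. norm ((indicator {0<..} (lam + \<epsilon> n * t) * h (lam + \<epsilon> n * t)) * odd_exp t) \<le> (\<bar>1 / sqrt (2 * pi)\<bar> * W) * cmod (odd_exp t)" for n
    proof (rule AE_I2)
      fix t :: real
      have "cmod (indicator {0<..} (lam + \<epsilon> n * t) * h (lam + \<epsilon> n * t)) \<le> cmod (h (lam + \<epsilon> n * t))" by (simp add: indicator_def)
      also have "\<dots> \<le> \<bar>1 / sqrt (2 * pi)\<bar> * W" by (rule h_bd)
      finally show "norm ((indicator {0<..} (lam + \<epsilon> n * t) * h (lam + \<epsilon> n * t)) * odd_exp t) \<le> (\<bar>1 / sqrt (2 * pi)\<bar> * W) * cmod (odd_exp t)"
        unfolding norm_mult[of _ "odd_exp t"] by (rule mult_right_mono) simp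
    qed
  qed measurable
  \<comment> \<open>H agrees with h only almost everywhere, so the exchange takes place under the
    integral in \<xi>.\<close>
  have Heq: "(LINT t|lborel. (indicator {0<..} (lam + \<epsilon> n * t) * H (lam + \<epsilon> n * t)) * odd_exp t) =
     (LINT t|lborel. (indicator {0<..} (lam + \<epsilon> n * t) * h (lam + \<epsilon> n * t)) * odd_exp t)" for n
  proof -
    have "(LINT \<xi>|lborel. (indicator {0<..} \<xi> * H \<xi>) * approx_id lam (\<epsilon> n) \<xi>) = (LINT \<xi>|lborel. (indicator {0<..} \<xi> * h \<xi>) * approx_id lam (\<epsilon> n) \<xi>)"
    proof (rule integral_cong_AE)
      show "AE \<xi> in lborel. (indicator {0<..} \<xi> * H \<xi>) * approx_id lam (\<epsilon> n) \<xi> = (indicator {0<..} \<xi> * h \<xi>) * approx_id lam (\<epsilon> n) \<xi>"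
        using Hh by eventually_elim simp
    qed measurable
    then show ?thesis unfolding approx_id_integral[OF \<epsilon>] .
  qed
  define I where "I n = (LINT x|lborel. (band lam x + q x) * E n x)" for n
  have Isplit: "I n = (LINT x|lborel. band lam x * E n x) + (LINT x|lborel. q x * E n x)" for n
    unfolding I_def distrib_right by (intro Bochner_Integration.integral_add L2_mult_integrable band_L2 qL EL)
  have "(- 2 * \<i>) * I n = of_real (sqrt (2 * pi)) * ((LINT t|lborel. indicator {lam<..<lam+1} (lam + \<epsilon> n * t) * odd_exp t)
      + (LINT t|lborel. (indicator {0<..} (lam + \<epsilon> n * t) * h (lam + \<epsilon> n * t)) * odd_exp t))" for n
    unfolding Isplit distrib_left parseval[OF band_fourier] parseval[OF H(2)] Heq ..
  moreover have "(\<lambda>n. of_real (sqrt (2 * pi)) * ((LINT t|lborel. indicator {lam<..<lam+1} (lam + \<epsilon> n * t) * odd_exp t)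
      + (LINT t|lborel. (indicator {0<..} (lam + \<epsilon> n * t) * h (lam + \<epsilon> n * t)) * odd_exp t))) \<longlonglongrightarrow>
     complex_of_real (sqrt (2 * pi)) * (1 + h lam * 0)"
    unfolding odd_exp_half_integral[symmetric] odd_exp_integral[symmetric] integral_mult_right_zero[symmetric]
    by (intro tendsto_intros lim1 lim2)
  ultimately have limA: "(\<lambda>n. (- 2 * \<i>) * I n) \<longlonglongrightarrow> complex_of_real (sqrt (2 * pi))" by simp
  have Ieq: "\<i> * I n = - (of_real (\<epsilon> n) * (LINT x|lborel. \<phi> x * (cis (- (lam * x)) * complex_of_real (rat_fun' (\<epsilon> n * x)))))" for n
  proof -
    have [measurable]: "\<phi> \<in> borel_measurable borel" "\<phi>' \<in> borel_measurable borel" "q \<in> borel_measurable borel" "E n \<in> borel_measurable borel"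
      using \<phi> \<phi>' qL EL by (auto intro: L2_measurable)
    have "\<i> * I n = (LINT x|lborel. \<i> * ((band lam x + q x) * E n x))"
      unfolding I_def by (rule integral_mult_right_zero[symmetric])
    also have "\<dots> = (LINT x|lborel. (\<phi>' x - \<i> * of_real lam * \<phi> x) * E n x)"
    proof (rule integral_cong_AE)
      show "AE x in lborel. \<i> * ((band lam x + q x) * E n x) = (\<phi>' x - \<i> * of_real lam * \<phi> x) * E n x"
        using eq
      proof eventually_elim
        case (elim x)
        then have "band lam x + q x = \<phi>' x / \<i> - of_real lam * \<phi> x" by (simp add: algebra_simps)
        then have "\<i> * (band lam x + q x) = \<i> * (\<phi>' x / \<i>) - \<i> * of_real lam * \<phi> x"
          by (simp only: right_diff_distrib mult.assoc)
        also have "\<i> * (\<phi>' x / \<i>) = \<phi>' x" by simp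
        finally have "\<i> * (band lam x + q x) = \<phi>' x - \<i> * of_real lam * \<phi> x" .
        then show ?case by (simp add: mult.assoc[symmetric])
      qed
    qed measurable
    also have "\<dots> = - (of_real (\<epsilon> n) * (LINT x|lborel. \<phi> x * (cis (- (lam * x)) * complex_of_real (rat_fun' (\<epsilon> n * x)))))"
      using weak_deriv_wave_packet(2)[OF w \<phi> \<phi>' \<epsilon> lam, of n] unfolding E_def by simp
    finally show ?thesis .
  qed
  have "(\<lambda>n. \<i> * I n) \<longlonglongrightarrow> - 0"
    unfolding Ieq using wave_packet_small[OF \<phi>, of lam] by (intro tendsto_minus) (simp add: \<epsilon>_def)
  then have "(\<lambda>n. (- 2) * (\<i> * I n)) \<longlonglongrightarrow> (- 2) * (- 0)" by (intro tendsto_intros)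
  then have "(\<lambda>n. (- 2 * \<i>) * I n) \<longlonglongrightarrow> 0" by (simp add: mult.assoc)
  with limA have "complex_of_real (sqrt (2 * pi)) = 0" by (rule LIMSEQ_unique)
  then show False using pi_gt_zero by simp
qed

section \<open>Perturbation of the Jost equation\<close>

text \<open>Rearranged, the equation reads \<alpha> (L I0/(2 pi) + 1 - \<mu> I0) = 1 + e, where e =
  (\<mu> - L/(2 pi)) (P - \<alpha> I0) is O(|L| \<rho>^a (1 + |\<alpha>|)). Since L dominates the
  constant 1 - \<mu> I0, this gives |\<alpha>| = O(1/|L|), and reinserting that bound gives the
  leading term with error O(1/|L|^2).\<close>

lemma coupling_generic:
  fixes I0 \<mu> :: complex and a D :: real
  assumes I0: "I0 \<noteq> 0" and a: "0 < a" and D: "0 \<le> D"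
  shows "\<exists>C \<rho>0. 0 \<le> C \<and> 0 < \<rho>0 \<and> (\<forall>\<rho> L \<alpha> P. 0 < \<rho> \<longrightarrow> \<rho> < \<rho>0 \<longrightarrow> \<bar>ln \<rho>\<bar> \<le> cmod L \<longrightarrow> cmod L \<le> 2 * \<bar>ln \<rho>\<bar> \<longrightarrow>
     \<alpha> = 1 + (\<mu> - L / (2 * of_real pi)) * P \<longrightarrow> cmod (P - \<alpha> * I0) \<le> D * \<rho> powr a * (1 + cmod \<alpha>) \<longrightarrow>
     cmod (\<alpha> - 2 * of_real pi / (I0 * L)) \<le> C / (cmod L)\<^sup>2 \<and> cmod \<alpha> \<le> C)"
proof -
  define k where "k = cmod (1 - \<mu> * I0)"
  define J where "J = cmod I0 / (2 * pi)"
  have J: "J > 0" using I0 by (simp add: J_def)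
  \<comment> \<open>Comes from |\<alpha>| l J \<le> 2 + |\<alpha>| l J / 2, where the constant 2
    collects 1 and the bound |e| \<le> 1 + |\<alpha>|.\<close>
  define A where "A = 4 / J"
  define C where "C = (1 + A + k * A) / J + A"
  have A0: "0 < A" using J by (simp add: A_def)
  have k0: "0 \<le> k" by (simp add: k_def)
  \<comment> \<open>Two logarithms are beaten here, one for the growth of \<mu> - L/(2 pi) and one
    to gain |e| \<le> (1 + |\<alpha>|)/|L|. The factor 8 below contains 4 from |L| \<le> 2 |ln
    \<rho>|.\<close>
  have "((\<lambda>\<rho>. \<rho> powr a * (ln \<rho>)\<^sup>2) \<longlongrightarrow> 0) (at_right 0)" using a by real_asymp
  then have "((\<lambda>\<rho>. 8 * D * (\<rho> powr a * (ln \<rho>)\<^sup>2)) \<longlongrightarrow> 8 * D * 0) (at_right 0)" by (intro tendsto_intros)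
  then have ev1: "\<forall>\<^sub>F \<rho> in at_right 0. 8 * D * (\<rho> powr a * (ln \<rho>)\<^sup>2) < 1" by (rule order_tendstoD) simp
  have "LIM \<rho> at_right (0::real). \<bar>ln \<rho>\<bar> :> at_top" by real_asymp
  \<comment> \<open>Makes |L| dominate |\<mu>|, and |L| J at least 2 (k + 1), so that the lower
    order terms can be absorbed.\<close>
  then have ev2: "\<forall>\<^sub>F \<rho> in at_right (0::real). 1 + cmod \<mu> + 2 * (k + 1) / J \<le> \<bar>ln \<rho>\<bar>"
    by (simp add: filterlim_at_top)
  obtain \<rho>0 where \<rho>0: "\<rho>0 > 0" "\<And>\<rho>. 0 < \<rho> \<Longrightarrow> \<rho> < \<rho>0 \<Longrightarrow> 8 * D * (\<rho> powr a * (ln \<rho>)\<^sup>2) < 1 \<and> 1 + cmod \<mu> + 2 * (k + 1) / J \<le> \<bar>ln \<rho>\<bar>"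
    using eventually_conj[OF ev1 ev2] unfolding eventually_at_right_field by blast
  have "cmod (\<alpha> - 2 * of_real pi / (I0 * L)) \<le> C / (cmod L)\<^sup>2 \<and> cmod \<alpha> \<le> C"
    if \<rho>: "0 < \<rho>" "\<rho> < \<rho>0" and L: "\<bar>ln \<rho>\<bar> \<le> cmod L" "cmod L \<le> 2 * \<bar>ln \<rho>\<bar>"
      and \<alpha>: "\<alpha> = 1 + (\<mu> - L / (2 * of_real pi)) * P" and P: "cmod (P - \<alpha> * I0) \<le> D * \<rho> powr a * (1 + cmod \<alpha>)"
    for \<rho> L \<alpha> P
  proof -
    define l where "l = cmod L"
    have q: "0 \<le> 2 * (k + 1) / J" using k0 J by simp
    have l1: "1 + cmod \<mu> + 2 * (k + 1) / J \<le> l" using \<rho>0(2)[OF \<rho>] L by (simp add: l_def)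
    have l_ge: "1 \<le> l" "cmod \<mu> \<le> l" using l1 q norm_ge_zero[of \<mu>] by linarith+
    have Lnz: "L \<noteq> 0" using l_ge by (auto simp: l_def)
    have "2 * (k + 1) / J \<le> l" using l1 norm_ge_zero[of \<mu>] by linarith
    then have lJ: "2 * (k + 1) \<le> l * J" using J by (simp add: pos_divide_le_eq)
    define \<eta> where "\<eta> = 2 * l * (D * \<rho> powr a)"
    have "l\<^sup>2 \<le> (2 * \<bar>ln \<rho>\<bar>)\<^sup>2" using L l_ge unfolding l_def by (intro power_mono) auto
    then have "l\<^sup>2 \<le> 4 * (ln \<rho>)\<^sup>2" by (simp add: power_mult_distrib)
    then have "2 * (D * \<rho> powr a) * l\<^sup>2 \<le> 2 * (D * \<rho> powr a) * (4 * (ln \<rho>)\<^sup>2)" using D by (intro mult_left_mono) auto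
    also have "\<dots> = 8 * D * (\<rho> powr a * (ln \<rho>)\<^sup>2)" by simp
    also have "\<dots> < 1" using \<rho>0(2)[OF \<rho>] by blast
    finally have "\<eta> * l \<le> 1" by (simp add: \<eta>_def power2_eq_square mult_ac)
    then have \<eta>1: "\<eta> \<le> 1 / l" using l_ge by (simp add: pos_le_divide_eq)
    have "1 / l \<le> 1" using l_ge by simp
    with \<eta>1 have \<eta>le1: "\<eta> \<le> 1" by linarith
    define e where "e = (\<mu> - L / (2 * of_real pi)) * (P - \<alpha> * I0)"
    have "cmod (L / (2 * of_real pi)) \<le> l"
    proof -
      have "cmod (L / (2 * of_real pi)) = l / (2 * pi)" by (simp add: norm_divide norm_mult l_def)
      also have "\<dots> \<le> l / 1" using l_ge pi_gt3 by (intro divide_left_mono) auto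
      finally show ?thesis by simp
    qed
    then have "cmod (\<mu> - L / (2 * of_real pi)) \<le> 2 * l"
      using norm_triangle_ineq4[of \<mu> "L / (2 * of_real pi)"] l_ge by linarith
    then have "cmod e \<le> (2 * l) * (D * \<rho> powr a * (1 + cmod \<alpha>))"
      unfolding e_def norm_mult using P l_ge by (intro mult_mono) auto
    then have en: "cmod e \<le> \<eta> * (1 + cmod \<alpha>)" by (simp only: \<eta>_def mult_ac)
    have key: "\<alpha> * (L * I0 / (2 * of_real pi)) = 1 + e - \<alpha> * (1 - \<mu> * I0)"
    proof -
      define z where "z = L / (2 * of_real pi)"
      have z: "L * I0 / (2 * of_real pi) = z * I0" by (simp add: z_def)
      have "\<alpha> = 1 + (\<mu> - z) * P" using \<alpha> by (simp add: z_def)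
      then have "\<alpha> - 1 - (\<mu> - z) * P = 0" by simp
      moreover have "1 + e - \<alpha> * (1 - \<mu> * I0) - \<alpha> * (z * I0) = - (\<alpha> - 1 - (\<mu> - z) * P)"
        unfolding e_def z_def[symmetric] by (simp add: algebra_simps)
      ultimately have "1 + e - \<alpha> * (1 - \<mu> * I0) - \<alpha> * (z * I0) = 0" by simp
      then show ?thesis unfolding z by simp
    qed
    have nJ: "cmod (L * I0 / (2 * of_real pi)) = l * J" by (simp add: norm_divide norm_mult l_def J_def)
    have "cmod \<alpha> * (l * J) = cmod (1 + e - \<alpha> * (1 - \<mu> * I0))"
      unfolding key[symmetric] norm_mult[of \<alpha>] nJ ..
    also have "\<dots> \<le> 1 + cmod e + cmod \<alpha> * k"
      using norm_triangle_ineq4[of "1 + e" "\<alpha> * (1 - \<mu> * I0)"] norm_triangle_ineq[of 1 e] by (simp add: norm_mult k_def)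
    also have "\<dots> \<le> 1 + (1 + cmod \<alpha>) + cmod \<alpha> * k"
      using en \<eta>le1 mult_right_mono[of \<eta> 1 "1 + cmod \<alpha>"] by simp
    also have "\<dots> = 2 + cmod \<alpha> * (k + 1)" by (simp add: algebra_simps)
    also have "\<dots> \<le> 2 + cmod \<alpha> * (l * J / 2)" using lJ by (intro add_left_mono mult_left_mono) auto
    finally have "cmod \<alpha> * (l * J) \<le> 4" by simp
    then have "cmod \<alpha> * l \<le> A" unfolding A_def using J by (simp add: pos_le_divide_eq mult.assoc)
    then have \<alpha>l: "cmod \<alpha> \<le> A / l" using l_ge by (simp add: pos_le_divide_eq)
    have "A / l \<le> A / 1" using l_ge A0 by (intro divide_left_mono) auto
    then have \<alpha>A: "cmod \<alpha> \<le> A" using \<alpha>l by simp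
    have "\<alpha> - 2 * of_real pi / (I0 * L) = (e - \<alpha> * (1 - \<mu> * I0)) / (L * I0 / (2 * of_real pi))"
    proof -
      have nz: "L * I0 / (2 * of_real pi) \<noteq> 0" using Lnz I0 by simp
      have "\<alpha> = (1 + e - \<alpha> * (1 - \<mu> * I0)) / (L * I0 / (2 * of_real pi))"
        by (subst nonzero_eq_divide_eq[OF nz]) (rule key)
      also have "\<dots> = 1 / (L * I0 / (2 * of_real pi)) + (e - \<alpha> * (1 - \<mu> * I0)) / (L * I0 / (2 * of_real pi))"
        by (simp only: add_divide_distrib[symmetric] add_diff_eq)
      also have "1 / (L * I0 / (2 * of_real pi)) = 2 * of_real pi / (I0 * L)" by (simp add: mult.commute)
      finally show ?thesis unfolding diff_eq_eq by (rule trans[OF _ add.commute])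
    qed
    then have "cmod (\<alpha> - 2 * of_real pi / (I0 * L)) = cmod (e - \<alpha> * (1 - \<mu> * I0)) / (l * J)"
      by (simp only: norm_divide[of "e - _"] nJ)
    also have "\<dots> \<le> ((1 / l) * (1 + A) + (A / l) * k) / (l * J)"
    proof (rule divide_right_mono)
      have "cmod e \<le> (1 / l) * (1 + A)"
        using \<eta>1 \<alpha>A l_ge by (intro order_trans[OF en] mult_mono) auto
      moreover have "cmod (\<alpha> * (1 - \<mu> * I0)) \<le> (A / l) * k"
        unfolding norm_mult k_def[symmetric] using \<alpha>l k0 by (intro mult_right_mono)
      ultimately show "cmod (e - \<alpha> * (1 - \<mu> * I0)) \<le> (1 / l) * (1 + A) + (A / l) * k"
        using norm_triangle_ineq4[of e "\<alpha> * (1 - \<mu> * I0)"] by linarith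
      show "0 \<le> l * J" using l_ge J by simp
    qed
    also have "\<dots> = ((1 + A + k * A) / J) / l\<^sup>2"
      using l_ge J by (simp add: power2_eq_square field_simps)
    also have "\<dots> \<le> C / l\<^sup>2" unfolding C_def using A0 by (intro divide_right_mono) auto
    finally have "cmod (\<alpha> - 2 * of_real pi / (I0 * L)) \<le> C / l\<^sup>2" .
    moreover have "A \<le> C" unfolding C_def using A0 k0 J by simp
    ultimately show ?thesis using \<alpha>A by (simp add: l_def)
  qed
  moreover have "0 \<le> C" unfolding C_def using A0 k0 J by simp
  ultimately show ?thesis using \<rho>0(1) by blast
qed

text \<open>The case of vanishing I0: \<alpha> - 1 is the product (\<mu> - L/(2 pi)) P, bounded by
  \<eta> (1 + |\<alpha>|) with \<eta> = O(\<rho>^a |L|). As \<eta> \<le> 1/2 near 0, |\<alpha> - 1|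
  is absorbed and is at most 4 \<eta>.\<close>

lemma coupling_nongeneric:
  fixes \<mu> :: complex and a D :: real
  assumes a: "0 < a" and D: "0 \<le> D"
  shows "\<exists>C \<rho>0. 0 \<le> C \<and> 0 < \<rho>0 \<and> (\<forall>\<rho> L \<alpha> P. 0 < \<rho> \<longrightarrow> \<rho> < \<rho>0 \<longrightarrow> \<bar>ln \<rho>\<bar> \<le> cmod L \<longrightarrow> cmod L \<le> 2 * \<bar>ln \<rho>\<bar> \<longrightarrow>
     \<alpha> = 1 + (\<mu> - L / (2 * of_real pi)) * P \<longrightarrow> cmod P \<le> D * \<rho> powr a * (1 + cmod \<alpha>) \<longrightarrow>
     cmod (\<alpha> - 1) \<le> C * (\<rho> powr a * cmod L) \<and> cmod \<alpha> \<le> C)"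
proof -
  have "((\<lambda>\<rho>. \<rho> powr a * \<bar>ln \<rho>\<bar>) \<longlongrightarrow> 0) (at_right 0)" using a by real_asymp
  then have "((\<lambda>\<rho>. 8 * D * (\<rho> powr a * \<bar>ln \<rho>\<bar>)) \<longlongrightarrow> 8 * D * 0) (at_right 0)" by (intro tendsto_intros)
  then have ev1: "\<forall>\<^sub>F \<rho> in at_right 0. 8 * D * (\<rho> powr a * \<bar>ln \<rho>\<bar>) < 1" by (rule order_tendstoD) simp
  have "LIM \<rho> at_right (0::real). \<bar>ln \<rho>\<bar> :> at_top" by real_asymp
  then have ev2: "\<forall>\<^sub>F \<rho> in at_right (0::real). 1 + cmod \<mu> \<le> \<bar>ln \<rho>\<bar>"
    by (simp add: filterlim_at_top)
  obtain \<rho>0 where \<rho>0: "\<rho>0 > 0" "\<And>\<rho>. 0 < \<rho> \<Longrightarrow> \<rho> < \<rho>0 \<Longrightarrow> 8 * D * (\<rho> powr a * \<bar>ln \<rho>\<bar>) < 1 \<and> 1 + cmod \<mu> \<le> \<bar>ln \<rho>\<bar>"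
    using eventually_conj[OF ev1 ev2] unfolding eventually_at_right_field by blast
  define C where "C = 8 * D + 3"
  have "cmod (\<alpha> - 1) \<le> C * (\<rho> powr a * cmod L) \<and> cmod \<alpha> \<le> C"
    if \<rho>: "0 < \<rho>" "\<rho> < \<rho>0" and L: "\<bar>ln \<rho>\<bar> \<le> cmod L" "cmod L \<le> 2 * \<bar>ln \<rho>\<bar>"
      and \<alpha>: "\<alpha> = 1 + (\<mu> - L / (2 * of_real pi)) * P" and P: "cmod P \<le> D * \<rho> powr a * (1 + cmod \<alpha>)"
    for \<rho> L \<alpha> P
  proof -
    define l where "l = cmod L"
    have l1: "1 + cmod \<mu> \<le> l" using \<rho>0(2)[OF \<rho>] L by (simp add: l_def)
    have l_ge: "1 \<le> l" "cmod \<mu> \<le> l" using l1 norm_ge_zero[of \<mu>] by linarith+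
    define \<eta> where "\<eta> = 2 * l * (D * \<rho> powr a)"
    have \<eta>0: "0 \<le> \<eta>" using l_ge D by (simp add: \<eta>_def)
    have "(D * \<rho> powr a) * l \<le> (D * \<rho> powr a) * (2 * \<bar>ln \<rho>\<bar>)" using D L by (intro mult_left_mono) (auto simp: l_def)
    moreover have "8 * D * (\<rho> powr a * \<bar>ln \<rho>\<bar>) < 1" using \<rho>0(2)[OF \<rho>] by blast
    ultimately have \<eta>le: "\<eta> \<le> 1 / 2" by (simp add: \<eta>_def mult_ac)
    have "cmod (L / (2 * of_real pi)) \<le> l"
    proof -
      have "cmod (L / (2 * of_real pi)) = l / (2 * pi)" by (simp add: norm_divide norm_mult l_def)
      also have "\<dots> \<le> l / 1" using l_ge pi_gt3 by (intro divide_left_mono) auto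
      finally show ?thesis by simp
    qed
    then have "cmod (\<mu> - L / (2 * of_real pi)) \<le> 2 * l"
      using norm_triangle_ineq4[of \<mu> "L / (2 * of_real pi)"] l_ge by linarith
    then have "cmod (\<alpha> - 1) \<le> (2 * l) * (D * \<rho> powr a * (1 + cmod \<alpha>))"
      unfolding \<alpha> add_diff_cancel_left' norm_mult[of "\<mu> - _"] using P l_ge unfolding \<alpha>[symmetric] by (intro mult_mono) auto
    then have "cmod (\<alpha> - 1) \<le> \<eta> * (1 + cmod \<alpha>)" by (simp only: \<eta>_def mult_ac)
    also have "\<dots> \<le> \<eta> * (2 + cmod (\<alpha> - 1))"
      using norm_triangle_ineq2[of \<alpha> 1] \<eta>0 by (intro mult_left_mono) auto
    also have "\<dots> \<le> 2 * \<eta> + (1 / 2) * cmod (\<alpha> - 1)"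
      using mult_right_mono[OF \<eta>le, of "cmod (\<alpha> - 1)"] by (simp add: distrib_left)
    finally have 1: "cmod (\<alpha> - 1) \<le> 4 * \<eta>" by simp
    also have "4 * \<eta> = 8 * D * (\<rho> powr a * cmod L)" by (simp add: \<eta>_def l_def)
    also have "\<dots> \<le> C * (\<rho> powr a * cmod L)" unfolding C_def by (intro mult_right_mono) auto
    finally have "cmod (\<alpha> - 1) \<le> C * (\<rho> powr a * cmod L)" .
    moreover have "cmod \<alpha> \<le> C" using 1 \<eta>le norm_triangle_ineq2[of \<alpha> 1] D by (simp add: C_def)
    ultimately show ?thesis ..
  qed
  moreover have "0 \<le> C" unfolding C_def using D by simp
  ultimately show ?thesis using \<rho>0(1) by blast
qed

lemma norm_cut_log:
  assumes "off_axis \<kappa>"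
  shows "\<bar>ln (cut_abs \<kappa>)\<bar> \<le> cmod (cut_log \<kappa>)" "cmod (cut_log \<kappa>) \<le> \<bar>ln (cut_abs \<kappa>)\<bar> + 2 * pi"
proof -
  have R: "Re (cut_log \<kappa>) = ln (cut_abs \<kappa>)" and I: "\<bar>Im (cut_log \<kappa>)\<bar> \<le> 2 * pi"
    using assms Arg2pi_ge_0 Arg2pi_lt_2pi by (cases \<kappa> rule: cut_log.cases; simp add: less_imp_le)+
  show "\<bar>ln (cut_abs \<kappa>)\<bar> \<le> cmod (cut_log \<kappa>)" using abs_Re_le_cmod[of "cut_log \<kappa>"] R by simp
  show "cmod (cut_log \<kappa>) \<le> \<bar>ln (cut_abs \<kappa>)\<bar> + 2 * pi" using cmod_le[of "cut_log \<kappa>"] R I by simp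
qed

section \<open>The Jost equation under a nearly constant change of the kernel\<close>

context weighted_potential
begin

text \<open>The functional P of the overview; as u is real it equals the pairing of m with
  u.\<close>

definition total :: "(real \<Rightarrow> complex) \<Rightarrow> complex" where
  "total m = (LINT y|lborel. of_real (u y) * m y)"

lemma integrable_u_times:
  assumes "bounded_by_wt N m" "h \<in> borel_measurable borel" "\<And>y. cmod (h y) \<le> c * wt y powr p" "p < s1 - 1/2" "0 \<le> N"
  shows "integrable lborel (\<lambda>y. h y * (of_real (u y) * m y))"
    and "cmod (LINT y|lborel. h y * (of_real (u y) * m y)) \<le> c * N * (LINT y|lborel. U y * wt y powr p)"
proof -
  have [measurable]: "m \<in> borel_measurable borel" "h \<in> borel_measurable borel"
    using assms bounded_by_wt_measurable by auto
  have i: "integrable lborel (\<lambda>y. (c * N) * (U y * wt y powr p))"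
    by (intro integrable_mult_right integrable_U_wt assms)
  have b: "AE y in lborel. cmod (h y * (of_real (u y) * m y)) \<le> (c * N) * (U y * wt y powr p)"
    using u_times_bound[OF assms(1)]
  proof eventually_elim
    case (elim y)
    have "cmod (h y * (of_real (u y) * m y)) \<le> (c * wt y powr p) * (N * U y)"
      unfolding norm_mult[of "h y"] using elim assms(3)[of y] assms(5)
      by (intro mult_mono) (auto intro: order_trans[OF norm_ge_zero])
    then show ?case by (simp add: mult_ac)
  qed
  show "integrable lborel (\<lambda>y. h y * (of_real (u y) * m y))"
  proof (rule Bochner_Integration.integrable_bound[OF i])
    show "AE y in lborel. norm (h y * (of_real (u y) * m y)) \<le> norm ((c * N) * (U y * wt y powr p))"
      using b by eventually_elim (auto intro: order_trans[OF _ abs_ge_self])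
  qed measurable
  have "cmod (LINT y|lborel. h y * (of_real (u y) * m y)) \<le> (LINT y|lborel. (c * N) * (U y * wt y powr p))"
    by (rule norm_integral_le_dominated[OF i b])
  then show "cmod (LINT y|lborel. h y * (of_real (u y) * m y)) \<le> c * N * (LINT y|lborel. U y * wt y powr p)"
    by simp
qed

lemma integrable_total: "0 \<le> N \<Longrightarrow> bounded_by_wt N m \<Longrightarrow> integrable lborel (\<lambda>y. of_real (u y) * m y)"
  using integrable_u_times(1)[of N m "\<lambda>_. 1" 1 0] s1 by simp

lemma total_bound: "0 \<le> N \<Longrightarrow> bounded_by_wt N m \<Longrightarrow> cmod (total m) \<le> N * integral\<^sup>L lborel U"
  using integrable_u_times(2)[of N m "\<lambda>_. 1" 1 0] s1 by (simp add: total_def)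

end

context log_type_kernel
begin

text \<open>A constant \<nu> in the kernel contributes exactly \<nu> times \<open>total m\<close>;
  the remaining kernel is at most d w(x)^b w(y)^b.\<close>

lemma conv_perturbation:
  assumes m: "0 \<le> N" "bounded_by_wt N m" and [measurable]: "K' \<in> borel_measurable borel"
    and K': "\<And>x. x \<noteq> 0 \<Longrightarrow> cmod (K' x - K x - \<nu>) \<le> d * wt x powr b" and d: "0 \<le> d"
  shows "cmod (conv K' (\<lambda>y. of_real (u y) * m y) x - T m x - \<nu> * total m)
    \<le> d * N * (LINT y|lborel. U y * wt y powr b) * wt x powr b"
proof -
  obtain M where "T_bound M" using T_bound_exists ..
  note iT = T_boundD(2)[OF this m]
  have [measurable]: "m \<in> borel_measurable borel" using m bounded_by_wt_measurable by auto
  have iu: "integrable lborel (\<lambda>y. of_real (u y) * m y)" by (rule integrable_total[OF m])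
  \<comment> \<open>No bound is available on the diagonal, a null set, so the value there is set to
    0.\<close>
  define R where "R y = (if y = x then 0 else K' (x - y) - K (x - y) - \<nu>)" for y
  have [measurable]: "R \<in> borel_measurable borel" unfolding R_def [abs_def] by measurable
  have Rb: "cmod (R y) \<le> (d * wt x powr b) * wt y powr b" for y
  proof (cases "y = x")
    case False
    have "cmod (R y) \<le> d * wt (x - y) powr b" using K'[of "x - y"] False by (simp add: R_def)
    also have "\<dots> \<le> d * (wt x * wt y) powr b" using b d by (intro mult_left_mono powr_mono2 wt_diff_le) auto
    finally show ?thesis by (simp add: powr_mult)
  qed (use d in \<open>simp add: R_def\<close>)
  note iR = integrable_u_times[OF m(2) _ Rb b(3) m(1)]
  have ne: "AE y in lborel. y \<noteq> x" by (rule AE_lborel_singleton)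
  have "conv K' (\<lambda>y. of_real (u y) * m y) x
    = (LINT y|lborel. R y * (of_real (u y) * m y) + (K (x - y) * (of_real (u y) * m y) + \<nu> * (of_real (u y) * m y)))"
    unfolding conv_def
  proof (rule integral_cong_AE)
    show "AE y in lborel. K' (x - y) * (of_real (u y) * m y) =
       R y * (of_real (u y) * m y) + (K (x - y) * (of_real (u y) * m y) + \<nu> * (of_real (u y) * m y))"
      using ne by eventually_elim (simp add: R_def algebra_simps)
  qed measurable
  also have "\<dots> = (LINT y|lborel. R y * (of_real (u y) * m y)) + ((LINT y|lborel. K (x - y) * (of_real (u y) * m y)) + \<nu> * total m)"
    unfolding total_def
    by (subst Bochner_Integration.integral_add, rule iR, measurable, intro Bochner_Integration.integrable_add iT integrable_mult_right iu)
      (subst Bochner_Integration.integral_add[OF iT integrable_mult_right[OF iu]], simp)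
  finally have "conv K' (\<lambda>y. of_real (u y) * m y) x - T m x - \<nu> * total m = (LINT y|lborel. R y * (of_real (u y) * m y))"
    by (simp add: conv_def)
  moreover have "cmod (LINT y|lborel. R y * (of_real (u y) * m y)) \<le> (d * wt x powr b) * N * (LINT y|lborel. U y * wt y powr b)"
    by (rule iR) measurable
  ultimately show ?thesis by (simp add: mult_ac)
qed

text \<open>If \<open>K'\<close> is \<open>K + \<nu>\<close> up to a small error and \<open>m = g + K' * (u m)\<close> with \<open>g\<close> close to \<open>1\<close>, then
  \<open>(1 - T) m\<close> is close to the constant \<open>\<alpha> = 1 + \<nu> \<integral> u m\<close>, hence \<open>m\<close> is close to \<open>\<alpha> m0\<close>.\<close>

lemma jost_perturbation:
  assumes uniq: "is_jost_solution (- q) u K (\<lambda>_. 1) m0"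
  shows "\<exists>D d0. 0 \<le> D \<and> 0 < d0 \<and> (\<forall>K' g m \<nu> d. K' \<in> borel_measurable borel \<longrightarrow> 0 \<le> d \<longrightarrow> d \<le> d0 \<longrightarrow>
     (\<forall>x. x \<noteq> 0 \<longrightarrow> cmod (K' x - K x - \<nu>) \<le> d * wt x powr b) \<longrightarrow> (\<forall>x. cmod (g x - 1) \<le> d * wt x powr b) \<longrightarrow>
     solves_jost_eq (- q) u K' g m \<longrightarrow>
     bounded_by_wt (D * d * (1 + cmod (1 + \<nu> * total m))) (\<lambda>x. m x - (1 + \<nu> * total m) * m0 x) \<and>
     bounded_by_wt (D * (1 + cmod (1 + \<nu> * total m))) m \<and>
     cmod (total m - (1 + \<nu> * total m) * total m0) \<le> D * d * (1 + cmod (1 + \<nu> * total m)))"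
proof -
  have m0: "m0 \<in> Linf_weighted (- q)" "AE x in lborel. m0 x = 1 + T m0 x"
    using uniq unfolding is_jost_solution_def solves_jost_eq_def by blast+
  obtain N0 where N0: "0 \<le> N0" "bounded_by_wt N0 m0" using m0(1) unfolding Linf_weighted_iff by blast
  define W where "W = (LINT y|lborel. U y * wt y powr b)"
  have W0: "0 \<le> W" unfolding W_def by (rule integral_nonneg_AE) auto
  define V where "V = integral\<^sup>L lborel U"
  have V0: "0 \<le> V" unfolding V_def by (rule integral_nonneg_AE) auto
  have "\<exists>B>0. \<forall>f M. f \<in> Linf_weighted (- q) \<longrightarrow> 0 \<le> M \<longrightarrow> (AE x in lborel. cmod (f x - T f x) \<le> M * wt x powr q)
       \<longrightarrow> bounded_by_wt (B * M) f"
  proof (rule bounded_below[OF uniq])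
    fix B assume "0 < B"
      and "\<And>f M. f \<in> Linf_weighted (- q) \<Longrightarrow> 0 \<le> M \<Longrightarrow> AE x in lborel. cmod (f x - T f x) \<le> M * wt x powr q
        \<Longrightarrow> bounded_by_wt (B * M) f"
    then show ?thesis by (intro exI[of _ B] conjI allI impI) 
  qed
  then obtain B where B: "0 < B" and Bb: "\<forall>f M. f \<in> Linf_weighted (- q) \<longrightarrow> 0 \<le> M \<longrightarrow> (AE x in lborel. cmod (f x - T f x) \<le> M * wt x powr q)
       \<longrightarrow> bounded_by_wt (B * M) f" by (elim exE conjE)
  \<comment> \<open>Combines the lower bound for 1 - T with the residual estimate (1 + W) d (1 +
    N).\<close>
  define A where "A = B * (1 + W)"
  have A0: "0 < A" using B W0 by (simp add: A_def)
  \<comment> \<open>Makes A d \<le> 1/2, so that the norm N of m, which occurs on the right of its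
    own estimate, can be absorbed.\<close>
  define d0 where "d0 = 1 / (2 * A)"
  define D where "D = (A * (2 + 2 * N0)) * (1 + V) + (2 * N0 + 1)"
  have P0: "0 \<le> A * (2 + 2 * N0)" using A0 N0 by simp
  have D1: "A * (2 + 2 * N0) \<le> D" "A * (2 + 2 * N0) * V \<le> D" "2 * N0 + 1 \<le> D"
  proof -
    have e: "D = A * (2 + 2 * N0) + A * (2 + 2 * N0) * V + (2 * N0 + 1)" by (simp add: D_def distrib_left)
    have "0 \<le> A * (2 + 2 * N0) * V" using P0 V0 by (rule mult_nonneg_nonneg)
    then show "A * (2 + 2 * N0) \<le> D" "A * (2 + 2 * N0) * V \<le> D" "2 * N0 + 1 \<le> D" using e P0 N0 by linarith+
  qed
  have D0: "0 \<le> D" using P0 D1(1) by linarith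
  have wtbq: "wt x powr b \<le> wt x powr q" for x using b one_le_wt by (intro powr_mono) auto
  have main: "bounded_by_wt (D * d * (1 + cmod (1 + \<nu> * total m))) (\<lambda>x. m x - (1 + \<nu> * total m) * m0 x) \<and>
     bounded_by_wt (D * (1 + cmod (1 + \<nu> * total m))) m \<and>
     cmod (total m - (1 + \<nu> * total m) * total m0) \<le> D * d * (1 + cmod (1 + \<nu> * total m))"
    if K'm: "K' \<in> borel_measurable borel" and d: "0 \<le> d" "d \<le> d0"
      and K': "\<forall>x. x \<noteq> 0 \<longrightarrow> cmod (K' x - K x - \<nu>) \<le> d * wt x powr b"
      and g: "\<forall>x. cmod (g x - 1) \<le> d * wt x powr b"
      and m: "solves_jost_eq (- q) u K' g m"
    for K' g m \<nu> d
  proof -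
    define \<alpha> where "\<alpha> = 1 + \<nu> * total m"
    have mL: "m \<in> Linf_weighted (- q)" and meq: "AE x in lborel. m x = g x + conv K' (\<lambda>y. of_real (u y) * m y) x"
      using m unfolding solves_jost_eq_def by blast+
    obtain N where N: "m \<in> borel_measurable borel" "0 \<le> N" "AE x in lborel. cmod (m x) \<le> N * wt x powr q"
        "\<And>N'. AE x in lborel. cmod (m x) \<le> N' * wt x powr q \<Longrightarrow> N \<le> N'"
      by (rule Linf_weightedE[OF mL], rule that; blast)
    have mN: "bounded_by_wt N m" using N by (simp add: bounded_by_wt_def)
    have \<alpha>m0: "bounded_by_wt (cmod \<alpha> * N0) (\<lambda>x. \<alpha> * m0 x)" by (rule bounded_by_wt_scale[OF N0(2)])
    have \<alpha>N0: "0 \<le> cmod \<alpha> * N0" using N0 by simp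
    define f where "f x = m x - \<alpha> * m0 x" for x
    have fb: "bounded_by_wt (N + cmod \<alpha> * N0) f" unfolding f_def [abs_def] by (rule bounded_by_wt_diff[OF mN \<alpha>m0])
    have fL: "f \<in> Linf_weighted (- q)" unfolding Linf_weighted_iff using fb N(2) \<alpha>N0 by (intro exI[of _ "N + cmod \<alpha> * N0"]) simp
    \<comment> \<open>The constant 1 + \<nu> \<open>total m\<close> produced by the perturbed
      equation is \<alpha>, and subtracting \<alpha> m0 removes it because m0 - T m0 = 1.\<close>
    have res: "AE x in lborel. cmod (f x - T f x) \<le> ((1 + W) * (d * (1 + N))) * wt x powr q"
      using m0(2) meq
    proof eventually_elim
      case (elim x)
      have Tf: "T f x = T m x - \<alpha> * T m0 x"
        unfolding f_def T_diff[OF N(2) mN \<alpha>N0 \<alpha>m0] T_scale ..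
      have "f x - T f x = (g x - 1) + (conv K' (\<lambda>y. of_real (u y) * m y) x - T m x - \<nu> * total m) + (1 + \<nu> * total m - \<alpha>)"
        unfolding Tf unfolding f_def using elim by (simp add: algebra_simps)
      then have "f x - T f x = (g x - 1) + (conv K' (\<lambda>y. of_real (u y) * m y) x - T m x - \<nu> * total m)"
        by (simp add: \<alpha>_def)
      then have "cmod (f x - T f x) \<le> cmod (g x - 1) + cmod (conv K' (\<lambda>y. of_real (u y) * m y) x - T m x - \<nu> * total m)"
        by (simp only: norm_triangle_ineq)
      also have "\<dots> \<le> d * wt x powr b + d * N * W * wt x powr b"
        unfolding W_def by (rule add_mono[OF g[rule_format] conv_perturbation[OF N(2) mN K'm K'[rule_format] d(1)]])
      also have "\<dots> = d * (1 + N * W) * wt x powr b" by (simp add: algebra_simps)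
      also have "\<dots> \<le> d * ((1 + W) * (1 + N)) * wt x powr q"
      proof (rule mult_mono)
        show "d * (1 + N * W) \<le> d * ((1 + W) * (1 + N))"
          using d N(2) W0 by (intro mult_left_mono) (auto simp: algebra_simps)
        show "0 \<le> d * ((1 + W) * (1 + N))" using d N(2) W0 by (intro mult_nonneg_nonneg) auto
      qed (auto intro: wtbq)
      finally show ?case by (simp add: mult_ac)
    qed
    have "0 \<le> (1 + W) * (d * (1 + N))" using d N(2) W0 by (intro mult_nonneg_nonneg) auto
    then have "bounded_by_wt (B * ((1 + W) * (d * (1 + N)))) f" using Bb fL res by blast
    then have fA: "bounded_by_wt (A * d * (1 + N)) f" by (simp only: A_def mult.assoc)
    have mb: "bounded_by_wt (A * d * (1 + N) + cmod \<alpha> * N0) m"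
    proof -
      have "bounded_by_wt (A * d * (1 + N) + cmod (- \<alpha>) * N0) (\<lambda>x. f x - (- \<alpha>) * m0 x)"
        by (rule bounded_by_wt_diff[OF fA bounded_by_wt_scale[OF N0(2)]])
      then show ?thesis by (simp add: f_def)
    qed
    \<comment> \<open>Minimality of N turns the bound for m into an inequality for N alone.\<close>
    then have "N \<le> A * d * (1 + N) + cmod \<alpha> * N0" by (intro N(4)) (simp add: bounded_by_wt_def)
    moreover have Ad: "A * d \<le> 1 / 2"
    proof -
      have "A * d \<le> A * d0" using d A0 by (intro mult_left_mono) auto
      also have "\<dots> = 1 / 2" using A0 by (simp add: d0_def)
      finally show ?thesis .
    qed
    have "A * d * (1 + N) \<le> (1 / 2) * (1 + N)" using Ad N(2) by (intro mult_right_mono) auto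
    ultimately have Nle: "N \<le> 2 * (cmod \<alpha> * N0) + 1" by simp
    have N1: "1 + N \<le> (2 + 2 * N0) * (1 + cmod \<alpha>)"
    proof -
      have "(2 + 2 * N0) * (1 + cmod \<alpha>) = 2 + 2 * N0 + 2 * cmod \<alpha> + 2 * (cmod \<alpha> * N0)" by (simp add: algebra_simps)
      then show ?thesis using Nle N0(1) norm_ge_zero[of \<alpha>] by linarith
    qed
    have Nf0: "0 \<le> A * (2 + 2 * N0) * (d * (1 + cmod \<alpha>))" using P0 d by simp
    have "A * d * (1 + N) \<le> A * d * ((2 + 2 * N0) * (1 + cmod \<alpha>))" using A0 d N1 by (intro mult_left_mono) auto
    then have fD: "bounded_by_wt (A * (2 + 2 * N0) * (d * (1 + cmod \<alpha>))) f"
      by (intro bounded_by_wt_mono[OF fA]) (simp only: mult_ac)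
    have nn: "0 \<le> d * (1 + cmod \<alpha>)" using d by simp
    have r1: "bounded_by_wt (D * d * (1 + cmod \<alpha>)) f"
      using mult_right_mono[OF D1(1) nn] by (intro bounded_by_wt_mono[OF fD]) (simp only: mult.assoc)
    have r2: "bounded_by_wt (D * (1 + cmod \<alpha>)) m"
    proof (rule bounded_by_wt_mono[OF mN])
      have "(2 * N0 + 1) * (1 + cmod \<alpha>) = 2 * (cmod \<alpha> * N0) + 1 + (2 * N0 + cmod \<alpha>)" by (simp add: algebra_simps)
      then have "N \<le> (2 * N0 + 1) * (1 + cmod \<alpha>)" using Nle N0(1) norm_ge_zero[of \<alpha>] by linarith
      also have "\<dots> \<le> D * (1 + cmod \<alpha>)" using D1(3) by (intro mult_right_mono) auto
      finally show "N \<le> D * (1 + cmod \<alpha>)" .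
    qed
    have "total m - \<alpha> * total m0 = total f"
    proof -
      have "total f = (LINT y|lborel. of_real (u y) * m y - \<alpha> * (of_real (u y) * m0 y))"
        unfolding total_def f_def by (simp add: algebra_simps)
      also have "\<dots> = total m - (LINT y|lborel. \<alpha> * (of_real (u y) * m0 y))"
        unfolding total_def
        by (intro Bochner_Integration.integral_diff integrable_mult_right integrable_total[OF N(2) mN] integrable_total[OF N0])
      finally show ?thesis by (simp add: total_def)
    qed
    moreover have "cmod (total f) \<le> A * (2 + 2 * N0) * (d * (1 + cmod \<alpha>)) * V"
      unfolding V_def by (rule total_bound[OF Nf0 fD])
    moreover have "A * (2 + 2 * N0) * (d * (1 + cmod \<alpha>)) * V \<le> D * d * (1 + cmod \<alpha>)"
      using mult_right_mono[OF D1(2) nn] by (simp only: mult_ac)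
    ultimately have r3: "cmod (total m - \<alpha> * total m0) \<le> D * d * (1 + cmod \<alpha>)" by simp
    show ?thesis using r1 r2 r3 unfolding f_def [abs_def] \<alpha>_def by blast
  qed
  have "0 < d0" using A0 by (simp add: d0_def)
  show ?thesis
    by (rule exI[of _ D], rule exI[of _ d0], intro conjI[of "0 \<le> D"] conjI[of "0 < d0"] D0 \<open>0 < d0\<close>, (rule allI impI)+, rule main)
qed

end

section \<open>Jost functions near zero energy\<close>

context log_type_kernel
begin

text \<open>Up to the factor i this is both \<beta> and \<Gamma> - 1, taken at the respective Jost
  function.\<close>

definition twisted :: "real \<Rightarrow> (real \<Rightarrow> complex) \<Rightarrow> complex" where
  "twisted \<rho> m = (LINT y|lborel. of_real (u y) * m y * cis (- (\<rho> * y)))"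

text \<open>Common description of m_1, with g = 1, and of m_e, with g = e^(i lam x): both
  inhomogeneities are 1 up to O(|k|^a w^b).\<close>

definition jost_near :: "real \<Rightarrow> cut_point \<Rightarrow> (real \<Rightarrow> complex) \<Rightarrow> (real \<Rightarrow> complex) \<Rightarrow> bool" where
  "jost_near a \<kappa> g m \<longleftrightarrow> off_axis \<kappa> \<and> 0 < cut_abs \<kappa> \<and>
     (\<forall>x. cmod (g x - 1) \<le> 2 * cut_abs \<kappa> powr a * wt x powr b) \<and> solves_jost_eq (- q) u (G \<kappa>) g m"

definition low_energy_expansion :: "real \<Rightarrow> complex \<Rightarrow> real \<Rightarrow> bool" where
  "low_energy_expansion a \<mu> C1 \<longleftrightarrow> (\<forall>\<kappa> x. off_axis \<kappa> \<longrightarrow> cut_abs \<kappa> < 1/2 \<longrightarrow> x \<noteq> 0 \<longrightarrow>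
     cmod (G \<kappa> x - K x - (\<mu> - cut_log \<kappa> / (2 * of_real pi))) \<le> C1 * cut_abs \<kappa> powr a * wt x powr b)"

text \<open>Applies the perturbation result with \<nu> = \<mu> - log k/(2 pi) and d proportional to
  |k|^a, and replaces the phase in \<open>twisted\<close> by 1 at the same cost |k|^a. The bounds
  still contain |\<alpha>|.\<close>

lemma jost_near_estimates:
  assumes uniq: "is_jost_solution (- q) u K (\<lambda>_. 1) m0" and a: "0 < a" "a \<le> b" "b \<le> 1" and C1: "0 \<le> C1"
    and ker: "low_energy_expansion a \<mu> C1"
  shows "\<exists>D \<rho>0. 0 \<le> D \<and> 0 < \<rho>0 \<and> (\<forall>\<kappa> g m \<alpha>. jost_near a \<kappa> g m \<longrightarrow> cut_abs \<kappa> < \<rho>0 \<longrightarrow>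
     \<alpha> = 1 + (\<mu> - cut_log \<kappa> / (2 * of_real pi)) * total m \<longrightarrow>
     bounded_by_wt (D * cut_abs \<kappa> powr a * (1 + cmod \<alpha>)) (\<lambda>x. m x - \<alpha> * m0 x) \<and>
     cmod (total m - \<alpha> * total m0) \<le> D * cut_abs \<kappa> powr a * (1 + cmod \<alpha>) \<and>
     cmod (twisted (cut_abs \<kappa>) m - total m) \<le> D * cut_abs \<kappa> powr a * (1 + cmod \<alpha>) \<and>
     1 \<le> \<bar>ln (cut_abs \<kappa>)\<bar> \<and> \<bar>ln (cut_abs \<kappa>)\<bar> \<le> cmod (cut_log \<kappa>) \<and> cmod (cut_log \<kappa>) \<le> 2 * \<bar>ln (cut_abs \<kappa>)\<bar>)"
proof -
  obtain D d0 where D: "0 \<le> D" "0 < d0" and pert: "\<forall>K' g m \<nu> d. K' \<in> borel_measurable borel \<longrightarrow> 0 \<le> d \<longrightarrow> d \<le> d0 \<longrightarrow>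
     (\<forall>x. x \<noteq> 0 \<longrightarrow> cmod (K' x - K x - \<nu>) \<le> d * wt x powr b) \<longrightarrow> (\<forall>x. cmod (g x - 1) \<le> d * wt x powr b) \<longrightarrow>
     solves_jost_eq (- q) u K' g m \<longrightarrow>
     bounded_by_wt (D * d * (1 + cmod (1 + \<nu> * total m))) (\<lambda>x. m x - (1 + \<nu> * total m) * m0 x) \<and>
     bounded_by_wt (D * (1 + cmod (1 + \<nu> * total m))) m \<and>
     cmod (total m - (1 + \<nu> * total m) * total m0) \<le> D * d * (1 + cmod (1 + \<nu> * total m))"
    using jost_perturbation[OF uniq] by (elim exE conjE)
  define W where "W = (LINT y|lborel. U y * wt y powr b)"
  have W0: "0 \<le> W" unfolding W_def by (rule integral_nonneg_AE) auto
  \<comment> \<open>C1 comes from the kernel expansion and 2 from the phase of the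
    inhomogeneity.\<close>
  define c where "c = C1 + 2"
  have c0: "0 < c" using C1 by (simp add: c_def)
  define E where "E = D * c + 2 * D * W"
  have E: "D * c \<le> E" "2 * D * W \<le> E" "0 \<le> E" using D(1) W0 c0 by (auto simp: E_def)
  have "((\<lambda>\<rho>. c * \<rho> powr a) \<longlongrightarrow> 0) (at_right 0)" using a(1) by real_asymp
  then have ev1: "\<forall>\<^sub>F \<rho> in at_right 0. c * \<rho> powr a < d0" by (rule order_tendstoD) (rule D)
  have "LIM \<rho> at_right (0::real). \<bar>ln \<rho>\<bar> :> at_top" by real_asymp
  \<comment> \<open>Once |ln \<rho>| exceeds 2 pi, the argument of k at most doubles |log k|; the
    summand 1 keeps the logarithms away from 0.\<close>
  then have ev2: "\<forall>\<^sub>F \<rho> in at_right (0::real). 1 + 2 * pi \<le> \<bar>ln \<rho>\<bar>"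
    by (simp add: filterlim_at_top)
  obtain \<rho>1 where \<rho>1: "\<rho>1 > 0" "\<And>\<rho>. 0 < \<rho> \<Longrightarrow> \<rho> < \<rho>1 \<Longrightarrow> c * \<rho> powr a < d0 \<and> 1 + 2 * pi \<le> \<bar>ln \<rho>\<bar>"
    using eventually_conj[OF ev1 ev2] unfolding eventually_at_right_field by blast
  define \<rho>0 where "\<rho>0 = min \<rho>1 (1/2)"
  have main: "bounded_by_wt (E * cut_abs \<kappa> powr a * (1 + cmod \<alpha>)) (\<lambda>x. m x - \<alpha> * m0 x) \<and>
     cmod (total m - \<alpha> * total m0) \<le> E * cut_abs \<kappa> powr a * (1 + cmod \<alpha>) \<and>
     cmod (twisted (cut_abs \<kappa>) m - total m) \<le> E * cut_abs \<kappa> powr a * (1 + cmod \<alpha>) \<and>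
     1 \<le> \<bar>ln (cut_abs \<kappa>)\<bar> \<and> \<bar>ln (cut_abs \<kappa>)\<bar> \<le> cmod (cut_log \<kappa>) \<and> cmod (cut_log \<kappa>) \<le> 2 * \<bar>ln (cut_abs \<kappa>)\<bar>"
    if near: "jost_near a \<kappa> g m" and small: "cut_abs \<kappa> < \<rho>0"
      and \<alpha>: "\<alpha> = 1 + (\<mu> - cut_log \<kappa> / (2 * of_real pi)) * total m"
    for \<kappa> g m \<alpha>
  proof -
    define \<rho> where "\<rho> = cut_abs \<kappa>"
    have off: "off_axis \<kappa>" and \<rho>: "0 < \<rho>" and g: "\<And>x. cmod (g x - 1) \<le> 2 * \<rho> powr a * wt x powr b"
      and m: "solves_jost_eq (- q) u (G \<kappa>) g m"
      using near unfolding jost_near_def \<rho>_def by auto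
    have \<rho>2: "\<rho> < 1/2" "\<rho> < \<rho>1" using small by (auto simp: \<rho>_def \<rho>0_def)
    define d where "d = c * \<rho> powr a"
    have d: "0 \<le> d" "d \<le> d0" using c0 \<rho>1(2)[OF \<rho> \<rho>2(2)] by (auto simp: d_def)
    have Kd: "\<forall>x. x \<noteq> 0 \<longrightarrow> cmod (G \<kappa> x - K x - (\<mu> - cut_log \<kappa> / (2 * of_real pi))) \<le> d * wt x powr b"
    proof (intro allI impI)
      fix x :: real assume "x \<noteq> 0"
      then have "cmod (G \<kappa> x - K x - (\<mu> - cut_log \<kappa> / (2 * of_real pi))) \<le> C1 * \<rho> powr a * wt x powr b"
        using ker[unfolded low_energy_expansion_def, rule_format, OF off, of x] \<rho>2(1) by (simp add: \<rho>_def)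
      also have "\<dots> \<le> d * wt x powr b" unfolding d_def c_def by (intro mult_right_mono) auto
      finally show "cmod (G \<kappa> x - K x - (\<mu> - cut_log \<kappa> / (2 * of_real pi))) \<le> d * wt x powr b" .
    qed
    have gd: "\<forall>x. cmod (g x - 1) \<le> d * wt x powr b"
    proof
      fix x
      have "2 * \<rho> powr a * wt x powr b \<le> d * wt x powr b" unfolding d_def c_def using C1 by (intro mult_right_mono) auto
      then show "cmod (g x - 1) \<le> d * wt x powr b" using g[of x] by linarith
    qed
    have Gm: "G \<kappa> \<in> borel_measurable borel" by (rule G_measurable[OF off]) (use \<rho>2 in \<open>simp add: \<rho>_def\<close>)
    have P: "bounded_by_wt (D * d * (1 + cmod \<alpha>)) (\<lambda>x. m x - \<alpha> * m0 x) \<and>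
       bounded_by_wt (D * (1 + cmod \<alpha>)) m \<and> cmod (total m - \<alpha> * total m0) \<le> D * d * (1 + cmod \<alpha>)"
      unfolding \<alpha> by (rule pert[rule_format, OF Gm d Kd[rule_format] gd[rule_format] m])
    have mono: "X * \<rho> powr a * (1 + cmod \<alpha>) \<le> E * \<rho> powr a * (1 + cmod \<alpha>)" if "X \<le> E" for X
      using that by (intro mult_right_mono) auto
    have De: "D * d * (1 + cmod \<alpha>) \<le> E * \<rho> powr a * (1 + cmod \<alpha>)"
      using mono[OF E(1)] by (simp add: d_def mult.assoc)
    have N0: "0 \<le> D * (1 + cmod \<alpha>)" using D by simp
    have tw: "cmod (twisted \<rho> m - total m) \<le> E * \<rho> powr a * (1 + cmod \<alpha>)"
    proof -
      have h: "cmod (cis (- (\<rho> * y)) - 1) \<le> (2 * \<rho> powr a) * wt y powr b" for y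
      proof -
        have "cmod (cis (- (\<rho> * y)) - cis 0) \<le> 2 * \<bar>- (\<rho> * y) - 0\<bar> powr a"
          using a by (intro norm_cis_diff_powr_le) auto
        also have "\<dots> = 2 * \<rho> powr a * \<bar>y\<bar> powr a" using \<rho> by (simp add: abs_mult powr_mult)
        also have "\<dots> \<le> 2 * \<rho> powr a * wt y powr b" using a by (intro mult_left_mono abs_powr_le_wt) auto
        finally show ?thesis by simp
      qed
      have mb: "bounded_by_wt (D * (1 + cmod \<alpha>)) m" using P by blast
      have hm: "(\<lambda>y. cis (- (\<rho> * y)) - 1) \<in> borel_measurable borel" by measurable
      note ii = integrable_u_times[OF mb hm h b(3) N0]
      have it: "integrable lborel (\<lambda>y. of_real (u y) * m y)" by (rule integrable_total[OF N0 mb])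
      have "twisted \<rho> m = (LINT y|lborel. (cis (- (\<rho> * y)) - 1) * (of_real (u y) * m y) + of_real (u y) * m y)"
        unfolding twisted_def by (simp add: algebra_simps)
      also have "\<dots> = (LINT y|lborel. (cis (- (\<rho> * y)) - 1) * (of_real (u y) * m y)) + total m"
        unfolding total_def by (rule Bochner_Integration.integral_add[OF ii(1) it])
      finally have "cmod (twisted \<rho> m - total m) \<le> 2 * \<rho> powr a * (D * (1 + cmod \<alpha>)) * W"
        using ii(2) by (simp add: W_def)
      also have "\<dots> = (2 * D * W) * \<rho> powr a * (1 + cmod \<alpha>)" by (simp add: mult_ac)
      also have "\<dots> \<le> E * \<rho> powr a * (1 + cmod \<alpha>)" by (rule mono[OF E(2)])
      finally show ?thesis .
    qed
    have ln1: "1 + 2 * pi \<le> \<bar>ln \<rho>\<bar>" using \<rho>1(2)[OF \<rho> \<rho>2(2)] by blast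
    have logs: "1 \<le> \<bar>ln \<rho>\<bar> \<and> \<bar>ln \<rho>\<bar> \<le> cmod (cut_log \<kappa>) \<and> cmod (cut_log \<kappa>) \<le> 2 * \<bar>ln \<rho>\<bar>"
      using norm_cut_log[OF off] ln1 pi_gt_zero unfolding \<rho>_def[symmetric] by linarith
    show ?thesis unfolding \<rho>_def[symmetric]
      using bounded_by_wt_mono[OF _ De] P tw logs De by (meson order_trans)
  qed
  have "0 < \<rho>0" using \<rho>1(1) by (simp add: \<rho>0_def)
  then show ?thesis using E(3) by (intro exI[of _ E] exI[of _ \<rho>0] conjI[of "0 \<le> E"] conjI[of "0 < \<rho>0"] allI impI main)
qed

text \<open>Powers of |k| are below 1/|log k|^2, so the scalar equation decides. The twisted
  integral is close to \<open>total m\<close>, which is close to \<alpha> \<open>total m0\<close>;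
  with \<alpha> about 2 pi / (\<open>total m0\<close> log k) the factor \<open>total m0\<close>
  cancels, so the leading term of \<beta> and \<Gamma> - 1 is the same for all generic u.\<close>

lemma jost_near_generic:
  assumes uniq: "is_jost_solution (- q) u K (\<lambda>_. 1) m0" and a: "0 < a" "a \<le> b" "b \<le> 1" and C1: "0 \<le> C1"
    and ker: "low_energy_expansion a \<mu> C1"
    and gen: "total m0 \<noteq> 0"
  shows "\<exists>E \<rho>0. 0 \<le> E \<and> 0 < \<rho>0 \<and> (\<forall>\<kappa> g m. jost_near a \<kappa> g m \<longrightarrow> cut_abs \<kappa> < \<rho>0 \<longrightarrow>
     \<bar>ln (cut_abs \<kappa>)\<bar> \<le> cmod (cut_log \<kappa>) \<and> 1 \<le> \<bar>ln (cut_abs \<kappa>)\<bar> \<and>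
     bounded_by_wt (E / (cmod (cut_log \<kappa>))\<^sup>2) (\<lambda>x. m x - 2 * of_real pi / (total m0 * cut_log \<kappa>) * m0 x) \<and>
     cmod (twisted (cut_abs \<kappa>) m - 2 * of_real pi / cut_log \<kappa>) \<le> E / (cmod (cut_log \<kappa>))\<^sup>2)"
proof -
  have "m0 \<in> Linf_weighted (- q)" using uniq unfolding is_jost_solution_def solves_jost_eq_def by blast
  then obtain N0 where N0: "0 \<le> N0" "bounded_by_wt N0 m0" unfolding Linf_weighted_iff by blast
  obtain D \<rho>1 where D: "0 \<le> D" "0 < \<rho>1" and near: "\<forall>\<kappa> g m \<alpha>. jost_near a \<kappa> g m \<longrightarrow> cut_abs \<kappa> < \<rho>1 \<longrightarrow>
     \<alpha> = 1 + (\<mu> - cut_log \<kappa> / (2 * of_real pi)) * total m \<longrightarrow>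
     bounded_by_wt (D * cut_abs \<kappa> powr a * (1 + cmod \<alpha>)) (\<lambda>x. m x - \<alpha> * m0 x) \<and>
     cmod (total m - \<alpha> * total m0) \<le> D * cut_abs \<kappa> powr a * (1 + cmod \<alpha>) \<and>
     cmod (twisted (cut_abs \<kappa>) m - total m) \<le> D * cut_abs \<kappa> powr a * (1 + cmod \<alpha>) \<and>
     1 \<le> \<bar>ln (cut_abs \<kappa>)\<bar> \<and> \<bar>ln (cut_abs \<kappa>)\<bar> \<le> cmod (cut_log \<kappa>) \<and> cmod (cut_log \<kappa>) \<le> 2 * \<bar>ln (cut_abs \<kappa>)\<bar>"
    using jost_near_estimates[OF uniq a C1 ker] by (elim exE conjE)
  obtain C \<rho>2 where C: "0 \<le> C" "0 < \<rho>2" and coup: "\<forall>\<rho> L \<alpha> P. 0 < \<rho> \<longrightarrow> \<rho> < \<rho>2 \<longrightarrow> \<bar>ln \<rho>\<bar> \<le> cmod L \<longrightarrow> cmod L \<le> 2 * \<bar>ln \<rho>\<bar> \<longrightarrow>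
     \<alpha> = 1 + (\<mu> - L / (2 * of_real pi)) * P \<longrightarrow> cmod (P - \<alpha> * total m0) \<le> D * \<rho> powr a * (1 + cmod \<alpha>) \<longrightarrow>
     cmod (\<alpha> - 2 * of_real pi / (total m0 * L)) \<le> C / (cmod L)\<^sup>2 \<and> cmod \<alpha> \<le> C"
    using coupling_generic[OF gen a(1) D(1), of \<mu>] by (elim exE conjE)
  \<comment> \<open>The factor 4 converts (ln \<rho>)^2 into |L|^2, since |L| \<le> 2 |ln
    \<rho>|.\<close>
  have "((\<lambda>\<rho>. 4 * (\<rho> powr a * (ln \<rho>)\<^sup>2)) \<longlongrightarrow> 0) (at_right 0)" using a(1) by real_asymp
  then have "\<forall>\<^sub>F \<rho> in at_right 0. 4 * (\<rho> powr a * (ln \<rho>)\<^sup>2) < 1" by (rule order_tendstoD) simp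
  then obtain \<rho>3 where \<rho>3: "\<rho>3 > 0" "\<And>\<rho>. 0 < \<rho> \<Longrightarrow> \<rho> < \<rho>3 \<Longrightarrow> 4 * (\<rho> powr a * (ln \<rho>)\<^sup>2) < 1"
    unfolding eventually_at_right_field by blast
  define E where "E = 2 * D * (1 + C) + C * N0 + C * cmod (total m0)"
  define \<rho>0 where "\<rho>0 = min \<rho>1 (min \<rho>2 \<rho>3)"
  have main: "\<bar>ln (cut_abs \<kappa>)\<bar> \<le> cmod (cut_log \<kappa>) \<and> 1 \<le> \<bar>ln (cut_abs \<kappa>)\<bar> \<and>
     bounded_by_wt (E / (cmod (cut_log \<kappa>))\<^sup>2) (\<lambda>x. m x - 2 * of_real pi / (total m0 * cut_log \<kappa>) * m0 x) \<and>
     cmod (twisted (cut_abs \<kappa>) m - 2 * of_real pi / cut_log \<kappa>) \<le> E / (cmod (cut_log \<kappa>))\<^sup>2"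
    if jn: "jost_near a \<kappa> g m" and small: "cut_abs \<kappa> < \<rho>0" for \<kappa> g m
  proof -
    define \<rho> L where "\<rho> = cut_abs \<kappa>" and "L = cut_log \<kappa>"
    define \<alpha> where "\<alpha> = 1 + (\<mu> - L / (2 * of_real pi)) * total m"
    have \<rho>: "0 < \<rho>" "\<rho> < \<rho>1" "\<rho> < \<rho>2" "\<rho> < \<rho>3" using jn small by (auto simp: jost_near_def \<rho>_def \<rho>0_def)
    have n1: "bounded_by_wt (D * \<rho> powr a * (1 + cmod \<alpha>)) (\<lambda>x. m x - \<alpha> * m0 x)"
      and n2: "cmod (total m - \<alpha> * total m0) \<le> D * \<rho> powr a * (1 + cmod \<alpha>)"
      and n3: "cmod (twisted \<rho> m - total m) \<le> D * \<rho> powr a * (1 + cmod \<alpha>)"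
      and l: "1 \<le> \<bar>ln \<rho>\<bar>" "\<bar>ln \<rho>\<bar> \<le> cmod L" "cmod L \<le> 2 * \<bar>ln \<rho>\<bar>"
      using near[rule_format, OF jn, of \<alpha>] \<rho>(2) unfolding \<alpha>_def \<rho>_def L_def by blast+
    have c: "cmod (\<alpha> - 2 * of_real pi / (total m0 * L)) \<le> C / (cmod L)\<^sup>2" "cmod \<alpha> \<le> C"
      using coup[rule_format, OF \<rho>(1,3) l(2,3) \<alpha>_def n2] by blast+
    have L1: "1 \<le> cmod L" using l by linarith
    then have Lsq: "0 < (cmod L)\<^sup>2" by auto
    have small': "D * \<rho> powr a * (1 + cmod \<alpha>) \<le> D * (1 + C) / (cmod L)\<^sup>2"
    proof -
      have "(cmod L)\<^sup>2 \<le> (2 * \<bar>ln \<rho>\<bar>)\<^sup>2" using l by (intro power_mono) auto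
      then have "\<rho> powr a * (cmod L)\<^sup>2 \<le> \<rho> powr a * (4 * (ln \<rho>)\<^sup>2)" by (intro mult_left_mono) (auto simp: power_mult_distrib)
      also have "\<dots> \<le> 1" using \<rho>3(2)[OF \<rho>(1,4)] by simp
      finally have "\<rho> powr a \<le> 1 / (cmod L)\<^sup>2" using Lsq by (simp add: pos_le_divide_eq)
      then have "\<rho> powr a * (1 + cmod \<alpha>) \<le> (1 / (cmod L)\<^sup>2) * (1 + C)" using c(2) by (intro mult_mono) auto
      then have "D * (\<rho> powr a * (1 + cmod \<alpha>)) \<le> D * ((1 / (cmod L)\<^sup>2) * (1 + C))" using D(1) by (rule mult_left_mono)
      then show ?thesis by (simp add: mult.assoc)
    qed
    have "bounded_by_wt (D * (1 + C) / (cmod L)\<^sup>2 + cmod (2 * of_real pi / (total m0 * L) - \<alpha>) * N0)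
       (\<lambda>x. (m x - \<alpha> * m0 x) - (2 * of_real pi / (total m0 * L) - \<alpha>) * m0 x)"
      by (intro bounded_by_wt_diff bounded_by_wt_scale N0 bounded_by_wt_mono[OF n1 small'])
    then have b1: "bounded_by_wt (D * (1 + C) / (cmod L)\<^sup>2 + cmod (2 * of_real pi / (total m0 * L) - \<alpha>) * N0)
       (\<lambda>x. m x - 2 * of_real pi / (total m0 * L) * m0 x)" by (simp add: algebra_simps)
    have r1: "bounded_by_wt (E / (cmod L)\<^sup>2) (\<lambda>x. m x - 2 * of_real pi / (total m0 * L) * m0 x)"
    proof (rule bounded_by_wt_mono[OF b1])
      have "cmod (2 * of_real pi / (total m0 * L) - \<alpha>) * N0 \<le> C / (cmod L)\<^sup>2 * N0"
        using c(1) N0 by (intro mult_right_mono) (simp_all add: norm_minus_commute)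
      then have "D * (1 + C) / (cmod L)\<^sup>2 + cmod (2 * of_real pi / (total m0 * L) - \<alpha>) * N0 \<le> (D * (1 + C) + C * N0) / (cmod L)\<^sup>2"
        by (simp add: add_divide_distrib)
      also have "\<dots> \<le> E / (cmod L)\<^sup>2"
        unfolding E_def using D(1) C(1) by (intro divide_right_mono) auto
      finally show "D * (1 + C) / (cmod L)\<^sup>2 + cmod (2 * of_real pi / (total m0 * L) - \<alpha>) * N0 \<le> E / (cmod L)\<^sup>2" .
    qed
    have r2: "cmod (twisted \<rho> m - 2 * of_real pi / L) \<le> E / (cmod L)\<^sup>2"
    proof -
      have e: "2 * of_real pi / L = 2 * of_real pi / (total m0 * L) * total m0" using gen by simp
      have "twisted \<rho> m - 2 * of_real pi / L = (twisted \<rho> m - total m) + (total m - \<alpha> * total m0)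
        + (\<alpha> - 2 * of_real pi / (total m0 * L)) * total m0"
        unfolding e by (simp only: left_diff_distrib) simp
      then have "cmod (twisted \<rho> m - 2 * of_real pi / L) \<le> cmod (twisted \<rho> m - total m) + cmod (total m - \<alpha> * total m0)
        + cmod ((\<alpha> - 2 * of_real pi / (total m0 * L)) * total m0)"
        by (simp only: norm_triangle_le add_mono norm_triangle_ineq order_refl)
      also have "\<dots> \<le> D * (1 + C) / (cmod L)\<^sup>2 + D * (1 + C) / (cmod L)\<^sup>2 + C / (cmod L)\<^sup>2 * cmod (total m0)"
        unfolding norm_mult[of "_ - _" "total m0"] using n2 n3 small' c(1) by (intro add_mono mult_right_mono) auto
      also have "\<dots> = (2 * D * (1 + C) + C * cmod (total m0)) / (cmod L)\<^sup>2" by (simp add: add_divide_distrib)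
      also have "\<dots> \<le> E / (cmod L)\<^sup>2" unfolding E_def using C(1) N0(1) by (intro divide_right_mono) auto
      finally show ?thesis .
    qed
    show ?thesis using r1 r2 l unfolding \<rho>_def L_def by blast
  qed
  have "0 < \<rho>0" using D C \<rho>3 by (simp add: \<rho>0_def)
  moreover have "0 \<le> E" unfolding E_def using D C N0 by simp
  ultimately show ?thesis by (intro exI[of _ E] exI[of _ \<rho>0] conjI[of "0 \<le> E"] conjI[of "0 < \<rho>0"] allI impI main)
qed

text \<open>Here \<open>total m\<close> itself is O(|k|^a), so its product with the logarithm tends
  to 0 and \<alpha> tends to 1; the logarithmic loss in |\<alpha> - 1| determines the final
  rate.\<close>

lemma jost_near_nongeneric:
  assumes uniq: "is_jost_solution (- q) u K (\<lambda>_. 1) m0" and a: "0 < a" "a \<le> b" "b \<le> 1" and C1: "0 \<le> C1"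
    and ker: "low_energy_expansion a \<mu> C1"
    and nongen: "total m0 = 0"
  shows "\<exists>E \<rho>0. 0 \<le> E \<and> 0 < \<rho>0 \<and> (\<forall>\<kappa> g m. jost_near a \<kappa> g m \<longrightarrow> cut_abs \<kappa> < \<rho>0 \<longrightarrow>
     cmod (cut_log \<kappa>) \<le> 2 * \<bar>ln (cut_abs \<kappa>)\<bar> \<and>
     bounded_by_wt (E * (cut_abs \<kappa> powr a * cmod (cut_log \<kappa>))) (\<lambda>x. m x - m0 x) \<and>
     cmod (twisted (cut_abs \<kappa>) m) \<le> E * (cut_abs \<kappa> powr a * cmod (cut_log \<kappa>)))"
proof -
  have "m0 \<in> Linf_weighted (- q)" using uniq unfolding is_jost_solution_def solves_jost_eq_def by blast
  then obtain N0 where N0: "0 \<le> N0" "bounded_by_wt N0 m0" unfolding Linf_weighted_iff by blast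
  obtain D \<rho>1 where D: "0 \<le> D" "0 < \<rho>1" and near: "\<forall>\<kappa> g m \<alpha>. jost_near a \<kappa> g m \<longrightarrow> cut_abs \<kappa> < \<rho>1 \<longrightarrow>
     \<alpha> = 1 + (\<mu> - cut_log \<kappa> / (2 * of_real pi)) * total m \<longrightarrow>
     bounded_by_wt (D * cut_abs \<kappa> powr a * (1 + cmod \<alpha>)) (\<lambda>x. m x - \<alpha> * m0 x) \<and>
     cmod (total m - \<alpha> * total m0) \<le> D * cut_abs \<kappa> powr a * (1 + cmod \<alpha>) \<and>
     cmod (twisted (cut_abs \<kappa>) m - total m) \<le> D * cut_abs \<kappa> powr a * (1 + cmod \<alpha>) \<and>
     1 \<le> \<bar>ln (cut_abs \<kappa>)\<bar> \<and> \<bar>ln (cut_abs \<kappa>)\<bar> \<le> cmod (cut_log \<kappa>) \<and> cmod (cut_log \<kappa>) \<le> 2 * \<bar>ln (cut_abs \<kappa>)\<bar>"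
    using jost_near_estimates[OF uniq a C1 ker] by (elim exE conjE)
  obtain C \<rho>2 where C: "0 \<le> C" "0 < \<rho>2" and coup: "\<forall>\<rho> L \<alpha> P. 0 < \<rho> \<longrightarrow> \<rho> < \<rho>2 \<longrightarrow> \<bar>ln \<rho>\<bar> \<le> cmod L \<longrightarrow> cmod L \<le> 2 * \<bar>ln \<rho>\<bar> \<longrightarrow>
     \<alpha> = 1 + (\<mu> - L / (2 * of_real pi)) * P \<longrightarrow> cmod P \<le> D * \<rho> powr a * (1 + cmod \<alpha>) \<longrightarrow>
     cmod (\<alpha> - 1) \<le> C * (\<rho> powr a * cmod L) \<and> cmod \<alpha> \<le> C"
    using coupling_nongeneric[OF a(1) D(1), of \<mu>] by (elim exE conjE)
  define E where "E = 2 * D * (1 + C) + C * N0"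
  define \<rho>0 where "\<rho>0 = min \<rho>1 \<rho>2"
  have main: "cmod (cut_log \<kappa>) \<le> 2 * \<bar>ln (cut_abs \<kappa>)\<bar> \<and>
     bounded_by_wt (E * (cut_abs \<kappa> powr a * cmod (cut_log \<kappa>))) (\<lambda>x. m x - m0 x) \<and>
     cmod (twisted (cut_abs \<kappa>) m) \<le> E * (cut_abs \<kappa> powr a * cmod (cut_log \<kappa>))"
    if jn: "jost_near a \<kappa> g m" and small: "cut_abs \<kappa> < \<rho>0" for \<kappa> g m
  proof -
    define \<rho> L where "\<rho> = cut_abs \<kappa>" and "L = cut_log \<kappa>"
    define \<alpha> where "\<alpha> = 1 + (\<mu> - L / (2 * of_real pi)) * total m"
    have \<rho>: "0 < \<rho>" "\<rho> < \<rho>1" "\<rho> < \<rho>2" using jn small by (auto simp: jost_near_def \<rho>_def \<rho>0_def)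
    have n1: "bounded_by_wt (D * \<rho> powr a * (1 + cmod \<alpha>)) (\<lambda>x. m x - \<alpha> * m0 x)"
      and n2': "cmod (total m - \<alpha> * total m0) \<le> D * \<rho> powr a * (1 + cmod \<alpha>)"
      and n3: "cmod (twisted \<rho> m - total m) \<le> D * \<rho> powr a * (1 + cmod \<alpha>)"
      and l: "1 \<le> \<bar>ln \<rho>\<bar>" "\<bar>ln \<rho>\<bar> \<le> cmod L" "cmod L \<le> 2 * \<bar>ln \<rho>\<bar>"
      using near[rule_format, OF jn, of \<alpha>] \<rho>(2) unfolding \<alpha>_def \<rho>_def L_def by blast+
    have n2: "cmod (total m) \<le> D * \<rho> powr a * (1 + cmod \<alpha>)" using n2' nongen by simp
    have c: "cmod (\<alpha> - 1) \<le> C * (\<rho> powr a * cmod L)" "cmod \<alpha> \<le> C"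
      using coup[rule_format, OF \<rho>(1,3) l(2,3) \<alpha>_def n2] by blast+
    have L1: "1 \<le> cmod L" using l by linarith
    have small': "D * \<rho> powr a * (1 + cmod \<alpha>) \<le> D * (1 + C) * (\<rho> powr a * cmod L)"
    proof -
      have "\<rho> powr a * (1 + cmod \<alpha>) \<le> (\<rho> powr a * cmod L) * (1 + C)"
        using c(2) L1 mult_left_mono[OF L1, of "\<rho> powr a"] by (intro mult_mono) auto
      then have "D * (\<rho> powr a * (1 + cmod \<alpha>)) \<le> D * ((\<rho> powr a * cmod L) * (1 + C))" using D(1) by (rule mult_left_mono)
      then show ?thesis by (simp only: mult_ac)
    qed
    have X0: "0 \<le> \<rho> powr a * cmod L" by simp
    have "bounded_by_wt (D * (1 + C) * (\<rho> powr a * cmod L) + cmod (1 - \<alpha>) * N0)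
       (\<lambda>x. (m x - \<alpha> * m0 x) - (1 - \<alpha>) * m0 x)"
      by (intro bounded_by_wt_diff bounded_by_wt_scale N0 bounded_by_wt_mono[OF n1 small'])
    then have b1: "bounded_by_wt (D * (1 + C) * (\<rho> powr a * cmod L) + cmod (1 - \<alpha>) * N0) (\<lambda>x. m x - m0 x)"
      by (simp add: algebra_simps)
    have r1: "bounded_by_wt (E * (\<rho> powr a * cmod L)) (\<lambda>x. m x - m0 x)"
    proof (rule bounded_by_wt_mono[OF b1])
      have "cmod (1 - \<alpha>) * N0 \<le> C * (\<rho> powr a * cmod L) * N0"
        using c(1) N0 by (intro mult_right_mono) (simp_all add: norm_minus_commute)
      moreover have "(D * (1 + C) + C * N0) * (\<rho> powr a * cmod L) = D * (1 + C) * (\<rho> powr a * cmod L) + C * (\<rho> powr a * cmod L) * N0"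
        by (simp add: algebra_simps)
      ultimately have "D * (1 + C) * (\<rho> powr a * cmod L) + cmod (1 - \<alpha>) * N0 \<le> (D * (1 + C) + C * N0) * (\<rho> powr a * cmod L)"
        by linarith
      also have "\<dots> \<le> E * (\<rho> powr a * cmod L)"
        unfolding E_def using D(1) C(1) X0 by (intro mult_right_mono) auto
      finally show "D * (1 + C) * (\<rho> powr a * cmod L) + cmod (1 - \<alpha>) * N0 \<le> E * (\<rho> powr a * cmod L)" .
    qed
    have r2: "cmod (twisted \<rho> m) \<le> E * (\<rho> powr a * cmod L)"
    proof -
      have "cmod (twisted \<rho> m) \<le> cmod (twisted \<rho> m - total m) + cmod (total m)"
        using norm_triangle_ineq[of "twisted \<rho> m - total m" "total m"] by simp
      also have "\<dots> \<le> D * (1 + C) * (\<rho> powr a * cmod L) + D * (1 + C) * (\<rho> powr a * cmod L)"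
        using n2 n3 small' by (intro add_mono) auto
      also have "\<dots> = (2 * D * (1 + C)) * (\<rho> powr a * cmod L)" by simp
      also have "\<dots> \<le> E * (\<rho> powr a * cmod L)" unfolding E_def using C(1) N0(1) X0 by (intro mult_right_mono) auto
      finally show ?thesis .
    qed
    show ?thesis using r1 r2 l unfolding \<rho>_def L_def by blast
  qed
  have "0 < \<rho>0" using D C by (simp add: \<rho>0_def)
  moreover have "0 \<le> E" unfolding E_def using D C N0 by simp
  ultimately show ?thesis by (intro exI[of _ E] exI[of _ \<rho>0] conjI[of "0 \<le> E"] conjI[of "0 < \<rho>0"] allI impI main)
qed

end

section \<open>Low energy asymptotics\<close>

text \<open>The spectral result enters here: an unsided point of the domain with nonzero modulus is
  never a positive real, so the kernel expansion covers it.\<close>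

lemma off_axis_of_jost_domain:
  assumes u: "(\<lambda>x. complex_of_real (u x)) \<in> L2" and k: "k \<in> jost_domain u" "0 < cut_abs k"
  shows "off_axis k"
proof (cases k)
  case (Off z)
  then have z: "z \<in> resolvent_set_Lu u" "z \<noteq> 0" using k by (auto simp: jost_domain_def)
  have "z \<notin> \<real>\<^sub>\<ge>\<^sub>0"
  proof
    assume "z \<in> \<real>\<^sub>\<ge>\<^sub>0"
    then obtain r where "z = of_real r" "0 \<le> r" by (rule nonneg_Reals_cases)
    then show False using z positive_notin_resolvent_set[OF u, of r] by simp
  qed
  then show ?thesis using Off by simp
next
  case (Edge \<sigma> lam)
  then show ?thesis using k by (auto simp: jost_domain_def)
qed

lemma eventually_k_to_0:
  assumes "0 < \<rho>0" "\<And>k. k \<in> jost_domain u \<Longrightarrow> 0 < cut_abs k \<Longrightarrow> cut_abs k < \<rho>0 \<Longrightarrow> P k"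
  shows "eventually P (k_to_0 u)"
proof -
  have "eventually (\<lambda>\<rho>. 0 < \<rho> \<and> \<rho> < \<rho>0) (at_right (0::real))"
    using assms(1) unfolding eventually_at_right_field by blast
  then have "eventually (\<lambda>k. 0 < cut_abs k \<and> cut_abs k < \<rho>0) (filtercomap cut_abs (at_right 0))"
    by (rule eventually_filtercomapI)
  then show ?thesis unfolding k_to_0_def eventually_inf_principal
    by (rule eventually_mono) (use assms(2) in blast)
qed

context weighted_potential
begin

lemma u_L2: "(\<lambda>x. complex_of_real (u x)) \<in> L2"
proof -
  have i: "integrable lborel (\<lambda>x. (cmod (complex_of_real (wt x powr s) * complex_of_real (u x)))\<^sup>2)"
    using u by (simp only: L2_weighted_def L2_def mem_Collect_eq)
  have "integrable lborel (\<lambda>x. (cmod (complex_of_real (u x)))\<^sup>2)"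
  proof (rule Bochner_Integration.integrable_bound[OF i])
    have "norm ((cmod (complex_of_real (u x)))\<^sup>2) \<le> norm ((cmod (complex_of_real (wt x powr s) * complex_of_real (u x)))\<^sup>2)" for x
    proof -
      have "1 * \<bar>u x\<bar> \<le> wt x powr s * \<bar>u x\<bar>"
        using s s1 by (intro mult_right_mono one_le_wt_powr) auto
      then have "\<bar>u x\<bar>\<^sup>2 \<le> (wt x powr s * \<bar>u x\<bar>)\<^sup>2" by (intro power_mono) auto
      then show ?thesis by (simp add: norm_mult)
    qed
    then show "AE x in lborel. norm ((cmod (complex_of_real (u x)))\<^sup>2)
        \<le> norm ((cmod (complex_of_real (wt x powr s) * complex_of_real (u x)))\<^sup>2)" by simp
  qed measurable
  then show ?thesis unfolding L2_def by simp
qed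

lemma Linf_bigoI:
  assumes "\<forall>\<^sub>F k in F. bounded_by_wt (E * h k) (f k)"
  shows "Linf_bigo (- q) F f h"
  unfolding Linf_bigo_def
proof (intro exI[of _ E])
  show "\<forall>\<^sub>F k in F. Linf_norm (- q) (f k) \<le> ereal (E * h k)"
    using assms by (rule eventually_mono) (auto simp only: bounded_by_wt_def intro: Linf_norm_le)
qed

text \<open>An additive constant cancels in differences and is harmless for the size, so both bounds
  pass from \<open>log_kernel\<close> to the modified kernel.\<close>

lemma G_zero_log_type_kernel:
  assumes b: "0 < b" "b < q" "b < s1 - 1/2"
    and G0: "\<And>x. x \<noteq> 0 \<Longrightarrow> G_zero c x = (log_kernel g x - w) / (2 * of_real pi)"
  shows "\<exists>C. log_type_kernel s s1 u (G_zero c) b C"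
proof -
  obtain C1 where C1: "0 \<le> C1" "\<And>x. x \<noteq> 0 \<Longrightarrow> cmod (log_kernel g x) \<le> C1 * (\<bar>x\<bar> powr b + \<bar>x\<bar> powr (-1/4))"
    using log_kernel_bound[OF b(1), of g] by blast
  \<comment> \<open>10 is the Hoelder constant of \<open>log_kernel\<close>; C1 + |w| serves the
    size bound.\<close>
  define C where "C = 10 + C1 + cmod w"
  have div: "cmod (z / (2 * of_real pi)) \<le> cmod z" for z
  proof -
    have "cmod z / (2 * pi) \<le> cmod z / 1" using pi_ge_two by (intro divide_left_mono) auto
    then show ?thesis by (simp add: norm_divide norm_mult)
  qed
  have "log_type_kernel s s1 u (G_zero c) b C"
  proof unfold_locales
    have "G_zero c = (\<lambda>x. if x = 0 then G_zero c 0 else (log_kernel g x - w) / (2 * of_real pi))"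
      using G0 by auto
    also have "\<dots> \<in> borel_measurable borel" by measurable
    finally show "G_zero c \<in> borel_measurable borel" .
    fix x :: real assume x: "x \<noteq> 0"
    \<comment> \<open>The two powers cover |x| \<ge> 1 and |x| < 1, so their sum absorbs the
      constant w.\<close>
    have one: "1 \<le> \<bar>x\<bar> powr b + \<bar>x\<bar> powr (-1/4)"
    proof (cases "1 \<le> \<bar>x\<bar>")
      case True
      then have "1 \<le> \<bar>x\<bar> powr b" using b by (intro ge_one_powr_ge_zero) auto
      then show ?thesis using powr_ge_zero[of "\<bar>x\<bar>" "-1/4"] by linarith
    next
      case False
      then have "\<bar>x\<bar> powr 0 \<le> \<bar>x\<bar> powr (-1/4)" by (intro powr_mono') auto
      then have "1 \<le> \<bar>x\<bar> powr (-1/4)" using x by simp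
      then show ?thesis using powr_ge_zero[of "\<bar>x\<bar>" b] by linarith
    qed
    have "cmod (G_zero c x) \<le> cmod (log_kernel g x) + cmod w"
      unfolding G0[OF x] by (rule order_trans[OF div norm_triangle_ineq4])
    also have "\<dots> \<le> C1 * (\<bar>x\<bar> powr b + \<bar>x\<bar> powr (-1/4)) + cmod w * (\<bar>x\<bar> powr b + \<bar>x\<bar> powr (-1/4))"
      using C1(2)[OF x] mult_left_mono[OF one norm_ge_zero[of w]] by linarith
    also have "\<dots> = (C1 + cmod w) * (\<bar>x\<bar> powr b + \<bar>x\<bar> powr (-1/4))" by (rule distrib_right[symmetric])
    also have "\<dots> \<le> C * (\<bar>x\<bar> powr b + \<bar>x\<bar> powr (-1/4))"
      unfolding C_def by (intro mult_right_mono) auto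
    finally show "cmod (G_zero c x) \<le> C * (\<bar>x\<bar> powr b + \<bar>x\<bar> powr (-1/4))" .
    fix y :: real assume y: "y \<noteq> 0"
    have "G_zero c x - G_zero c y = (log_kernel g x - log_kernel g y) / (2 * of_real pi)"
      unfolding G0[OF x] G0[OF y] by (simp add: diff_divide_distrib)
    then have "cmod (G_zero c x - G_zero c y) \<le> cmod (log_kernel g x - log_kernel g y)"
      by (simp only: div)
    also have "\<dots> \<le> 10 * \<bar>x - y\<bar> powr (1/4) * (\<bar>x\<bar> powr (-1/4) + \<bar>y\<bar> powr (-1/4))"
      by (rule log_kernel_holder[OF x y])
    also have "\<dots> \<le> C * \<bar>x - y\<bar> powr (1/4) * (\<bar>x\<bar> powr (-1/4) + \<bar>y\<bar> powr (-1/4))"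
      unfolding C_def using C1(1) by (intro mult_right_mono) auto
    finally show "cmod (G_zero c x - G_zero c y) \<le> C * \<bar>x - y\<bar> powr (1/4) * (\<bar>x\<bar> powr (-1/4) + \<bar>y\<bar> powr (-1/4))" .
  qed (use b C1(1) in \<open>auto simp: C_def\<close>)
  then show ?thesis ..
qed

end

context log_type_kernel
begin

lemma jost_near_m1:
  assumes "k \<in> jost_domain u" "0 < cut_abs k" "is_jost_solution (- q) u (G k) (\<lambda>x. 1) m"
  shows "jost_near a k (\<lambda>x. 1) m"
  using assms off_axis_of_jost_domain[OF u_L2 assms(1,2)] unfolding jost_near_def is_jost_solution_def by simp

lemma jost_near_me:
  assumes "0 < a" "a \<le> b" "b \<le> 1" "0 < lam" "is_jost_solution (- q) u (G (Edge \<sigma> lam)) (\<lambda>x. cis (lam * x)) m"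
  shows "jost_near a (Edge \<sigma> lam) (\<lambda>x. cis (lam * x)) m"
proof -
  have "cmod (cis (lam * x) - 1) \<le> 2 * lam powr a * wt x powr b" for x
  proof -
    have "cmod (cis (lam * x) - cis 0) \<le> 2 * \<bar>lam * x - 0\<bar> powr a"
      using assms by (intro norm_cis_diff_powr_le) auto
    also have "\<dots> = 2 * lam powr a * \<bar>x\<bar> powr a" using assms by (simp add: abs_mult powr_mult)
    also have "\<dots> \<le> 2 * lam powr a * wt x powr b" using assms by (intro mult_left_mono abs_powr_le_wt) auto
    finally show ?thesis by simp
  qed
  then show ?thesis using assms(4,5) unfolding jost_near_def is_jost_solution_def by simp
qed

lemma Gamma_coeff_eq: "Gamma_coeff u me lam = 1 + \<i> * twisted lam (me Above lam)"
  by (simp add: Gamma_coeff_def twisted_def)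

lemma beta_coeff_eq: "beta_coeff u m1 lam = \<i> * twisted lam (m1 (Edge Above lam))"
  by (simp add: beta_coeff_def twisted_def)

lemma generic_asymptotics:
  assumes uniq: "is_jost_solution (- q) u K (\<lambda>_. 1) m0" and a: "0 < a" "a \<le> b" "b \<le> 1" and C1: "0 \<le> C1"
    and ker: "low_energy_expansion a \<mu> C1" and gen: "total m0 \<noteq> 0"
    and m1: "\<And>k. k \<in> jost_domain u \<Longrightarrow> is_jost_solution (- q) u (G k) (\<lambda>x. 1) (m1 k)"
    and me: "\<And>\<sigma> lam. lam > 0 \<Longrightarrow> is_jost_solution (- q) u (G (Edge \<sigma> lam)) (\<lambda>x. cis (lam * x)) (me \<sigma> lam)"
  shows "Linf_bigo (- q) (k_to_0 u) (\<lambda>k x. m1 k x - 2 * of_real pi / (total m0 * cut_log k) * m0 x)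
           (\<lambda>k. 1 / cmod ((cut_log k)\<^sup>2))"
    and "Linf_bigo (- q) (at_right 0) (\<lambda>lam x. me \<sigma> lam x - 2 * of_real pi / (total m0 * cut_log (Edge \<sigma> lam)) * m0 x)
           (\<lambda>lam. 1 / \<bar>(ln lam)\<^sup>2\<bar>)"
    and "(\<lambda>lam. Gamma_coeff u me lam - (1 + 2 * of_real pi * \<i> / cut_log (Edge Above lam)))
           \<in> O[at_right 0](\<lambda>lam. of_real (1 / \<bar>(ln lam)\<^sup>2\<bar>))"
    and "(\<lambda>lam. beta_coeff u m1 lam - 2 * of_real pi * \<i> / cut_log (Edge Above lam))
           \<in> O[at_right 0](\<lambda>lam. of_real (1 / \<bar>(ln lam)\<^sup>2\<bar>))"
proof -
  obtain E \<rho>0 where E: "0 \<le> E" "0 < \<rho>0" and near: "\<forall>\<kappa> g m. jost_near a \<kappa> g m \<longrightarrow> cut_abs \<kappa> < \<rho>0 \<longrightarrow>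
     \<bar>ln (cut_abs \<kappa>)\<bar> \<le> cmod (cut_log \<kappa>) \<and> 1 \<le> \<bar>ln (cut_abs \<kappa>)\<bar> \<and>
     bounded_by_wt (E / (cmod (cut_log \<kappa>))\<^sup>2) (\<lambda>x. m x - 2 * of_real pi / (total m0 * cut_log \<kappa>) * m0 x) \<and>
     cmod (twisted (cut_abs \<kappa>) m - 2 * of_real pi / cut_log \<kappa>) \<le> E / (cmod (cut_log \<kappa>))\<^sup>2"
    using jost_near_generic[OF uniq a C1 ker gen] by (elim exE conjE)
  have ev: "\<forall>\<^sub>F lam in at_right 0. 0 < lam \<and> lam < \<rho>0"
    using E(2) unfolding eventually_at_right_field by blast
  show "Linf_bigo (- q) (k_to_0 u) (\<lambda>k x. m1 k x - 2 * of_real pi / (total m0 * cut_log k) * m0 x)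
           (\<lambda>k. 1 / cmod ((cut_log k)\<^sup>2))"
  proof (rule Linf_bigoI, rule eventually_k_to_0[OF E(2)])
    fix k assume k: "k \<in> jost_domain u" "0 < cut_abs k" "cut_abs k < \<rho>0"
    show "bounded_by_wt (E * (1 / cmod ((cut_log k)\<^sup>2))) (\<lambda>x. m1 k x - 2 * of_real pi / (total m0 * cut_log k) * m0 x)"
      using near[rule_format, OF jost_near_m1[OF k(1,2) m1[OF k(1)]] k(3)] by (simp add: norm_power)
  qed
  show "Linf_bigo (- q) (at_right 0) (\<lambda>lam x. me \<sigma> lam x - 2 * of_real pi / (total m0 * cut_log (Edge \<sigma> lam)) * m0 x)
           (\<lambda>lam. 1 / \<bar>(ln lam)\<^sup>2\<bar>)"
  proof (rule Linf_bigoI, rule eventually_mono[OF ev])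
    fix lam assume lam: "0 < lam \<and> lam < \<rho>0"
    then have n: "\<bar>ln lam\<bar> \<le> cmod (cut_log (Edge \<sigma> lam))" "1 \<le> \<bar>ln lam\<bar>"
      "bounded_by_wt (E / (cmod (cut_log (Edge \<sigma> lam)))\<^sup>2)
        (\<lambda>x. me \<sigma> lam x - 2 * of_real pi / (total m0 * cut_log (Edge \<sigma> lam)) * m0 x)"
      using near[rule_format, OF jost_near_me[OF a _ me, of lam \<sigma>]] by auto
    \<comment> \<open>On either edge |log| is at least |ln lam|, which turns the error 1/|log|^2
      into the stated 1/(ln lam)^2.\<close>
    have "\<bar>ln lam\<bar>\<^sup>2 \<le> (cmod (cut_log (Edge \<sigma> lam)))\<^sup>2" using n by (intro power_mono) auto
    moreover have "0 < \<bar>ln lam\<bar>\<^sup>2" using n(2) by (intro zero_less_power) linarith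
    ultimately have "E / (cmod (cut_log (Edge \<sigma> lam)))\<^sup>2 \<le> E / \<bar>ln lam\<bar>\<^sup>2"
      using E(1) by (intro divide_left_mono mult_pos_pos) auto
    then show "bounded_by_wt (E * (1 / \<bar>(ln lam)\<^sup>2\<bar>))
        (\<lambda>x. me \<sigma> lam x - 2 * of_real pi / (total m0 * cut_log (Edge \<sigma> lam)) * m0 x)"
      by (intro bounded_by_wt_mono[OF n(3)]) simp
  qed
  show "(\<lambda>lam. Gamma_coeff u me lam - (1 + 2 * of_real pi * \<i> / cut_log (Edge Above lam)))
           \<in> O[at_right 0](\<lambda>lam. of_real (1 / \<bar>(ln lam)\<^sup>2\<bar>))"
  proof (rule bigoI[of _ E], rule eventually_mono[OF ev])
    fix lam assume lam: "0 < lam \<and> lam < \<rho>0"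
    have e: "Gamma_coeff u me lam - (1 + 2 * of_real pi * \<i> / cut_log (Edge Above lam)) =
      \<i> * (twisted lam (me Above lam) - 2 * of_real pi / cut_log (Edge Above lam))"
      by (simp add: Gamma_coeff_eq algebra_simps)
    \<comment> \<open>On the upper edge the logarithm is the real number ln lam, so the two forms of
      the error coincide.\<close>
    have "cmod (twisted lam (me Above lam) - 2 * of_real pi / cut_log (Edge Above lam)) \<le> E / (ln lam)\<^sup>2"
      using near[rule_format, OF jost_near_me[OF a _ me, of lam Above]] lam by auto
    then show "norm (Gamma_coeff u me lam - (1 + 2 * of_real pi * \<i> / cut_log (Edge Above lam)))
      \<le> E * norm (complex_of_real (1 / \<bar>(ln lam)\<^sup>2\<bar>))"
      unfolding e norm_mult by (simp add: norm_divide norm_power)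
  qed
  show "(\<lambda>lam. beta_coeff u m1 lam - 2 * of_real pi * \<i> / cut_log (Edge Above lam))
           \<in> O[at_right 0](\<lambda>lam. of_real (1 / \<bar>(ln lam)\<^sup>2\<bar>))"
  proof (rule bigoI[of _ E], rule eventually_mono[OF ev])
    fix lam assume lam: "0 < lam \<and> lam < \<rho>0"
    have k: "Edge Above lam \<in> jost_domain u" "0 < cut_abs (Edge Above lam)"
      using lam by (auto simp: jost_domain_def)
    have e: "beta_coeff u m1 lam - 2 * of_real pi * \<i> / cut_log (Edge Above lam) =
      \<i> * (twisted lam (m1 (Edge Above lam)) - 2 * of_real pi / cut_log (Edge Above lam))"
      by (simp add: beta_coeff_eq algebra_simps)
    have "cmod (twisted lam (m1 (Edge Above lam)) - 2 * of_real pi / cut_log (Edge Above lam)) \<le> E / (ln lam)\<^sup>2"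
      using near[rule_format, OF jost_near_m1[OF k m1[OF k(1)]]] lam by auto
    then show "norm (beta_coeff u m1 lam - 2 * of_real pi * \<i> / cut_log (Edge Above lam))
      \<le> E * norm (complex_of_real (1 / \<bar>(ln lam)\<^sup>2\<bar>))"
      unfolding e norm_mult by (simp add: norm_divide norm_power)
  qed
qed

lemma nongeneric_asymptotics:
  assumes uniq: "is_jost_solution (- q) u K (\<lambda>_. 1) m0" and a: "0 < a" "a \<le> b" "b \<le> 1" and C1: "0 \<le> C1"
    and ker: "low_energy_expansion a \<mu> C1" and nongen: "total m0 = 0"
    and m1: "\<And>k. k \<in> jost_domain u \<Longrightarrow> is_jost_solution (- q) u (G k) (\<lambda>x. 1) (m1 k)"
    and me: "\<And>\<sigma> lam. lam > 0 \<Longrightarrow> is_jost_solution (- q) u (G (Edge \<sigma> lam)) (\<lambda>x. cis (lam * x)) (me \<sigma> lam)"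
  shows "Linf_bigo (- q) (k_to_0 u) (\<lambda>k x. m1 k x - m0 x) (\<lambda>k. cut_abs k powr a * cmod (cut_log k))"
    and "Linf_bigo (- q) (at_right 0) (\<lambda>lam x. me \<sigma> lam x - m0 x) (\<lambda>lam. lam powr a * \<bar>ln lam\<bar>)"
    and "(\<lambda>lam. Gamma_coeff u me lam - 1) \<in> O[at_right 0](\<lambda>lam. of_real (lam powr a * \<bar>ln lam\<bar>))"
    and "(\<lambda>lam. beta_coeff u m1 lam) \<in> O[at_right 0](\<lambda>lam. of_real (lam powr a * \<bar>ln lam\<bar>))"
proof -
  obtain E \<rho>0 where E: "0 \<le> E" "0 < \<rho>0" and near: "\<forall>\<kappa> g m. jost_near a \<kappa> g m \<longrightarrow> cut_abs \<kappa> < \<rho>0 \<longrightarrow>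
     cmod (cut_log \<kappa>) \<le> 2 * \<bar>ln (cut_abs \<kappa>)\<bar> \<and>
     bounded_by_wt (E * (cut_abs \<kappa> powr a * cmod (cut_log \<kappa>))) (\<lambda>x. m x - m0 x) \<and>
     cmod (twisted (cut_abs \<kappa>) m) \<le> E * (cut_abs \<kappa> powr a * cmod (cut_log \<kappa>))"
    using jost_near_nongeneric[OF uniq a C1 ker nongen] by (elim exE conjE)
  have ev: "\<forall>\<^sub>F lam in at_right 0. 0 < lam \<and> lam < \<rho>0"
    using E(2) unfolding eventually_at_right_field by blast
  show "Linf_bigo (- q) (k_to_0 u) (\<lambda>k x. m1 k x - m0 x) (\<lambda>k. cut_abs k powr a * cmod (cut_log k))"
  proof (rule Linf_bigoI, rule eventually_k_to_0[OF E(2)])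
    fix k assume k: "k \<in> jost_domain u" "0 < cut_abs k" "cut_abs k < \<rho>0"
    show "bounded_by_wt (E * (cut_abs k powr a * cmod (cut_log k))) (\<lambda>x. m1 k x - m0 x)"
      using near[rule_format, OF jost_near_m1[OF k(1,2) m1[OF k(1)]] k(3)] by blast
  qed
  show "Linf_bigo (- q) (at_right 0) (\<lambda>lam x. me \<sigma> lam x - m0 x) (\<lambda>lam. lam powr a * \<bar>ln lam\<bar>)"
  proof (rule Linf_bigoI, rule eventually_mono[OF ev])
    fix lam assume lam: "0 < lam \<and> lam < \<rho>0"
    then have n: "cmod (cut_log (Edge \<sigma> lam)) \<le> 2 * \<bar>ln lam\<bar>"
      "bounded_by_wt (E * (lam powr a * cmod (cut_log (Edge \<sigma> lam)))) (\<lambda>x. me \<sigma> lam x - m0 x)"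
      using near[rule_format, OF jost_near_me[OF a _ me, of lam \<sigma>]] by auto
    \<comment> \<open>On the lower edge 2 pi i is absorbed through |log| \<le> 2 |ln lam|, which
      doubles the constant.\<close>
    have "E * (lam powr a * cmod (cut_log (Edge \<sigma> lam))) \<le> E * (lam powr a * (2 * \<bar>ln lam\<bar>))"
      using E(1) n(1) by (intro mult_left_mono) auto
    then show "bounded_by_wt ((2 * E) * (lam powr a * \<bar>ln lam\<bar>)) (\<lambda>x. me \<sigma> lam x - m0 x)"
      by (intro bounded_by_wt_mono[OF n(2)]) simp
  qed
  show "(\<lambda>lam. Gamma_coeff u me lam - 1) \<in> O[at_right 0](\<lambda>lam. of_real (lam powr a * \<bar>ln lam\<bar>))"
  proof (rule bigoI[of _ E], rule eventually_mono[OF ev])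
    fix lam assume lam: "0 < lam \<and> lam < \<rho>0"
    have "cmod (twisted lam (me Above lam)) \<le> E * (lam powr a * \<bar>ln lam\<bar>)"
      using near[rule_format, OF jost_near_me[OF a _ me, of lam Above]] lam by auto
    then show "norm (Gamma_coeff u me lam - 1) \<le> E * norm (complex_of_real (lam powr a * \<bar>ln lam\<bar>))"
      unfolding Gamma_coeff_eq by (simp add: norm_mult)
  qed
  show "(\<lambda>lam. beta_coeff u m1 lam) \<in> O[at_right 0](\<lambda>lam. of_real (lam powr a * \<bar>ln lam\<bar>))"
  proof (rule bigoI[of _ E], rule eventually_mono[OF ev])
    fix lam assume lam: "0 < lam \<and> lam < \<rho>0"
    have k: "Edge Above lam \<in> jost_domain u" "0 < cut_abs (Edge Above lam)"
      using lam by (auto simp: jost_domain_def)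
    have "cmod (twisted lam (m1 (Edge Above lam))) \<le> E * (lam powr a * \<bar>ln lam\<bar>)"
      using near[rule_format, OF jost_near_m1[OF k m1[OF k(1)]]] lam by auto
    then show "norm (beta_coeff u m1 lam) \<le> E * norm (complex_of_real (lam powr a * \<bar>ln lam\<bar>))"
      unfolding beta_coeff_eq by (simp add: norm_mult)
  qed
qed

end

theorem theorem5p10:
  fixes s s1 :: real
    and u :: "real \<Rightarrow> real"
    and c :: "real \<Rightarrow> complex"
    and m1 :: "cut_point \<Rightarrow> real \<Rightarrow> complex"
    and me :: "side \<Rightarrow> real \<Rightarrow> real \<Rightarrow> complex"
    and m0 :: "real \<Rightarrow> complex"
  assumes "s1 > 1/2" and "s > s1"
    and "(\<lambda>x. complex_of_real (u x)) \<in> L2_weighted s"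
    and "\<And>k. k \<in> jost_domain u \<Longrightarrow> is_jost_solution (-(s - s1)) u (G k) (\<lambda>x. 1) (m1 k)"
    and "\<And>\<sigma> lam. lam > 0 \<Longrightarrow>
           is_jost_solution (-(s - s1)) u (G (Edge \<sigma> lam)) (\<lambda>x. cis (lam * x)) (me \<sigma> lam)"
    and "cutoff_fun c"
    and "is_jost_solution (-(s - s1)) u (G_zero c) (\<lambda>x. 1) m0"
  shows "\<exists>\<epsilon>::real. 0 < \<epsilon> \<and> \<epsilon> < 1 \<and>
    (generic u m0 \<longrightarrow>
       Linf_bigo (-(s - s1)) (k_to_0 u)
         (\<lambda>k x. m1 k x - 2 * of_real pi / (pairing m0 (\<lambda>y. of_real (u y)) * cut_log k) * m0 x)
         (\<lambda>k. 1 / cmod ((cut_log k)\<^sup>2)) \<and>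
       (\<forall>\<sigma>. Linf_bigo (-(s - s1)) (at_right 0)
         (\<lambda>lam x. me \<sigma> lam x -
            2 * of_real pi / (pairing m0 (\<lambda>y. of_real (u y)) * cut_log (Edge \<sigma> lam)) * m0 x)
         (\<lambda>lam. 1 / \<bar>(ln lam)\<^sup>2\<bar>)) \<and>
       (\<lambda>lam. Gamma_coeff u me lam - (1 + 2 * of_real pi * \<i> / cut_log (Edge Above lam)))
         \<in> O[at_right 0](\<lambda>lam. of_real (1 / \<bar>(ln lam)\<^sup>2\<bar>)) \<and>
       (\<lambda>lam. beta_coeff u m1 lam - 2 * of_real pi * \<i> / cut_log (Edge Above lam))
         \<in> O[at_right 0](\<lambda>lam. of_real (1 / \<bar>(ln lam)\<^sup>2\<bar>))) \<and>
    (\<not> generic u m0 \<longrightarrow>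
       Linf_bigo (-(s - s1)) (k_to_0 u)
         (\<lambda>k x. m1 k x - m0 x)
         (\<lambda>k. cut_abs k powr \<epsilon> * cmod (cut_log k)) \<and>
       (\<forall>\<sigma>. Linf_bigo (-(s - s1)) (at_right 0)
         (\<lambda>lam x. me \<sigma> lam x - m0 x)
         (\<lambda>lam. lam powr \<epsilon> * \<bar>ln lam\<bar>)) \<and>
       (\<lambda>lam. Gamma_coeff u me lam - 1)
         \<in> O[at_right 0](\<lambda>lam. of_real (lam powr \<epsilon> * \<bar>ln lam\<bar>)) \<and>
       (\<lambda>lam. beta_coeff u m1 lam)
         \<in> O[at_right 0](\<lambda>lam. of_real (lam powr \<epsilon> * \<bar>ln lam\<bar>)))"
proof -
  interpret W: weighted_potential s s1 u by unfold_locales (use assms in auto)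
  \<comment> \<open>Half of the minimum makes all constraints strict: b < s - s1 for compactness, b
    < s1 - 1/2 for integrability, b < 1 for the Hoelder bound on phases.\<close>
  define b where "b = min (s - s1) (min 1 (s1 - 1/2)) / 2"
  \<comment> \<open>Any exponent strictly between 0 and b keeps \<xi>^(b - \<epsilon> - 1)
    integrable at 0. The same \<epsilon> enters the kernel expansion in both alternatives.\<close>
  define \<epsilon> where "\<epsilon> = b / 2"
  have bs: "0 < b" "b < s - s1" "b < s1 - 1/2" "b \<le> 1"
    using assms(1,2) by (auto simp: b_def min_def)
  have \<epsilon>: "0 < \<epsilon>" "\<epsilon> < b" "\<epsilon> \<le> b" "\<epsilon> < 1" using bs by (auto simp: \<epsilon>_def)
  obtain g w C1 \<mu> where G0: "\<And>x. x \<noteq> 0 \<Longrightarrow> G_zero c x = (log_kernel g x - w) / (2 * of_real pi)" and C1: "0 \<le> C1"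
    and ker: "\<And>\<kappa> x. off_axis \<kappa> \<Longrightarrow> cut_abs \<kappa> < 1/2 \<Longrightarrow> x \<noteq> 0 \<Longrightarrow>
       cmod (G \<kappa> x - G_zero c x - (\<mu> - cut_log \<kappa> / (2 * of_real pi))) \<le> C1 * cut_abs \<kappa> powr \<epsilon> * wt x powr b"
    by (rule kernel_asymptotics[OF \<epsilon>(1,2) bs(4) assms(6)], rule that)
  have "\<exists>C. log_type_kernel s s1 u (G_zero c) b C"
    by (rule W.G_zero_log_type_kernel[OF bs(1-3)], rule G0)
  then obtain C where "log_type_kernel s s1 u (G_zero c) b C" ..
  then interpret log_type_kernel s s1 u "G_zero c" b C .
  have exp: "low_energy_expansion \<epsilon> \<mu> C1"
    unfolding low_energy_expansion_def by (intro allI impI ker)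
  have gen: "generic u m0 \<longleftrightarrow> W.total m0 \<noteq> 0" by (simp add: generic_def W.total_def)
  \<comment> \<open>As u is real, the number that decides genericity is also the denominator of the
    leading coefficient.\<close>
  have pair: "pairing m0 (\<lambda>y. of_real (u y)) = W.total m0" by (simp add: pairing_def W.total_def mult.commute)
  note G = generic_asymptotics[OF assms(7) \<epsilon>(1,3) bs(4) C1 exp _ assms(4,5)]
  note N = nongeneric_asymptotics[OF assms(7) \<epsilon>(1,3) bs(4) C1 exp _ assms(4,5)]
  show ?thesis unfolding gen pair not_not
    by (rule exI[of _ \<epsilon>], intro conjI \<epsilon>(1,4) impI allI G N)
qed

end
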